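(* Let $\alpha\in(0,1)$ and $q>\alpha$. Let $Z=(Z(s),0\le s\le 1)$ be a random continuous nonnegative path with $Z(0)=Z(1)=0$ and distribution $\kappa_q(1,\cdot)$. Suppose that $Z$ is $\gamma$-Hölder continuous for some $\gamma\in(0,q)$, that the Hölder constant $$D_\gamma:=\sup_{0\le r<s\le 1}\frac{|Z(s)-Z(r)|}{|s-r|^\gamma}$$ has moments of all orders, and that $c:=(1+\alpha)(\Gamma(1-\alpha))^{-1}\mathbb{E}\big((Z(U))^{\alpha/q}\big)>0$, where $U$ is a uniform variable on $[0,1]$ independent of $Z$. Then the following holds almost surely for a $\kappa_q$-marked spectrally positive stable Lévy process $X$ with Laplace exponent $\psi(\eta)=\eta^{1+\alpha}$: $$\lim_{h\downarrow 0}\ \sup_{0\le t\le T}\ \sup_{y\in\mathbb{R}}\left|\frac{h^{\alpha/q}}{c}\,m_h(y,t)-\ell^y(t)\right|=0\qquad\text{for all }T>0.$$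
   Context: $X=(X_t,t\ge 0)$ is a Lévy process with $X_0=0$, no negative jumps, and $\mathbb{E}(e^{-\eta X_t})=e^{t\psi(\eta)}$, $\eta\ge 0$, where $\psi(\eta)=\eta^{1+\alpha}$. Write $\Delta X_t=X_t-X_{t-}$. $\kappa_q$-marking: for $x>0$, $\kappa_q(x,\cdot)$ is the distribution of $(x^qZ(s/x),0\le s\le x)$, where $Z\sim\kappa_q(1,\cdot)$. Given $X$, each jump $(t,\Delta X_t)$ with $\Delta X_t>0$ is marked, independently over the jumps, by a random path $Z_t=(Z_t(s),0\le s\le\Delta X_t)$ with distribution $\kappa_q(\Delta X_t,\cdot)$. Convention: $Z_t(s)=0$ for $s\notin(0,\Delta X_t)$, and $Z_t\equiv 0$ if $\Delta X_t=0$. For $h>0$, $y\in\mathbb{R}$, $T\ge0$: $m_h(y,T)=\#\{0\le t\le T: Z_t(y-X_{t-})\ge h\}$. $(\ell^y(t),y\in\mathbb{R},t\ge0)$ are the jointly continuous local times of $X$, normalised by the occupation density formula $\int_0^Tf(X_t)\,dt=\int_{-\infty}^\infty f(y)\ell^y(T)\,dy$ a.s. for all bounded measurable $f:\mathbb{R}\to\mathbb{R}$ and $T\ge0$. A random variable $V$ has moments of all orders if $\mathbb{E}(|V|^p)<\infty$ for all $p>0$. *)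

theory Defs
  imports "HOL-Probability.Probability"
begin

section \<open>Cadlag paths and Levy processes\<close>

text \<open>Processes and paths are indexed by \<^typ>\<open>real\<close>, but only times \<open>t \<ge> 0\<close> are ever used.\<close>

definition cadlag :: "(real \<Rightarrow> real) \<Rightarrow> bool" where
  "cadlag x \<longleftrightarrow>
     (\<forall>t\<ge>0. (x \<longlongrightarrow> x t) (at_right t)) \<and> (\<forall>t>0. \<exists>l. (x \<longlongrightarrow> l) (at_left t))"

text \<open>At time \<open>0\<close> the left limit is the starting value, so there is no jump at \<open>0\<close>.\<close>

definition left_lim :: "(real \<Rightarrow> real) \<Rightarrow> real \<Rightarrow> real" where
  "left_lim x t = (if t \<le> 0 then x 0 else Lim (at_left t) x)"

definition jump :: "(real \<Rightarrow> real) \<Rightarrow> real \<Rightarrow> real" where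
  "jump x t = x t - left_lim x t"

definition levy_process :: "'a measure \<Rightarrow> (real \<Rightarrow> 'a \<Rightarrow> real) \<Rightarrow> bool" where
  "levy_process M X \<longleftrightarrow>
     (\<forall>t\<ge>0. X t \<in> borel_measurable M) \<and>
     (\<forall>\<omega>\<in>space M. cadlag (\<lambda>t. X t \<omega>)) \<and>
     (AE \<omega> in M. X 0 \<omega> = 0) \<and>
     (\<forall>(t :: nat \<Rightarrow> real) n. 0 \<le> t 0 \<longrightarrow> mono t \<longrightarrow>
        prob_space.indep_vars M (\<lambda>_. borel) (\<lambda>i \<omega>. X (t (Suc i)) \<omega> - X (t i) \<omega>) {..<n}) \<and>
     (\<forall>s\<ge>0. \<forall>t\<ge>0. distr M borel (\<lambda>\<omega>. X (s + t) \<omega> - X s \<omega>) = distr M borel (X t))"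

definition no_negative_jumps :: "'a measure \<Rightarrow> (real \<Rightarrow> 'a \<Rightarrow> real) \<Rightarrow> bool" where
  "no_negative_jumps M X \<longleftrightarrow> (AE \<omega> in M. \<forall>t\<ge>0. 0 \<le> jump (\<lambda>u. X u \<omega>) t)"

definition has_laplace_exponent :: "'a measure \<Rightarrow> (real \<Rightarrow> 'a \<Rightarrow> real) \<Rightarrow> (real \<Rightarrow> real) \<Rightarrow> bool" where
  "has_laplace_exponent M X \<psi> \<longleftrightarrow>
     (\<forall>t\<ge>0. \<forall>\<eta>\<ge>0. has_bochner_integral M (\<lambda>\<omega>. exp (- \<eta> * X t \<omega>)) (exp (t * \<psi> \<eta>)))"

section \<open>Random paths and their moments\<close>

text \<open>Laws of random paths are measures on the product sigma-algebra; for the continuous paths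
  considered here it carries the same information as the Borel sigma-algebra of the uniform
  topology.\<close>

abbreviation path_space :: "real set \<Rightarrow> (real \<Rightarrow> real) measure" where
  "path_space I \<equiv> Pi\<^sub>M I (\<lambda>_. borel)"

definition holder_continuous :: "real \<Rightarrow> (real \<Rightarrow> real) \<Rightarrow> bool" where
  "holder_continuous \<gamma> z \<longleftrightarrow>
     (\<exists>C. \<forall>r\<in>{0..1}. \<forall>s\<in>{0..1}. \<bar>z s - z r\<bar> \<le> C * \<bar>s - r\<bar> powr \<gamma>)"

definition holder_constant :: "real \<Rightarrow> (real \<Rightarrow> real) \<Rightarrow> real" where
  "holder_constant \<gamma> z =
     (SUP (r, s)\<in>{(r, s). 0 \<le> r \<and> r < s \<and> s \<le> 1}. \<bar>z s - z r\<bar> / \<bar>s - r\<bar> powr \<gamma>)"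

definition moments_of_all_orders :: "'a measure \<Rightarrow> ('a \<Rightarrow> real) \<Rightarrow> bool" where
  "moments_of_all_orders M V \<longleftrightarrow> (\<forall>p>0. integrable M (\<lambda>\<omega>. \<bar>V \<omega>\<bar> powr p))"

section \<open>Marked processes\<close>

text \<open>The path \<open>s \<mapsto> x\<^sup>q z (s / x)\<close> on \<open>[0, x]\<close>, extended by \<open>0\<close>, so that marks of all lengths
  live in the single space \<^term>\<open>path_space UNIV\<close>.\<close>

definition scale_path :: "real \<Rightarrow> real \<Rightarrow> (real \<Rightarrow> real) \<Rightarrow> real \<Rightarrow> real" where
  "scale_path q x z s = (if 0 \<le> s \<and> s \<le> x then x powr q * z (s / x) else 0)"

text \<open>\<open>\<kappa>\<^sub>q(x, \<cdot>)\<close>, where \<open>\<kappa>\<^sub>q(1, \<cdot>)\<close> is the law of the random path \<open>Z\<close> under \<open>N\<close>.\<close>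

definition mark_kernel :: "real \<Rightarrow> 'b measure \<Rightarrow> ('b \<Rightarrow> real \<Rightarrow> real) \<Rightarrow> real \<Rightarrow> (real \<Rightarrow> real) measure"
  where "mark_kernel q N Z x = distr N (path_space UNIV) (\<lambda>\<omega>. scale_path q x (Z \<omega>))"

text \<open>The sigma-algebra generated by the whole process.\<close>

definition sigma_process :: "'a measure \<Rightarrow> (real \<Rightarrow> 'a \<Rightarrow> real) \<Rightarrow> 'a measure" where
  "sigma_process M X =
     vimage_algebra (space M) (\<lambda>\<omega>. \<lambda>t\<in>{0..}. X t \<omega>) (path_space {0..})"

text \<open>\<open>\<zeta> t \<omega>\<close> is the mark at time \<open>t\<close>. That the marks are, given \<open>X\<close>, independent over the jumps
  with laws \<open>\<kappa> (jump size)\<close> is expressed along arbitrary finite families of times \<open>\<tau> i\<close> that are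
  functions of \<open>X\<close>: given \<open>X\<close>, on the event that these are pairwise distinct positive-jump times,
  the joint conditional law of their marks is the product of the laws \<open>\<kappa> (jump size)\<close>. Since the
  jump times of a cadlag process can be enumerated by such \<open>\<tau> i\<close>, this determines the joint law
  of \<open>X\<close> and all its marks.\<close>

definition marked_process ::
  "'a measure \<Rightarrow> (real \<Rightarrow> 'a \<Rightarrow> real) \<Rightarrow> (real \<Rightarrow> (real \<Rightarrow> real) measure) \<Rightarrow>
     (real \<Rightarrow> 'a \<Rightarrow> real \<Rightarrow> real) \<Rightarrow> bool" where
  "marked_process M X \<kappa> \<zeta> \<longleftrightarrow>
     (\<forall>\<omega>\<in>space M. \<forall>t\<ge>0. \<forall>s. s \<notin> {0<..<jump (\<lambda>u. X u \<omega>) t} \<longrightarrow> \<zeta> t \<omega> s = 0) \<and>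
     (AE \<omega> in M. \<forall>t\<ge>0. continuous_on UNIV (\<zeta> t \<omega>)) \<and>
     (\<forall>\<tau>\<in>borel_measurable (sigma_process M X). (\<forall>\<omega>\<in>space M. 0 \<le> \<tau> \<omega>) \<longrightarrow>
        (\<lambda>\<omega>. \<zeta> (\<tau> \<omega>) \<omega>) \<in> measurable M (path_space UNIV)) \<and>
     (\<forall>(n :: nat) \<tau> B.
        (\<forall>i<n. \<tau> i \<in> borel_measurable (sigma_process M X) \<and> (\<forall>\<omega>\<in>space M. 0 \<le> \<tau> i \<omega>)) \<longrightarrow>
        (\<forall>i<n. B i \<in> sets (path_space UNIV)) \<longrightarrow>
        (AE \<omega> in M.
           inj_on (\<lambda>i. \<tau> i \<omega>) {..<n} \<and> (\<forall>i<n. 0 < jump (\<lambda>u. X u \<omega>) (\<tau> i \<omega>)) \<longrightarrow>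
           nn_cond_exp M (sigma_process M X)
               (\<lambda>\<omega>'. \<Prod>i<n. indicator (B i) (\<zeta> (\<tau> i \<omega>') \<omega>')) \<omega> =
             (\<Prod>i<n. emeasure (\<kappa> (jump (\<lambda>u. X u \<omega>) (\<tau> i \<omega>))) (B i))))"

text \<open>\<open>m\<^sub>h(y, T)\<close> for the path \<open>x\<close> with marks \<open>z\<close>. Counting measure is used instead of
  \<^const>\<open>card\<close> so that an infinite set counts as \<open>\<infinity>\<close>.\<close>

definition mark_count ::
  "(real \<Rightarrow> real) \<Rightarrow> (real \<Rightarrow> real \<Rightarrow> real) \<Rightarrow> real \<Rightarrow> real \<Rightarrow> real \<Rightarrow> ennreal" where
  "mark_count x z h y T =
     emeasure (count_space UNIV) {t. 0 \<le> t \<and> t \<le> T \<and> h \<le> z t (y - left_lim x t)}"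

section \<open>Local times\<close>

definition local_times ::
  "'a measure \<Rightarrow> (real \<Rightarrow> 'a \<Rightarrow> real) \<Rightarrow> (real \<Rightarrow> real \<Rightarrow> 'a \<Rightarrow> real) \<Rightarrow> bool" where
  "local_times M X L \<longleftrightarrow>
     (\<forall>y. \<forall>t\<ge>0. L y t \<in> borel_measurable M) \<and>
     (AE \<omega> in M. continuous_on (UNIV \<times> {0..}) (\<lambda>(y, t). L y t \<omega>)) \<and>
     (\<forall>f\<in>borel_measurable borel. bounded (range f) \<longrightarrow>
        (\<forall>T\<ge>0. AE \<omega> in M.
           has_bochner_integral lborel (\<lambda>y. f y * L y T \<omega>)
             (LINT t:{0..T}|lborel. f (X t \<omega>))))"

end

theory Submission
  imports Defs
begin

text \<open>
  A mark is counted in \<open>m\<^sub>h(y, t)\<close> if its jump, of size \<open>x\<close> from the left limit \<open>w\<close>, carries a path that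
  is at least \<open>h\<close> at \<open>y - w\<close>. As jumps occur at the rate \<open>\<nu>(dx)\<close>, where \<open>\<nu>\<close> is the Levy measure with density
  \<open>\<alpha> (1 + \<alpha>) \<Gamma>(1 - \<alpha>)\<^bsup>-1\<^esup> x\<^bsup>-2-\<alpha>\<^esup>\<close>, the count should be close to its compensator, the integral over
  \<open>0 \<le> s \<le> t\<close> of \<open>k\<^sub>h(y - X\<^sub>s)\<close> with \<open>k\<^sub>h(u) = \<integral> P(x\<^sup>q Z(u / x) \<ge> h) \<nu>(dx)\<close>. By scaling,
  \<open>k\<^sub>h(u) = h\<^bsup>-(1+\<alpha>)/q\<^esup> k\<^sub>1(u h\<^bsup>-1/q\<^esup>)\<close>, and integrating first over \<open>x\<close> shows that \<open>k\<^sub>1\<close> has the integral \<open>c\<close>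
  (\<open>exceedance_measure\<close>). So \<open>h\<^bsup>\<alpha>/q\<^esup> k\<^sub>h\<close> is \<open>c\<close> times an approximate identity, and by the occupation density
  formula \<open>h\<^bsup>\<alpha>/q\<^esup> / c\<close> times the compensator is a smoothed local time, which converges to the local time
  uniformly in \<open>y\<close> (\<open>compensator_tendsto_local_time\<close>).

  The deviation of the count from its compensator is controlled by an exponential inequality: for both
  signs of \<open>\<theta>\<close>, the variable \<open>exp (\<theta> (count) - (exp \<theta> - 1) (compensator))\<close> has a mean of at most \<open>1\<close>
  (\<open>smooth_count_exponential_inequality\<close>). Count and compensator are of order \<open>h\<^bsup>-\<alpha>/q\<^esup>\<close>, so a relative
  deviation of size \<open>\<rho>\<close> has a probability of order \<open>exp (- \<rho>\<^sup>2 h\<^bsup>-\<alpha>/q\<^esup>)\<close>. This beats any number of levels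
  that is a power of \<open>1 / h\<close>, and Borel-Cantelli yields uniform bounds along geometric sequences of heights
  \<open>h\<close> and fine grids of levels \<open>y\<close> (\<open>count_bounds_eventually\<close>). Between the levels of the grid the marks
  vary by less than \<open>\<rho> h\<close>: the moments of \<open>D\<^sub>\<gamma>\<close> imply that the Hoelder constants of all marks up to time
  \<open>t\<close> are eventually at most \<open>2\<^sup>n\<close> at the \<open>n\<close>-th height (\<open>marks_eventually_holder\<close>). The remaining heights and
  times follow because the count is monotone in \<open>h\<close> and in \<open>t\<close>, with a limit that is continuous in \<open>t\<close>.

  The exponential inequality is obtained from the increments of \<open>X\<close> over a grid of times, which are
  independent. Over a short time \<open>\<tau>\<close> the law of an increment is to first order \<open>\<tau> \<nu>\<close> away from \<open>0\<close>; this
  is read off from the second differences of the Laplace transform (\<open>small_time_convergence\<close>). For a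
  function \<open>\<phi>\<close> of the position and the increment, with mean value \<open>E \<phi>\<close> given the position, the product of
  the factors \<open>(1 + a \<phi>) exp (- a E \<phi>)\<close> has a mean of at most \<open>1\<close>, and in the limit of
  a vanishing mesh Fatou's lemma gives an inequality for the jumps (\<open>jump_exponential_inequality\<close>). The
  marks are included by averaging over them given \<open>X\<close> (\<open>marking_theorem\<close>). The indicators of the
  heights above \<open>h\<close> are replaced by continuous ramps, and the small jumps are removed by cutoffs, which are
  then lifted by Fatou's lemma again.
\<close>

section \<open>Cadlag paths\<close>

lemma cadlag_left_lim:
  assumes "cadlag x" "0 < t"
  shows "(x \<longlongrightarrow> left_lim x t) (at_left t)"
proof -
  from assms obtain l where l: "(x \<longlongrightarrow> l) (at_left t)" by (auto simp: cadlag_def)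
  have "Lim (at_left t) x = l" by (rule tendsto_Lim[OF _ l]) simp
  with l assms show ?thesis by (simp add: left_lim_def)
qed

lemma cadlag_right:
  assumes "cadlag x" "0 \<le> t"
  shows "(x \<longlongrightarrow> x t) (at_right t)"
  using assms by (auto simp: cadlag_def)

text \<open>The substitute for uniform continuity of a cadlag path: its increments over short intervals are
  small unless the interval contains one of finitely many exceptional times. The times of the jumps
  larger than \<open>e\<close> are necessarily among the latter.\<close>

definition small_oscillation_off :: "(real \<Rightarrow> real) \<Rightarrow> real \<Rightarrow> real \<Rightarrow> real set \<Rightarrow> real \<Rightarrow> bool" where
  "small_oscillation_off x t e S \<delta> \<longleftrightarrow> finite S \<and> 0 < \<delta> \<and> (\<forall>a b. 0 \<le> a \<longrightarrow> a \<le> b \<longrightarrow> b \<le> t \<longrightarrow> b - a < \<delta> \<longrightarrow>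
     {a<..b} \<inter> S = {} \<longrightarrow> \<bar>x b - x a\<bar> < e)"

lemma small_oscillation_offD:
  assumes "small_oscillation_off x t e S \<delta>"
  shows "finite S" "0 < \<delta>"
    "0 \<le> a \<Longrightarrow> a \<le> b \<Longrightarrow> b \<le> t \<Longrightarrow> b - a < \<delta> \<Longrightarrow> {a<..b} \<inter> S = {} \<Longrightarrow> \<bar>x b - x a\<bar> < e"
  using assms unfolding small_oscillation_off_def by blast+

text \<open>Around any time \<open>u\<close> the one-sided limits make the increments that do not cross \<open>u\<close> small. By
  compactness finitely many such \<open>u\<close> serve for the whole of \<open>[0, t]\<close>; they are the exceptional times,
  and a Lebesgue number of the cover is the length.\<close>

lemma cadlag_small_oscillation:
  assumes x: "cadlag x" and e: "0 < e"
  obtains S \<delta> where "small_oscillation_off x t e S \<delta>"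
proof -
  define P where "P u d \<longleftrightarrow> (\<forall>a b. 0 \<le> a \<and> a \<le> b \<and> u - d < a \<and> b < u + d \<and> u \<notin> {a<..b} \<longrightarrow> \<bar>x b - x a\<bar> < e)" for u d
  have "\<exists>d>0. P u d" if u: "u \<in> {0..t}" for u
  proof -
    have "\<forall>\<^sub>F a in at_right u. dist (x a) (x u) < e/2"
      using cadlag_right[OF x, of u] u e by (intro tendstoD) auto
    then obtain c where c: "c > u" "\<And>a. u < a \<Longrightarrow> a < c \<Longrightarrow> \<bar>x a - x u\<bar> < e/2"
      by (auto simp: eventually_at_right_field dist_real_def)
    have R: "\<bar>x b - x a\<bar> < e" if "u \<le> a" "a < c" "u \<le> b" "b < c" for a b
    proof -
      have 1: "\<bar>x a - x u\<bar> < e/2" if "u \<le> a" "a < c" for a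
        using c(2)[of a] that e by (cases "a = u") auto
      show ?thesis using 1[of a] 1[of b] that by linarith
    qed
    show ?thesis
    proof (cases "u = 0")
      case True
      have "P u (c - u)" unfolding P_def using R True by auto
      then show ?thesis using c(1) by (intro exI[of _ "c - u"]) auto
    next
      case False
      with u have u0: "u > 0" by auto
      have "\<forall>\<^sub>F a in at_left u. dist (x a) (left_lim x u) < e/2"
        using cadlag_left_lim[OF x u0] e by (intro tendstoD) auto
      then obtain c' where c': "c' < u" "\<And>a. c' < a \<Longrightarrow> a < u \<Longrightarrow> \<bar>x a - left_lim x u\<bar> < e/2"
        by (auto simp: eventually_at_left_field dist_real_def)
      have "P u (min (c - u) (u - c'))" unfolding P_def
      proof (intro allI impI)
        fix a b assume h: "0 \<le> a \<and> a \<le> b \<and> u - min (c - u) (u - c') < a \<and> b < u + min (c - u) (u - c') \<and> u \<notin> {a<..b}"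
        then consider "u \<le> a" | "b < u" by fastforce
        then show "\<bar>x b - x a\<bar> < e"
        proof cases
          case 1 with h R[of a b] show ?thesis by auto
        next
          case 2
          with h have "c' < a" "c' < b" "a < u" by auto
          with 2 have "\<bar>x a - left_lim x u\<bar> < e/2" "\<bar>x b - left_lim x u\<bar> < e/2" using c'(2) by blast+
          then show ?thesis by linarith
        qed
      qed
      then show ?thesis using c(1) c'(1) by (intro exI[of _ "min (c - u) (u - c')"]) auto
    qed
  qed
  then obtain d where d: "\<And>u. u \<in> {0..t} \<Longrightarrow> d u > 0 \<and> P u (d u)" by metis
  have "{0..t} \<subseteq> (\<Union>u\<in>{0..t}. ball u (d u))" using d by force
  then obtain C where C: "C \<subseteq> {0..t}" "finite C" "{0..t} \<subseteq> (\<Union>u\<in>C. ball u (d u))"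
    by (rule compactE_image[of "{0..t}" "{0..t}" "\<lambda>u. ball u (d u)", rotated 2]) auto
  have "\<exists>\<delta>>0. \<forall>y\<in>{0..t}. \<exists>G\<in>(\<lambda>u. ball u (d u)) ` C. ball y \<delta> \<subseteq> G"
    by (rule Heine_Borel_lemma[of "{0..t}" "(\<lambda>u. ball u (d u)) ` C"]) (use C in auto)
  then obtain \<delta> where \<delta>: "\<delta> > 0" "\<And>y. y \<in> {0..t} \<Longrightarrow> \<exists>u\<in>C. ball y \<delta> \<subseteq> ball u (d u)"
    by auto
  have "\<bar>x b - x a\<bar> < e" if h: "0 \<le> a" "a \<le> b" "b \<le> t" "b - a < \<delta>" "{a<..b} \<inter> C = {}" for a b
  proof -
    obtain u where u: "u \<in> C" "ball a \<delta> \<subseteq> ball u (d u)" using \<delta>(2)[of a] h by auto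
    have "a \<in> ball u (d u)" "b \<in> ball u (d u)" using u(2) h \<delta>(1) by (auto simp: subset_iff dist_real_def)
    then have "u - d u < a" "b < u + d u" by (auto simp: dist_real_def)
    moreover have "u \<notin> {a<..b}" using h(5) u(1) by auto
    moreover have "P u (d u)" using d u(1) C(1) by auto
    ultimately show ?thesis using h unfolding P_def by blast
  qed
  then show thesis using C \<delta> by (intro that[of C \<delta>]) (auto simp: small_oscillation_off_def)
qed

lemma cadlag_seq_left:
  assumes x: "cadlag x" and s: "0 < s" and p: "\<And>n. p n < s" "p \<longlonglongrightarrow> s"
  shows "(\<lambda>n. x (p n)) \<longlonglongrightarrow> left_lim x s"
  using cadlag_left_lim[OF x s] p
  by (intro tendsto_compose_filtermap[unfolded o_def] filterlim_compose[OF cadlag_left_lim[OF x s]])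
     (auto simp: filterlim_at less_imp_neq)

lemma cadlag_seq_right:
  assumes x: "cadlag x" and s: "0 \<le> s" and r: "\<And>n. s \<le> r n" "r \<longlonglongrightarrow> s"
  shows "(\<lambda>n. x (r n)) \<longlonglongrightarrow> x s"
proof -
  have "(x \<longlongrightarrow> x s) (at s within {s..})"
    using cadlag_right[OF x s]
    by (metis at_within_Ici_at_right)
  then have "continuous (at s within {s..}) x" by (simp add: continuous_within)
  then show ?thesis
    using r by (intro continuous_within_tendsto_compose'[of s "{s..}" x r]) auto
qed

lemma left_lim_bound:
  assumes x: "cadlag x" and s: "0 < s" "s \<le> t" and R: "\<And>u. 0 \<le> u \<Longrightarrow> u \<le> t \<Longrightarrow> x u \<in> {a..b}"
  shows "left_lim x s \<in> {a..b}"
proof -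
  have "\<forall>\<^sub>F u in at_left s. x u \<in> {a..b}"
    using s R unfolding eventually_at_left_field by (intro exI[of _ 0]) auto
  then show ?thesis
    using Lim_in_closed_set[OF closed_atLeastAtMost _ _ cadlag_left_lim[OF x s(1)]] by simp
qed

text \<open>The path moves by less than \<open>1\<close> after the last preceding time of a finite set, made of the
  exceptional times and of a mesh finer than \<open>\<delta>\<close>.\<close>

lemma cadlag_bounded:
  assumes x: "cadlag x" and t: "0 \<le> t"
  obtains B where "B > 0" "\<And>s. 0 \<le> s \<Longrightarrow> s \<le> t \<Longrightarrow> \<bar>x s\<bar> \<le> B"
proof -
  obtain S \<delta> where S0: "small_oscillation_off x t 1 S \<delta>"
    by (rule cadlag_small_oscillation[OF x zero_less_one])
  note S = small_oscillation_offD[OF S0]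
  obtain n :: nat where n: "t < \<delta> * n" using S(2) ex_less_of_nat_mult[of \<delta> t] by (auto simp: mult.commute)
  have n0: "n > 0" using n t by (cases n) auto
  define F where "F = insert 0 (S \<inter> {0..t}) \<union> (\<lambda>k. t * real k / n) ` {..n}"
  have F: "finite F" using S(1) by (auto simp: F_def)
  have *: "\<exists>c\<in>F. 0 \<le> c \<and> \<bar>x s - x c\<bar> < 1" if s: "0 \<le> s" "s \<le> t" for s
  proof -
    define c where "c = Max {c\<in>F. c \<le> s}"
    have ne: "{c\<in>F. c \<le> s} \<noteq> {}" using s by (auto simp: F_def)
    have c: "c \<in> F" "c \<le> s" using Max_in[OF _ ne] F by (auto simp: c_def)
    have cm: "u \<le> c" if "u \<in> F" "u \<le> s" for u
      unfolding c_def using that F by (intro Max_ge) auto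
    have c0: "0 \<le> c" using cm[of 0] s by (auto simp: F_def)
    have "s - c < \<delta>"
    proof (cases "t = 0")
      case True with s c0 c S(2) show ?thesis by auto
    next
      case False
      with t have t0: "t > 0" by simp
      define k where "k = nat \<lfloor>s * n / t\<rfloor>"
      have k1: "real k \<le> s * n / t" using s t0 by (simp add: k_def)
      have k2: "s * n / t < real k + 1" using s t0 unfolding k_def by linarith
      have "real k \<le> n" using k1 s t0 n0 by (smt (verit, best) divide_right_mono mult_right_mono nonzero_mult_div_cancel_left of_nat_0_le_iff)
      then have "t * real k / n \<in> F" by (auto simp: F_def)
      moreover have "t * real k / n \<le> s" using k1 t0 n0 by (simp add: field_simps)
      ultimately have "t * real k / n \<le> c" by (rule cm)
      moreover have "s < t * real k / n + t / n" using k2 t0 n0 by (simp add: field_simps)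
      moreover have "t / n < \<delta>" using n n0 by (simp add: field_simps)
      ultimately show ?thesis by linarith
    qed
    moreover have "{c<..s} \<inter> S = {}"
    proof (rule ccontr)
      assume "{c<..s} \<inter> S \<noteq> {}"
      then obtain u where u: "u \<in> S" "c < u" "u \<le> s" by auto
      then have "u \<in> F" using s c0 by (auto simp: F_def)
      with cm[of u] u show False by auto
    qed
    ultimately show ?thesis using S(3)[of c s] c c0 s by auto
  qed
  show thesis
  proof (rule that[of "1 + (\<Sum>c\<in>F. \<bar>x c\<bar>)"])
    show "0 < 1 + (\<Sum>c\<in>F. \<bar>x c\<bar>)" by (smt (verit, best) sum_nonneg)
    fix s assume "0 \<le> s" "s \<le> t"
    then obtain c where c: "c \<in> F" "\<bar>x s - x c\<bar> < 1" using * by blast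
    have "\<bar>x c\<bar> \<le> (\<Sum>c\<in>F. \<bar>x c\<bar>)" using c F by (intro member_le_sum) auto
    then show "\<bar>x s\<bar> \<le> 1 + (\<Sum>c\<in>F. \<bar>x c\<bar>)" using c by linarith
  qed
qed

definition big_jumps :: "(real \<Rightarrow> real) \<Rightarrow> real \<Rightarrow> real \<Rightarrow> real set" where
  "big_jumps x e t = {s \<in> {0<..t}. e < jump x s}"

lemma jump_le_if_no_oscillation:
  assumes x: "cadlag x" and osc: "small_oscillation_off x t e S \<delta>"
    and s: "0 < s" "s \<le> t" "s \<notin> S"
  shows "\<bar>jump x s\<bar> \<le> e"
proof -
  note S = small_oscillation_offD[OF osc]
  have "open (- S)" using S(1) by (simp add: finite_imp_closed open_Compl)
  then obtain d where d: "d > 0" "ball s d \<subseteq> - S" using s(3) by (auto simp: open_contains_ball)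
  have "\<forall>\<^sub>F a in at_left s. \<bar>x s - x a\<bar> \<le> e"
    unfolding eventually_at_left_field
  proof (intro exI[of _ "max 0 (max (s - d) (s - \<delta>))"] conjI allI impI)
    fix a assume a: "max 0 (max (s - d) (s - \<delta>)) < a" "a < s"
    have "{a<..s} \<inter> S = {}" using d a by (auto simp: dist_real_def subset_iff)
    then show "\<bar>x s - x a\<bar> \<le> e" using S(3)[of a s] a s by auto
  qed (use s d S(2) in auto)
  moreover have "((\<lambda>a. \<bar>x s - x a\<bar>) \<longlongrightarrow> \<bar>x s - left_lim x s\<bar>) (at_left s)"
    by (intro tendsto_intros cadlag_left_lim x s)
  ultimately show ?thesis
    unfolding jump_def by (intro tendsto_upperbound) auto
qed

lemma finite_big_jumps:
  assumes x: "cadlag x" and e: "0 < e"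
  shows "finite (big_jumps x e t)"
proof -
  obtain S \<delta> where S0: "small_oscillation_off x t e S \<delta>"
    by (rule cadlag_small_oscillation[OF x e])
  note S = small_oscillation_offD[OF S0]
  have "s \<in> S" if "s \<in> big_jumps x e t" for s
    using jump_le_if_no_oscillation[OF x S0, of s] that unfolding big_jumps_def by (cases "s \<in> S") auto
  then have "big_jumps x e t \<subseteq> S" by blast
  then show ?thesis using S(1) finite_subset by blast
qed

definition grid :: "real \<Rightarrow> nat \<Rightarrow> nat \<Rightarrow> real" where
  "grid t n k = t * real k / real n"

text \<open>The index \<open>k\<close> of the cell \<open>(t k / n, t (k + 1) / n]\<close> that contains \<open>s\<close>.\<close>

definition grid_index :: "real \<Rightarrow> nat \<Rightarrow> real \<Rightarrow> nat" where
  "grid_index t n s = nat (\<lceil>s * real n / t\<rceil> - 1)"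

lemma grid_index_iff:
  assumes "0 < t" "0 < n" "0 < s"
  shows "grid_index t n s = k \<longleftrightarrow> grid t n k < s \<and> s \<le> grid t n (Suc k)"
proof -
  have "\<lceil>s * real n / t\<rceil> > 0" using assms by simp
  then have "grid_index t n s = k \<longleftrightarrow> \<lceil>s * real n / t\<rceil> = int k + 1"
    unfolding grid_index_def by linarith
  also have "\<dots> \<longleftrightarrow> real k < s * real n / t \<and> s * real n / t \<le> real k + 1"
    by (simp add: ceiling_eq_iff)
  also have "\<dots> \<longleftrightarrow> grid t n k < s \<and> s \<le> grid t n (Suc k)"
    using assms by (auto simp: grid_def field_simps)
  finally show ?thesis .
qed

lemma grid_index_bounds:
  assumes "0 < t" "0 < n" "0 < s"
  shows "grid t n (grid_index t n s) < s" "s \<le> grid t n (Suc (grid_index t n s))"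
  using grid_index_iff[OF assms] by blast+

lemma grid_index_less:
  assumes "0 < t" "0 < n" "0 < s" "s \<le> t"
  shows "grid_index t n s < n"
proof -
  have "grid t n (grid_index t n s) < t" using grid_index_bounds(1)[OF assms(1-3)] assms by simp
  then have "t * real (grid_index t n s) < t * real n" using assms by (simp add: grid_def field_simps)
  then show ?thesis using assms by simp
qed

lemma grid_mono: "0 \<le> t \<Longrightarrow> j \<le> k \<Longrightarrow> grid t n j \<le> grid t n k"
  by (auto simp: grid_def intro!: divide_right_mono mult_left_mono)

lemma grid_nonneg [simp]: "0 \<le> t \<Longrightarrow> 0 \<le> grid t n k"
  by (simp add: grid_def)

lemma grid_le: "0 \<le> t \<Longrightarrow> k \<le> n \<Longrightarrow> grid t n k \<le> t"
  by (cases "n = 0") (auto simp: grid_def divide_le_eq mult_left_mono)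

lemma grid_Suc: "grid t n (Suc k) = grid t n k + t / n"
  by (simp add: grid_def distrib_left add_divide_distrib)

lemma grid_0 [simp]: "grid t n 0 = 0"
  by (simp add: grid_def)

lemma grid_index_tendsto:
  assumes t: "0 < t" and s: "0 < s"
  shows "(\<lambda>n. grid t (Suc n) (grid_index t (Suc n) s)) \<longlonglongrightarrow> s"
    "(\<lambda>n. grid t (Suc n) (Suc (grid_index t (Suc n) s))) \<longlonglongrightarrow> s"
proof -
  have l: "(\<lambda>n. s - t / real (Suc n)) \<longlonglongrightarrow> s" "(\<lambda>n. s + t / real (Suc n)) \<longlonglongrightarrow> s"
    using tendsto_diff[OF tendsto_const lim_const_over_n[THEN LIMSEQ_Suc, of t], of s]
       tendsto_add[OF tendsto_const lim_const_over_n[THEN LIMSEQ_Suc, of t], of s] by simp_all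
  note b = grid_index_bounds[OF t _ s, of "Suc n" for n, simplified grid_Suc]
  show "(\<lambda>n. grid t (Suc n) (grid_index t (Suc n) s)) \<longlonglongrightarrow> s"
    by (rule tendsto_sandwich[OF _ _ l(1) tendsto_const])
       (use b in \<open>auto intro!: always_eventually simp: diff_le_eq less_imp_le\<close>)
  show "(\<lambda>n. grid t (Suc n) (Suc (grid_index t (Suc n) s))) \<longlonglongrightarrow> s"
    by (rule tendsto_sandwich[OF _ _ tendsto_const l(2)])
       (use b in \<open>auto intro!: always_eventually simp: grid_Suc less_imp_le\<close>)
qed

lemma grid_index_inj_eventually:
  assumes t: "0 < t" and S: "finite S" "S \<subseteq> {0<..t}"
  shows "\<forall>\<^sub>F n in sequentially. inj_on (grid_index t (Suc n)) S"
proof -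
  have "\<forall>\<^sub>F n in sequentially. s \<noteq> s' \<longrightarrow> grid_index t (Suc n) s \<noteq> grid_index t (Suc n) s'"
    if s: "s \<in> S" "s' \<in> S" for s s'
  proof (cases "s = s'")
    case False
    have "(\<lambda>n. t / real (Suc n)) \<longlonglongrightarrow> 0" by (rule lim_const_over_n[THEN LIMSEQ_Suc])
    then have "\<forall>\<^sub>F n in sequentially. t / real (Suc n) < \<bar>s - s'\<bar>"
      using False by (intro order_tendstoD) auto
    then show ?thesis
    proof eventually_elim
      case (elim n)
      have "0 < s" "0 < s'" using s S by auto
      with grid_index_bounds[OF t _ this(1), of "Suc n"] grid_index_bounds[OF t _ this(2), of "Suc n"] elim
      show ?case by (auto simp: grid_Suc)
    qed
  qed simp
  then have "\<forall>\<^sub>F n in sequentially. \<forall>s\<in>S. \<forall>s'\<in>S. s \<noteq> s' \<longrightarrow> grid_index t (Suc n) s \<noteq> grid_index t (Suc n) s'"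
    using S(1) by (intro eventually_ball_finite ballI)
  then show ?thesis by eventually_elim (auto simp: inj_on_def)
qed

text \<open>For a fine grid each exceptional time has a cell of its own, over which the increment tends to the
  jump; over the other cells the increments are below \<open>e\<close>, so that the factors are \<open>1\<close>.\<close>

lemma prod_increments_tendsto_prod_jumps:
  fixes f :: "real \<Rightarrow> real \<Rightarrow> real"
  assumes x: "cadlag x" and t: "0 < t" and e: "0 < e"
    and f: "continuous_on UNIV (\<lambda>(w, d). f w d)" and f1: "\<And>w d. d \<le> e \<Longrightarrow> f w d = 1"
  shows "(\<lambda>n. \<Prod>k<Suc n. f (x (grid t (Suc n) k)) (x (grid t (Suc n) (Suc k)) - x (grid t (Suc n) k)))
           \<longlonglongrightarrow> (\<Prod>s\<in>big_jumps x e t. f (left_lim x s) (jump x s))"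
proof -
  obtain S' \<delta> where osc: "small_oscillation_off x t e S' \<delta>" by (rule cadlag_small_oscillation[OF x e])
  note O = small_oscillation_offD[OF osc]
  define S where "S = S' \<inter> {0<..t}"
  have S: "finite S" "S \<subseteq> {0<..t}" using O(1) by (auto simp: S_def)
  let ?i = "\<lambda>n. grid_index t (Suc n)"
  let ?g = "\<lambda>n k. f (x (grid t (Suc n) k)) (x (grid t (Suc n) (Suc k)) - x (grid t (Suc n) k))"
  have "(\<lambda>n. t / real (Suc n)) \<longlonglongrightarrow> 0" by (rule lim_const_over_n[THEN LIMSEQ_Suc])
  then have ev: "\<forall>\<^sub>F n in sequentially. t / real (Suc n) < \<delta>"
    using O(2) by (intro order_tendstoD) auto
  have "\<forall>\<^sub>F n in sequentially. (\<Prod>s\<in>S. ?g n (?i n s)) = (\<Prod>k<Suc n. ?g n k)"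
    using ev grid_index_inj_eventually[OF t S]
  proof eventually_elim
    case (elim n)
    have "(\<Prod>s\<in>S. ?g n (?i n s)) = (\<Prod>k\<in>?i n ` S. ?g n k)"
      by (simp add: prod.reindex[OF elim(2)])
    also have "\<dots> = (\<Prod>k<Suc n. ?g n k)"
    proof (rule prod.mono_neutral_left)
      show "?i n ` S \<subseteq> {..<Suc n}" using grid_index_less[OF t, of "Suc n"] S by auto
      show "\<forall>k\<in>{..<Suc n} - ?i n ` S. ?g n k = 1"
      proof
        fix k assume k: "k \<in> {..<Suc n} - ?i n ` S"
        have "{grid t (Suc n) k<..grid t (Suc n) (Suc k)} \<inter> S' = {}"
        proof (rule ccontr)
          assume "\<not> ?thesis"
          then obtain s where s: "s \<in> S'" "grid t (Suc n) k < s" "s \<le> grid t (Suc n) (Suc k)" by auto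
          have "0 < s" using s(2) grid_nonneg[of t "Suc n" k] t by linarith
          moreover have "s \<le> t" using s(3) grid_le[of t "Suc k" "Suc n"] k t by auto
          moreover have "?i n s = k" using grid_index_iff[OF t _ \<open>0 < s\<close>, of "Suc n" k] s by auto
          ultimately have "s \<in> S" "?i n s = k" using s(1) by (auto simp: S_def)
          with k show False by blast
        qed
        then have "\<bar>x (grid t (Suc n) (Suc k)) - x (grid t (Suc n) k)\<bar> < e"
          using elim(1) k t by (intro O(3) grid_mono grid_le) (auto simp: grid_Suc)
        then show "?g n k = 1" by (intro f1) auto
      qed
    qed auto
    finally show ?case .
  qed
  moreover have "(\<lambda>n. \<Prod>s\<in>S. ?g n (?i n s)) \<longlonglongrightarrow> (\<Prod>s\<in>S. f (left_lim x s) (jump x s))"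
  proof (intro tendsto_prod)
    fix s assume "s \<in> S"
    then have s: "0 < s" using S by auto
    have 1: "(\<lambda>n. x (grid t (Suc n) (?i n s))) \<longlonglongrightarrow> left_lim x s"
      using s t by (intro cadlag_seq_left[OF x s] grid_index_tendsto grid_index_bounds) auto
    have 2: "(\<lambda>n. x (grid t (Suc n) (Suc (?i n s)))) \<longlonglongrightarrow> x s"
      using s t by (intro cadlag_seq_right[OF x] grid_index_tendsto grid_index_bounds) auto
    have "isCont (\<lambda>(w, d). f w d) (left_lim x s, jump x s)"
      using f by (simp add: continuous_on_eq_continuous_at)
    from this[unfolded jump_def, THEN isCont_tendsto_compose, OF tendsto_Pair[OF 1 tendsto_diff[OF 2 1]]]
    show "(\<lambda>n. ?g n (?i n s)) \<longlonglongrightarrow> f (left_lim x s) (jump x s)"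
      by (simp add: jump_def)
  qed
  moreover have "(\<Prod>s\<in>S. f (left_lim x s) (jump x s)) = (\<Prod>s\<in>big_jumps x e t. f (left_lim x s) (jump x s))"
  proof (rule prod.mono_neutral_right[OF S(1)])
    show "big_jumps x e t \<subseteq> S"
    proof
      fix s assume s: "s \<in> big_jumps x e t"
      then have "s \<in> S'" using jump_le_if_no_oscillation[OF x osc, of s]
        unfolding big_jumps_def by (cases "s \<in> S'") auto
      with s show "s \<in> S" by (auto simp: S_def big_jumps_def)
    qed
    show "\<forall>s\<in>S - big_jumps x e t. f (left_lim x s) (jump x s) = 1"
      using S(2) by (auto simp: big_jumps_def intro!: f1)
  qed
  ultimately show ?thesis by (simp add: Lim_transform_eventually)
qed

lemma real_floor_approx: "(\<lambda>n. real_of_int \<lfloor>u * real (Suc n)\<rfloor> / real (Suc n)) \<longlonglongrightarrow> u"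
proof (rule tendsto_sandwich[OF _ _ _ tendsto_const])
  show "(\<lambda>n. u - 1 / real (Suc n)) \<longlonglongrightarrow> u"
    using tendsto_diff[OF tendsto_const lim_const_over_n[THEN LIMSEQ_Suc, of 1], of u] by simp
  show "\<forall>\<^sub>F n in sequentially. u - 1 / real (Suc n) \<le> real_of_int \<lfloor>u * real (Suc n)\<rfloor> / real (Suc n)"
  proof (intro always_eventually allI)
    fix n
    have "(u * real (Suc n) - 1) / real (Suc n) \<le> real_of_int \<lfloor>u * real (Suc n)\<rfloor> / real (Suc n)"
      by (intro divide_right_mono) linarith+
    then show "u - 1 / real (Suc n) \<le> real_of_int \<lfloor>u * real (Suc n)\<rfloor> / real (Suc n)"
      by (simp add: diff_divide_distrib del: of_nat_Suc)
  qed
  show "\<forall>\<^sub>F n in sequentially. real_of_int \<lfloor>u * real (Suc n)\<rfloor> / real (Suc n) \<le> u"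
    by (intro always_eventually allI) (simp add: pos_divide_le_eq)
qed

text \<open>The path is the limit of step functions with values at the multiples of \<open>1 / (n + 1)\<close>.\<close>

lemma caratheodory_measurable:
  fixes f :: "'w \<Rightarrow> real \<Rightarrow> real"
  assumes cont: "\<And>\<omega>. \<omega> \<in> space N \<Longrightarrow> continuous_on UNIV (f \<omega>)"
    and meas: "\<And>u. (\<lambda>\<omega>. f \<omega> u) \<in> borel_measurable N"
  shows "(\<lambda>(u, \<omega>). f \<omega> u) \<in> borel_measurable (borel \<Otimes>\<^sub>M N)"
proof (rule borel_measurable_LIMSEQ_real)
  fix p :: "real \<times> 'w" assume p: "p \<in> space (borel \<Otimes>\<^sub>M N)"
  obtain u \<omega> where [simp]: "p = (u, \<omega>)" by (cases p)
  have \<omega>: "\<omega> \<in> space N" using p by (simp add: space_pair_measure)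
  have "(\<lambda>n. f \<omega> (real_of_int \<lfloor>u * real (Suc n)\<rfloor> / real (Suc n))) \<longlonglongrightarrow> f \<omega> u"
    using cont[OF \<omega>] real_floor_approx[of u] by (auto simp: continuous_on_sequentially o_def)
  then show "(\<lambda>n. case p of (u, \<omega>) \<Rightarrow> f \<omega> (real_of_int \<lfloor>u * real (Suc n)\<rfloor> / real (Suc n))) \<longlonglongrightarrow> (case p of (u, \<omega>) \<Rightarrow> f \<omega> u)"
    by simp
next
  fix n
  have g: "(\<lambda>p. \<lfloor>fst p * real (Suc n)\<rfloor>) \<in> borel \<Otimes>\<^sub>M N \<rightarrow>\<^sub>M count_space UNIV" by measurable
  have "(\<lambda>p. f (snd p) (real_of_int \<lfloor>fst p * real (Suc n)\<rfloor> / real (Suc n))) \<in> borel_measurable (borel \<Otimes>\<^sub>M N)"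
    by (rule measurable_compose_countable[OF _ g]) (rule measurable_compose[OF measurable_snd meas])
  then show "(\<lambda>p. case p of (u, \<omega>) \<Rightarrow> f \<omega> (real_of_int \<lfloor>u * real (Suc n)\<rfloor> / real (Suc n))) \<in> borel_measurable (borel \<Otimes>\<^sub>M N)"
    by (simp add: case_prod_beta')
qed

lemma cadlag_right_approx:
  assumes x: "cadlag x" and s: "0 \<le> s"
  shows "(\<lambda>n. x ((real_of_int \<lfloor>s * real (Suc n)\<rfloor> + 1) / real (Suc n))) \<longlonglongrightarrow> x s"
proof (rule cadlag_seq_right[OF x s])
  have *: "s \<le> (real_of_int \<lfloor>s * real (Suc n)\<rfloor> + 1) / real (Suc n)"
     "(real_of_int \<lfloor>s * real (Suc n)\<rfloor> + 1) / real (Suc n) \<le> s + 1 / real (Suc n)" for n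
  proof -
    have "s * real (Suc n) \<le> real_of_int \<lfloor>s * real (Suc n)\<rfloor> + 1" by linarith
    then show "s \<le> (real_of_int \<lfloor>s * real (Suc n)\<rfloor> + 1) / real (Suc n)" by (simp add: pos_le_divide_eq)
    have "real_of_int \<lfloor>s * real (Suc n)\<rfloor> + 1 \<le> s * real (Suc n) + 1" by linarith
    then have "(real_of_int \<lfloor>s * real (Suc n)\<rfloor> + 1) / real (Suc n) \<le> (s * real (Suc n) + 1) / real (Suc n)"
      by (rule divide_right_mono) simp
    then show "(real_of_int \<lfloor>s * real (Suc n)\<rfloor> + 1) / real (Suc n) \<le> s + 1 / real (Suc n)"
      by (simp add: add_divide_distrib del: of_nat_Suc)
  qed
  show "s \<le> (real_of_int \<lfloor>s * real (Suc n)\<rfloor> + 1) / real (Suc n)" for n by (rule *)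
  have l: "(\<lambda>n. s + 1 / real (Suc n)) \<longlonglongrightarrow> s"
    using tendsto_add[OF tendsto_const lim_const_over_n[THEN LIMSEQ_Suc, of 1], of s] by simp
  show "(\<lambda>n. (real_of_int \<lfloor>s * real (Suc n)\<rfloor> + 1) / real (Suc n)) \<longlonglongrightarrow> s"
    by (rule tendsto_sandwich[OF _ _ tendsto_const l]) (use * in \<open>auto intro!: always_eventually\<close>)
qed

lemma cadlag_left_approx:
  assumes x: "cadlag x" and s: "0 < s"
  shows "(\<lambda>n. x (max 0 ((real_of_int \<lceil>s * real (Suc n)\<rceil> - 1) / real (Suc n)))) \<longlonglongrightarrow> left_lim x s"
proof (rule cadlag_seq_left[OF x s])
  have *: "(real_of_int \<lceil>s * real (Suc n)\<rceil> - 1) / real (Suc n) < s"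
     "s - 1 / real (Suc n) \<le> (real_of_int \<lceil>s * real (Suc n)\<rceil> - 1) / real (Suc n)" for n
  proof -
    have "real_of_int \<lceil>s * real (Suc n)\<rceil> - 1 < s * real (Suc n)" by linarith
    then show "(real_of_int \<lceil>s * real (Suc n)\<rceil> - 1) / real (Suc n) < s" by (simp add: pos_divide_less_eq)
    have "s * real (Suc n) - 1 \<le> real_of_int \<lceil>s * real (Suc n)\<rceil> - 1" by linarith
    then have "(s * real (Suc n) - 1) / real (Suc n) \<le> (real_of_int \<lceil>s * real (Suc n)\<rceil> - 1) / real (Suc n)"
      by (rule divide_right_mono) simp
    then show "s - 1 / real (Suc n) \<le> (real_of_int \<lceil>s * real (Suc n)\<rceil> - 1) / real (Suc n)"
      by (simp add: diff_divide_distrib del: of_nat_Suc)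
  qed
  show "max 0 ((real_of_int \<lceil>s * real (Suc n)\<rceil> - 1) / real (Suc n)) < s" for n
    using *(1)[of n] s by auto
  have l: "(\<lambda>n. s - 1 / real (Suc n)) \<longlonglongrightarrow> s"
    using tendsto_diff[OF tendsto_const lim_const_over_n[THEN LIMSEQ_Suc, of 1], of s] by simp
  show "(\<lambda>n. max 0 ((real_of_int \<lceil>s * real (Suc n)\<rceil> - 1) / real (Suc n))) \<longlonglongrightarrow> s"
    by (rule tendsto_sandwich[OF _ _ l tendsto_const])
       (use * s in \<open>auto intro!: always_eventually simp: le_max_iff_disj less_imp_le\<close>)
qed

lemma cadlag_measurable:
  assumes x: "cadlag x"
  shows "(\<lambda>s. x (max 0 s)) \<in> borel_measurable borel"
proof (rule borel_measurable_LIMSEQ_real)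
  show "(\<lambda>n. x ((real_of_int \<lfloor>max 0 s * real (Suc n)\<rfloor> + 1) / real (Suc n))) \<longlonglongrightarrow> x (max 0 s)" for s
    by (rule cadlag_right_approx[OF x]) simp
  show "(\<lambda>s. x ((real_of_int \<lfloor>max 0 s * real (Suc n)\<rfloor> + 1) / real (Suc n))) \<in> borel_measurable borel" for n
    by (rule measurable_compose[where N="count_space UNIV" and f="\<lambda>s. \<lfloor>max 0 s * real (Suc n)\<rfloor>"])
       measurable
qed

lemma jump_countable:
  assumes x: "cadlag x"
  shows "countable {s \<in> {0<..t}. left_lim x s \<noteq> x s}"
proof -
  have "\<exists>S \<delta>. small_oscillation_off x t (1 / real (Suc k)) S \<delta>" for k
    using cadlag_small_oscillation[OF x, of "1 / real (Suc k)" t] by (metis of_nat_0_less_iff zero_less_Suc zero_less_divide_1_iff)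
  then obtain S \<delta> where S: "\<And>k. small_oscillation_off x t (1 / real (Suc k)) (S k) (\<delta> k)" by metis
  have "{s \<in> {0<..t}. left_lim x s \<noteq> x s} \<subseteq> (\<Union>k. S k)"
  proof (rule ccontr)
    assume "\<not> ?thesis"
    then obtain s where s: "0 < s" "s \<le> t" "left_lim x s \<noteq> x s" "\<And>k. s \<notin> S k" by auto
    have "\<bar>jump x s\<bar> \<le> 1 / real (Suc k)" for k
      using jump_le_if_no_oscillation[OF x S s(1,2,4)] .
    then have "\<bar>jump x s\<bar> \<le> 0"
      by (intro tendsto_lowerbound[OF lim_const_over_n[THEN LIMSEQ_Suc, of 1, simplified]]) (auto intro!: always_eventually)
    with s(3) show False by (simp add: jump_def)
  qed
  moreover have "countable (\<Union>k. S k)"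
    using small_oscillation_offD(1)[OF S] by (intro countable_UN) (auto intro: countable_finite)
  ultimately show ?thesis by (rule countable_subset)
qed

text \<open>The right-hand side involves countably many values of the path only, which makes the left-hand side
  measurable. If increments over shorter and shorter intervals exceed \<open>e\<close> by a fixed margin, these
  intervals contain exceptional times, one and the same infinitely often, and the increments around it
  tend to its jump. The end \<open>b\<close> is added to the rationals for the sake of a jump at \<open>b\<close>.\<close>

lemma big_jump_between_iff:
  assumes x: "cadlag x" and a: "0 \<le> a" and e: "0 < e"
  shows "(\<exists>s\<in>{a<..b}. e < jump x s) \<longleftrightarrow>
    (\<exists>j::nat. \<forall>n::nat. \<exists>p\<in>insert b \<rat>. \<exists>r\<in>insert b \<rat>. a \<le> p \<and> p < r \<and> r \<le> b \<and>
        r < p + 1 / real (Suc n) \<and> e + 1 / real (Suc j) < x r - x p)"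
    (is "?L \<longleftrightarrow> ?R")
proof
  assume ?L
  then obtain s where s: "a < s" "s \<le> b" "e < jump x s" by auto
  obtain j :: nat where j: "inverse (real (Suc j)) < jump x s - e"
    using s(3) reals_Archimedean[of "jump x s - e"] by auto
  have s0: "0 < s" using s a by simp
  show ?R
  proof (intro exI[of _ j] allI)
    fix n :: nat
    define \<eta> where "\<eta> = (jump x s - e - inverse (real (Suc j))) / 2"
    have \<eta>: "\<eta> > 0" using j by (simp add: \<eta>_def)
    define d where "d = 1 / (2 * real (Suc n))"
    have d: "d > 0" "2 * d = 1 / real (Suc n)" by (auto simp: d_def field_simps)
    have "\<forall>\<^sub>F p in at_left s. dist (x p) (left_lim x s) < \<eta>"
      using cadlag_left_lim[OF x s0] \<eta> by (intro tendstoD) auto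
    then obtain l where l: "l < s" "\<And>p. l < p \<Longrightarrow> p < s \<Longrightarrow> \<bar>x p - left_lim x s\<bar> < \<eta>"
      by (auto simp: eventually_at_left_field dist_real_def)
    obtain p where p: "p \<in> \<rat>" "max (max a l) (s - d) < p" "p < s"
      using Rats_dense_in_real[of "max (max a l) (s - d)" s] s l d by auto
    have "\<forall>\<^sub>F r in at_right s. dist (x r) (x s) < \<eta>"
      using cadlag_right[OF x, of s] s0 \<eta> by (intro tendstoD) auto
    then obtain u where u: "s < u" "\<And>r. s < r \<Longrightarrow> r < u \<Longrightarrow> \<bar>x r - x s\<bar> < \<eta>"
      by (auto simp: eventually_at_right_field dist_real_def)
    obtain r where r: "r \<in> insert b \<rat>" "s \<le> r" "r \<le> b" "r < s + d" "\<bar>x r - x s\<bar> < \<eta>"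
    proof (cases "s = b")
      case True
      with d \<eta> show ?thesis by (intro that[of b]) auto
    next
      case False
      then obtain r where "r \<in> \<rat>" "s < r" "r < min (min b u) (s + d)"
        using Rats_dense_in_real[of s "min (min b u) (s + d)"] s u d by auto
      then show ?thesis using u by (intro that[of r]) auto
    qed
    have "\<bar>x p - left_lim x s\<bar> < \<eta>" using l(2)[of p] p by auto
    with r(5) have "e + 1 / real (Suc j) < x r - x p"
      unfolding \<eta>_def jump_def inverse_eq_divide by (auto simp: abs_less_iff field_simps)
    then show "\<exists>p\<in>insert b \<rat>. \<exists>r\<in>insert b \<rat>. a \<le> p \<and> p < r \<and> r \<le> b \<and>
        r < p + 1 / real (Suc n) \<and> e + 1 / real (Suc j) < x r - x p"
      using p r d by (intro bexI[of _ p] bexI[of _ r]) auto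
  qed
next
  assume ?R
  then obtain j where "\<forall>n. \<exists>p r. a \<le> p \<and> p < r \<and> r \<le> b \<and>
        r < p + 1 / real (Suc n) \<and> e + 1 / real (Suc j) < x r - x p" by blast
  then obtain p r where pr: "\<And>n. a \<le> p n" "\<And>n. p n < r n" "\<And>n. r n \<le> b"
    "\<And>n. r n < p n + 1 / real (Suc n)" "\<And>n. e + 1 / real (Suc j) < x (r n) - x (p n)" by metis
  obtain S \<delta> where osc: "small_oscillation_off x b e S \<delta>" by (rule cadlag_small_oscillation[OF x e])
  note S = small_oscillation_offD[OF osc]
  obtain N :: nat where "inverse (real (Suc N)) < \<delta>" using reals_Archimedean[OF S(2)] by auto
  then have N: "1 / real (Suc n) < \<delta>" if "n \<ge> N" for n
    using that by (smt (verit) frac_le inverse_eq_divide of_nat_0_less_iff of_nat_le_iff Suc_le_mono zero_less_Suc)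
  have "\<exists>s\<in>S. p n < s \<and> s \<le> r n" if n: "n \<ge> N" for n
  proof (rule ccontr)
    assume c: "\<not> ?thesis"
    have "\<bar>x (r n) - x (p n)\<bar> < e"
      using pr(1,2,3,4)[of n] N[OF n] a c by (intro S(3)) auto
    moreover have "1 / real (Suc j) > 0" by simp
    ultimately show False using pr(5)[of n] by linarith
  qed
  then obtain s where s: "\<And>n. n \<ge> N \<Longrightarrow> s n \<in> S \<and> p n < s n \<and> s n \<le> r n" by metis
  have "finite (s ` {N..})" using S(1) s by (intro finite_subset[of "s ` {N..}" S]) auto
  then have "\<exists>n0\<in>{N..}. infinite {n \<in> {N..}. s n = s n0}"
    by (intro pigeonhole_infinite infinite_Ici)
  then obtain s0 where s0: "infinite {n \<in> {N..}. s n = s0}" by auto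
  define \<phi> where "\<phi> = enumerate {n \<in> {N..}. s n = s0}"
  have \<phi>: "strict_mono \<phi>" "\<And>n. \<phi> n \<ge> N" "\<And>n. s (\<phi> n) = s0"
    using enumerate_in_set[OF s0] strict_mono_enumerate[OF s0] by (auto simp: \<phi>_def)
  have b: "p (\<phi> n) < s0" "s0 \<le> r (\<phi> n)" for n using s[OF \<phi>(2)[of n]] \<phi>(3)[of n] by auto
  have s0pos: "a < s0" "s0 \<le> b" using b[of 0] pr(1,3)[of "\<phi> 0"] by auto
  have lim0: "(\<lambda>n. 1 / real (Suc (\<phi> n))) \<longlonglongrightarrow> 0"
    using LIMSEQ_subseq_LIMSEQ[OF lim_const_over_n[THEN LIMSEQ_Suc, of 1] \<phi>(1)] by (simp add: o_def)
  have b1: "s0 - 1 / real (Suc (\<phi> n)) \<le> p (\<phi> n)" "r (\<phi> n) \<le> s0 + 1 / real (Suc (\<phi> n))" for n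
    using b[of n] pr(4)[of "\<phi> n"] by auto
  have "(\<lambda>n. p (\<phi> n)) \<longlonglongrightarrow> s0"
    by (rule tendsto_sandwich[of "\<lambda>n. s0 - 1 / real (Suc (\<phi> n))" _ _ "\<lambda>n. s0"])
       (use b b1 tendsto_diff[OF tendsto_const lim0, of s0] in \<open>auto intro!: always_eventually simp: less_imp_le\<close>)
  then have 1: "(\<lambda>n. x (p (\<phi> n))) \<longlonglongrightarrow> left_lim x s0"
    using b s0pos a by (intro cadlag_seq_left[OF x]) auto
  have "(\<lambda>n. r (\<phi> n)) \<longlonglongrightarrow> s0"
    by (rule tendsto_sandwich[of "\<lambda>n. s0" _ _ "\<lambda>n. s0 + 1 / real (Suc (\<phi> n))"])
       (use b b1 tendsto_add[OF tendsto_const lim0, of s0] in \<open>auto intro!: always_eventually simp: less_imp_le\<close>)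
  then have 2: "(\<lambda>n. x (r (\<phi> n))) \<longlonglongrightarrow> x s0"
    using b s0pos a by (intro cadlag_seq_right[OF x]) auto
  have "e + 1 / real (Suc j) \<le> x s0 - left_lim x s0"
    by (rule tendsto_lowerbound[OF tendsto_diff[OF 2 1]])
       (use pr(5) in \<open>auto intro!: always_eventually simp: less_imp_le\<close>)
  moreover have "1 / real (Suc j) > 0" by simp
  ultimately have "e < jump x s0" unfolding jump_def by linarith
  with s0pos show ?L by auto
qed

text \<open>At all but countably many times \<open>s\<close> the path is continuous, so its values at the grid points before
  \<open>s\<close> converge. The integrand depends on the mesh because it will be a mean value over an increment.\<close>

lemma riemann_sum_tendsto:
  fixes F :: "nat \<Rightarrow> real \<Rightarrow> real"
  assumes x: "cadlag x" and t: "0 < t"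
    and lim: "\<And>v w. v \<longlonglongrightarrow> w \<Longrightarrow> (\<lambda>n. F n (v n)) \<longlonglongrightarrow> G w"
    and G: "continuous_on UNIV G" and C: "\<And>n w. \<bar>F n w\<bar> \<le> C"
  shows "(\<lambda>n. \<Sum>k<Suc n. t / real (Suc n) * F n (x (grid t (Suc n) k))) \<longlonglongrightarrow> (LINT s:{0..t}|lborel. G (x s))"
proof -
  let ?i = "\<lambda>n. grid_index t (Suc n)"
  let ?I = "\<lambda>n k. {grid t (Suc n) k<..grid t (Suc n) (Suc k)}"
  define h where "h n s = indicator {0<..t} s * F n (x (grid t (Suc n) (?i n s)))" for n and s :: real
  have hs: "h n s = (\<Sum>k<Suc n. F n (x (grid t (Suc n) k)) * indicator (?I n k) s)" for n s
  proof (cases "s \<in> {0<..t}")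
    case True
    then have s: "0 < s" "s \<le> t" by auto
    have "indicator (?I n k) s = (if k = ?i n s then 1 else 0 :: real)" for k
      using grid_index_iff[OF t _ s(1), of "Suc n" k] by (auto simp: indicator_def)
    then have "(\<Sum>k<Suc n. F n (x (grid t (Suc n) k)) * indicator (?I n k) s) =
       (\<Sum>k<Suc n. if k = ?i n s then F n (x (grid t (Suc n) k)) else 0)"
      by (intro sum.cong) auto
    also have "\<dots> = F n (x (grid t (Suc n) (?i n s)))"
      using grid_index_less[OF t _ s, of "Suc n"] by (simp add: sum.delta)
    finally show ?thesis using True by (simp add: h_def)
  next
    case False
    have "indicator (?I n k) s = (0::real)" if "k < Suc n" for k
    proof -
      have "0 \<le> grid t (Suc n) k" "grid t (Suc n) (Suc k) \<le> t" using t that by (auto intro!: grid_le)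
      then show ?thesis using False by (auto simp: indicator_def)
    qed
    then show ?thesis using False by (simp add: h_def)
  qed
  have int_h: "integral\<^sup>L lborel (h n) = (\<Sum>k<Suc n. t / real (Suc n) * F n (x (grid t (Suc n) k)))" for n
  proof -
    have "integral\<^sup>L lborel (h n) = (\<integral>s. (\<Sum>k<Suc n. F n (x (grid t (Suc n) k)) * indicator (?I n k) s) \<partial>lborel)"
      by (intro Bochner_Integration.integral_cong refl hs)
    also have "\<dots> = (\<Sum>k<Suc n. F n (x (grid t (Suc n) k)) * measure lborel (?I n k))"
      using t by (subst Bochner_Integration.integral_sum) (auto simp: grid_mono)
    also have "\<dots> = (\<Sum>k<Suc n. t / real (Suc n) * F n (x (grid t (Suc n) k)))"
    proof (intro sum.cong refl)
      fix k
      have "measure lborel (?I n k) = t / real (Suc n)"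
        using t by (subst measure_lborel_Ioc) (auto simp: grid_Suc)
      then show "F n (x (grid t (Suc n) k)) * measure lborel (?I n k) = t / real (Suc n) * F n (x (grid t (Suc n) k))"
        by simp
    qed
    finally show ?thesis .
  qed
  have Gx: "(\<lambda>s. G (x (max 0 s))) \<in> borel_measurable borel"
    using measurable_compose[OF cadlag_measurable[OF x] borel_measurable_continuous_onI[OF G]] .
  have m: "h n \<in> borel_measurable lborel" for n
    unfolding hs[abs_def] by measurable
  have "(\<lambda>n. integral\<^sup>L lborel (h n)) \<longlonglongrightarrow> (\<integral>s. indicator {0<..t} s * G (x (max 0 s)) \<partial>lborel)"
  proof (rule integral_dominated_convergence[where w="\<lambda>s. indicator {0<..t} s * C"])
    show "(\<lambda>s. indicator {0<..t} s * G (x (max 0 s))) \<in> borel_measurable lborel" using Gx by simp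
    show "integrable lborel (\<lambda>s. indicator {0<..t} s * C)"
      using t by (intro integrable_mult_left) auto
    have "AE s in lborel. s \<notin> {s \<in> {0<..t}. left_lim x s \<noteq> x s}"
      using jump_countable[OF x] by (rule countable_imp_null_set_lborel[THEN AE_not_in])
    then show "AE s in lborel. (\<lambda>n. h n s) \<longlonglongrightarrow> indicator {0<..t} s * G (x (max 0 s))"
    proof eventually_elim
      case (elim s)
      show ?case
      proof (cases "s \<in> {0<..t}")
        case True
        with elim have s: "0 < s" "left_lim x s = x s" by auto
        have "(\<lambda>n. x (grid t (Suc n) (?i n s))) \<longlonglongrightarrow> left_lim x s"
          using s t by (intro cadlag_seq_left[OF x] grid_index_tendsto grid_index_bounds) auto
        from lim[OF this] show ?thesis using s True by (simp add: h_def)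
      qed (simp add: h_def)
    qed
    show "AE s in lborel. norm (h n s) \<le> indicator {0<..t} s * C" for n
      using C by (intro AE_I2) (auto simp: h_def indicator_def)
  qed (use m in auto)
  also have "(\<integral>s. indicator {0<..t} s * G (x (max 0 s)) \<partial>lborel) = (LINT s:{0..t}|lborel. G (x s))"
    unfolding set_lebesgue_integral_def
  proof (rule integral_cong_AE)
    have "(\<lambda>s. indicator {0..t} s *\<^sub>R G (x s)) = (\<lambda>s. indicator {0..t} s *\<^sub>R G (x (max 0 s)))"
      by (auto simp: indicator_def)
    then show "(\<lambda>s. indicator {0..t} s *\<^sub>R G (x s)) \<in> borel_measurable lborel" using Gx by simp
    have "AE s in lborel. s \<noteq> (0::real)" by (rule AE_lborel_singleton)
    then show "AE s in lborel. indicator {0<..t} s * G (x (max 0 s)) = indicator {0..t} s *\<^sub>R G (x s)"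
      by eventually_elim (auto simp: indicator_def)
  qed (use Gx in simp)
  finally show ?thesis by (simp add: int_h)
qed

section \<open>The Levy measure\<close>

text \<open>The jump rate of the process with Laplace exponent \<open>\<eta>\<^bsup>1+\<alpha>\<^esup>\<close>; the constant is the one for which the
  integral of \<open>e\<^bsup>-\<eta>x\<^esup> - 1 + \<eta> x\<close> is \<open>\<eta>\<^bsup>1+\<alpha>\<^esup>\<close>.\<close>

definition levy_density :: "real \<Rightarrow> real \<Rightarrow> real" where
  "levy_density \<alpha> x = (if 0 < x then \<alpha> * (1 + \<alpha>) / Gamma (1 - \<alpha>) * x powr (- 2 - \<alpha>) else 0)"

definition levy_measure :: "real \<Rightarrow> real measure" where
  "levy_measure \<alpha> = density lborel (\<lambda>x. ennreal (levy_density \<alpha> x))"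

lemma levy_density_measurable [measurable]: "levy_density \<alpha> \<in> borel_measurable borel"
  unfolding levy_density_def[abs_def] by measurable

lemma sets_levy_measure [simp, measurable_cong]: "sets (levy_measure \<alpha>) = sets borel"
  by (simp add: levy_measure_def)

lemma levy_density_nonneg: "0 < \<alpha> \<Longrightarrow> \<alpha> < 1 \<Longrightarrow> 0 \<le> levy_density \<alpha> x"
  by (simp add: levy_density_def Gamma_real_nonneg)

lemma nn_integral_levy_measure:
  assumes [measurable]: "f \<in> borel_measurable borel"
  shows "(\<integral>\<^sup>+x. f x \<partial>levy_measure \<alpha>) = (\<integral>\<^sup>+x. ennreal (levy_density \<alpha> x) * f x \<partial>lborel)"
  unfolding levy_measure_def by (subst nn_integral_density) auto

lemma AE_levy_measure_pos: "AE x in levy_measure \<alpha>. 0 < x"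
  unfolding levy_measure_def by (subst AE_density) (auto simp: levy_density_def)

lemma nn_integral_powr_exp:
  assumes "\<alpha> < 1" "0 < r"
  shows "(\<integral>\<^sup>+x. ennreal (indicator {0<..} x * (x powr (- \<alpha>) * exp (- r * x))) \<partial>lborel) =
    ennreal (Gamma (1 - \<alpha>) * r powr (\<alpha> - 1))"
proof -
  let ?f = "\<lambda>x::real. ennreal (indicator {0<..} x * (x powr (- \<alpha>) * exp (- r * x)))"
  have "(\<integral>\<^sup>+x. ?f x \<partial>lborel) = \<bar>1/r\<bar> * (\<integral>\<^sup>+x. ?f (0 + (1/r) * x) \<partial>lborel)"
    by (rule nn_integral_real_affine) (use assms in auto)
  also have "(\<integral>\<^sup>+x. ?f (0 + (1/r) * x) \<partial>lborel) =
     (\<integral>\<^sup>+x. ennreal (r powr \<alpha>) * ennreal (indicator {0..} x * x powr ((1 - \<alpha>) - 1) / exp x) \<partial>lborel)"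
  proof (intro nn_integral_cong_AE)
    have "AE s in lborel. s \<noteq> (0::real)" by (rule AE_lborel_singleton)
    then show "AE x in lborel. ?f (0 + (1/r) * x) =
       ennreal (r powr \<alpha>) * ennreal (indicator {0..} x * x powr ((1 - \<alpha>) - 1) / exp x)"
    proof eventually_elim
      case (elim x)
      show ?case
      proof (cases "0 < x")
        case True
        then have "(x / r) powr (-\<alpha>) = r powr \<alpha> * x powr (-\<alpha>)"
          using assms by (simp add: powr_divide powr_minus field_simps)
        then show ?thesis using True assms
          by (simp add: ennreal_mult'[symmetric] exp_minus field_simps)
      next
        case False
        with elim assms have "x < 0" by simp
        then show ?thesis using assms by (simp add: indicator_def zero_less_divide_iff)
      qed
    qed
  qed
  also have "\<dots> = ennreal (r powr \<alpha>) * ennreal (Gamma (1 - \<alpha>))"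
    using assms by (subst nn_integral_cmult) (auto simp: Gamma_conv_nn_integral_real)
  also have "ennreal \<bar>1/r\<bar> * \<dots> = ennreal (Gamma (1 - \<alpha>) * r powr (\<alpha> - 1))"
    using assms by (simp add: ennreal_mult'[symmetric] Gamma_real_nonneg powr_diff field_simps)
  finally show ?thesis .
qed

lemma nn_integral_exp_Icc:
  assumes "0 \<le> x"
  shows "(\<integral>\<^sup>+v. ennreal (x * exp (- v * x)) * indicator {0..1} v \<partial>lborel) = ennreal (1 - exp (- x))"
proof -
  have "(\<integral>\<^sup>+v. ennreal (x * exp (- v * x)) * indicator {0..1} v \<partial>lborel) = ennreal (- exp (- 1 * x) - (- exp (- 0 * x)))"
    by (rule nn_integral_FTC_Icc) (use assms in \<open>auto intro!: derivative_eq_intros\<close>)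
  then show ?thesis by simp
qed

text \<open>This is \<open>1 - e\<^bsup>-x\<^esup> = \<integral>\<^sub>0\<^sup>1 x e\<^bsup>-vx\<^esup> dv\<close> followed by Tonelli's theorem.\<close>

lemma nn_integral_one_minus_exp:
  assumes [measurable]: "g \<in> borel_measurable borel"
  shows "(\<integral>\<^sup>+x. indicator {0<..} x * ennreal (1 - exp (- x)) * g x \<partial>lborel) =
    (\<integral>\<^sup>+v. (\<integral>\<^sup>+x. indicator {0<..} x * ennreal (x * exp (- v * x)) * g x \<partial>lborel) * indicator {0..1} v \<partial>lborel)"
proof -
  have "(\<integral>\<^sup>+x. indicator {0<..} x * ennreal (1 - exp (- x)) * g x \<partial>lborel) =
    (\<integral>\<^sup>+x. (\<integral>\<^sup>+v. indicator {0<..} x * ennreal (x * exp (- v * x)) * g x * indicator {0..1} v \<partial>lborel) \<partial>lborel)"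
  proof (intro nn_integral_cong)
    fix x :: real
    have "(\<integral>\<^sup>+v. indicator {0<..} x * ennreal (x * exp (- v * x)) * g x * indicator {0..1} v \<partial>lborel) =
      (\<integral>\<^sup>+v. (indicator {0<..} x * g x) * (ennreal (x * exp (- v * x)) * indicator {0..1} v) \<partial>lborel)"
      by (intro nn_integral_cong) (simp add: mult_ac)
    also have "\<dots> = (indicator {0<..} x * g x) * (\<integral>\<^sup>+v. ennreal (x * exp (- v * x)) * indicator {0..1} v \<partial>lborel)"
      by (rule nn_integral_cmult) measurable
    also have "\<dots> = indicator {0<..} x * ennreal (1 - exp (- x)) * g x"
    proof (cases "0 < x")
      case True
      then show ?thesis by (subst nn_integral_exp_Icc) (simp_all add: mult_ac)
    qed simp
    finally show "indicator {0<..} x * ennreal (1 - exp (- x)) * g x =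
      (\<integral>\<^sup>+v. indicator {0<..} x * ennreal (x * exp (- v * x)) * g x * indicator {0..1} v \<partial>lborel)" ..
  qed
  also have "\<dots> = (\<integral>\<^sup>+v. (\<integral>\<^sup>+x. indicator {0<..} x * ennreal (x * exp (- v * x)) * g x * indicator {0..1} v \<partial>lborel) \<partial>lborel)"
    by (rule lborel_pair.Fubini') measurable
  also have "\<dots> = (\<integral>\<^sup>+v. (\<integral>\<^sup>+x. indicator {0<..} x * ennreal (x * exp (- v * x)) * g x \<partial>lborel) * indicator {0..1} v \<partial>lborel)"
    by (intro nn_integral_cong nn_integral_multc) measurable
  finally show ?thesis .
qed

lemma nn_integral_Icc_derivative:
  fixes F f :: "real \<Rightarrow> real"
  assumes "a \<le> b" "continuous_on {a..b} F" "\<And>x. x \<in> {a<..<b} \<Longrightarrow> (F has_real_derivative f x) (at x)"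
    "\<And>x. x \<in> {a..b} \<Longrightarrow> 0 \<le> f x"
  shows "(\<integral>\<^sup>+x. ennreal (f x) * indicator {a..b} x \<partial>lborel) = ennreal (F b - F a)"
  by (rule nn_integral_has_integral_lebesgue'[OF assms(4) fundamental_theorem_of_calculus_interior[OF assms(1,2)]])
     (use assms(3) in \<open>auto simp: has_real_derivative_iff_has_vector_derivative\<close>)

lemma first_difference_integral:
  assumes a: "0 < \<alpha>" "\<alpha> < 1" and r: "0 < r"
  shows "(\<integral>\<^sup>+x. indicator {0<..} x * ennreal (1 - exp (- x)) * ennreal (x powr (- 1 - \<alpha>) * exp (- r * x)) \<partial>lborel) =
     ennreal (Gamma (1 - \<alpha>) / \<alpha> * ((r + 1) powr \<alpha> - r powr \<alpha>))"
proof -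
  have "(\<integral>\<^sup>+x. indicator {0<..} x * ennreal (1 - exp (- x)) * ennreal (x powr (- 1 - \<alpha>) * exp (- r * x)) \<partial>lborel) =
    (\<integral>\<^sup>+v. (\<integral>\<^sup>+x. indicator {0<..} x * ennreal (x * exp (- v * x)) * ennreal (x powr (- 1 - \<alpha>) * exp (- r * x)) \<partial>lborel)
       * indicator {0..1} v \<partial>lborel)"
    by (rule nn_integral_one_minus_exp) measurable
  also have "\<dots> = (\<integral>\<^sup>+v. ennreal (Gamma (1 - \<alpha>) * (r + v) powr (\<alpha> - 1)) * indicator {0..1} v \<partial>lborel)"
  proof (intro nn_integral_cong)
    fix v :: real
    have "(\<integral>\<^sup>+x. indicator {0<..} x * ennreal (x * exp (- v * x)) * ennreal (x powr (- 1 - \<alpha>) * exp (- r * x)) \<partial>lborel) =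
       ennreal (Gamma (1 - \<alpha>) * (r + v) powr (\<alpha> - 1))" if v: "0 \<le> v"
    proof -
      have "(\<integral>\<^sup>+x. indicator {0<..} x * ennreal (x * exp (- v * x)) * ennreal (x powr (- 1 - \<alpha>) * exp (- r * x)) \<partial>lborel) =
        (\<integral>\<^sup>+x. ennreal (indicator {0<..} x * (x powr (- \<alpha>) * exp (- (r + v) * x))) \<partial>lborel)"
      proof (intro nn_integral_cong)
        fix x :: real
        show "indicator {0<..} x * ennreal (x * exp (- v * x)) * ennreal (x powr (- 1 - \<alpha>) * exp (- r * x)) =
          ennreal (indicator {0<..} x * (x powr (- \<alpha>) * exp (- (r + v) * x)))"
        proof (cases "0 < x")
          case True
          have "x * exp (- v * x) * (x powr (- 1 - \<alpha>) * exp (- r * x)) = (x powr 1 * x powr (- 1 - \<alpha>)) * (exp (- v * x) * exp (- r * x))"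
            using True by simp
          also have "\<dots> = x powr (- \<alpha>) * exp (- (r + v) * x)"
            unfolding powr_add[symmetric] exp_add[symmetric] by (simp add: algebra_simps)
          finally show ?thesis using True by (simp add: ennreal_mult'[symmetric])
        qed simp
      qed
      also have "\<dots> = ennreal (Gamma (1 - \<alpha>) * (r + v) powr (\<alpha> - 1))"
        using a r v by (intro nn_integral_powr_exp) auto
      finally show ?thesis .
    qed
    then show "(\<integral>\<^sup>+x. indicator {0<..} x * ennreal (x * exp (- v * x)) * ennreal (x powr (- 1 - \<alpha>) * exp (- r * x)) \<partial>lborel)
       * indicator {0..1} v = ennreal (Gamma (1 - \<alpha>) * (r + v) powr (\<alpha> - 1)) * indicator {0..1} v"
      by (auto simp: indicator_def)
  qed
  also have "\<dots> = ennreal (Gamma (1 - \<alpha>) / \<alpha> * (r + 1) powr \<alpha> - Gamma (1 - \<alpha>) / \<alpha> * (r + 0) powr \<alpha>)"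
    by (rule nn_integral_Icc_derivative)
       (use a r in \<open>auto intro!: continuous_intros derivative_eq_intros simp: Gamma_real_nonneg\<close>)
  finally show ?thesis by (simp add: algebra_simps)
qed

text \<open>The second difference at \<open>k\<close>, with step \<open>1\<close>, of the Laplace exponent.\<close>

definition second_difference :: "real \<Rightarrow> nat \<Rightarrow> real" where
  "second_difference \<alpha> k = real k powr (1 + \<alpha>) - 2 * (real k + 1) powr (1 + \<alpha>) + (real k + 2) powr (1 + \<alpha>)"

text \<open>The integrand is the second difference of \<open>\<eta> \<mapsto> e\<^bsup>-\<eta>x\<^esup>\<close>, for which the linear compensation of small
  jumps cancels. Each of the two factors \<open>1 - e\<^bsup>-x\<^esup>\<close> is written as an integral of \<open>x e\<^bsup>-vx\<^esup>\<close>; what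
  remains is a Gamma integral, and each integration over \<open>v\<close> raises the power of \<open>k + v\<close> by one.\<close>

lemma nn_integral_levy_measure_second_difference:
  assumes a: "0 < \<alpha>" "\<alpha> < 1"
  shows "(\<integral>\<^sup>+x. ennreal ((1 - exp (- x))\<^sup>2 * exp (- x) ^ k) \<partial>levy_measure \<alpha>) = ennreal (second_difference \<alpha> k)"
proof -
  define D where "D = \<alpha> * (1 + \<alpha>) / Gamma (1 - \<alpha>)"
  have G: "Gamma (1 - \<alpha>) > 0" using a by (simp add: Gamma_real_pos)
  have D: "D > 0" using a G by (simp add: D_def)
  have "(\<integral>\<^sup>+x. ennreal ((1 - exp (- x))\<^sup>2 * exp (- x) ^ k) \<partial>levy_measure \<alpha>) =
     (\<integral>\<^sup>+x. ennreal (levy_density \<alpha> x) * ennreal ((1 - exp (- x))\<^sup>2 * exp (- x) ^ k) \<partial>lborel)"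
    by (rule nn_integral_levy_measure) measurable
  also have "\<dots> = (\<integral>\<^sup>+x. ennreal D * (indicator {0<..} x * ennreal (1 - exp (- x)) *
      ennreal ((1 - exp (- x)) * (x powr (- 2 - \<alpha>) * exp (- real k * x)))) \<partial>lborel)"
    by (intro nn_integral_cong)
       (use D in \<open>auto simp: levy_density_def D_def indicator_def ennreal_mult'[symmetric] power2_eq_square exp_of_nat_mult[symmetric] mult_ac\<close>)
  also have "\<dots> = ennreal D * (\<integral>\<^sup>+x. indicator {0<..} x * ennreal (1 - exp (- x)) *
      ennreal ((1 - exp (- x)) * (x powr (- 2 - \<alpha>) * exp (- real k * x))) \<partial>lborel)"
    by (rule nn_integral_cmult) measurable
  also have "(\<integral>\<^sup>+x. indicator {0<..} x * ennreal (1 - exp (- x)) *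
      ennreal ((1 - exp (- x)) * (x powr (- 2 - \<alpha>) * exp (- real k * x))) \<partial>lborel) =
    (\<integral>\<^sup>+v. (\<integral>\<^sup>+x. indicator {0<..} x * ennreal (x * exp (- v * x)) *
      ennreal ((1 - exp (- x)) * (x powr (- 2 - \<alpha>) * exp (- real k * x))) \<partial>lborel) * indicator {0..1} v \<partial>lborel)"
    by (rule nn_integral_one_minus_exp) measurable
  also have "\<dots> = (\<integral>\<^sup>+v. ennreal (Gamma (1 - \<alpha>) / \<alpha> * ((real k + v + 1) powr \<alpha> - (real k + v) powr \<alpha>)) * indicator {0..1} v \<partial>lborel)"
  proof (intro nn_integral_cong_AE)
    have "AE s in lborel. s \<noteq> (0::real)" by (rule AE_lborel_singleton)
    then show "AE v in lborel. (\<integral>\<^sup>+x. indicator {0<..} x * ennreal (x * exp (- v * x)) *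
      ennreal ((1 - exp (- x)) * (x powr (- 2 - \<alpha>) * exp (- real k * x))) \<partial>lborel) * indicator {0..1} v =
      ennreal (Gamma (1 - \<alpha>) / \<alpha> * ((real k + v + 1) powr \<alpha> - (real k + v) powr \<alpha>)) * indicator {0..1} v"
    proof eventually_elim
      case (elim v)
      have "(\<integral>\<^sup>+x. indicator {0<..} x * ennreal (x * exp (- v * x)) *
        ennreal ((1 - exp (- x)) * (x powr (- 2 - \<alpha>) * exp (- real k * x))) \<partial>lborel) =
        ennreal (Gamma (1 - \<alpha>) / \<alpha> * ((real k + v + 1) powr \<alpha> - (real k + v) powr \<alpha>))" if v: "0 < v"
      proof -
        have "(\<integral>\<^sup>+x. indicator {0<..} x * ennreal (x * exp (- v * x)) *
          ennreal ((1 - exp (- x)) * (x powr (- 2 - \<alpha>) * exp (- real k * x))) \<partial>lborel) =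
          (\<integral>\<^sup>+x. indicator {0<..} x * ennreal (1 - exp (- x)) * ennreal (x powr (- 1 - \<alpha>) * exp (- (real k + v) * x)) \<partial>lborel)"
        proof (intro nn_integral_cong)
          fix x :: real
          show "indicator {0<..} x * ennreal (x * exp (- v * x)) *
            ennreal ((1 - exp (- x)) * (x powr (- 2 - \<alpha>) * exp (- real k * x))) =
            indicator {0<..} x * ennreal (1 - exp (- x)) * ennreal (x powr (- 1 - \<alpha>) * exp (- (real k + v) * x))"
          proof (cases "0 < x")
            case True
            have "x * exp (- v * x) * (x powr (- 2 - \<alpha>) * exp (- real k * x)) = (x powr 1 * x powr (- 2 - \<alpha>)) * (exp (- v * x) * exp (- real k * x))"
              using True by simp
            also have "\<dots> = x powr (- 1 - \<alpha>) * exp (- (real k + v) * x)"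
              unfolding powr_add[symmetric] exp_add[symmetric] by (simp add: algebra_simps)
            finally have "x * exp (- v * x) * ((1 - exp (- x)) * (x powr (- 2 - \<alpha>) * exp (- real k * x))) =
              (1 - exp (- x)) * (x powr (- 1 - \<alpha>) * exp (- (real k + v) * x))" by (simp add: mult_ac)
            then show ?thesis using True by (simp add: ennreal_mult'[symmetric])
          qed simp
        qed
        also have "\<dots> = ennreal (Gamma (1 - \<alpha>) / \<alpha> * ((real k + v + 1) powr \<alpha> - (real k + v) powr \<alpha>))"
          using a v by (intro first_difference_integral) auto
        finally show ?thesis .
      qed
      with elim show ?case by (auto simp: indicator_def)
    qed
  qed
  also have "\<dots> = ennreal (Gamma (1 - \<alpha>) / \<alpha> * (((real k + 1 + 1) powr (1 + \<alpha>) - (real k + 1) powr (1 + \<alpha>)) / (1 + \<alpha>)) -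
     Gamma (1 - \<alpha>) / \<alpha> * (((real k + 0 + 1) powr (1 + \<alpha>) - (real k + 0) powr (1 + \<alpha>)) / (1 + \<alpha>)))"
  proof (rule nn_integral_Icc_derivative)
    show "continuous_on {0..1} (\<lambda>v. Gamma (1 - \<alpha>) / \<alpha> * (((real k + v + 1) powr (1 + \<alpha>) - (real k + v) powr (1 + \<alpha>)) / (1 + \<alpha>)))"
      using a by (intro continuous_intros continuous_on_powr') auto
    show "((\<lambda>v. Gamma (1 - \<alpha>) / \<alpha> * (((real k + v + 1) powr (1 + \<alpha>) - (real k + v) powr (1 + \<alpha>)) / (1 + \<alpha>)))
       has_real_derivative Gamma (1 - \<alpha>) / \<alpha> * ((real k + x + 1) powr \<alpha> - (real k + x) powr \<alpha>)) (at x)"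
      if "x \<in> {0<..<1}" for x
    proof -
      have p: "real k + x + 1 > 0" "real k + x > 0" using that by auto
      have "((\<lambda>v. (real k + v + 1) powr (1 + \<alpha>) - (real k + v) powr (1 + \<alpha>)) has_real_derivative
         (1 + \<alpha>) * ((real k + x + 1) powr \<alpha> - (real k + x) powr \<alpha>)) (at x)"
        using p by (auto intro!: derivative_eq_intros simp: algebra_simps)
      from DERIV_cmult[OF DERIV_cdivide[OF this, of "1 + \<alpha>"], of "Gamma (1 - \<alpha>) / \<alpha>"]
      show ?thesis using a by simp
    qed
    show "0 \<le> Gamma (1 - \<alpha>) / \<alpha> * ((real k + x + 1) powr \<alpha> - (real k + x) powr \<alpha>)" if "x \<in> {0..1}" for x
      using that a G by (intro mult_nonneg_nonneg) (auto intro!: powr_mono2)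
  qed simp
  also have "ennreal D * \<dots> = ennreal (second_difference \<alpha> k)"
  proof -
    have "D * (Gamma (1 - \<alpha>) / \<alpha> * (A / (1 + \<alpha>)) - Gamma (1 - \<alpha>) / \<alpha> * (B / (1 + \<alpha>))) = A - B" for A B
    proof -
      have "a * x / g * (g / a * (A / x) - g / a * (B / x)) = A - B" if "a \<noteq> 0" "x \<noteq> 0" "g \<noteq> 0" for a x g :: real
        using that by (simp add: field_simps)
      from this[of \<alpha> "1 + \<alpha>" "Gamma (1 - \<alpha>)"] show ?thesis using a G unfolding D_def by simp
    qed
    note DD = this
    show ?thesis using D by (subst ennreal_mult'[symmetric], simp, subst DD) (simp add: second_difference_def algebra_simps)
  qed
  finally show ?thesis .
qed

lemma second_difference_nonneg:
  assumes a: "0 < \<alpha>" "\<alpha> < 1"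
  shows "0 \<le> second_difference \<alpha> k"
proof -
  have "(real k + 0 + 1) powr (1 + \<alpha>) - (real k + 0) powr (1 + \<alpha>) \<le> (real k + 1 + 1) powr (1 + \<alpha>) - (real k + 1) powr (1 + \<alpha>)"
  proof (rule DERIV_nonneg_imp_increasing_open[of 0 1 "\<lambda>v. (real k + v + 1) powr (1 + \<alpha>) - (real k + v) powr (1 + \<alpha>)"])
    fix x :: real assume "0 < x" "x < 1"
    then have p: "real k + x + 1 > 0" "real k + x > 0" by auto
    have "((\<lambda>v. (real k + v + 1) powr (1 + \<alpha>) - (real k + v) powr (1 + \<alpha>)) has_real_derivative
         (1 + \<alpha>) * ((real k + x + 1) powr \<alpha> - (real k + x) powr \<alpha>)) (at x)"
      using p by (auto intro!: derivative_eq_intros simp: algebra_simps)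
    moreover have "0 \<le> (1 + \<alpha>) * ((real k + x + 1) powr \<alpha> - (real k + x) powr \<alpha>)"
      using a p by (intro mult_nonneg_nonneg) (auto intro!: powr_mono2)
    ultimately show "\<exists>y. ((\<lambda>v. (real k + v + 1) powr (1 + \<alpha>) - (real k + v) powr (1 + \<alpha>)) has_real_derivative y) (at x) \<and> 0 \<le> y"
      by blast
  qed (use a in \<open>auto intro!: continuous_intros continuous_on_powr'\<close>)
  then show ?thesis by (simp add: second_difference_def algebra_simps)
qed

lemma has_bochner_integral_levy_measure_second_difference:
  assumes a: "0 < \<alpha>" "\<alpha> < 1"
  shows "has_bochner_integral (levy_measure \<alpha>) (\<lambda>x. (1 - exp (- x))\<^sup>2 * exp (- x) ^ k) (second_difference \<alpha> k)"
  by (rule has_bochner_integral_nn_integral)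
     (use nn_integral_levy_measure_second_difference[OF a] second_difference_nonneg[OF a] in auto)

section \<open>Convergence of measures from their Laplace transforms\<close>

text \<open>In the variable \<open>v = e\<^bsup>-x\<^esup>\<close> the hypothesis says that the moments of the measures weighted by
  \<open>(1 - v)\<^sup>2\<close> converge, the limit having bounded moments, so living on \<open>v \<le> 1\<close>. A test function is
  approximated by a polynomial \<open>p\<close> on \<open>[0, 2]\<close>; on \<open>v > 2\<close> the error is at most
  \<open>B v\<^sup>d \<le> B v\<^sup>d (v / 2)\<^sup>m\<close>, and its integral, in the limit at most \<open>2\<^bsup>-m\<^esup> B\<close> times a constant, vanishes
  as \<open>m\<close> grows.\<close>

lemma weighted_laplace_convergence:
  fixes \<mu> :: "nat \<Rightarrow> real measure" and \<nu> :: "real measure" and c :: "nat \<Rightarrow> real"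
  assumes sets: "\<And>n. sets (\<mu> n) = sets borel" "sets \<nu> = sets borel"
    and int: "\<And>n k. integrable (\<mu> n) (\<lambda>x. (1 - exp (- x))\<^sup>2 * exp (- x) ^ k)"
      "\<And>k. integrable \<nu> (\<lambda>x. (1 - exp (- x))\<^sup>2 * exp (- x) ^ k)"
    and c: "\<And>n. 0 \<le> c n"
    and conv: "\<And>k. (\<lambda>n. c n * (LINT x|\<mu> n. (1 - exp (- x))\<^sup>2 * exp (- x) ^ k)) \<longlonglongrightarrow>
                  (LINT x|\<nu>. (1 - exp (- x))\<^sup>2 * exp (- x) ^ k)"
    and bdd: "\<And>k. (LINT x|\<nu>. (1 - exp (- x))\<^sup>2 * exp (- x) ^ k) \<le> M"
    and f: "continuous_on UNIV f" and e: "0 < \<epsilon>" "\<epsilon> < K" and f0: "\<And>x. x \<le> \<epsilon> \<or> K \<le> x \<Longrightarrow> f x = 0"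
  shows "(\<lambda>n. c n * (LINT x|\<mu> n. f x)) \<longlonglongrightarrow> (LINT x|\<nu>. f x)"
proof -
  define w where "w x = (1 - exp (- x))\<^sup>2" for x :: real
  have w0: "0 \<le> w x" for x by (simp add: w_def)
  note int = int[folded w_def] and conv = conv[folded w_def] and bdd = bdd[folded w_def]
  have [measurable_cong]: "sets (\<mu> n) = sets borel" "sets \<nu> = sets borel" for n by (rule sets)+
  \<comment> \<open>The function \<open>f / w\<close> in the variable \<open>v = e\<^bsup>-x\<^esup>\<close>; clipping \<open>v\<close> extends it continuously.\<close>
  define F where "F v = f (- ln (max (exp (- K)) (min (exp (- \<epsilon>)) v))) / (1 - max (exp (- K)) (min (exp (- \<epsilon>)) v))\<^sup>2" for v
  have m: "max (exp (- K)) (min (exp (- \<epsilon>)) v) > 0" "max (exp (- K)) (min (exp (- \<epsilon>)) v) < 1" for v :: real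
    using e by (auto simp: less_max_iff_disj min_less_iff_disj)
  have n: "max (exp (- K)) (min (exp (- \<epsilon>)) v) \<noteq> 0" "(1 - max (exp (- K)) (min (exp (- \<epsilon>)) v))\<^sup>2 \<noteq> 0" for v :: real
    using m(1)[of v] m(2)[of v] unfolding power_eq_0_iff by linarith+
  have Fc: "continuous_on UNIV F"
    unfolding F_def
    by (intro continuous_intros continuous_on_compose2[OF f] ballI n) auto
  have fF: "f x = w x * F (exp (- x))" for x
  proof (cases "\<epsilon> \<le> x \<and> x \<le> K")
    case True
    then have "max (exp (- K)) (min (exp (- \<epsilon>)) (exp (- x))) = exp (- x)" by auto
    moreover have "x > 0" using True e by auto
    ultimately show ?thesis by (simp add: F_def w_def)
  next
    case False
    then have "max (exp (- K)) (min (exp (- \<epsilon>)) (exp (- x))) \<in> {exp (- K), exp (- \<epsilon>)}"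
      using e by (auto simp: max_def min_def)
    then show ?thesis using f0[of K] f0[of \<epsilon>] f0[of x] False by (auto simp: F_def)
  qed
  have F0: "F v = 0" if "v > 2" for v
  proof -
    have "exp (- \<epsilon>) < 1" "exp (- K) < exp (- \<epsilon>)" using e by auto
    then have "max (exp (- K)) (min (exp (- \<epsilon>)) v) = exp (- \<epsilon>)" using that by linarith
    then show ?thesis using f0[of \<epsilon>] by (simp add: F_def)
  qed
  have M0: "0 \<le> M" using order.trans[OF Bochner_Integration.integral_nonneg[of \<nu> w] bdd[of 0, simplified]] w0 by simp
  show ?thesis
  proof (rule LIMSEQ_I)
    fix r :: real assume r: "0 < r"
    define \<eta> where "\<eta> = r / (16 * (M + 1))"
    have "r / (16 * p) * p = r / 16" if "p > 0" for p :: real using that by simp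
    from this[of "M + 1"] have \<eta>: "\<eta> > 0" "\<eta> * (M + 1) = r / 16" using r M0 by (auto simp: \<eta>_def)
    obtain p where p': "real_polynomial_function p \<and> (\<forall>v\<in>{0..2}. \<bar>F v - p v\<bar> < \<eta>)"
      by (rule Stone_Weierstrass_real_polynomial_function[OF compact_Icc continuous_on_subset[OF Fc subset_UNIV] \<eta>(1), of 0 2]) blast
    note p = p'[THEN conjunct1] p'[THEN conjunct2, rule_format]
    from p(1) obtain a d where pa: "p = (\<lambda>v. \<Sum>i\<le>d. a i * v ^ i)"
      unfolding real_polynomial_function_iff_sum by auto
    define B where "B = (\<Sum>i\<le>d. \<bar>a i\<bar>)"
    have B0: "0 \<le> B" by (simp add: B_def sum_nonneg)
    have pB: "\<bar>p v\<bar> \<le> B * v ^ d" if "v \<ge> 1" for v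
    proof -
      have "\<bar>p v\<bar> \<le> (\<Sum>i\<le>d. \<bar>a i\<bar> * v ^ d)"
        unfolding pa using that
        by (intro order.trans[OF sum_abs] sum_mono) (auto simp: abs_mult power_abs intro!: mult_left_mono power_increasing)
      then show ?thesis by (simp add: B_def sum_distrib_right)
    qed
    obtain m where m': "(1/2) ^ m < \<eta> / (B + 1)"
      using real_arch_pow_inv[of "\<eta> / (B + 1)" "1/2"] \<eta> B0 by auto
    have Bm: "B * (1/2) ^ m \<le> \<eta>"
    proof -
      have "B * (1/2) ^ m \<le> (B + 1) * (\<eta> / (B + 1))" using m' B0 by (intro mult_mono) auto
      then show ?thesis using B0 by simp
    qed
    have Fp: "\<bar>F v - p v\<bar> \<le> \<eta> + \<eta> * v ^ (d + m)" if v: "v > 0" for v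
    proof (cases "v \<le> 2")
      case True
      with v p(2)[of v] have "\<bar>F v - p v\<bar> \<le> \<eta>" by auto
      moreover have "0 \<le> \<eta> * v ^ (d + m)" using v \<eta>(1) by simp
      ultimately show ?thesis by linarith
    next
      case False
      have "1 \<le> (v / 2) ^ m" using False by (intro one_le_power) auto
      then have "B * v ^ d * 1 \<le> B * v ^ d * (v / 2) ^ m" using v B0 by (intro mult_left_mono) auto
      also have "\<dots> = (B * (1/2) ^ m) * v ^ (d + m)" by (simp add: power_add power_divide)
      also have "\<dots> \<le> \<eta> * v ^ (d + m)" using Bm v by (intro mult_right_mono) auto
      finally show ?thesis using pB[of v] F0[of v] False \<eta>(1) by auto
    qed
    have intp: "integrable \<kappa> (\<lambda>x. w x * p (exp (- x)))"
      and est: "\<bar>(LINT x|\<kappa>. f x) - (LINT x|\<kappa>. w x * p (exp (- x)))\<bar> \<le>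
         \<eta> * (LINT x|\<kappa>. w x * exp (- x) ^ 0) + \<eta> * (LINT x|\<kappa>. w x * exp (- x) ^ (d + m))"
      if S: "sets \<kappa> = sets borel" and I: "\<And>k. integrable \<kappa> (\<lambda>x. w x * exp (- x) ^ k)" for \<kappa> :: "real measure"
    proof -
      note [measurable_cong] = S
      have "integrable \<kappa> (\<lambda>x. \<Sum>i\<le>d. a i * (w x * exp (- x) ^ i))" using I by auto
      then show ip: "integrable \<kappa> (\<lambda>x. w x * p (exp (- x)))" by (simp add: pa sum_distrib_left mult_ac)
      have ib: "integrable \<kappa> (\<lambda>x. \<eta> * (w x * exp (- x) ^ 0) + \<eta> * (w x * exp (- x) ^ (d + m)))"
        by (intro Bochner_Integration.integrable_add integrable_mult_right I)
      have bd: "\<bar>f x - w x * p (exp (- x))\<bar> \<le> \<eta> * (w x * exp (- x) ^ 0) + \<eta> * (w x * exp (- x) ^ (d + m))" for x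
      proof -
        have "\<bar>f x - w x * p (exp (- x))\<bar> = w x * \<bar>F (exp (- x)) - p (exp (- x))\<bar>"
          using w0[of x] by (simp add: fF right_diff_distrib[symmetric] abs_mult)
        also have "\<dots> \<le> w x * (\<eta> + \<eta> * exp (- x) ^ (d + m))" by (intro mult_left_mono Fp w0) simp
        finally show ?thesis by (simp add: algebra_simps)
      qed
      have fm: "f \<in> borel_measurable borel" using f by (rule borel_measurable_continuous_onI)
      then have id: "integrable \<kappa> (\<lambda>x. f x - w x * p (exp (- x)))"
        using bd ip S by (intro Bochner_Integration.integrable_bound[OF ib]) (auto intro!: borel_measurable_diff simp: measurable_cong_sets[OF S refl] order.trans[OF _ abs_ge_self])
      from Bochner_Integration.integrable_add[OF this ip] have "integrable \<kappa> f" by simp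
      then have "\<bar>(LINT x|\<kappa>. f x) - (LINT x|\<kappa>. w x * p (exp (- x)))\<bar> = \<bar>LINT x|\<kappa>. f x - w x * p (exp (- x))\<bar>"
        using ip by simp
      also have "\<dots> \<le> (LINT x|\<kappa>. \<bar>f x - w x * p (exp (- x))\<bar>)" by (rule integral_abs_bound)
      also have "\<dots> \<le> (LINT x|\<kappa>. \<eta> * (w x * exp (- x) ^ 0) + \<eta> * (w x * exp (- x) ^ (d + m)))"
        using id ib bd by (intro integral_mono) auto
      also have "\<dots> = \<eta> * (LINT x|\<kappa>. w x * exp (- x) ^ 0) + \<eta> * (LINT x|\<kappa>. w x * exp (- x) ^ (d + m))"
        using I[of 0] I[of "d + m"] by simp
      finally show "\<bar>(LINT x|\<kappa>. f x) - (LINT x|\<kappa>. w x * p (exp (- x)))\<bar> \<le>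
         \<eta> * (LINT x|\<kappa>. w x * exp (- x) ^ 0) + \<eta> * (LINT x|\<kappa>. w x * exp (- x) ^ (d + m))" .
    qed
    have pint: "(LINT x|\<kappa>. w x * p (exp (- x))) = (\<Sum>i\<le>d. a i * (LINT x|\<kappa>. w x * exp (- x) ^ i))"
      if I: "\<And>k. integrable \<kappa> (\<lambda>x. w x * exp (- x) ^ k)" for \<kappa> :: "real measure"
    proof -
      have "(LINT x|\<kappa>. w x * p (exp (- x))) = (LINT x|\<kappa>. (\<Sum>i\<le>d. a i * (w x * exp (- x) ^ i)))"
        by (simp add: pa sum_distrib_left mult_ac)
      also have "\<dots> = (\<Sum>i\<le>d. a i * (LINT x|\<kappa>. w x * exp (- x) ^ i))" using I by (simp add: Bochner_Integration.integral_sum)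
      finally show ?thesis .
    qed
    have "(\<lambda>n. c n * (LINT x|\<mu> n. w x * p (exp (- x)))) \<longlonglongrightarrow> (LINT x|\<nu>. w x * p (exp (- x)))"
    proof -
      have "(\<lambda>n. \<Sum>i\<le>d. a i * (c n * (LINT x|\<mu> n. w x * exp (- x) ^ i))) \<longlonglongrightarrow> (\<Sum>i\<le>d. a i * (LINT x|\<nu>. w x * exp (- x) ^ i))"
        by (intro tendsto_sum tendsto_mult tendsto_const conv)
      then show ?thesis by (simp add: pint[OF int(1)] pint[OF int(2)] sum_distrib_left mult_ac)
    qed
    then have "\<forall>\<^sub>F n in sequentially. dist (c n * (LINT x|\<mu> n. w x * p (exp (- x)))) (LINT x|\<nu>. w x * p (exp (- x))) < r/4"
      using r by (intro tendstoD) auto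
    moreover have B1: "\<forall>\<^sub>F n in sequentially. c n * (LINT x|\<mu> n. w x * exp (- x) ^ k) < M + 1" for k
      by (rule order_tendstoD(2)[OF conv]) (use bdd[of k] in linarith)
    ultimately have "\<forall>\<^sub>F n in sequentially. \<bar>c n * (LINT x|\<mu> n. w x * p (exp (- x))) - (LINT x|\<nu>. w x * p (exp (- x)))\<bar> < r/4 \<and>
      c n * (LINT x|\<mu> n. w x * exp (- x) ^ 0) < M + 1 \<and> c n * (LINT x|\<mu> n. w x * exp (- x) ^ (d + m)) < M + 1"
      unfolding dist_real_def by (intro eventually_conj B1)
    then have "\<forall>\<^sub>F n in sequentially. norm (c n * (LINT x|\<mu> n. f x) - (LINT x|\<nu>. f x)) < r"
    proof eventually_elim
      case (elim n)
      have "c n * \<bar>(LINT x|\<mu> n. f x) - (LINT x|\<mu> n. w x * p (exp (- x)))\<bar> \<le>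
        c n * (\<eta> * (LINT x|\<mu> n. w x * exp (- x) ^ 0) + \<eta> * (LINT x|\<mu> n. w x * exp (- x) ^ (d + m)))"
        by (intro mult_left_mono est sets int c)
      also have "\<dots> = \<eta> * (c n * (LINT x|\<mu> n. w x * exp (- x) ^ 0)) + \<eta> * (c n * (LINT x|\<mu> n. w x * exp (- x) ^ (d + m)))"
        by (simp add: algebra_simps)
      also have "\<dots> \<le> \<eta> * (M + 1) + \<eta> * (M + 1)" using elim \<eta>(1) by (intro add_mono mult_left_mono) auto
      finally have 1: "\<bar>c n * (LINT x|\<mu> n. f x) - c n * (LINT x|\<mu> n. w x * p (exp (- x)))\<bar> \<le> r / 8"
        using c[of n] \<eta>(2) by (simp add: abs_mult right_diff_distrib[symmetric])
      have "\<bar>(LINT x|\<nu>. f x) - (LINT x|\<nu>. w x * p (exp (- x)))\<bar> \<le>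
        \<eta> * (LINT x|\<nu>. w x * exp (- x) ^ 0) + \<eta> * (LINT x|\<nu>. w x * exp (- x) ^ (d + m))"
        by (intro est sets int)
      also have "\<dots> \<le> \<eta> * (M + 1) + \<eta> * (M + 1)"
        using bdd[of 0] bdd[of "d + m"] \<eta>(1) by (intro add_mono mult_left_mono) auto
      finally have 2: "\<bar>(LINT x|\<nu>. f x) - (LINT x|\<nu>. w x * p (exp (- x)))\<bar> \<le> r / 8" using \<eta>(2) by simp
      have tri: "\<bar>A - D\<bar> < r" if "\<bar>A - B\<bar> \<le> r / 8" "\<bar>D - C\<bar> \<le> r / 8" "\<bar>B - C\<bar> < r / 4" for A B C D :: real
        using that r by linarith
      show ?case unfolding real_norm_def by (rule tri[OF 1 2 elim[THEN conjunct1]])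
    qed
    then show "\<exists>no. \<forall>n\<ge>no. norm (c n * (LINT x|\<mu> n. f x) - (LINT x|\<nu>. f x)) < r"
      by (simp add: eventually_sequentially)
  qed
qed

section \<open>Small-time behaviour of the increments\<close>

lemma weight_lower_bound:
  fixes x \<epsilon> :: real
  assumes "\<epsilon> \<le> x" "0 < \<epsilon>"
  shows "(1 - exp (- \<epsilon>))\<^sup>2 \<le> (1 - exp (- x))\<^sup>2 * exp (- x) ^ (0::nat)"
proof -
  have "exp (- x) \<le> exp (- \<epsilon>)" using assms by simp
  moreover have "exp (- \<epsilon>) < 1" using assms by simp
  ultimately show ?thesis by (auto intro!: power_mono)
qed

text \<open>A bounded function that vanishes up to \<open>\<epsilon>\<close> is dominated by a multiple of the weight.\<close>

lemma integral_le_weight: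
  fixes \<mu> :: "real measure"
  assumes S: "sets \<mu> = sets borel" and g: "g \<in> borel_measurable borel"
    and w: "integrable \<mu> (\<lambda>x. (1 - exp (- x))\<^sup>2 * exp (- x) ^ (0::nat))"
    and e: "0 < \<epsilon>" and g0: "\<And>x. x \<le> \<epsilon> \<Longrightarrow> g x = 0" and g1: "\<And>x. \<bar>g x\<bar> \<le> \<eta>"
  shows "integrable \<mu> g"
    and "\<bar>LINT x|\<mu>. g x\<bar> \<le> \<eta> / (1 - exp (- \<epsilon>))\<^sup>2 * (LINT x|\<mu>. (1 - exp (- x))\<^sup>2 * exp (- x) ^ (0::nat))"
proof -
  let ?w = "\<lambda>x::real. (1 - exp (- x))\<^sup>2 * exp (- x) ^ (0::nat)"
  define \<beta> where "\<beta> = (1 - exp (- \<epsilon>))\<^sup>2"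
  have b: "\<beta> > 0" using e by (simp add: \<beta>_def)
  have eta: "0 \<le> \<eta>" by (rule order.trans[OF abs_ge_zero g1])
  have bd: "\<bar>g x\<bar> \<le> \<eta> / \<beta> * ?w x" for x
  proof (cases "\<epsilon> \<le> x")
    case True
    then have "\<eta> / \<beta> * \<beta> \<le> \<eta> / \<beta> * ?w x"
      unfolding \<beta>_def using eta by (intro mult_left_mono weight_lower_bound e) auto
    then show ?thesis using g1[of x] b by auto
  qed (use g0[of x] eta b in auto)
  have gm: "g \<in> borel_measurable \<mu>" using g by (simp add: measurable_cong_sets[OF S refl])
  have ib: "integrable \<mu> (\<lambda>x. \<eta> / \<beta> * ?w x)" using w by (intro integrable_mult_right) auto
  show i: "integrable \<mu> g"
    by (rule Bochner_Integration.integrable_bound[OF ib gm]) (unfold real_norm_def, intro AE_I2 order.trans[OF bd abs_ge_self])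
  have "\<bar>LINT x|\<mu>. g x\<bar> \<le> (LINT x|\<mu>. \<bar>g x\<bar>)" by (rule integral_abs_bound)
  also have "\<dots> \<le> (LINT x|\<mu>. \<eta> / \<beta> * ?w x)" using i ib bd by (intro integral_mono) auto
  also have "\<dots> = \<eta> / \<beta> * (LINT x|\<mu>. ?w x)" by simp
  finally show "\<bar>LINT x|\<mu>. g x\<bar> \<le> \<eta> / (1 - exp (- \<epsilon>))\<^sup>2 * (LINT x|\<mu>. ?w x)" by (simp add: \<beta>_def)
qed

text \<open>The functions \<open>\<phi> (v n)\<close> and \<open>\<phi> w\<close> are uniformly close, and they vanish outside a compact interval
  away from \<open>0\<close>, which has bounded mass under the measures \<open>c n \<mu>\<^sub>n\<close>.\<close>

lemma continuous_family_convergence: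
  fixes \<mu> :: "nat \<Rightarrow> real measure" and \<nu> :: "real measure" and c :: "nat \<Rightarrow> real" and \<phi> :: "real \<Rightarrow> real \<Rightarrow> real"
  assumes sets: "\<And>n. sets (\<mu> n) = sets borel"
    and int: "\<And>n. integrable (\<mu> n) (\<lambda>x. (1 - exp (- x))\<^sup>2 * exp (- x) ^ (0::nat))"
    and c: "\<And>n. 0 \<le> c n"
    and bdd: "\<And>n. c n * (LINT x|\<mu> n. (1 - exp (- x))\<^sup>2 * exp (- x) ^ (0::nat)) \<le> B"
    and conv: "\<And>w. (\<lambda>n. c n * (LINT x|\<mu> n. \<phi> w x)) \<longlonglongrightarrow> L w"
    and \<phi>: "continuous_on UNIV (\<lambda>(w, x). \<phi> w x)" and e: "0 < \<epsilon>" "\<epsilon> < K"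
    and \<phi>0: "\<And>w x. x \<le> \<epsilon> \<or> K \<le> x \<Longrightarrow> \<phi> w x = 0"
    and v: "v \<longlonglongrightarrow> w"
  shows "(\<lambda>n. c n * (LINT x|\<mu> n. \<phi> (v n) x)) \<longlonglongrightarrow> L w"
proof -
  let ?w = "\<lambda>x::real. (1 - exp (- x))\<^sup>2 * exp (- x) ^ (0::nat)"
  define \<beta> where "\<beta> = (1 - exp (- \<epsilon>))\<^sup>2"
  have b: "\<beta> > 0" using e by (simp add: \<beta>_def)
  have c1: "continuous_on UNIV (\<phi> u)" for u
  proof -
    have "continuous_on UNIV ((\<lambda>(w, x). \<phi> w x) \<circ> (\<lambda>x. (u, x)))"
      by (intro continuous_on_compose continuous_intros continuous_on_subset[OF \<phi>]) auto
    then show ?thesis by (simp add: o_def)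
  qed
  have intB: "integrable (\<mu> n) g \<and> \<bar>LINT x|\<mu> n. g x\<bar> \<le> \<eta> / \<beta> * (LINT x|\<mu> n. ?w x)"
    if g: "continuous_on UNIV g" "\<And>x. x \<le> \<epsilon> \<or> K \<le> x \<Longrightarrow> g x = 0" "\<And>x. \<epsilon> \<le> x \<Longrightarrow> x \<le> K \<Longrightarrow> \<bar>g x\<bar> \<le> \<eta>" for g n \<eta>
  proof -
    have "0 \<le> \<eta>" using g(3)[of \<epsilon>] e by auto
    then have "\<bar>g x\<bar> \<le> \<eta>" for x using g(2,3)[of x] by (cases "\<epsilon> \<le> x \<and> x \<le> K") auto
    then show ?thesis
      unfolding \<beta>_def using integral_le_weight[OF sets borel_measurable_continuous_onI[OF g(1)] int e(1)] g(2) by blast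
  qed
  have uc: "uniformly_continuous_on ({w - 1..w + 1} \<times> {\<epsilon>..K}) (\<lambda>(w, x). \<phi> w x)"
    by (intro compact_uniformly_continuous continuous_on_subset[OF \<phi>] compact_Times) auto
  have B0: "0 \<le> B" using bdd[of 0] c[of 0] by (intro order.trans[OF _ bdd[of 0]] mult_nonneg_nonneg Bochner_Integration.integral_nonneg) auto
  have "(\<lambda>n. c n * (LINT x|\<mu> n. \<phi> (v n) x) - c n * (LINT x|\<mu> n. \<phi> w x)) \<longlonglongrightarrow> 0"
  proof (rule LIMSEQ_I)
    fix r :: real assume r: "0 < r"
    define \<eta> where "\<eta> = r * \<beta> / (2 * (B + 1))"
    have "r * \<beta> / (2 * p) / \<beta> * p = r / 2" if "p > 0" for p using that b by simp
    from this[of "B + 1"] have eta: "\<eta> > 0" "\<eta> / \<beta> * (B + 1) = r / 2" using r b B0 by (auto simp: \<eta>_def)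
    obtain d where d: "d > 0" "\<And>p p'. p \<in> {w - 1..w + 1} \<times> {\<epsilon>..K} \<Longrightarrow> p' \<in> {w - 1..w + 1} \<times> {\<epsilon>..K} \<Longrightarrow> dist p' p < d \<Longrightarrow>
       dist ((\<lambda>(w, x). \<phi> w x) p') ((\<lambda>(w, x). \<phi> w x) p) < \<eta>"
      using uc eta(1) unfolding uniformly_continuous_on_def by meson
    have "\<forall>\<^sub>F n in sequentially. dist (v n) w < min d 1" using v d(1) by (intro tendstoD) auto
    then have "\<forall>\<^sub>F n in sequentially. norm (c n * (LINT x|\<mu> n. \<phi> (v n) x) - c n * (LINT x|\<mu> n. \<phi> w x) - 0) < r"
    proof eventually_elim
      case (elim n)
      have 1: "\<bar>\<phi> (v n) x - \<phi> w x\<bar> \<le> \<eta>" if "\<epsilon> \<le> x" "x \<le> K" for x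
        using d(2)[of "(w, x)" "(v n, x)"] elim that by (auto simp: dist_real_def dist_Pair_Pair abs_less_iff)
      have "\<exists>\<eta>. \<forall>x\<in>{\<epsilon>..K}. \<bar>\<phi> u x\<bar> \<le> \<eta>" for u
      proof -
        have "compact (\<phi> u ` {\<epsilon>..K})"
          by (intro compact_continuous_image continuous_on_subset[OF c1]) auto
        then have "bounded (\<phi> u ` {\<epsilon>..K})" by (rule compact_imp_bounded)
        then show ?thesis by (auto simp: bounded_iff)
      qed
      then have iu: "integrable (\<mu> n) (\<phi> u)" for u
        using intB[OF c1[of u] \<phi>0] by (meson atLeastAtMost_iff)
      have "\<bar>LINT x|\<mu> n. \<phi> (v n) x - \<phi> w x\<bar> \<le> \<eta> / \<beta> * (LINT x|\<mu> n. ?w x)"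
        by (rule intB[THEN conjunct2]) (use 1 \<phi>0 in \<open>auto intro!: continuous_intros c1\<close>)
      then have "c n * \<bar>(LINT x|\<mu> n. \<phi> (v n) x) - (LINT x|\<mu> n. \<phi> w x)\<bar> \<le> c n * (\<eta> / \<beta> * (LINT x|\<mu> n. ?w x))"
        using iu c by (intro mult_left_mono) auto
      also have "\<dots> = \<eta> / \<beta> * (c n * (LINT x|\<mu> n. ?w x))" by simp
      also have "\<dots> \<le> \<eta> / \<beta> * (B + 1)" using bdd[of n] eta(1) b by (intro mult_left_mono) auto
      finally have "c n * \<bar>(LINT x|\<mu> n. \<phi> (v n) x) - (LINT x|\<mu> n. \<phi> w x)\<bar> \<le> r / 2" unfolding eta(2) .
      then have "c n * \<bar>(LINT x|\<mu> n. \<phi> (v n) x) - (LINT x|\<mu> n. \<phi> w x)\<bar> < r" using r by linarith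
      then show ?case using c[of n] by (simp add: abs_mult right_diff_distrib[symmetric])
    qed
    then show "\<exists>no. \<forall>n\<ge>no. norm (c n * (LINT x|\<mu> n. \<phi> (v n) x) - c n * (LINT x|\<mu> n. \<phi> w x) - 0) < r"
      by (simp add: eventually_sequentially)
  qed
  from tendsto_add[OF this conv[of w]] show ?thesis by simp
qed

lemma levy_integral_continuous:
  fixes \<phi> :: "real \<Rightarrow> real \<Rightarrow> real"
  assumes a: "0 < \<alpha>" "\<alpha> < 1"
    and \<phi>: "continuous_on UNIV (\<lambda>(w, x). \<phi> w x)" and e: "0 < \<epsilon>" "\<epsilon> < K"
    and \<phi>0: "\<And>w x. x \<le> \<epsilon> \<or> K \<le> x \<Longrightarrow> \<phi> w x = 0"
  shows "continuous_on UNIV (\<lambda>w. LINT x|levy_measure \<alpha>. \<phi> w x)"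
proof -
  note hb = has_bochner_integral_levy_measure_second_difference[OF a, of 0]
  have "(\<lambda>n. 1 * (LINT x|levy_measure \<alpha>. \<phi> (v n) x)) \<longlonglongrightarrow> (LINT x|levy_measure \<alpha>. \<phi> w x)" if "v \<longlonglongrightarrow> w" for v w
    by (rule continuous_family_convergence[where B="second_difference \<alpha> 0", OF _ _ _ _ _ \<phi> e \<phi>0 that])
       (use hb in \<open>auto simp: has_bochner_integral_iff\<close>)
  then show ?thesis by (auto simp: continuous_on_sequentially o_def)
qed

text \<open>Over a short time \<open>\<tau>\<close> the increment has a law close to \<open>\<tau>\<close> times the Levy measure: the second
  differences of its Laplace transform \<open>e\<^bsup>\<tau>\<psi>\<^esup>\<close> are to first order \<open>\<tau>\<close> times those of \<open>\<psi>\<close>, and second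
  differences determine the limit. The convergence is uniform enough to let \<open>w\<close>, later the position of
  the process, vary with \<open>n\<close>.\<close>

lemma small_time_convergence:
  fixes \<mu> :: "nat \<Rightarrow> real measure" and \<tau> :: "nat \<Rightarrow> real" and \<phi> :: "real \<Rightarrow> real \<Rightarrow> real"
  assumes a: "0 < \<alpha>" "\<alpha> < 1"
    and sets: "\<And>n. sets (\<mu> n) = sets borel"
    and \<tau>: "\<And>n. 0 < \<tau> n" "\<tau> \<longlonglongrightarrow> 0"
    and laplace: "\<And>n k. has_bochner_integral (\<mu> n) (\<lambda>x. exp (- real k * x)) (exp (\<tau> n * real k powr (1 + \<alpha>)))"
    and \<phi>: "continuous_on UNIV (\<lambda>(w, x). \<phi> w x)" and e: "0 < \<epsilon>" "\<epsilon> < K"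
    and \<phi>0: "\<And>w x. x \<le> \<epsilon> \<or> K \<le> x \<Longrightarrow> \<phi> w x = 0"
    and \<phi>1: "\<And>w x. \<bar>\<phi> w x\<bar> \<le> 1"
  shows "v \<longlonglongrightarrow> w \<Longrightarrow> (\<lambda>n. 1 / \<tau> n * (LINT x|\<mu> n. \<phi> (v n) x)) \<longlonglongrightarrow> (LINT x|levy_measure \<alpha>. \<phi> w x)"
    and "\<exists>C. \<forall>n w. \<bar>1 / \<tau> n * (LINT x|\<mu> n. \<phi> w x)\<bar> \<le> C"
proof -
  note hb = has_bochner_integral_levy_measure_second_difference[OF a]
  let ?E = "\<lambda>n k. exp (\<tau> n * real k powr (1 + \<alpha>))"
  have w: "has_bochner_integral (\<mu> n) (\<lambda>x. (1 - exp (- x))\<^sup>2 * exp (- x) ^ k) (?E n k - 2 * ?E n (k + 1) + ?E n (k + 2))" for n k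
  proof -
    have "has_bochner_integral (\<mu> n) (\<lambda>x. exp (- real k * x) - 2 * exp (- real (k + 1) * x) + exp (- real (k + 2) * x))
       (?E n k - 2 * ?E n (k + 1) + ?E n (k + 2))"
      by (intro has_bochner_integral_add has_bochner_integral_diff has_bochner_integral_mult_right laplace)
    also have "(\<lambda>x. exp (- real k * x) - 2 * exp (- real (k + 1) * x) + exp (- real (k + 2) * x)) =
       (\<lambda>x. (1 - exp (- x))\<^sup>2 * exp (- x) ^ k)"
    proof
      fix x :: real
      have e: "exp (- real m * x) = exp (- x) ^ m" for m by (simp add: exp_of_nat_mult[symmetric])
      show "exp (- real k * x) - 2 * exp (- real (k + 1) * x) + exp (- real (k + 2) * x) = (1 - exp (- x))\<^sup>2 * exp (- x) ^ k"
        unfolding e by (simp add: power2_eq_square power_add algebra_simps)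
    qed
    finally show ?thesis .
  qed
  have int: "integrable (\<mu> n) (\<lambda>x. (1 - exp (- x))\<^sup>2 * exp (- x) ^ k)" for n k
    using w by (rule integrable.intros)
  have weq: "(LINT x|\<mu> n. (1 - exp (- x))\<^sup>2 * exp (- x) ^ k) = ?E n k - 2 * ?E n (k + 1) + ?E n (k + 2)" for n k
    using w by (rule has_bochner_integral_integral_eq)
  have exp_lim: "(\<lambda>n. (exp (\<tau> n * b) - 1) / \<tau> n) \<longlonglongrightarrow> b" for b
  proof -
    have "((\<lambda>y. exp (y * b)) has_real_derivative b) (at 0)" by (auto intro!: derivative_eq_intros)
    then have "((\<lambda>y. (exp (y * b) - 1) / y) \<longlongrightarrow> b) (at 0)"
      by (simp add: has_field_derivative_iff)
    moreover have "filterlim \<tau> (at 0) sequentially" using \<tau> by (auto simp: filterlim_at less_imp_neq[OF \<tau>(1), symmetric])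
    ultimately show ?thesis by (rule filterlim_compose)
  qed
  have conv: "(\<lambda>n. 1 / \<tau> n * (LINT x|\<mu> n. (1 - exp (- x))\<^sup>2 * exp (- x) ^ k)) \<longlonglongrightarrow>
     (LINT x|levy_measure \<alpha>. (1 - exp (- x))\<^sup>2 * exp (- x) ^ k)" for k
  proof -
    have "(\<lambda>n. (?E n k - 1) / \<tau> n - 2 * ((?E n (k + 1) - 1) / \<tau> n) + (?E n (k + 2) - 1) / \<tau> n) \<longlonglongrightarrow>
       real k powr (1 + \<alpha>) - 2 * real (k + 1) powr (1 + \<alpha>) + real (k + 2) powr (1 + \<alpha>)"
      by (intro tendsto_intros exp_lim)
    also have "real k powr (1 + \<alpha>) - 2 * real (k + 1) powr (1 + \<alpha>) + real (k + 2) powr (1 + \<alpha>) =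
       (LINT x|levy_measure \<alpha>. (1 - exp (- x))\<^sup>2 * exp (- x) ^ k)"
      using has_bochner_integral_integral_eq[OF hb[of k]] by (simp add: second_difference_def algebra_simps)
    also have "(\<lambda>n. (?E n k - 1) / \<tau> n - 2 * ((?E n (k + 1) - 1) / \<tau> n) + (?E n (k + 2) - 1) / \<tau> n) =
       (\<lambda>n. 1 / \<tau> n * (LINT x|\<mu> n. (1 - exp (- x))\<^sup>2 * exp (- x) ^ k))"
      unfolding weq by (intro ext) (simp add: diff_divide_distrib add_divide_distrib)
    finally show ?thesis .
  qed
  have mono: "(LINT x|levy_measure \<alpha>. (1 - exp (- x))\<^sup>2 * exp (- x) ^ k) \<le> second_difference \<alpha> 0" for k
  proof -
    have "AE x in levy_measure \<alpha>. (1 - exp (- x))\<^sup>2 * exp (- x) ^ k \<le> (1 - exp (- x))\<^sup>2 * exp (- x) ^ (0::nat)"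
      using AE_levy_measure_pos by eventually_elim (auto intro!: mult_left_le power_le_one)
    from integral_mono_AE[OF integrable.intros[OF hb] integrable.intros[OF hb] this]
    show ?thesis using has_bochner_integral_integral_eq[OF hb[of 0]] by simp
  qed
  have "Bseq (\<lambda>n. 1 / \<tau> n * (LINT x|\<mu> n. (1 - exp (- x))\<^sup>2 * exp (- x) ^ (0::nat)))"
    by (rule convergent_imp_Bseq) (use conv[of 0] convergentI in blast)
  then obtain B where B: "\<And>n. \<bar>1 / \<tau> n * (LINT x|\<mu> n. (1 - exp (- x))\<^sup>2 * exp (- x) ^ (0::nat))\<bar> \<le> B"
    unfolding Bseq_def real_norm_def by blast
  have c1: "continuous_on UNIV (\<phi> u)" for u
  proof -
    have "continuous_on UNIV ((\<lambda>(w, x). \<phi> w x) \<circ> (\<lambda>x. (u, x)))"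
      by (intro continuous_on_compose continuous_intros continuous_on_subset[OF \<phi>]) auto
    then show ?thesis by (simp add: o_def)
  qed
  have convw: "(\<lambda>n. 1 / \<tau> n * (LINT x|\<mu> n. \<phi> u x)) \<longlonglongrightarrow> (LINT x|levy_measure \<alpha>. \<phi> u x)" for u
    by (rule weighted_laplace_convergence[OF sets _ int _ _ conv mono c1 e \<phi>0])
       (use \<tau>(1) integrable.intros[OF hb] in \<open>auto simp: less_imp_le\<close>)
  show "(\<lambda>n. 1 / \<tau> n * (LINT x|\<mu> n. \<phi> (v n) x)) \<longlonglongrightarrow> (LINT x|levy_measure \<alpha>. \<phi> w x)" if v: "v \<longlonglongrightarrow> w"
    by (rule continuous_family_convergence[OF sets int _ _ convw \<phi> e \<phi>0 v])
       (use \<tau>(1) B abs_le_D1 in \<open>auto simp: less_imp_le\<close>)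
  define \<beta> where "\<beta> = (1 - exp (- \<epsilon>))\<^sup>2"
  have b: "\<beta> > 0" using e by (simp add: \<beta>_def)
  have "\<bar>1 / \<tau> n * (LINT x|\<mu> n. \<phi> u x)\<bar> \<le> 1 / \<beta> * B" for n u
  proof -
    let ?w = "\<lambda>x::real. (1 - exp (- x))\<^sup>2 * exp (- x) ^ (0::nat)"
    have "\<bar>1 / \<tau> n * (LINT x|\<mu> n. \<phi> u x)\<bar> = 1 / \<tau> n * \<bar>LINT x|\<mu> n. \<phi> u x\<bar>"
      using \<tau>(1)[of n] by (simp add: abs_mult)
    also have "\<dots> \<le> 1 / \<tau> n * (1 / \<beta> * (LINT x|\<mu> n. ?w x))"
      unfolding \<beta>_def using \<tau>(1)[of n] \<phi>0 \<phi>1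
      by (intro mult_left_mono integral_le_weight(2)[OF sets borel_measurable_continuous_onI[OF c1] int e(1)]) auto
    also have "\<dots> = 1 / \<beta> * (1 / \<tau> n * (LINT x|\<mu> n. ?w x))" by simp
    also have "\<dots> \<le> 1 / \<beta> * B" using b by (intro mult_left_mono abs_le_D1[OF B]) auto
    finally show ?thesis .
  qed
  then show "\<exists>C. \<forall>n w. \<bar>1 / \<tau> n * (LINT x|\<mu> n. \<phi> w x)\<bar> \<le> C" by blast
qed

section \<open>An exponential inequality for the jumps\<close>

text \<open>The factors are integrated out from the last one to the first, each for fixed earlier coordinates.\<close>

lemma PiM_chain_nn_integral_le_1:
  fixes H :: "real \<Rightarrow> real \<Rightarrow> ennreal" and m :: nat
  assumes \<nu>: "prob_space \<nu>" and sets: "sets \<nu> = sets borel"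
    and H[measurable]: "(\<lambda>(w, x). H w x) \<in> borel_measurable (borel \<Otimes>\<^sub>M borel)"
    and le: "\<And>w. (\<integral>\<^sup>+x. H w x \<partial>\<nu>) \<le> 1"
  shows "(\<integral>\<^sup>+x. (\<Prod>k<m. H (\<Sum>i<k. x i) (x k)) \<partial>Pi\<^sub>M {..<m} (\<lambda>_. \<nu>)) \<le> 1"
proof (induction m)
  case 0
  have "prob_space (Pi\<^sub>M {} (\<lambda>_::nat. \<nu>))" by (intro prob_space_PiM \<nu>)
  then show ?case by (simp add: prob_space.emeasure_space_1)
next
  case (Suc m)
  interpret \<nu>: prob_space \<nu> by fact
  interpret P: product_prob_space "\<lambda>_::nat. \<nu>" UNIV by standard
  note [measurable_cong] = sets
  have sm[measurable]: "(\<lambda>x. \<Sum>i<k. x i) \<in> borel_measurable (Pi\<^sub>M I (\<lambda>_::nat. \<nu>))" if "{..<k} \<subseteq> I" for k I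
    by (rule borel_measurable_sum) (use that in \<open>auto intro!: measurable_component_singleton simp: measurable_cong_sets[OF refl sets[symmetric]]\<close>)
  have m: "(\<lambda>x. \<Prod>k<Suc m. H (\<Sum>i<k. x i) (x k)) \<in> borel_measurable (Pi\<^sub>M (insert m {..<m}) (\<lambda>_. \<nu>))"
  proof (rule borel_measurable_prod_ennreal)
    fix k assume "k \<in> {..<Suc m}"
    then have "(\<lambda>x. ((\<Sum>i<k. x i), x k)) \<in> Pi\<^sub>M (insert m {..<m}) (\<lambda>_. \<nu>) \<rightarrow>\<^sub>M borel \<Otimes>\<^sub>M borel"
      by (intro measurable_Pair sm) (auto intro!: measurable_component_singleton simp: measurable_cong_sets[OF refl sets[symmetric]])
    from measurable_compose[OF this H] show "(\<lambda>x. H (\<Sum>i<k. x i) (x k)) \<in> borel_measurable (Pi\<^sub>M (insert m {..<m}) (\<lambda>_. \<nu>))"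
      by simp
  qed
  have "(\<integral>\<^sup>+x. (\<Prod>k<Suc m. H (\<Sum>i<k. x i) (x k)) \<partial>Pi\<^sub>M {..<Suc m} (\<lambda>_. \<nu>)) =
    (\<integral>\<^sup>+x. (\<integral>\<^sup>+y. (\<Prod>k<Suc m. H (\<Sum>i<k. (x(m := y)) i) ((x(m := y)) k)) \<partial>\<nu>) \<partial>Pi\<^sub>M {..<m} (\<lambda>_. \<nu>))"
    unfolding lessThan_Suc by (rule P.product_nn_integral_insert) (use m in \<open>auto simp: lessThan_Suc\<close>)
  also have "\<dots> = (\<integral>\<^sup>+x. (\<integral>\<^sup>+y. (\<Prod>k<m. H (\<Sum>i<k. x i) (x k)) * H (\<Sum>i<m. x i) y \<partial>\<nu>) \<partial>Pi\<^sub>M {..<m} (\<lambda>_. \<nu>))"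
  proof (intro nn_integral_cong)
    fix x :: "nat \<Rightarrow> real" and y :: real
    have "(\<Prod>k<m. H (\<Sum>i<k. (x(m := y)) i) ((x(m := y)) k)) = (\<Prod>k<m. H (\<Sum>i<k. x i) (x k))"
      by (intro prod.cong) auto
    moreover have "(\<Sum>i<m. (x(m := y)) i) = (\<Sum>i<m. x i)" by (intro sum.cong) auto
    ultimately show "(\<Prod>k<Suc m. H (\<Sum>i<k. (x(m := y)) i) ((x(m := y)) k)) = (\<Prod>k<m. H (\<Sum>i<k. x i) (x k)) * H (\<Sum>i<m. x i) y"
      by simp
  qed
  also have "\<dots> = (\<integral>\<^sup>+x. (\<Prod>k<m. H (\<Sum>i<k. x i) (x k)) * (\<integral>\<^sup>+y. H (\<Sum>i<m. x i) y \<partial>\<nu>) \<partial>Pi\<^sub>M {..<m} (\<lambda>_. \<nu>))"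
    by (intro nn_integral_cong nn_integral_cmult) measurable
  also have "\<dots> \<le> (\<integral>\<^sup>+x. (\<Prod>k<m. H (\<Sum>i<k. x i) (x k)) * 1 \<partial>Pi\<^sub>M {..<m} (\<lambda>_. \<nu>))"
    by (intro nn_integral_mono mult_left_mono le) auto
  also have "\<dots> \<le> 1" using Suc by simp
  finally show ?case .
qed

locale stable_process = prob_space M for M :: "'a measure" +
  fixes X :: "real \<Rightarrow> 'a \<Rightarrow> real" and \<alpha> :: real
  assumes alpha: "0 < \<alpha>" "\<alpha> < 1"
    and levy: "levy_process M X"
    and laplace: "has_laplace_exponent M X (\<lambda>\<eta>. \<eta> powr (1 + \<alpha>))"
begin

lemma X_measurable: "0 \<le> t \<Longrightarrow> X t \<in> borel_measurable M"
  using levy by (simp add: levy_process_def)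

lemma X_cadlag: "\<omega> \<in> space M \<Longrightarrow> cadlag (\<lambda>t. X t \<omega>)"
  using levy by (simp add: levy_process_def)

lemma X_increments_indep:
  fixes u :: "nat \<Rightarrow> real"
  assumes "0 \<le> u 0" "mono u"
  shows "indep_vars (\<lambda>_. borel) (\<lambda>i \<omega>. X (u (Suc i)) \<omega> - X (u i) \<omega>) {..<n}"
  using levy assms by (simp add: levy_process_def)

lemma X_increments_stationary:
  "0 \<le> s \<Longrightarrow> 0 \<le> t \<Longrightarrow> distr M borel (\<lambda>\<omega>. X (s + t) \<omega> - X s \<omega>) = distr M borel (X t)"
  using levy by (simp add: levy_process_def)

text \<open>The increments over a grid are independent with the law \<open>\<nu>\<close> of the value at the first grid point,
  and their partial sums are the values of the process.\<close>

lemma increments_nn_integral_le_1: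
  fixes H :: "real \<Rightarrow> real \<Rightarrow> ennreal"
  assumes t: "0 < t"
    and H[measurable]: "(\<lambda>(w, x). H w x) \<in> borel_measurable (borel \<Otimes>\<^sub>M borel)"
    and le: "\<And>w. (\<integral>\<^sup>+x. H w x \<partial>distr M borel (X (t / real (Suc n)))) \<le> 1"
  shows "(\<integral>\<^sup>+\<omega>. (\<Prod>k<Suc n. H (X (grid t (Suc n) k) \<omega>) (X (grid t (Suc n) (Suc k)) \<omega> - X (grid t (Suc n) k) \<omega>)) \<partial>M) \<le> 1"
proof -
  let ?g = "grid t (Suc n)"
  let ?\<xi> = "\<lambda>i \<omega>. X (?g (Suc i)) \<omega> - X (?g i) \<omega>"
  let ?\<nu> = "distr M borel (X (t / real (Suc n)))"
  have [measurable]: "X (?g i) \<in> borel_measurable M" for i using t by (intro X_measurable) auto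
  have nu: "prob_space ?\<nu>" using t by (intro prob_space_distr X_measurable) auto
  have ind: "indep_vars (\<lambda>_. borel) ?\<xi> {..<Suc n}"
    by (rule X_increments_indep) (use t in \<open>auto intro!: monoI grid_mono\<close>)
  have law: "distr M borel (?\<xi> i) = ?\<nu>" for i
    using X_increments_stationary[of "?g i" "t / real (Suc n)"] t by (simp add: grid_Suc)
  have "AE \<omega> in M. X 0 \<omega> = 0" using levy by (simp add: levy_process_def)
  then have "(\<integral>\<^sup>+\<omega>. (\<Prod>k<Suc n. H (X (?g k) \<omega>) (?\<xi> k \<omega>)) \<partial>M) =
    (\<integral>\<^sup>+\<omega>. (\<Prod>k<Suc n. H (\<Sum>i<k. (\<lambda>i\<in>{..<Suc n}. ?\<xi> i \<omega>) i) ((\<lambda>i\<in>{..<Suc n}. ?\<xi> i \<omega>) k)) \<partial>M)"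
  proof (intro nn_integral_cong_AE, eventually_elim)
    case (elim \<omega>)
    show ?case
    proof (intro prod.cong refl)
      fix k assume k: "k \<in> {..<Suc n}"
      have "(\<Sum>i<k. (\<lambda>i\<in>{..<Suc n}. ?\<xi> i \<omega>) i) = (\<Sum>i<k. ?\<xi> i \<omega>)"
        using k by (intro sum.cong) auto
      also have "\<dots> = X (?g k) \<omega>"
        by (subst sum_lessThan_telescope[of "\<lambda>i. X (?g i) \<omega>"]) (simp add: elim)
      finally show "H (X (?g k) \<omega>) (?\<xi> k \<omega>) = H (\<Sum>i<k. (\<lambda>i\<in>{..<Suc n}. ?\<xi> i \<omega>) i) ((\<lambda>i\<in>{..<Suc n}. ?\<xi> i \<omega>) k)"
        using k by simp
    qed
  qed
  also have "\<dots> = (\<integral>\<^sup>+x. (\<Prod>k<Suc n. H (\<Sum>i<k. x i) (x k)) \<partial>distr M (Pi\<^sub>M {..<Suc n} (\<lambda>_. borel)) (\<lambda>\<omega>. \<lambda>i\<in>{..<Suc n}. ?\<xi> i \<omega>))"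
  proof (rule nn_integral_distr[symmetric])
    have "(\<lambda>x. \<Prod>k<Suc n. H (\<Sum>i<k. x i) (x k)) \<in> borel_measurable (Pi\<^sub>M {..<Suc n} (\<lambda>_. borel))"
    proof (rule borel_measurable_prod_ennreal)
      fix k assume "k \<in> {..<Suc n}"
      then have "(\<lambda>x::nat \<Rightarrow> real. ((\<Sum>i<k. x i), x k)) \<in> Pi\<^sub>M {..<Suc n} (\<lambda>_. borel) \<rightarrow>\<^sub>M borel \<Otimes>\<^sub>M borel"
        by (intro measurable_Pair borel_measurable_sum measurable_component_singleton) auto
      from measurable_compose[OF this H] show "(\<lambda>x. H (\<Sum>i<k. x i) (x k)) \<in> borel_measurable (Pi\<^sub>M {..<Suc n} (\<lambda>_. borel))"
        by simp
    qed
    then show "(\<lambda>x. \<Prod>k<Suc n. H (\<Sum>i<k. x i) (x k)) \<in>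
        borel_measurable (distr M (Pi\<^sub>M {..<Suc n} (\<lambda>_. borel)) (\<lambda>\<omega>. \<lambda>i\<in>{..<Suc n}. ?\<xi> i \<omega>))" by simp
  qed measurable
  also have "distr M (Pi\<^sub>M {..<Suc n} (\<lambda>_. borel)) (\<lambda>\<omega>. \<lambda>i\<in>{..<Suc n}. ?\<xi> i \<omega>) = Pi\<^sub>M {..<Suc n} (\<lambda>i. distr M borel (?\<xi> i))"
    using ind by (subst (asm) indep_vars_iff_distr_eq_PiM) auto
  also have "\<dots> = Pi\<^sub>M {..<Suc n} (\<lambda>_. ?\<nu>)" by (simp only: law)
  also have "(\<integral>\<^sup>+x. (\<Prod>k<Suc n. H (\<Sum>i<k. x i) (x k)) \<partial>Pi\<^sub>M {..<Suc n} (\<lambda>_. ?\<nu>)) \<le> 1"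
    by (rule PiM_chain_nn_integral_le_1[OF nu _ H le]) simp
  finally show ?thesis .
qed

lemma time_integral_measurable:
  fixes G :: "real \<Rightarrow> real"
  assumes F: "space F = space M" "\<And>s. 0 \<le> s \<Longrightarrow> X s \<in> borel_measurable F"
    and t: "0 < t" and G: "continuous_on UNIV G" "\<And>w. \<bar>G w\<bar> \<le> C"
  shows "(\<lambda>\<omega>. LINT s:{0..t}|lborel. G (X s \<omega>)) \<in> borel_measurable F"
proof (rule borel_measurable_LIMSEQ_real)
  fix \<omega> assume "\<omega> \<in> space F"
  then have c: "cadlag (\<lambda>s. X s \<omega>)" using X_cadlag F by simp
  have "(\<lambda>n. G (v n)) \<longlonglongrightarrow> G w" if "v \<longlonglongrightarrow> w" for v w
    using G(1) that by (auto simp: continuous_on_sequentially o_def)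
  then show "(\<lambda>n. \<Sum>k<Suc n. t / real (Suc n) * G (X (grid t (Suc n) k) \<omega>)) \<longlonglongrightarrow> (LINT s:{0..t}|lborel. G (X s \<omega>))"
    by (rule riemann_sum_tendsto[OF c t _ G(1) G(2)])
next
  fix n
  have [measurable]: "G \<in> borel_measurable borel" by (rule borel_measurable_continuous_onI[OF G(1)])
  have [measurable]: "X (grid t (Suc n) k) \<in> borel_measurable F" for k using t by (intro F(2)) auto
  show "(\<lambda>\<omega>. \<Sum>k<Suc n. t / real (Suc n) * G (X (grid t (Suc n) k) \<omega>)) \<in> borel_measurable F" by measurable
qed

text \<open>The discretised product \<open>\<Prod> (1 + a \<phi>) exp (- a E \<phi>)\<close> over the increments has integral at
  most \<open>1\<close>, one factor at a time, because \<open>(1 + a E \<phi>) exp (- a E \<phi>) \<le> 1\<close>. As the mesh tends to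
  \<open>0\<close>, the product tends to a product over the jumps, the sum of the expectations tends to a time
  integral by the small-time behaviour of the increments, and Fatou's lemma applies.\<close>

theorem jump_exponential_inequality:
  fixes \<phi> :: "real \<Rightarrow> real \<Rightarrow> real"
  assumes t: "0 < t" and a: "-1 \<le> a"
    and \<phi>: "continuous_on UNIV (\<lambda>(w, x). \<phi> w x)" and e: "0 < \<epsilon>" "\<epsilon> < K"
    and \<phi>0: "\<And>w x. x \<le> \<epsilon> \<or> K \<le> x \<Longrightarrow> \<phi> w x = 0"
    and \<phi>1: "\<And>w x. 0 \<le> \<phi> w x" "\<And>w x. \<phi> w x \<le> 1"
  shows "(\<integral>\<^sup>+\<omega>. ennreal ((\<Prod>s\<in>big_jumps (\<lambda>u. X u \<omega>) \<epsilon> t. 1 + a * \<phi> (left_lim (\<lambda>u. X u \<omega>) s) (jump (\<lambda>u. X u \<omega>) s)) *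
     exp (- a * (LINT s:{0..t}|lborel. (LINT x|levy_measure \<alpha>. \<phi> (X s \<omega>) x)))) \<partial>M) \<le> 1"
proof -
  define \<mu> where "\<mu> n = distr M borel (X (t / real (Suc n)))" for n
  have sets_mu [measurable_cong]: "sets (\<mu> n) = sets borel" for n by (simp add: \<mu>_def)
  have [measurable]: "X (t / real (Suc n)) \<in> borel_measurable M" for n using t by (intro X_measurable) auto
  have p\<mu>: "prob_space (\<mu> n)" for n unfolding \<mu>_def by (intro prob_space_distr) measurable
  have \<phi>m[measurable]: "(\<lambda>(w, x). \<phi> w x) \<in> borel_measurable (borel \<Otimes>\<^sub>M borel)"
    using borel_measurable_continuous_onI[OF \<phi>] by (simp add: borel_prod)
  have abs1: "\<bar>\<phi> w x\<bar> \<le> 1" for w x using \<phi>1[of w x] by auto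
  have lap: "has_bochner_integral (\<mu> n) (\<lambda>x. exp (- real k * x)) (exp (t / real (Suc n) * real k powr (1 + \<alpha>)))" for n k
  proof -
    have "has_bochner_integral M (\<lambda>\<omega>. exp (- real k * X (t / real (Suc n)) \<omega>)) (exp (t / real (Suc n) * real k powr (1 + \<alpha>)))"
      using laplace[unfolded has_laplace_exponent_def, rule_format, of "t / real (Suc n)" "real k"] t by simp
    then show ?thesis unfolding \<mu>_def
      by (subst has_bochner_integral_distr) measurable
  qed
  have tau: "0 < t / real (Suc n)" for n using t by simp
  have tau0: "(\<lambda>n. t / real (Suc n)) \<longlonglongrightarrow> 0" by (rule lim_const_over_n[THEN LIMSEQ_Suc])
  note small = small_time_convergence[OF alpha sets_mu tau tau0 lap \<phi> e \<phi>0 abs1]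
  define \<Phi> where "\<Phi> n w = (LINT x|\<mu> n. \<phi> w x)" for n w
  obtain C where C: "\<And>n w. \<bar>1 / (t / real (Suc n)) * \<Phi> n w\<bar> \<le> C" unfolding \<Phi>_def using small(2) by blast
  have \<Phi>m[measurable]: "\<Phi> n \<in> borel_measurable borel" for n
  proof -
    interpret \<mu>: prob_space "\<mu> n" by (rule p\<mu>)
    show ?thesis unfolding \<Phi>_def by (rule \<mu>.borel_measurable_lebesgue_integral) measurable
  qed
  define G where "G w = (LINT x|levy_measure \<alpha>. \<phi> w x)" for w
  have Gc: "continuous_on UNIV G"
    unfolding G_def by (rule levy_integral_continuous[OF alpha \<phi> e \<phi>0])
  \<comment> \<open>The factors of the discretised product.\<close>
  define H where "H n w x = (1 + a * \<phi> w x) * exp (- a * \<Phi> n w)" for n w x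
  have pos: "0 \<le> 1 + a * \<phi> w x" for w x
  proof -
    have "- 1 * \<phi> w x \<le> a * \<phi> w x" using a \<phi>1(1) by (intro mult_right_mono) auto
    then show ?thesis using \<phi>1(2)[of w x] by auto
  qed
  have H0: "0 \<le> H n w x" for n w x using pos by (simp add: H_def)
  have Hle: "(\<integral>\<^sup>+x. ennreal (H n w x) \<partial>\<mu> n) \<le> 1" for n w
  proof -
    interpret \<mu>: prob_space "\<mu> n" by (rule p\<mu>)
    have i: "integrable (\<mu> n) (\<phi> w)"
      using abs1 \<phi>m by (intro \<mu>.integrable_const_bound[of _ 1]) auto
    have i2: "integrable (\<mu> n) (H n w)" unfolding H_def using i by auto
    have "(\<integral>\<^sup>+x. ennreal (H n w x) \<partial>\<mu> n) = ennreal (LINT x|\<mu> n. H n w x)"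
      by (rule nn_integral_eq_integral[OF i2]) (use H0 in auto)
    also have Heq: "(LINT x|\<mu> n. H n w x) = (1 + a * \<Phi> n w) * exp (- a * \<Phi> n w)"
      unfolding H_def \<Phi>_def using i by (simp add: \<mu>.prob_space)
    finally have "(\<integral>\<^sup>+x. ennreal (H n w x) \<partial>\<mu> n) = ennreal ((1 + a * \<Phi> n w) * exp (- a * \<Phi> n w))" .
    moreover have "(1 + a * \<Phi> n w) * exp (- a * \<Phi> n w) \<le> exp (a * \<Phi> n w) * exp (- a * \<Phi> n w)"
      by (intro mult_right_mono exp_ge_add_one_self) auto
    moreover have "exp (a * \<Phi> n w) * exp (- a * \<Phi> n w) = 1" by (simp add: exp_minus)
    ultimately show ?thesis by (metis ennreal_le_1)
  qed
  let ?P = "\<lambda>n \<omega>. \<Prod>k<Suc n. H n (X (grid t (Suc n) k) \<omega>) (X (grid t (Suc n) (Suc k)) \<omega> - X (grid t (Suc n) k) \<omega>)"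
  have Hm[measurable]: "(\<lambda>(w, x). H n w x) \<in> borel_measurable (borel \<Otimes>\<^sub>M borel)" for n
    unfolding H_def by measurable
  have Pm: "?P n \<in> borel_measurable M" for n
  proof (rule borel_measurable_prod)
    fix k
    have [measurable]: "X (grid t (Suc n) k) \<in> borel_measurable M" for k using t by (intro X_measurable) auto
    show "(\<lambda>\<omega>. H n (X (grid t (Suc n) k) \<omega>) (X (grid t (Suc n) (Suc k)) \<omega> - X (grid t (Suc n) k) \<omega>)) \<in> borel_measurable M"
      by (rule measurable_compose[OF _ Hm[of n], where f="\<lambda>\<omega>. (X (grid t (Suc n) k) \<omega>, X (grid t (Suc n) (Suc k)) \<omega> - X (grid t (Suc n) k) \<omega>)", simplified]) measurable
  qed
  have P1: "(\<integral>\<^sup>+\<omega>. ennreal (?P n \<omega>) \<partial>M) \<le> 1" for n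
    using increments_nn_integral_le_1[OF t, of "\<lambda>w x. ennreal (H n w x)" n] Hle[of n] H0
    by (simp add: \<mu>_def prod_ennreal del: prod.lessThan_Suc)
  have lim: "(\<lambda>n. ?P n \<omega>) \<longlonglongrightarrow> (\<Prod>s\<in>big_jumps (\<lambda>u. X u \<omega>) \<epsilon> t. 1 + a * \<phi> (left_lim (\<lambda>u. X u \<omega>) s) (jump (\<lambda>u. X u \<omega>) s)) *
     exp (- a * (LINT s:{0..t}|lborel. G (X s \<omega>)))" if \<omega>: "\<omega> \<in> space M" for \<omega>
  proof -
    note c = X_cadlag[OF \<omega>]
    have f: "continuous_on UNIV (\<lambda>(w, x). 1 + a * \<phi> w x)"
      using \<phi> by (auto simp: case_prod_beta intro!: continuous_intros)
    have 1: "(\<lambda>n. \<Prod>k<Suc n. 1 + a * \<phi> (X (grid t (Suc n) k) \<omega>) (X (grid t (Suc n) (Suc k)) \<omega> - X (grid t (Suc n) k) \<omega>))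
      \<longlonglongrightarrow> (\<Prod>s\<in>big_jumps (\<lambda>u. X u \<omega>) \<epsilon> t. 1 + a * \<phi> (left_lim (\<lambda>u. X u \<omega>) s) (jump (\<lambda>u. X u \<omega>) s))"
      by (rule prod_increments_tendsto_prod_jumps[OF c t e(1) f]) (simp add: \<phi>0)
    have 2: "(\<lambda>n. \<Sum>k<Suc n. t / real (Suc n) * (1 / (t / real (Suc n)) * \<Phi> n (X (grid t (Suc n) k) \<omega>))) \<longlonglongrightarrow> (LINT s:{0..t}|lborel. G (X s \<omega>))"
      by (rule riemann_sum_tendsto[OF c t _ Gc C]) (use small(1) in \<open>simp add: \<Phi>_def G_def\<close>)
    have eq: "?P n \<omega> = (\<Prod>k<Suc n. 1 + a * \<phi> (X (grid t (Suc n) k) \<omega>) (X (grid t (Suc n) (Suc k)) \<omega> - X (grid t (Suc n) k) \<omega>)) *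
       exp (- a * (\<Sum>k<Suc n. t / real (Suc n) * (1 / (t / real (Suc n)) * \<Phi> n (X (grid t (Suc n) k) \<omega>))))" for n
      unfolding H_def prod.distrib sum_distrib_left using t
      by (subst exp_sum) (auto simp del: prod.lessThan_Suc)
    show ?thesis unfolding eq by (intro tendsto_intros 1 2)
  qed
  have "(\<integral>\<^sup>+\<omega>. ennreal ((\<Prod>s\<in>big_jumps (\<lambda>u. X u \<omega>) \<epsilon> t. 1 + a * \<phi> (left_lim (\<lambda>u. X u \<omega>) s) (jump (\<lambda>u. X u \<omega>) s)) *
     exp (- a * (LINT s:{0..t}|lborel. G (X s \<omega>)))) \<partial>M) = (\<integral>\<^sup>+\<omega>. liminf (\<lambda>n. ennreal (?P n \<omega>)) \<partial>M)"
  proof (intro nn_integral_cong)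
    fix \<omega> assume "\<omega> \<in> space M"
    from tendsto_ennrealI[OF lim[OF this]] show "ennreal ((\<Prod>s\<in>big_jumps (\<lambda>u. X u \<omega>) \<epsilon> t. 1 + a * \<phi> (left_lim (\<lambda>u. X u \<omega>) s) (jump (\<lambda>u. X u \<omega>) s)) *
     exp (- a * (LINT s:{0..t}|lborel. G (X s \<omega>)))) = liminf (\<lambda>n. ennreal (?P n \<omega>))"
      by (intro lim_imp_Liminf[symmetric]) auto
  qed
  also have "\<dots> \<le> liminf (\<lambda>n. \<integral>\<^sup>+\<omega>. ennreal (?P n \<omega>) \<partial>M)"
    using Pm by (intro nn_integral_liminf) (auto simp del: prod.lessThan_Suc)
  also have "\<dots> \<le> liminf (\<lambda>n::nat. 1)" by (intro Liminf_mono always_eventually allI P1)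
  also have "\<dots> = 1" by (simp add: Liminf_const)
  finally show ?thesis by (simp add: G_def)
qed

end

section \<open>A measurable enumeration of the large jumps\<close>

lemma pred_Bex_countable:
  assumes "countable A" "\<And>p. p \<in> A \<Longrightarrow> Measurable.pred M (P p)"
  shows "Measurable.pred M (\<lambda>\<omega>. \<exists>p\<in>A. P p \<omega>)"
proof -
  have "{\<omega> \<in> space M. \<exists>p\<in>A. P p \<omega>} = (\<Union>p\<in>A. {\<omega> \<in> space M. P p \<omega>})" by auto
  also have "\<dots> \<in> sets M" using assms by (intro sets.countable_UN'') (auto simp: pred_def)
  finally show ?thesis by (simp add: pred_def)
qed

lemma sorted_list_nth_le_iff:
  fixes J :: "real set"
  assumes J: "finite J" and k: "k < card J"
  shows "sorted_list_of_set J ! k \<le> b \<longleftrightarrow> Suc k \<le> card {s \<in> J. s \<le> b}"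
proof -
  let ?xs = "sorted_list_of_set J"
  have xs: "set ?xs = J" "distinct ?xs" "sorted ?xs" "length ?xs = card J" using J by auto
  show ?thesis
  proof
    assume le: "?xs ! k \<le> b"
    have "set (take (Suc k) ?xs) \<subseteq> {s \<in> J. s \<le> b}"
    proof
      fix s assume "s \<in> set (take (Suc k) ?xs)"
      then obtain i where i: "i < Suc k" "i < length ?xs" "s = ?xs ! i" by (auto simp: in_set_conv_nth)
      have "?xs ! i \<le> ?xs ! k" using i k xs by (intro sorted_nth_mono) auto
      then show "s \<in> {s \<in> J. s \<le> b}" using i le xs(1) nth_mem[of i ?xs] by auto
    qed
    then have "card (set (take (Suc k) ?xs)) \<le> card {s \<in> J. s \<le> b}" using J by (intro card_mono) auto
    then show "Suc k \<le> card {s \<in> J. s \<le> b}" using xs k by (simp add: distinct_card)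
  next
    assume c: "Suc k \<le> card {s \<in> J. s \<le> b}"
    show "?xs ! k \<le> b"
    proof (rule ccontr)
      assume n: "\<not> ?xs ! k \<le> b"
      have "{s \<in> J. s \<le> b} \<subseteq> set (take k ?xs)"
      proof
        fix s assume "s \<in> {s \<in> J. s \<le> b}"
        then have s: "s \<in> set ?xs" "s \<le> b" using xs(1) by auto
        from s(1) obtain i where i: "i < length ?xs" "s = ?xs ! i" unfolding in_set_conv_nth by blast
        have "i < k"
        proof (rule ccontr)
          assume "\<not> i < k"
          then have "?xs ! k \<le> ?xs ! i" using i xs by (intro sorted_nth_mono) auto
          then show False using n i s(2) by auto
        qed
        then show "s \<in> set (take k ?xs)" using i by (auto simp: in_set_conv_nth)
      qed
      then have "card {s \<in> J. s \<le> b} \<le> card (set (take k ?xs))" by (intro card_mono) auto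
      also have "\<dots> \<le> k" using card_length[of "take k ?xs"] by simp
      finally show False using c by simp
    qed
  qed
qed

text \<open>A rational time separates the last of the large jumps from the others, which reduces the
  measurability of their number to that of the event of a large jump in an interval.\<close>

lemma Suc_le_card_big_jumps_iff:
  assumes x: "cadlag x" and e: "0 < e"
  shows "Suc k \<le> card (big_jumps x e b) \<longleftrightarrow>
    (\<exists>p\<in>{p\<in>\<rat>. 0 \<le> p \<and> p < b}. k \<le> card (big_jumps x e p) \<and> (\<exists>s\<in>{p<..b}. e < jump x s))"
proof
  assume c: "Suc k \<le> card (big_jumps x e b)"
  let ?J = "big_jumps x e b"
  have J: "finite ?J" by (rule finite_big_jumps[OF x e])
  have ne: "?J \<noteq> {}" using c by auto
  define s where "s = Max ?J"
  have s: "s \<in> ?J" "\<And>u. u \<in> ?J \<Longrightarrow> u \<le> s" unfolding s_def using J ne by auto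
  define m where "m = Max (insert 0 (?J - {s}))"
  have fin: "finite (insert 0 (?J - {s}))" using J by simp
  have m: "m \<in> insert 0 (?J - {s})" "\<And>u. u \<in> insert 0 (?J - {s}) \<Longrightarrow> u \<le> m"
    unfolding m_def by (rule Max_in[OF fin insert_not_empty], rule Max_ge[OF fin])
  have "m < s" using m(1) s by (fastforce simp: big_jumps_def order.strict_iff_order)
  then obtain p where p: "p \<in> \<rat>" "m < p" "p < s" using Rats_dense_in_real by blast
  have "?J - {s} \<subseteq> big_jumps x e p"
    using m(2) p by (fastforce simp: big_jumps_def)
  then have "card (?J - {s}) \<le> card (big_jumps x e p)" by (intro card_mono finite_big_jumps x e)
  then have "k \<le> card (big_jumps x e p)" using c s(1) J by simp
  moreover have "0 \<le> p" "p < b" "s \<in> {p<..b}" "e < jump x s" using m(2)[of 0] p s(1) by (auto simp: big_jumps_def)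
  ultimately show "\<exists>p\<in>{p\<in>\<rat>. 0 \<le> p \<and> p < b}. k \<le> card (big_jumps x e p) \<and> (\<exists>s\<in>{p<..b}. e < jump x s)"
    using p(1) by blast
next
  assume "\<exists>p\<in>{p\<in>\<rat>. 0 \<le> p \<and> p < b}. k \<le> card (big_jumps x e p) \<and> (\<exists>s\<in>{p<..b}. e < jump x s)"
  then obtain p s where p: "0 \<le> p" "p < b" "k \<le> card (big_jumps x e p)" "p < s" "s \<le> b" "e < jump x s" by auto
  have "insert s (big_jumps x e p) \<subseteq> big_jumps x e b" using p by (auto simp: big_jumps_def)
  then have "card (insert s (big_jumps x e p)) \<le> card (big_jumps x e b)" by (intro card_mono finite_big_jumps x e)
  moreover have "s \<notin> big_jumps x e p" using p by (auto simp: big_jumps_def)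
  ultimately show "Suc k \<le> card (big_jumps x e b)" using p(3) finite_big_jumps[OF x e, of p] by simp
qed

text \<open>The default \<open>0\<close> is not a jump time and keeps the value within \<open>[0, t]\<close>.\<close>

definition nth_big_jump :: "(real \<Rightarrow> real) \<Rightarrow> real \<Rightarrow> real \<Rightarrow> nat \<Rightarrow> real" where
  "nth_big_jump x e t k = (if k < card (big_jumps x e t) then sorted_list_of_set (big_jumps x e t) ! k else 0)"

lemma bij_betw_nth_big_jump:
  assumes "cadlag x" "0 < e"
  shows "bij_betw (nth_big_jump x e t) {..<card (big_jumps x e t)} (big_jumps x e t)"
proof -
  have "bij_betw ((!) (sorted_list_of_set (big_jumps x e t))) {..<card (big_jumps x e t)} (big_jumps x e t)"
    using finite_big_jumps[OF assms] by (intro bij_betw_nth) auto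
  then show ?thesis by (rule bij_betw_cong[THEN iffD1, rotated]) (simp add: nth_big_jump_def)
qed

lemma nth_big_jump_bounds:
  assumes "cadlag x" "0 < e" "0 \<le> t"
  shows "0 \<le> nth_big_jump x e t k" "nth_big_jump x e t k \<le> t"
proof -
  have "nth_big_jump x e t k \<in> insert 0 (big_jumps x e t)"
    using bij_betwE[OF bij_betw_nth_big_jump[OF assms(1,2)], of t] by (cases "k < card (big_jumps x e t)") (auto simp: nth_big_jump_def)
  then show "0 \<le> nth_big_jump x e t k" "nth_big_jump x e t k \<le> t" using assms by (auto simp: big_jumps_def)
qed

lemma nth_big_jump_le_iff:
  assumes "cadlag x" "0 < e" "0 \<le> b" "b < t"
  shows "nth_big_jump x e t k \<le> b \<longleftrightarrow> \<not> Suc k \<le> card (big_jumps x e t) \<or> Suc k \<le> card (big_jumps x e b)"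
proof (cases "k < card (big_jumps x e t)")
  case True
  have "{s \<in> big_jumps x e t. s \<le> b} = big_jumps x e b" using assms by (auto simp: big_jumps_def)
  then show ?thesis
    using sorted_list_nth_le_iff[OF finite_big_jumps[OF assms(1,2)] True, of b] True by (simp add: nth_big_jump_def)
qed (use assms in \<open>auto simp: nth_big_jump_def\<close>)

context stable_process
begin

abbreviation FX :: "'a measure" where "FX \<equiv> sigma_process M X"

lemma space_FX [simp]: "space FX = space M"
  by (simp add: sigma_process_def)

lemma X_FX_measurable:
  assumes "0 \<le> t"
  shows "X t \<in> borel_measurable FX"
proof -
  have "(\<lambda>\<omega>. \<lambda>t\<in>{0..}. X t \<omega>) \<in> FX \<rightarrow>\<^sub>M path_space {0..}"
    unfolding sigma_process_def by (rule measurable_vimage_algebra1) (auto simp: space_PiM)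
  from measurable_compose[OF this measurable_component_singleton[of t]] assms
  show ?thesis by simp
qed

lemma subalgebra_FX: "subalgebra M FX"
  unfolding subalgebra_def
proof
  show "sets FX \<subseteq> sets M"
    unfolding sigma_process_def
    by (rule sets_image_in_sets) (auto intro!: measurable_restrict X_measurable)
qed simp

lemma FX_measurable_imp_measurable: "f \<in> FX \<rightarrow>\<^sub>M B \<Longrightarrow> f \<in> M \<rightarrow>\<^sub>M B"
  by (rule measurable_from_subalg[OF subalgebra_FX])

lemma big_jump_between_measurable:
  assumes "0 \<le> a" "0 < e"
  shows "Measurable.pred FX (\<lambda>\<omega>. \<exists>s\<in>{a<..b}. e < jump (\<lambda>u. X u \<omega>) s)"
proof -
  have c: "countable (insert b \<rat>)" by (simp add: countable_rat)
  have "Measurable.pred FX (\<lambda>\<omega>. \<exists>j::nat. \<forall>n::nat. \<exists>p\<in>insert b \<rat>. \<exists>r\<in>insert b \<rat>. a \<le> p \<and> p < r \<and> r \<le> b \<and>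
        r < p + 1 / real (Suc n) \<and> e + 1 / real (Suc j) < X r \<omega> - X p \<omega>)"
  proof (intro pred_intros_countable pred_Bex_countable[OF c])
    fix j n :: nat and p r
    show "Measurable.pred FX (\<lambda>\<omega>. a \<le> p \<and> p < r \<and> r \<le> b \<and>
        r < p + 1 / real (Suc n) \<and> e + 1 / real (Suc j) < X r \<omega> - X p \<omega>)"
    proof (cases "a \<le> p \<and> p < r")
      case True
      then have [measurable]: "X p \<in> borel_measurable FX" "X r \<in> borel_measurable FX"
        using assms by (auto intro!: X_FX_measurable)
      show ?thesis by measurable
    next
      case False
      then have "(\<lambda>\<omega>. a \<le> p \<and> p < r \<and> r \<le> b \<and> r < p + 1 / real (Suc n) \<and> e + 1 / real (Suc j) < X r \<omega> - X p \<omega>) =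
        (\<lambda>\<omega>. False)" by blast
      then show ?thesis by simp
    qed
  qed
  then show ?thesis
    by (rule measurable_cong[THEN iffD2, rotated])
       (use big_jump_between_iff[OF X_cadlag assms] in simp)
qed

lemma card_big_jumps_ge_measurable:
  assumes "0 < e" "0 \<le> b"
  shows "Measurable.pred FX (\<lambda>\<omega>. k \<le> card (big_jumps (\<lambda>u. X u \<omega>) e b))"
  using assms(2)
proof (induction k arbitrary: b)
  case 0
  then show ?case by simp
next
  case (Suc k)
  have "Measurable.pred FX (\<lambda>\<omega>. \<exists>p\<in>{p\<in>\<rat>. 0 \<le> p \<and> p < b}. k \<le> card (big_jumps (\<lambda>u. X u \<omega>) e p) \<and>
     (\<exists>s\<in>{p<..b}. e < jump (\<lambda>u. X u \<omega>) s))"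
    by (intro pred_Bex_countable pred_intros_logic Suc big_jump_between_measurable)
       (auto intro: countable_subset[OF _ countable_rat] simp: assms)
  then show ?case
    by (rule measurable_cong[THEN iffD2, rotated])
       (use Suc_le_card_big_jumps_iff[OF X_cadlag assms(1)] in simp)
qed

lemma card_big_jumps_measurable:
  assumes "0 < e" "0 \<le> t"
  shows "(\<lambda>\<omega>. card (big_jumps (\<lambda>u. X u \<omega>) e t)) \<in> FX \<rightarrow>\<^sub>M count_space UNIV"
proof (rule measurable_count_space_eq2_countable[THEN iffD2, OF conjI])
  show "\<forall>k\<in>UNIV. (\<lambda>\<omega>. card (big_jumps (\<lambda>u. X u \<omega>) e t)) -` {k} \<inter> space FX \<in> sets FX"
  proof
    fix k :: nat
    have "Measurable.pred FX (\<lambda>\<omega>. k \<le> card (big_jumps (\<lambda>u. X u \<omega>) e t) \<and> \<not> Suc k \<le> card (big_jumps (\<lambda>u. X u \<omega>) e t))"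
      by (intro pred_intros_logic card_big_jumps_ge_measurable assms)
    then have "{\<omega> \<in> space FX. k \<le> card (big_jumps (\<lambda>u. X u \<omega>) e t) \<and> \<not> Suc k \<le> card (big_jumps (\<lambda>u. X u \<omega>) e t)} \<in> sets FX"
      by (simp add: pred_def)
    also have "{\<omega> \<in> space FX. k \<le> card (big_jumps (\<lambda>u. X u \<omega>) e t) \<and> \<not> Suc k \<le> card (big_jumps (\<lambda>u. X u \<omega>) e t)} =
       (\<lambda>\<omega>. card (big_jumps (\<lambda>u. X u \<omega>) e t)) -` {k} \<inter> space FX" by auto
    finally show "(\<lambda>\<omega>. card (big_jumps (\<lambda>u. X u \<omega>) e t)) -` {k} \<inter> space FX \<in> sets FX" .
  qed
qed auto

lemma nth_big_jump_measurable:
  assumes "0 < e" "0 < t"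
  shows "(\<lambda>\<omega>. nth_big_jump (\<lambda>u. X u \<omega>) e t k) \<in> borel_measurable FX"
  unfolding borel_measurable_iff_le
proof
  fix b
  consider "b < 0" | "0 \<le> b" "b < t" | "t \<le> b" by linarith
  then show "{\<omega> \<in> space FX. nth_big_jump (\<lambda>u. X u \<omega>) e t k \<le> b} \<in> sets FX"
  proof cases
    case 1
    then have "{\<omega> \<in> space FX. nth_big_jump (\<lambda>u. X u \<omega>) e t k \<le> b} = {}"
      using nth_big_jump_bounds(1)[OF X_cadlag assms(1), of _ t k] assms by force
    then show ?thesis by (simp only: sets.empty_sets)
  next
    case 2
    have "Measurable.pred FX (\<lambda>\<omega>. \<not> Suc k \<le> card (big_jumps (\<lambda>u. X u \<omega>) e t) \<or> Suc k \<le> card (big_jumps (\<lambda>u. X u \<omega>) e b))"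
      using 2 assms by (intro pred_intros_logic card_big_jumps_ge_measurable) auto
    also have "{\<omega> \<in> space FX. \<not> Suc k \<le> card (big_jumps (\<lambda>u. X u \<omega>) e t) \<or> Suc k \<le> card (big_jumps (\<lambda>u. X u \<omega>) e b)} =
       {\<omega> \<in> space FX. nth_big_jump (\<lambda>u. X u \<omega>) e t k \<le> b}"
      using nth_big_jump_le_iff[OF X_cadlag assms(1) 2] by auto
    ultimately show ?thesis unfolding pred_def by simp
  next
    case 3
    then have "{\<omega> \<in> space FX. nth_big_jump (\<lambda>u. X u \<omega>) e t k \<le> b} = space FX"
      using nth_big_jump_bounds(2)[OF X_cadlag assms(1), of _ t k] assms by force
    then show ?thesis by (simp only: sets.top)
  qed
qed

text \<open>Random times with countably many values approximate \<open>T\<close> from the right, which recovers \<open>X\<^sub>T\<close>, or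
  strictly from the left, which recovers the left limit.\<close>

lemma X_at_random_time_measurable:
  assumes T[measurable]: "T \<in> borel_measurable FX" and T0: "\<And>\<omega>. \<omega> \<in> space M \<Longrightarrow> 0 \<le> T \<omega>"
  shows "(\<lambda>\<omega>. X (T \<omega>) \<omega>) \<in> borel_measurable FX" "(\<lambda>\<omega>. left_lim (\<lambda>u. X u \<omega>) (T \<omega>)) \<in> borel_measurable FX"
proof -
  show "(\<lambda>\<omega>. X (T \<omega>) \<omega>) \<in> borel_measurable FX"
  proof (rule borel_measurable_LIMSEQ_real)
    fix \<omega> assume "\<omega> \<in> space FX"
    then have "\<omega> \<in> space M" by simp
    have "(real_of_int \<lfloor>T \<omega> * real (Suc n)\<rfloor> + 1) / real (Suc n) = max 0 ((real_of_int \<lfloor>T \<omega> * real (Suc n)\<rfloor> + 1) / real (Suc n))" for n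
    proof -
      have "0 \<le> \<lfloor>T \<omega> * real (Suc n)\<rfloor>" using T0[OF \<open>\<omega> \<in> space M\<close>] by simp
      then show ?thesis by (simp del: of_nat_Suc)
    qed
    then show "(\<lambda>n. X (max 0 ((real_of_int \<lfloor>T \<omega> * real (Suc n)\<rfloor> + 1) / real (Suc n))) \<omega>) \<longlonglongrightarrow> X (T \<omega>) \<omega>"
      using cadlag_right_approx[OF X_cadlag[OF \<open>\<omega> \<in> space M\<close>] T0[OF \<open>\<omega> \<in> space M\<close>]] by simp
  next
    fix n
    have g: "(\<lambda>\<omega>. \<lfloor>T \<omega> * real (Suc n)\<rfloor>) \<in> FX \<rightarrow>\<^sub>M count_space UNIV" by measurable
    show "(\<lambda>\<omega>. X (max 0 ((real_of_int \<lfloor>T \<omega> * real (Suc n)\<rfloor> + 1) / real (Suc n))) \<omega>) \<in> borel_measurable FX"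
      by (rule measurable_compose_countable[OF _ g]) (rule X_FX_measurable, simp)
  qed
  show "(\<lambda>\<omega>. left_lim (\<lambda>u. X u \<omega>) (T \<omega>)) \<in> borel_measurable FX"
  proof (rule borel_measurable_LIMSEQ_real)
    fix \<omega> assume "\<omega> \<in> space FX"
    then have w: "\<omega> \<in> space M" by simp
    show "(\<lambda>n. X (max 0 ((real_of_int \<lceil>T \<omega> * real (Suc n)\<rceil> - 1) / real (Suc n))) \<omega>) \<longlonglongrightarrow> left_lim (\<lambda>u. X u \<omega>) (T \<omega>)"
    proof (cases "T \<omega> = 0")
      case True
      then show ?thesis by (simp add: left_lim_def max_def)
    next
      case False
      with T0[OF w] show ?thesis by (intro cadlag_left_approx[OF X_cadlag[OF w]]) auto
    qed
  next
    fix n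
    have g: "(\<lambda>\<omega>. \<lceil>T \<omega> * real (Suc n)\<rceil>) \<in> FX \<rightarrow>\<^sub>M count_space UNIV" by measurable
    show "(\<lambda>\<omega>. X (max 0 ((real_of_int \<lceil>T \<omega> * real (Suc n)\<rceil> - 1) / real (Suc n))) \<omega>) \<in> borel_measurable FX"
      by (rule measurable_compose_countable[OF _ g]) (rule X_FX_measurable, simp)
  qed
qed

lemma jump_at_random_time_measurable:
  assumes T: "T \<in> borel_measurable FX" and T0: "\<And>\<omega>. \<omega> \<in> space M \<Longrightarrow> 0 \<le> T \<omega>"
  shows "(\<lambda>\<omega>. jump (\<lambda>u. X u \<omega>) (T \<omega>)) \<in> borel_measurable FX"
  unfolding jump_def using X_at_random_time_measurable[OF assms] by measurable

end

section \<open>The joint law of the process and its marks\<close>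

locale marked_stable_process = stable_process M X \<alpha> + mark: prob_space N
  for M :: "'a measure" and X :: "real \<Rightarrow> 'a \<Rightarrow> real" and \<alpha> :: real and N :: "'b measure" +
  fixes Z :: "'b \<Rightarrow> real \<Rightarrow> real" and q :: real and \<zeta> :: "real \<Rightarrow> 'a \<Rightarrow> real \<Rightarrow> real"
  assumes Z_path_measurable: "Z \<in> N \<rightarrow>\<^sub>M path_space {0..1}"
    and Z_continuous: "\<And>\<omega>. \<omega> \<in> space N \<Longrightarrow> continuous_on {0..1} (Z \<omega>)"
    and Z_nonneg: "\<And>\<omega> s. \<omega> \<in> space N \<Longrightarrow> s \<in> {0..1} \<Longrightarrow> 0 \<le> Z \<omega> s"
    and Z_ends: "\<And>\<omega>. \<omega> \<in> space N \<Longrightarrow> Z \<omega> 0 = 0" "\<And>\<omega>. \<omega> \<in> space N \<Longrightarrow> Z \<omega> 1 = 0"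
    and marked: "marked_process M X (mark_kernel q N Z) \<zeta>"
begin

text \<open>Both end values of the path are \<open>0\<close>, so this is its continuous extension by \<open>0\<close> to the line.\<close>

definition Z01 :: "'b \<Rightarrow> real \<Rightarrow> real" where
  "Z01 \<omega> u = Z \<omega> (max 0 (min 1 u))"

lemma Z_measurable: "s \<in> {0..1} \<Longrightarrow> (\<lambda>\<omega>. Z \<omega> s) \<in> borel_measurable N"
  using measurable_compose[OF Z_path_measurable measurable_component_singleton[of s "{0..1}"]] by simp

lemma Z01_continuous: "\<omega> \<in> space N \<Longrightarrow> continuous_on UNIV (Z01 \<omega>)"
  unfolding Z01_def
  by (rule continuous_on_compose2[OF Z_continuous]) (auto intro!: continuous_intros)

lemma Z01_nonneg: "\<omega> \<in> space N \<Longrightarrow> 0 \<le> Z01 \<omega> u"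
  unfolding Z01_def by (rule Z_nonneg) auto

lemma Z01_measurable [measurable]: "(\<lambda>(u, \<omega>). Z01 \<omega> u) \<in> borel_measurable (borel \<Otimes>\<^sub>M N)"
  by (rule caratheodory_measurable[OF Z01_continuous]) (auto simp: Z01_def intro!: Z_measurable)

lemma scale_path_eq:
  assumes "\<omega> \<in> space N"
  shows "scale_path q x (Z \<omega>) s = (if 0 < x then x powr q * Z01 \<omega> (s / x) else 0)"
proof (cases "0 < x")
  case True
  then have "0 \<le> s \<and> s \<le> x \<longleftrightarrow> 0 \<le> s / x \<and> s / x \<le> 1" by (auto simp: zero_le_divide_iff divide_le_eq)
  then show ?thesis using True Z_ends[OF assms]
    by (auto simp: scale_path_def Z01_def max_def min_def)
next
  case False
  then show ?thesis by (auto simp: scale_path_def)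
qed

definition scaled_Z :: "real \<Rightarrow> 'b \<Rightarrow> real \<Rightarrow> real" where
  "scaled_Z x \<omega> = scale_path q x (Z \<omega>)"

lemma scaled_Z_continuous:
  assumes "\<omega> \<in> space N"
  shows "continuous_on UNIV (scaled_Z x \<omega>)"
proof -
  have "scaled_Z x \<omega> = (\<lambda>s. if 0 < x then x powr q * Z01 \<omega> (s / x) else 0)"
    by (simp add: fun_eq_iff scaled_Z_def scale_path_eq[OF assms])
  then show ?thesis
    by (cases "0 < x") (auto intro!: continuous_intros continuous_on_compose2[OF Z01_continuous[OF assms]])
qed

lemma scaled_Z_measurable [measurable]: "(\<lambda>(x, \<omega>). scaled_Z x \<omega>) \<in> borel \<Otimes>\<^sub>M N \<rightarrow>\<^sub>M path_space UNIV"
proof (rule measurable_PiM_single')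
  fix s :: real
  have "(\<lambda>(x, \<omega>). if 0 < x then x powr q * (\<lambda>(u, \<omega>). Z01 \<omega> u) (s / x, \<omega>) else 0) \<in> borel_measurable (borel \<Otimes>\<^sub>M N)"
    by measurable
  then show "(\<lambda>p. (case p of (x, \<omega>) \<Rightarrow> scaled_Z x \<omega>) s) \<in> borel_measurable (borel \<Otimes>\<^sub>M N)"
    by (rule measurable_cong[THEN iffD2, rotated]) (auto simp: space_pair_measure scaled_Z_def scale_path_eq)
qed (auto simp: space_PiM)

lemma scaled_Z_measurable1 [measurable]: "scaled_Z x \<in> N \<rightarrow>\<^sub>M path_space UNIV"
  using measurable_compose[OF measurable_Pair1'[of x borel N] scaled_Z_measurable] by simp

lemma mark_at_random_time_measurable:
  assumes "T \<in> borel_measurable FX" "\<And>\<omega>. \<omega> \<in> space M \<Longrightarrow> 0 \<le> T \<omega>"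
  shows "(\<lambda>\<omega>. \<zeta> (T \<omega>) \<omega>) \<in> M \<rightarrow>\<^sub>M path_space UNIV"
  using marked assms unfolding marked_process_def by blast

lemma emeasure_mark_kernel:
  assumes "B \<in> sets (path_space UNIV)"
  shows "emeasure (mark_kernel q N Z x) B = (\<integral>\<^sup>+w. indicator B (scaled_Z x w) \<partial>N)"
proof -
  have "emeasure (mark_kernel q N Z x) B = (\<integral>\<^sup>+z. indicator B z \<partial>distr N (path_space UNIV) (scaled_Z x))"
    using assms by (simp add: mark_kernel_def scaled_Z_def[abs_def])
  also have "\<dots> = (\<integral>\<^sup>+w. indicator B (scaled_Z x w) \<partial>N)"
    using assms by (subst nn_integral_distr) auto
  finally show ?thesis .
qed

text \<open>On rectangles the identity is the defining property of the marks; rectangles generate.\<close>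

theorem joint_law_of_marks:
  fixes n :: nat and T :: "nat \<Rightarrow> 'a \<Rightarrow> real"
  assumes T: "\<And>i. i < n \<Longrightarrow> T i \<in> borel_measurable FX" "\<And>i \<omega>. i < n \<Longrightarrow> \<omega> \<in> space M \<Longrightarrow> 0 \<le> T i \<omega>"
    and E: "E \<in> sets FX"
      "\<And>\<omega>. \<omega> \<in> E \<Longrightarrow> inj_on (\<lambda>i. T i \<omega>) {..<n}"
      "\<And>\<omega> i. \<omega> \<in> E \<Longrightarrow> i < n \<Longrightarrow> 0 < jump (\<lambda>u. X u \<omega>) (T i \<omega>)"
    and H: "H \<in> borel_measurable (FX \<Otimes>\<^sub>M Pi\<^sub>M {..<n} (\<lambda>_. path_space UNIV))"
  shows "(\<integral>\<^sup>+\<omega>. indicator E \<omega> * H (\<omega>, \<lambda>i\<in>{..<n}. \<zeta> (T i \<omega>) \<omega>) \<partial>M) =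
    (\<integral>\<^sup>+\<omega>. indicator E \<omega> * (\<integral>\<^sup>+w. H (\<omega>, \<lambda>i\<in>{..<n}. scaled_Z (jump (\<lambda>u. X u \<omega>) (T i \<omega>)) (w i)) \<partial>Pi\<^sub>M {..<n} (\<lambda>_. N)) \<partial>M)"
proof -
  let ?P = "Pi\<^sub>M {..<n} (\<lambda>_. path_space UNIV) :: (nat \<Rightarrow> real \<Rightarrow> real) measure"
  let ?Q = "Pi\<^sub>M {..<n} (\<lambda>_. N)"
  let ?x = "\<lambda>i \<omega>. jump (\<lambda>u. X u \<omega>) (T i \<omega>)"
  interpret Q: product_prob_space "\<lambda>_::nat. N" UNIV by standard
  interpret Q': prob_space ?Q by (intro prob_space_PiM mark.prob_space_axioms)
  define D where "D = density M (indicator E)"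
  have EM[measurable]: "E \<in> sets M" using E(1) subalgebra_FX by (auto simp: subalgebra_def)
  have sD[measurable_cong]: "sets D = sets M" "space D = space M" by (simp_all add: D_def)
  define T1 where "T1 \<omega> = (\<omega>, \<lambda>i\<in>{..<n}. \<zeta> (T i \<omega>) \<omega>)" for \<omega>
  define T2 where "T2 = (\<lambda>(\<omega>, w). (\<omega>, \<lambda>i\<in>{..<n}. scaled_Z (?x i \<omega>) (w i)))"
  have idm: "(\<lambda>\<omega>. \<omega>) \<in> M \<rightarrow>\<^sub>M FX" by (rule FX_measurable_imp_measurable) simp
  have T1m[measurable]: "T1 \<in> M \<rightarrow>\<^sub>M FX \<Otimes>\<^sub>M ?P"
    unfolding T1_def by (intro measurable_Pair idm measurable_restrict mark_at_random_time_measurable T) auto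
  have xm: "?x i \<in> borel_measurable M" if "i < n" for i
    by (rule FX_measurable_imp_measurable[OF jump_at_random_time_measurable[OF T(1) T(2)]]) (use that in auto)
  have T2m[measurable]: "T2 \<in> M \<Otimes>\<^sub>M ?Q \<rightarrow>\<^sub>M FX \<Otimes>\<^sub>M ?P"
    unfolding T2_def case_prod_beta'
  proof (intro measurable_Pair measurable_compose[OF measurable_fst idm] measurable_restrict)
    fix i assume i: "i \<in> {..<n}"
    then have "(\<lambda>p. (?x i (fst p), snd p i)) \<in> M \<Otimes>\<^sub>M ?Q \<rightarrow>\<^sub>M borel \<Otimes>\<^sub>M N"
      by (intro measurable_Pair measurable_compose[OF measurable_fst xm] measurable_compose[OF measurable_snd measurable_component_singleton]) auto
    from measurable_compose[OF this scaled_Z_measurable]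
    show "(\<lambda>p. scaled_Z (?x i (fst p)) (snd p i)) \<in> M \<Otimes>\<^sub>M ?Q \<rightarrow>\<^sub>M path_space UNIV" by simp
  qed
  define \<mu>1 where "\<mu>1 = distr D (FX \<Otimes>\<^sub>M ?P) T1"
  define \<mu>2 where "\<mu>2 = distr (D \<Otimes>\<^sub>M ?Q) (FX \<Otimes>\<^sub>M ?P) T2"
  have i1: "(\<integral>\<^sup>+p. F p \<partial>\<mu>1) = (\<integral>\<^sup>+\<omega>. indicator E \<omega> * F (T1 \<omega>) \<partial>M)" if [measurable]: "F \<in> borel_measurable (FX \<Otimes>\<^sub>M ?P)" for F
  proof -
    have "(\<integral>\<^sup>+p. F p \<partial>\<mu>1) = (\<integral>\<^sup>+\<omega>. F (T1 \<omega>) \<partial>D)"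
      unfolding \<mu>1_def by (rule nn_integral_distr) measurable
    also have "\<dots> = (\<integral>\<^sup>+\<omega>. indicator E \<omega> * F (T1 \<omega>) \<partial>M)"
      unfolding D_def by (rule nn_integral_density) measurable
    finally show ?thesis .
  qed
  have i2: "(\<integral>\<^sup>+p. F p \<partial>\<mu>2) = (\<integral>\<^sup>+\<omega>. indicator E \<omega> * (\<integral>\<^sup>+w. F (T2 (\<omega>, w)) \<partial>?Q) \<partial>M)" if [measurable]: "F \<in> borel_measurable (FX \<Otimes>\<^sub>M ?P)" for F
  proof -
    have "(\<integral>\<^sup>+p. F p \<partial>\<mu>2) = (\<integral>\<^sup>+p. F (T2 p) \<partial>(D \<Otimes>\<^sub>M ?Q))"
      unfolding \<mu>2_def by (rule nn_integral_distr) measurable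
    also have "\<dots> = (\<integral>\<^sup>+\<omega>. (\<integral>\<^sup>+w. F (T2 (\<omega>, w)) \<partial>?Q) \<partial>D)"
      by (rule Q'.nn_integral_fst[symmetric]) measurable
    also have "\<dots> = (\<integral>\<^sup>+\<omega>. indicator E \<omega> * (\<integral>\<^sup>+w. F (T2 (\<omega>, w)) \<partial>?Q) \<partial>M)"
      unfolding D_def by (rule nn_integral_density) measurable
    finally show ?thesis .
  qed
  let ?G = "{C \<times> (\<Pi>\<^sub>E i\<in>{..<n}. B i) |C B. C \<in> sets FX \<and> (\<forall>i\<in>{..<n}. B i \<in> sets (path_space UNIV))}"
  have alg: "prod_algebra {..<n} (\<lambda>_. path_space UNIV) = {(\<Pi>\<^sub>E i\<in>{..<n}. B i) |B. B \<in> {..<n} \<rightarrow> sets (path_space UNIV)}"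
    by (rule prod_algebra_eq_finite) simp
  have spaceP: "space ?P = (\<Pi>\<^sub>E i\<in>{..<n}. UNIV)" by (simp add: space_PiM)
  have G_sub: "?G \<subseteq> Pow (space FX \<times> space ?P)"
  proof
    fix A assume "A \<in> ?G"
    then obtain C B where A: "A = C \<times> (\<Pi>\<^sub>E i\<in>{..<n}. B i)" "C \<in> sets FX" by blast
    then have "C \<subseteq> space FX" by (intro sets.sets_into_space)
    moreover have "(\<Pi>\<^sub>E i\<in>{..<n}. B i) \<subseteq> space ?P" unfolding spaceP by (rule PiE_mono) simp
    ultimately show "A \<in> Pow (space FX \<times> space ?P)" unfolding A(1) by blast
  qed
  have sets_pair: "sets (FX \<Otimes>\<^sub>M ?P) = sigma_sets (space FX \<times> space ?P) ?G"
  proof -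
    have "sets (FX \<Otimes>\<^sub>M ?P) = sets (sigma (space FX \<times> space ?P) {a \<times> b |a b. a \<in> sets FX \<and> b \<in> prod_algebra {..<n} (\<lambda>_. path_space UNIV)})"
    proof (rule sets_pair_eq)
      show "sets FX \<subseteq> Pow (space FX)" by (rule sets.space_closed)
      show "sets FX = sigma_sets (space FX) (sets FX)" by (rule sets.sigma_sets_eq[symmetric])
      show "countable {space FX}" "\<Union>{space FX} = space FX" by auto
      show "{space FX} \<subseteq> sets FX" using sets.top[of FX] by blast
      show "prod_algebra {..<n} (\<lambda>_. path_space UNIV) \<subseteq> Pow (space ?P)"
        using prod_algebra_sets_into_space[of "{..<n}" "\<lambda>_. path_space UNIV"] by (simp add: space_PiM)
      show "sets ?P = sigma_sets (space ?P) (prod_algebra {..<n} (\<lambda>_. path_space UNIV))"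
        by (simp add: sets_PiM space_PiM)
      show "countable {space ?P}" "\<Union>{space ?P} = space ?P" by auto
      show "{space ?P} \<subseteq> prod_algebra {..<n} (\<lambda>_. path_space UNIV)"
        using space_in_prod_algebra[of "{..<n}" "\<lambda>_. path_space UNIV"] by (simp add: space_PiM)
    qed
    also have "{a \<times> b |a b. a \<in> sets FX \<and> b \<in> prod_algebra {..<n} (\<lambda>_. path_space UNIV)} = ?G"
      unfolding alg by (auto simp: Pi_iff)
    also have "sets (sigma (space FX \<times> space ?P) ?G) = sigma_sets (space FX \<times> space ?P) ?G"
      by (rule sets_measure_of[OF G_sub])
    finally show ?thesis .
  qed
  have "\<mu>1 = \<mu>2"
  proof (rule measure_eqI_generator_eq[where E="?G" and \<Omega>="space FX \<times> space ?P" and A="\<lambda>_. space FX \<times> space ?P"])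
    show "Int_stable ?G"
    proof (rule Int_stableI)
      fix a b assume "a \<in> ?G" "b \<in> ?G"
      then obtain C B C' B' where "a = C \<times> (\<Pi>\<^sub>E i\<in>{..<n}. B i)" "b = C' \<times> (\<Pi>\<^sub>E i\<in>{..<n}. B' i)"
        "C \<in> sets FX" "C' \<in> sets FX" "\<forall>i\<in>{..<n}. B i \<in> sets (path_space UNIV)" "\<forall>i\<in>{..<n}. B' i \<in> sets (path_space UNIV)" by blast
      then have "a \<inter> b = (C \<inter> C') \<times> (\<Pi>\<^sub>E i\<in>{..<n}. B i \<inter> B' i)" "C \<inter> C' \<in> sets FX"
        "\<forall>i\<in>{..<n}. B i \<inter> B' i \<in> sets (path_space UNIV)" by (auto simp: Times_Int_Times PiE_Int)
      then show "a \<inter> b \<in> ?G" by blast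
    qed
    show "?G \<subseteq> Pow (space FX \<times> space ?P)" by (rule G_sub)
    show "sets \<mu>1 = sigma_sets (space FX \<times> space ?P) ?G" "sets \<mu>2 = sigma_sets (space FX \<times> space ?P) ?G"
      by (simp_all add: \<mu>1_def \<mu>2_def sets_pair)
    show "range (\<lambda>_. space FX \<times> space ?P) \<subseteq> ?G" unfolding spaceP
      using sets.top[of FX] sets.top[of "path_space UNIV :: (real \<Rightarrow> real) measure"] by (auto intro!: exI[of _ "space M"] exI[of _ "\<lambda>_. UNIV"] simp: space_PiM)
    show "(\<Union>i::nat. space FX \<times> space ?P) = space FX \<times> space ?P" by auto
    show "emeasure \<mu>1 (space FX \<times> space ?P) \<noteq> \<infinity>"
    proof -
      have "emeasure \<mu>1 (space FX \<times> space ?P) = (\<integral>\<^sup>+p. 1 \<partial>\<mu>1)" by (simp add: \<mu>1_def space_pair_measure)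
      also have "\<dots> = (\<integral>\<^sup>+\<omega>. indicator E \<omega> * 1 \<partial>M)" by (rule i1) simp
      also have "\<dots> = emeasure M E" by simp
      finally show ?thesis by simp
    qed
    fix A assume "A \<in> ?G"
    then obtain C B where A: "A = C \<times> (\<Pi>\<^sub>E i\<in>{..<n}. B i)" and C: "C \<in> sets FX" and B: "\<And>i. i < n \<Longrightarrow> B i \<in> sets (path_space UNIV)" by blast
    have Am[measurable]: "A \<in> sets (FX \<Otimes>\<^sub>M ?P)" unfolding A by (intro pair_measureI C sets_PiM_I_finite) (use B in auto)
    have CE: "C \<inter> E \<in> sets FX" using C E(1) by auto
    let ?g = "\<lambda>\<omega>. \<Prod>i<n. indicator (B i) (\<zeta> (T i \<omega>) \<omega>) :: ennreal"
    have gm: "?g \<in> borel_measurable M"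
      by (intro borel_measurable_prod_ennreal measurable_compose[OF mark_at_random_time_measurable[OF T] borel_measurable_indicator] B) auto
    have "AE \<omega> in M. inj_on (\<lambda>i. T i \<omega>) {..<n} \<and> (\<forall>i<n. 0 < ?x i \<omega>) \<longrightarrow>
       nn_cond_exp M FX ?g \<omega> = (\<Prod>i<n. emeasure (mark_kernel q N Z (?x i \<omega>)) (B i))"
      using marked T B unfolding marked_process_def by blast
    then have ae: "AE \<omega> in M. indicator (C \<inter> E) \<omega> * nn_cond_exp M FX ?g \<omega> =
       indicator E \<omega> * (\<integral>\<^sup>+w. indicator A (T2 (\<omega>, w)) \<partial>?Q)"
    proof (eventually_elim, cases)
      fix \<omega> assume "inj_on (\<lambda>i. T i \<omega>) {..<n} \<and> (\<forall>i<n. 0 < ?x i \<omega>) \<longrightarrow>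
       nn_cond_exp M FX ?g \<omega> = (\<Prod>i<n. emeasure (mark_kernel q N Z (?x i \<omega>)) (B i))" and \<omega>: "\<omega> \<in> E"
      with E(2,3)[OF \<omega>] have 1: "nn_cond_exp M FX ?g \<omega> = (\<Prod>i<n. emeasure (mark_kernel q N Z (?x i \<omega>)) (B i))" by blast
      have "(\<integral>\<^sup>+w. indicator A (T2 (\<omega>, w)) \<partial>?Q) = (\<integral>\<^sup>+w. indicator C \<omega> * (\<Prod>i<n. indicator (B i) (scaled_Z (?x i \<omega>) (w i))) \<partial>?Q)"
      proof (intro nn_integral_cong)
        fix w
        show "(indicator A (T2 (\<omega>, w)) :: ennreal) = indicator C \<omega> * (\<Prod>i<n. indicator (B i) (scaled_Z (?x i \<omega>) (w i)))"
        proof (cases "\<forall>i<n. scaled_Z (?x i \<omega>) (w i) \<in> B i")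
          case True
          then show ?thesis by (auto simp: A T2_def indicator_def)
        next
          case False
          then obtain i where "i < n" "scaled_Z (?x i \<omega>) (w i) \<notin> B i" by blast
          then have "(\<Prod>i<n. indicator (B i) (scaled_Z (?x i \<omega>) (w i))) = (0 :: ennreal)"
            by (intro prod_zero bexI[of _ i]) auto
          with False show ?thesis by (auto simp: A T2_def indicator_def PiE_iff)
        qed
      qed
      also have "\<dots> = indicator C \<omega> * (\<integral>\<^sup>+w. (\<Prod>i<n. indicator (B i) (scaled_Z (?x i \<omega>) (w i))) \<partial>?Q)"
        by (rule nn_integral_cmult, intro borel_measurable_prod_ennreal
           measurable_compose[OF measurable_compose[OF measurable_component_singleton[where I="{..<n}" and M="\<lambda>_. N"] scaled_Z_measurable1] borel_measurable_indicator] B) auto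
      also have "(\<integral>\<^sup>+w. (\<Prod>i<n. indicator (B i) (scaled_Z (?x i \<omega>) (w i))) \<partial>?Q) = (\<Prod>i<n. \<integral>\<^sup>+w. indicator (B i) (scaled_Z (?x i \<omega>) w) \<partial>N)"
        by (rule Q.product_nn_integral_prod) (auto intro!: measurable_compose[OF scaled_Z_measurable1 borel_measurable_indicator] B)
      also have "\<dots> = (\<Prod>i<n. emeasure (mark_kernel q N Z (?x i \<omega>)) (B i))"
        by (intro prod.cong refl emeasure_mark_kernel[symmetric] B) auto
      finally show "indicator (C \<inter> E) \<omega> * nn_cond_exp M FX ?g \<omega> = indicator E \<omega> * (\<integral>\<^sup>+w. indicator A (T2 (\<omega>, w)) \<partial>?Q)"
        using 1 \<omega> by (simp add: indicator_inter_arith)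
    qed (auto simp: indicator_def)
    interpret sub: finite_measure_subalgebra M FX by standard (rule subalgebra_FX)
    have "emeasure \<mu>1 A = (\<integral>\<^sup>+p. indicator A p \<partial>\<mu>1)" by (simp add: \<mu>1_def)
    also have "\<dots> = (\<integral>\<^sup>+\<omega>. indicator E \<omega> * indicator A (T1 \<omega>) \<partial>M)" by (rule i1) measurable
    also have "\<dots> = (\<integral>\<^sup>+\<omega>. indicator (C \<inter> E) \<omega> * ?g \<omega> \<partial>M)"
    proof (intro nn_integral_cong)
      fix \<omega>
      show "indicator E \<omega> * indicator A (T1 \<omega>) = indicator (C \<inter> E) \<omega> * ?g \<omega>"
      proof (cases "\<forall>i<n. \<zeta> (T i \<omega>) \<omega> \<in> B i")
        case True
        then show ?thesis by (auto simp: A T1_def indicator_def)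
      next
        case False
        then obtain i where "i < n" "\<zeta> (T i \<omega>) \<omega> \<notin> B i" by blast
        then have "?g \<omega> = 0" by (intro prod_zero bexI[of _ i]) auto
        with False show ?thesis by (auto simp: A T1_def indicator_def PiE_iff)
      qed
    qed
    also have "\<dots> = (\<integral>\<^sup>+\<omega>. indicator (C \<inter> E) \<omega> * nn_cond_exp M FX ?g \<omega> \<partial>M)"
      by (rule sub.nn_cond_exp_intg[symmetric]) (use CE gm in auto)
    also have "\<dots> = (\<integral>\<^sup>+\<omega>. indicator E \<omega> * (\<integral>\<^sup>+w. indicator A (T2 (\<omega>, w)) \<partial>?Q) \<partial>M)"
      by (rule nn_integral_cong_AE[OF ae])
    also have "\<dots> = (\<integral>\<^sup>+p. indicator A p \<partial>\<mu>2)" by (rule i2[symmetric]) measurable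
    also have "\<dots> = emeasure \<mu>2 A" by (simp add: \<mu>2_def)
    finally show "emeasure \<mu>1 A = emeasure \<mu>2 A" .
  qed
  then show ?thesis using i1[OF H] i2[OF H] by (simp add: T1_def T2_def)
qed

abbreviation "JX \<epsilon> t \<omega> \<equiv> big_jumps (\<lambda>u. X u \<omega>) \<epsilon> t"
abbreviation "lX \<omega> \<equiv> left_lim (\<lambda>u. X u \<omega>)"
abbreviation "dX \<omega> \<equiv> jump (\<lambda>u. X u \<omega>)"

lemma prod_big_jumps_eq:
  assumes "\<omega> \<in> space M" "0 < \<epsilon>" "card (JX \<epsilon> t \<omega>) = n"
  shows "(\<Prod>s\<in>JX \<epsilon> t \<omega>. f s) = (\<Prod>k<n. f (nth_big_jump (\<lambda>u. X u \<omega>) \<epsilon> t k))"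
  using prod.reindex_bij_betw[OF bij_betw_nth_big_jump[OF X_cadlag[OF assms(1)] assms(2), of t], of f] assms(3) by simp

text \<open>On \<open>E\<close> the random times \<open>\<tau>\<close> enumerate the large jumps, so that their marks are, given \<open>X\<close>,
  independent with the laws of the scaled paths; the mean value of the product factorises.\<close>

lemma marks_given_number_of_jumps:
  fixes H :: "real \<Rightarrow> real \<Rightarrow> (real \<Rightarrow> real) \<Rightarrow> real" and n :: nat
  assumes t: "0 < t" and e: "0 < \<epsilon>"
    and H[measurable]: "(\<lambda>(w, x, z). H w x z) \<in> borel_measurable (borel \<Otimes>\<^sub>M borel \<Otimes>\<^sub>M path_space UNIV)"
    and H0: "\<And>w x z. 0 \<le> H w x z" and HC: "\<And>w x z. H w x z \<le> C"
    and Y[measurable]: "Y \<in> borel_measurable FX" and Y0: "\<And>\<omega>. 0 \<le> Y \<omega>"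
    and E: "E = {\<omega> \<in> space M. card (JX \<epsilon> t \<omega>) = n}"
    and \<tau>: "\<tau> = (\<lambda>k \<omega>. nth_big_jump (\<lambda>u. X u \<omega>) \<epsilon> t k)"
  shows "(\<integral>\<^sup>+\<omega>. indicator E \<omega> * ennreal (Y \<omega> * (\<Prod>k<n. H (lX \<omega> (\<tau> k \<omega>)) (dX \<omega> (\<tau> k \<omega>)) (\<zeta> (\<tau> k \<omega>) \<omega>))) \<partial>M) =
    (\<integral>\<^sup>+\<omega>. indicator E \<omega> * ennreal (Y \<omega> * (\<Prod>k<n. LINT w|N. H (lX \<omega> (\<tau> k \<omega>)) (dX \<omega> (\<tau> k \<omega>)) (scaled_Z (dX \<omega> (\<tau> k \<omega>)) w))) \<partial>M)"
proof -
  let ?P = "Pi\<^sub>M {..<n} (\<lambda>_. path_space UNIV) :: (nat \<Rightarrow> real \<Rightarrow> real) measure"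
  let ?Q = "Pi\<^sub>M {..<n} (\<lambda>_. N)"
  interpret Q: product_prob_space "\<lambda>_::nat. N" UNIV by standard
  interpret Q': prob_space ?Q by (intro prob_space_PiM mark.prob_space_axioms)
  have \<tau>m[measurable]: "\<tau> k \<in> borel_measurable FX" for k
    unfolding \<tau> by (rule nth_big_jump_measurable[OF e t])
  have \<tau>0: "0 \<le> \<tau> k \<omega>" if "\<omega> \<in> space M" for k \<omega>
    unfolding \<tau> using nth_big_jump_bounds(1)[OF X_cadlag[OF that] e] t by simp
  have EF: "E \<in> sets FX"
    using measurable_sets[OF card_big_jumps_measurable[OF e, of t], of "{n}"] t unfolding E
    by (simp add: vimage_def Int_def conj_commute)
  have Einj: "inj_on (\<lambda>i. \<tau> i \<omega>) {..<n}" and Epos: "\<And>i. i < n \<Longrightarrow> 0 < dX \<omega> (\<tau> i \<omega>)" if "\<omega> \<in> E" for \<omega>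
    using bij_betw_nth_big_jump[OF X_cadlag e, of \<omega> t] that e unfolding E \<tau>
    by (auto simp: bij_betw_def big_jumps_def set_eq_iff image_iff) (metis (no_types, lifting) lessThan_iff less_trans)
  have lm[measurable]: "(\<lambda>\<omega>. lX \<omega> (\<tau> k \<omega>)) \<in> borel_measurable FX" for k
    by (rule X_at_random_time_measurable[OF \<tau>m \<tau>0])
  have dm[measurable]: "(\<lambda>\<omega>. dX \<omega> (\<tau> k \<omega>)) \<in> borel_measurable FX" for k
    by (rule jump_at_random_time_measurable[OF \<tau>m \<tau>0])
  define F where "F = (\<lambda>(\<omega>, z). ennreal (Y \<omega> * (\<Prod>k<n. H (lX \<omega> (\<tau> k \<omega>)) (dX \<omega> (\<tau> k \<omega>)) (z k))))"
  have Fm: "F \<in> borel_measurable (FX \<Otimes>\<^sub>M ?P)"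
    unfolding F_def case_prod_beta'
  proof (intro measurable_compose[OF _ measurable_ennreal] borel_measurable_times borel_measurable_prod measurable_compose[OF measurable_fst Y])
    fix k assume k: "k \<in> {..<n}"
    have "(\<lambda>p. (lX (fst p) (\<tau> k (fst p)), dX (fst p) (\<tau> k (fst p)), snd p k)) \<in> FX \<Otimes>\<^sub>M ?P \<rightarrow>\<^sub>M borel \<Otimes>\<^sub>M borel \<Otimes>\<^sub>M path_space UNIV"
      by (intro measurable_Pair measurable_compose[OF measurable_fst lm] measurable_compose[OF measurable_fst dm]
         measurable_compose[OF measurable_snd measurable_component_singleton] k)
    from measurable_compose[OF this H]
    show "(\<lambda>p. H (lX (fst p) (\<tau> k (fst p))) (dX (fst p) (\<tau> k (fst p))) (snd p k)) \<in> borel_measurable (FX \<Otimes>\<^sub>M ?P)"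
      by simp
  qed
  have Hs: "(\<lambda>w. H a b (scaled_Z b w)) \<in> borel_measurable N" for a b
  proof -
    have "(\<lambda>w. (a, b, scaled_Z b w)) \<in> N \<rightarrow>\<^sub>M borel \<Otimes>\<^sub>M borel \<Otimes>\<^sub>M path_space UNIV" by measurable
    from measurable_compose[OF this H] show ?thesis by simp
  qed
  have Hi: "integrable N (\<lambda>w. H a b (scaled_Z b w))" for a b
    by (rule mark.integrable_const_bound[of _ C]) (use Hs H0 HC in auto)
  have inner: "(\<integral>\<^sup>+w. F (\<omega>, \<lambda>i\<in>{..<n}. scaled_Z (dX \<omega> (\<tau> i \<omega>)) (w i)) \<partial>?Q) =
    ennreal (Y \<omega> * (\<Prod>k<n. LINT w|N. H (lX \<omega> (\<tau> k \<omega>)) (dX \<omega> (\<tau> k \<omega>)) (scaled_Z (dX \<omega> (\<tau> k \<omega>)) w)))" for \<omega>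
  proof -
    let ?h = "\<lambda>k w. H (lX \<omega> (\<tau> k \<omega>)) (dX \<omega> (\<tau> k \<omega>)) (scaled_Z (dX \<omega> (\<tau> k \<omega>)) w)"
    have "(\<integral>\<^sup>+w. F (\<omega>, \<lambda>i\<in>{..<n}. scaled_Z (dX \<omega> (\<tau> i \<omega>)) (w i)) \<partial>?Q) = (\<integral>\<^sup>+w. ennreal (Y \<omega>) * (\<Prod>k<n. ennreal (?h k (w k))) \<partial>?Q)"
      by (intro nn_integral_cong) (simp add: F_def ennreal_mult'[OF Y0] prod_ennreal H0)
    also have "\<dots> = ennreal (Y \<omega>) * (\<integral>\<^sup>+w. (\<Prod>k<n. ennreal (?h k (w k))) \<partial>?Q)"
      by (rule nn_integral_cmult, intro borel_measurable_prod_ennreal measurable_compose[OF _ measurable_ennreal]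
        measurable_compose[OF measurable_component_singleton[where I="{..<n}" and M="\<lambda>_. N"] Hs]) auto
    also have "(\<integral>\<^sup>+w. (\<Prod>k<n. ennreal (?h k (w k))) \<partial>?Q) = (\<Prod>k<n. \<integral>\<^sup>+w. ennreal (?h k w) \<partial>N)"
      by (rule Q.product_nn_integral_prod) (use Hs in auto)
    also have "\<dots> = (\<Prod>k<n. ennreal (LINT w|N. ?h k w))"
      by (intro prod.cong refl nn_integral_eq_integral Hi) (auto simp: H0)
    also have "\<dots> = ennreal (\<Prod>k<n. LINT w|N. ?h k w)"
      by (intro prod_ennreal Bochner_Integration.integral_nonneg) (auto simp: H0)
    finally show ?thesis unfolding ennreal_mult'[OF Y0] .
  qed
  have "(\<integral>\<^sup>+\<omega>. indicator E \<omega> * F (\<omega>, \<lambda>i\<in>{..<n}. \<zeta> (\<tau> i \<omega>) \<omega>) \<partial>M) =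
    (\<integral>\<^sup>+\<omega>. indicator E \<omega> * (\<integral>\<^sup>+w. F (\<omega>, \<lambda>i\<in>{..<n}. scaled_Z (dX \<omega> (\<tau> i \<omega>)) (w i)) \<partial>?Q) \<partial>M)"
    by (rule joint_law_of_marks[OF \<tau>m \<tau>0 EF Einj Epos Fm])
  then show ?thesis unfolding inner by (simp add: F_def)
qed

text \<open>The functionals of the marks needed below evaluate a mark at a point depending on \<open>X\<close>, which
  is not a measurable operation on the product space. They are limits, along continuous paths,
  of measurable functionals; the integrals are bounded for a given number of jumps, so dominated
  convergence applies there, and the number of jumps is summed over at the end.\<close>

theorem marking_theorem:
  fixes H :: "nat \<Rightarrow> real \<Rightarrow> real \<Rightarrow> (real \<Rightarrow> real) \<Rightarrow> real"
  assumes t: "0 < t" and e: "0 < \<epsilon>"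
    and H[measurable]: "\<And>j. (\<lambda>(w, x, z). H j w x z) \<in> borel_measurable (borel \<Otimes>\<^sub>M borel \<Otimes>\<^sub>M path_space UNIV)"
    and H0: "\<And>j w x z. 0 \<le> H j w x z" and HC: "\<And>j w x z. H j w x z \<le> C"
    and lim: "\<And>w x z. continuous_on UNIV z \<Longrightarrow> (\<lambda>j. H j w x z) \<longlonglongrightarrow> H' w x z"
    and Y[measurable]: "Y \<in> borel_measurable FX" and Y0: "\<And>\<omega>. 0 \<le> Y \<omega>" and YB: "\<And>\<omega>. Y \<omega> \<le> B"
  shows "\<exists>R\<in>borel_measurable M. (AE \<omega> in M. R \<omega> = ennreal (Y \<omega> * (\<Prod>s\<in>JX \<epsilon> t \<omega>. H' (lX \<omega> s) (dX \<omega> s) (\<zeta> s \<omega>)))) \<and>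
    (\<integral>\<^sup>+\<omega>. R \<omega> \<partial>M) = (\<integral>\<^sup>+\<omega>. ennreal (Y \<omega> * (\<Prod>s\<in>JX \<epsilon> t \<omega>. LINT w|N. H' (lX \<omega> s) (dX \<omega> s) (scaled_Z (dX \<omega> s) w))) \<partial>M)"
proof -
  define \<tau> where "\<tau> k \<omega> = nth_big_jump (\<lambda>u. X u \<omega>) \<epsilon> t k" for k \<omega>
  define E where "E n = {\<omega> \<in> space M. card (JX \<epsilon> t \<omega>) = n}" for n
  have YM[measurable]: "Y \<in> borel_measurable M" by (rule FX_measurable_imp_measurable[OF Y])
  have \<tau>m: "\<tau> k \<in> borel_measurable FX" for k
    unfolding \<tau>_def by (rule nth_big_jump_measurable[OF e t])
  have \<tau>0: "0 \<le> \<tau> k \<omega>" if "\<omega> \<in> space M" for k \<omega>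
    unfolding \<tau>_def using nth_big_jump_bounds(1)[OF X_cadlag[OF that] e] t by simp
  have lm[measurable]: "(\<lambda>\<omega>. lX \<omega> (\<tau> k \<omega>)) \<in> borel_measurable M" for k
    by (rule FX_measurable_imp_measurable[OF X_at_random_time_measurable(2)[OF \<tau>m \<tau>0]])
  have dm[measurable]: "(\<lambda>\<omega>. dX \<omega> (\<tau> k \<omega>)) \<in> borel_measurable M" for k
    by (rule FX_measurable_imp_measurable[OF jump_at_random_time_measurable[OF \<tau>m \<tau>0]])
  have zm[measurable]: "(\<lambda>\<omega>. \<zeta> (\<tau> k \<omega>) \<omega>) \<in> M \<rightarrow>\<^sub>M path_space UNIV" for k
    by (rule mark_at_random_time_measurable[OF \<tau>m \<tau>0])
  have EM[measurable]: "E n \<in> sets M" for n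
    using measurable_sets[OF FX_measurable_imp_measurable[OF card_big_jumps_measurable[OF e, of t]], of "{n}"] t unfolding E_def
    by (simp add: vimage_def Int_def conj_commute)
  have "AE \<omega> in M. \<forall>t\<ge>0. continuous_on UNIV (\<zeta> t \<omega>)" using marked by (simp add: marked_process_def)
  then obtain U where U: "U \<in> null_sets M" "{\<omega> \<in> space M. \<not> (\<forall>t\<ge>0. continuous_on UNIV (\<zeta> t \<omega>))} \<subseteq> U"
    by (auto simp: eventually_ae_filter)
  \<comment> \<open>A measurable event of full probability on which the marks are continuous.\<close>
  define \<Omega>0 where "\<Omega>0 = space M - U"
  have O[measurable]: "\<Omega>0 \<in> sets M" using U by (auto simp: \<Omega>0_def)
  have Oc: "continuous_on UNIV (\<zeta> (\<tau> k \<omega>) \<omega>)" if "\<omega> \<in> \<Omega>0" for k \<omega>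
    using that U(2) \<tau>0[of \<omega> k] by (auto simp: \<Omega>0_def)
  have Oae: "AE \<omega> in M. \<omega> \<in> \<Omega>0" using AE_not_in[OF U(1)] by (auto simp: \<Omega>0_def)
  have C0: "0 \<le> C" by (rule order.trans[OF H0[of 0 0 0 "\<lambda>_. 0"] HC])
  have Hs: "(\<lambda>w. H j a b (scaled_Z b w)) \<in> borel_measurable N" for j a b
  proof -
    have "(\<lambda>w. (a, b, scaled_Z b w)) \<in> N \<rightarrow>\<^sub>M borel \<Otimes>\<^sub>M borel \<Otimes>\<^sub>M path_space UNIV" by measurable
    from measurable_compose[OF this H] show ?thesis by simp
  qed
  have Hs': "(\<lambda>w. H' a b (scaled_Z b w)) \<in> borel_measurable N" for a b
    by (rule borel_measurable_LIMSEQ_real[OF lim[OF scaled_Z_continuous] Hs])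
  define h where "h j a b = (LINT w|N. H j a b (scaled_Z b w))" for j a b
  define h' where "h' a b = (LINT w|N. H' a b (scaled_Z b w))" for a b
  have h0: "0 \<le> h j a b" for j a b unfolding h_def by (intro Bochner_Integration.integral_nonneg H0)
  have hC: "h j a b \<le> C" for j a b
  proof -
    have "h j a b \<le> (LINT w|N. C)" unfolding h_def
      by (intro integral_mono mark.integrable_const_bound[of _ C]) (use Hs H0 HC C0 in auto)
    then show ?thesis by (simp add: mark.prob_space)
  qed
  have hlim: "(\<lambda>j. h j a b) \<longlonglongrightarrow> h' a b" for a b
    unfolding h_def h'_def
    by (rule integral_dominated_convergence[where w="\<lambda>_. C"])
       (use Hs Hs' H0 HC C0 lim[OF scaled_Z_continuous] in auto)
  have hm[measurable]: "(\<lambda>(a, b). h j a b) \<in> borel_measurable (borel \<Otimes>\<^sub>M borel)" for j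
  proof -
    have "(\<lambda>p. (fst (fst p), snd (fst p), scaled_Z (snd (fst p)) (snd p))) \<in> (borel \<Otimes>\<^sub>M borel) \<Otimes>\<^sub>M N \<rightarrow>\<^sub>M borel \<Otimes>\<^sub>M borel \<Otimes>\<^sub>M path_space UNIV"
    proof (intro measurable_Pair)
      have "(\<lambda>p. (snd (fst p), snd p)) \<in> (borel \<Otimes>\<^sub>M borel) \<Otimes>\<^sub>M N \<rightarrow>\<^sub>M borel \<Otimes>\<^sub>M N" by measurable
      from measurable_compose[OF this scaled_Z_measurable]
      show "(\<lambda>p. scaled_Z (snd (fst p)) (snd p)) \<in> (borel \<Otimes>\<^sub>M borel) \<Otimes>\<^sub>M N \<rightarrow>\<^sub>M path_space UNIV" by simp
    qed measurable
    from measurable_compose[OF this H]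
    have "(\<lambda>(p, w). H j (fst p) (snd p) (scaled_Z (snd p) w)) \<in> borel_measurable ((borel \<Otimes>\<^sub>M borel) \<Otimes>\<^sub>M N)"
      by (simp add: case_prod_beta')
    from mark.borel_measurable_lebesgue_integral[OF this] show ?thesis by (simp add: h_def case_prod_beta')
  qed
  define u where "u n j \<omega> = indicator (E n) \<omega> * (indicator \<Omega>0 \<omega> * (Y \<omega> * (\<Prod>k<n. H j (lX \<omega> (\<tau> k \<omega>)) (dX \<omega> (\<tau> k \<omega>)) (\<zeta> (\<tau> k \<omega>) \<omega>))))" for n j \<omega>
  define u' where "u' n \<omega> = indicator (E n) \<omega> * (indicator \<Omega>0 \<omega> * (Y \<omega> * (\<Prod>k<n. H' (lX \<omega> (\<tau> k \<omega>)) (dX \<omega> (\<tau> k \<omega>)) (\<zeta> (\<tau> k \<omega>) \<omega>))))" for n \<omega>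
  define v where "v n j \<omega> = indicator (E n) \<omega> * (Y \<omega> * (\<Prod>k<n. h j (lX \<omega> (\<tau> k \<omega>)) (dX \<omega> (\<tau> k \<omega>))))" for n j \<omega>
  define v' where "v' n \<omega> = indicator (E n) \<omega> * (Y \<omega> * (\<Prod>k<n. h' (lX \<omega> (\<tau> k \<omega>)) (dX \<omega> (\<tau> k \<omega>))))" for n \<omega>
  have um[measurable]: "u n j \<in> borel_measurable M" for n j
  proof -
    have [measurable]: "(\<lambda>\<omega>. H j (lX \<omega> (\<tau> k \<omega>)) (dX \<omega> (\<tau> k \<omega>)) (\<zeta> (\<tau> k \<omega>) \<omega>)) \<in> borel_measurable M" for k
    proof -
      have "(\<lambda>\<omega>. (lX \<omega> (\<tau> k \<omega>), dX \<omega> (\<tau> k \<omega>), \<zeta> (\<tau> k \<omega>) \<omega>)) \<in> M \<rightarrow>\<^sub>M borel \<Otimes>\<^sub>M borel \<Otimes>\<^sub>M path_space UNIV"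
        by (intro measurable_Pair lm dm zm)
      from measurable_compose[OF this H] show ?thesis by simp
    qed
    show ?thesis unfolding u_def by measurable
  qed
  have vm[measurable]: "v n j \<in> borel_measurable M" for n j
  proof -
    have [measurable]: "(\<lambda>\<omega>. h j (lX \<omega> (\<tau> k \<omega>)) (dX \<omega> (\<tau> k \<omega>))) \<in> borel_measurable M" for k
      using measurable_compose[OF measurable_Pair[OF lm dm] hm] by simp
    show ?thesis unfolding v_def by measurable
  qed
  have ulim: "(\<lambda>j. u n j \<omega>) \<longlonglongrightarrow> u' n \<omega>" for n \<omega>
    unfolding u_def u'_def
  proof (cases "\<omega> \<in> \<Omega>0")
    case True
    then show "(\<lambda>j. indicator (E n) \<omega> * (indicator \<Omega>0 \<omega> * (Y \<omega> * (\<Prod>k<n. H j (lX \<omega> (\<tau> k \<omega>)) (dX \<omega> (\<tau> k \<omega>)) (\<zeta> (\<tau> k \<omega>) \<omega>)))))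
      \<longlonglongrightarrow> indicator (E n) \<omega> * (indicator \<Omega>0 \<omega> * (Y \<omega> * (\<Prod>k<n. H' (lX \<omega> (\<tau> k \<omega>)) (dX \<omega> (\<tau> k \<omega>)) (\<zeta> (\<tau> k \<omega>) \<omega>))))"
      by (intro tendsto_intros lim Oc)
  qed simp
  have vlim: "(\<lambda>j. v n j \<omega>) \<longlonglongrightarrow> v' n \<omega>" for n \<omega>
    unfolding v_def v'_def by (intro tendsto_intros hlim)
  have u'm[measurable]: "u' n \<in> borel_measurable M" for n by (rule borel_measurable_LIMSEQ_real[OF ulim um])
  have v'm[measurable]: "v' n \<in> borel_measurable M" for n by (rule borel_measurable_LIMSEQ_real[OF vlim vm])
  have B0: "0 \<le> B" by (rule order.trans[OF Y0[of undefined] YB])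
  have pC: "(\<Prod>k<n. H j (lX \<omega> (\<tau> k \<omega>)) (dX \<omega> (\<tau> k \<omega>)) (\<zeta> (\<tau> k \<omega>) \<omega>)) \<le> C ^ n"
    "(\<Prod>k<n. h j (lX \<omega> (\<tau> k \<omega>)) (dX \<omega> (\<tau> k \<omega>))) \<le> C ^ n" for n j \<omega>
    using prod_mono[of "{..<n}" "\<lambda>k. H j (lX \<omega> (\<tau> k \<omega>)) (dX \<omega> (\<tau> k \<omega>)) (\<zeta> (\<tau> k \<omega>) \<omega>)" "\<lambda>_. C"]
      prod_mono[of "{..<n}" "\<lambda>k. h j (lX \<omega> (\<tau> k \<omega>)) (dX \<omega> (\<tau> k \<omega>))" "\<lambda>_. C"] H0 HC h0 hC by auto
  have ub: "ennreal (u n j \<omega>) \<le> ennreal (B * C ^ n)" and vb: "ennreal (v n j \<omega>) \<le> ennreal (B * C ^ n)" for n j \<omega>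
    unfolding u_def v_def using Y0[of \<omega>] B0 C0
    by (auto simp: indicator_def intro!: ennreal_leI mult_mono YB pC prod_nonneg H0 h0)
  have uint: "(\<lambda>j. \<integral>\<^sup>+\<omega>. ennreal (u n j \<omega>) \<partial>M) \<longlonglongrightarrow> (\<integral>\<^sup>+\<omega>. ennreal (u' n \<omega>) \<partial>M)" for n
    by (rule nn_integral_dominated_convergence[where w="\<lambda>_. ennreal (B * C ^ n)"])
       (use ub ulim in \<open>auto intro!: tendsto_ennrealI simp: emeasure_space_1\<close>)
  have vint: "(\<lambda>j. \<integral>\<^sup>+\<omega>. ennreal (v n j \<omega>) \<partial>M) \<longlonglongrightarrow> (\<integral>\<^sup>+\<omega>. ennreal (v' n \<omega>) \<partial>M)" for n
    by (rule nn_integral_dominated_convergence[where w="\<lambda>_. ennreal (B * C ^ n)"])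
       (use vb vlim in \<open>auto intro!: tendsto_ennrealI simp: emeasure_space_1\<close>)
  have uv: "(\<integral>\<^sup>+\<omega>. ennreal (u n j \<omega>) \<partial>M) = (\<integral>\<^sup>+\<omega>. ennreal (v n j \<omega>) \<partial>M)" for n j
  proof -
    have "(\<integral>\<^sup>+\<omega>. ennreal (u n j \<omega>) \<partial>M) = (\<integral>\<^sup>+\<omega>. indicator (E n) \<omega> * ennreal (Y \<omega> * (\<Prod>k<n. H j (lX \<omega> (\<tau> k \<omega>)) (dX \<omega> (\<tau> k \<omega>)) (\<zeta> (\<tau> k \<omega>) \<omega>))) \<partial>M)"
      by (intro nn_integral_cong_AE) (use Oae in eventually_elim, auto simp: u_def indicator_def)
    also have "\<dots> = (\<integral>\<^sup>+\<omega>. indicator (E n) \<omega> * ennreal (Y \<omega> * (\<Prod>k<n. h j (lX \<omega> (\<tau> k \<omega>)) (dX \<omega> (\<tau> k \<omega>)))) \<partial>M)"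
      unfolding h_def
      by (rule marks_given_number_of_jumps[OF t e H H0 HC Y Y0]) (simp_all add: E_def \<tau>_def fun_eq_iff)
    also have "\<dots> = (\<integral>\<^sup>+\<omega>. ennreal (v n j \<omega>) \<partial>M)"
      by (intro nn_integral_cong) (auto simp: v_def indicator_def)
    finally show ?thesis .
  qed
  have u'v': "(\<integral>\<^sup>+\<omega>. ennreal (u' n \<omega>) \<partial>M) = (\<integral>\<^sup>+\<omega>. ennreal (v' n \<omega>) \<partial>M)" for n
    using LIMSEQ_unique[OF uint[of n]] vint[of n] by (simp add: uv)
  have single: "(\<Sum>n. ennreal (if n = m then c else 0)) = ennreal c" for m :: nat and c :: real
    using sums_unique[OF sums_single[of m "\<lambda>_. ennreal c"]] by (simp add: if_distrib[of ennreal] cong: if_cong)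
  define R where "R \<omega> = (\<Sum>n. ennreal (u' n \<omega>))" for \<omega>
  have "AE \<omega> in M. R \<omega> = ennreal (Y \<omega> * (\<Prod>s\<in>JX \<epsilon> t \<omega>. H' (lX \<omega> s) (dX \<omega> s) (\<zeta> s \<omega>)))"
    using Oae AE_space
  proof eventually_elim
    case (elim \<omega>)
    have "u' n \<omega> = (if n = card (JX \<epsilon> t \<omega>) then Y \<omega> * (\<Prod>s\<in>JX \<epsilon> t \<omega>. H' (lX \<omega> s) (dX \<omega> s) (\<zeta> s \<omega>)) else 0)" for n
      using elim prod_big_jumps_eq[OF elim(2) e, of t n "\<lambda>s. H' (lX \<omega> s) (dX \<omega> s) (\<zeta> s \<omega>)"] by (auto simp: u'_def E_def \<tau>_def)
    then show ?case by (simp add: R_def single)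
  qed
  moreover have "R \<in> borel_measurable M" unfolding R_def by measurable
  moreover have "(\<integral>\<^sup>+\<omega>. R \<omega> \<partial>M) = (\<integral>\<^sup>+\<omega>. ennreal (Y \<omega> * (\<Prod>s\<in>JX \<epsilon> t \<omega>. LINT w|N. H' (lX \<omega> s) (dX \<omega> s) (scaled_Z (dX \<omega> s) w))) \<partial>M)"
  proof -
    have "(\<integral>\<^sup>+\<omega>. R \<omega> \<partial>M) = (\<Sum>n. \<integral>\<^sup>+\<omega>. ennreal (v' n \<omega>) \<partial>M)"
      unfolding R_def by (subst nn_integral_suminf) (simp_all add: u'v')
    also have "\<dots> = (\<integral>\<^sup>+\<omega>. (\<Sum>n. ennreal (v' n \<omega>)) \<partial>M)"
      by (rule nn_integral_suminf[symmetric]) measurable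
    also have "\<dots> = (\<integral>\<^sup>+\<omega>. ennreal (Y \<omega> * (\<Prod>s\<in>JX \<epsilon> t \<omega>. h' (lX \<omega> s) (dX \<omega> s))) \<partial>M)"
    proof (intro nn_integral_cong)
      fix \<omega> assume \<omega>: "\<omega> \<in> space M"
      have "v' n \<omega> = (if n = card (JX \<epsilon> t \<omega>) then Y \<omega> * (\<Prod>s\<in>JX \<epsilon> t \<omega>. h' (lX \<omega> s) (dX \<omega> s)) else 0)" for n
        using \<omega> prod_big_jumps_eq[OF \<omega> e, of t n "\<lambda>s. h' (lX \<omega> s) (dX \<omega> s)"] by (auto simp: v'_def E_def \<tau>_def)
      then show "(\<Sum>n. ennreal (v' n \<omega>)) = ennreal (Y \<omega> * (\<Prod>s\<in>JX \<epsilon> t \<omega>. h' (lX \<omega> s) (dX \<omega> s)))" by (simp add: single)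
    qed
    finally show ?thesis by (simp add: h'_def)
  qed
  ultimately show ?thesis by blast
qed

end

section \<open>Exponential inequalities for the marks\<close>

lemma levy_integral_bounded:
  fixes \<phi> :: "real \<Rightarrow> real \<Rightarrow> real"
  assumes a: "0 < \<alpha>" "\<alpha> < 1" and m: "\<And>w. \<phi> w \<in> borel_measurable borel"
    and e: "0 < \<epsilon>" and \<phi>0: "\<And>w x. x \<le> \<epsilon> \<Longrightarrow> \<phi> w x = 0" and \<phi>1: "\<And>w x. \<bar>\<phi> w x\<bar> \<le> 1"
  obtains C where "\<And>w. \<bar>LINT x|levy_measure \<alpha>. \<phi> w x\<bar> \<le> C"
  using integral_le_weight(2)[OF sets_levy_measure m
      integrable.intros[OF has_bochner_integral_levy_measure_second_difference[OF a]] e \<phi>0 \<phi>1] by blast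

lemma abs_time_integral_le:
  assumes "\<And>s. \<bar>f s\<bar> \<le> C" "0 \<le> t"
  shows "\<bar>LINT s:{0..t}|lborel. f s\<bar> \<le> C * (t::real)"
proof -
  have C: "0 \<le> C" using order.trans[OF abs_ge_zero assms(1)] .
  have "\<bar>LINT s:{0..t}|lborel. f s\<bar> \<le> (LINT s|lborel. \<bar>indicator {0..t} s *\<^sub>R f s\<bar>)"
    unfolding set_lebesgue_integral_def by (rule integral_abs_bound)
  also have "\<dots> \<le> (LINT s|lborel. indicator {0..t} s * C)"
  proof (rule integral_mono')
    have "integrable lborel (indicator {0..t} :: real \<Rightarrow> real)" using assms by (intro integrable_real_indicator) auto
    then show "integrable lborel (\<lambda>s. indicator {0..t} s * C)" by (rule integrable_mult_left)
  qed (use assms C in \<open>auto simp: indicator_def\<close>)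
  also have "\<dots> = C * t" using assms(2) by simp
  finally show ?thesis .
qed

context marked_stable_process
begin

text \<open>Averaging over the marks given \<open>X\<close> replaces each factor \<open>1 + a g'\<close> by its mean value, at most
  \<open>1 + a \<phi>\<close>, to which the inequality for the jumps applies. The bound \<open>dom\<close> bounds the mean from above
  if \<open>a\<close> is positive and from below if it is negative. The variable \<open>R\<close> is a measurable version of the
  product, the marks being continuous almost surely only.\<close>

theorem marked_exponential_inequality:
  fixes g :: "nat \<Rightarrow> real \<Rightarrow> real \<Rightarrow> (real \<Rightarrow> real) \<Rightarrow> real" and \<phi> :: "real \<Rightarrow> real \<Rightarrow> real"
  assumes t: "0 < t" and a: "-1 \<le> a"
    and g[measurable]: "\<And>j. (\<lambda>(w, x, z). g j w x z) \<in> borel_measurable (borel \<Otimes>\<^sub>M borel \<Otimes>\<^sub>M path_space UNIV)"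
    and g01: "\<And>j w x z. 0 \<le> g j w x z" "\<And>j w x z. g j w x z \<le> 1"
    and lim: "\<And>w x z. continuous_on UNIV z \<Longrightarrow> (\<lambda>j. g j w x z) \<longlonglongrightarrow> g' w x z"
    and \<phi>: "continuous_on UNIV (\<lambda>(w, x). \<phi> w x)" and e: "0 < \<epsilon>" "\<epsilon> < K"
    and \<phi>0: "\<And>w x. x \<le> \<epsilon> \<or> K \<le> x \<Longrightarrow> \<phi> w x = 0"
    and \<phi>1: "\<And>w x. 0 \<le> \<phi> w x" "\<And>w x. \<phi> w x \<le> 1"
    and dom: "\<And>w x. \<epsilon> < x \<Longrightarrow> a * (LINT v|N. g' w x (scaled_Z x v)) \<le> a * \<phi> w x"
  shows "\<exists>R\<in>borel_measurable M. (AE \<omega> in M. R \<omega> = ennreal ((\<Prod>s\<in>JX \<epsilon> t \<omega>. 1 + a * g' (lX \<omega> s) (dX \<omega> s) (\<zeta> s \<omega>)) *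
       exp (- a * (LINT s:{0..t}|lborel. LINT x|levy_measure \<alpha>. \<phi> (X s \<omega>) x)))) \<and>
     (\<integral>\<^sup>+\<omega>. R \<omega> \<partial>M) \<le> 1"
proof -
  define G where "G w = (LINT x|levy_measure \<alpha>. \<phi> w x)" for w
  have Gc: "continuous_on UNIV G" unfolding G_def by (rule levy_integral_continuous[OF alpha \<phi> e \<phi>0])
  have abs1: "\<bar>\<phi> w x\<bar> \<le> 1" for w x using \<phi>1[of w x] by auto
  have "\<phi> w \<in> borel_measurable borel" for w
    by (intro borel_measurable_continuous_onI continuous_on_compose2[OF \<phi>, of UNIV "\<lambda>x. (w, x)", simplified])
       (auto intro!: continuous_intros)
  then obtain C where C: "\<And>w. \<bar>G w\<bar> \<le> C"
    using levy_integral_bounded[OF alpha _ e(1), of \<phi>] \<phi>0 abs1 unfolding G_def by blast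
  define Y where "Y \<omega> = exp (- a * (LINT s:{0..t}|lborel. G (X s \<omega>)))" for \<omega>
  have Ym: "Y \<in> borel_measurable FX"
  proof -
    have "(\<lambda>\<omega>. LINT s:{0..t}|lborel. G (X s \<omega>)) \<in> borel_measurable FX"
      by (rule time_integral_measurable[OF space_FX X_FX_measurable t Gc C])
    then show ?thesis unfolding Y_def by measurable
  qed
  have YB: "Y \<omega> \<le> exp (\<bar>a\<bar> * (C * t))" for \<omega>
  proof -
    have "\<bar>LINT s:{0..t}|lborel. G (X s \<omega>)\<bar> \<le> C * t" using t by (intro abs_time_integral_le C) auto
    then have "\<bar>a\<bar> * \<bar>LINT s:{0..t}|lborel. G (X s \<omega>)\<bar> \<le> \<bar>a\<bar> * (C * t)" by (intro mult_left_mono) auto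
    then have "\<bar>a * (LINT s:{0..t}|lborel. G (X s \<omega>))\<bar> \<le> \<bar>a\<bar> * (C * t)" by (simp add: abs_mult)
    then show ?thesis unfolding Y_def by (auto simp: abs_le_iff)
  qed
  have pos: "0 \<le> 1 + a * r" if "0 \<le> r" "r \<le> 1" for r
  proof -
    have "- 1 * r \<le> a * r" using a that by (intro mult_right_mono) auto
    then show ?thesis using that by auto
  qed
  have up: "1 + a * r \<le> 1 + \<bar>a\<bar>" if "0 \<le> r" "r \<le> 1" for r
  proof -
    have "a * r \<le> \<bar>a\<bar> * 1" using that by (intro mult_mono) auto
    then show ?thesis by simp
  qed
  have Hm: "(\<lambda>(w, x, z). 1 + a * g j w x z) \<in> borel_measurable (borel \<Otimes>\<^sub>M borel \<Otimes>\<^sub>M path_space UNIV)" for j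
  proof -
    have "(\<lambda>p. 1 + a * (case p of (w, x, z) \<Rightarrow> g j w x z)) \<in> borel_measurable (borel \<Otimes>\<^sub>M borel \<Otimes>\<^sub>M path_space UNIV)"
      using g[of j] by measurable
    then show ?thesis by (simp add: case_prod_beta')
  qed
  have "\<exists>R\<in>borel_measurable M. (AE \<omega> in M. R \<omega> = ennreal (Y \<omega> * (\<Prod>s\<in>JX \<epsilon> t \<omega>. 1 + a * g' (lX \<omega> s) (dX \<omega> s) (\<zeta> s \<omega>)))) \<and>
    (\<integral>\<^sup>+\<omega>. R \<omega> \<partial>M) = (\<integral>\<^sup>+\<omega>. ennreal (Y \<omega> * (\<Prod>s\<in>JX \<epsilon> t \<omega>. LINT w|N. 1 + a * g' (lX \<omega> s) (dX \<omega> s) (scaled_Z (dX \<omega> s) w))) \<partial>M)"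
    by (rule marking_theorem[OF t e(1) Hm _ _ _ Ym _ YB]) (auto intro!: pos up g01 tendsto_intros lim simp: Y_def)
  then obtain R where R: "R \<in> borel_measurable M" "AE \<omega> in M. R \<omega> = ennreal (Y \<omega> * (\<Prod>s\<in>JX \<epsilon> t \<omega>. 1 + a * g' (lX \<omega> s) (dX \<omega> s) (\<zeta> s \<omega>)))"
    "(\<integral>\<^sup>+\<omega>. R \<omega> \<partial>M) = (\<integral>\<^sup>+\<omega>. ennreal (Y \<omega> * (\<Prod>s\<in>JX \<epsilon> t \<omega>. LINT w|N. 1 + a * g' (lX \<omega> s) (dX \<omega> s) (scaled_Z (dX \<omega> s) w))) \<partial>M)"
    by blast
  have gs: "(\<lambda>v. g j w x (scaled_Z x v)) \<in> borel_measurable N" for j w x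
  proof -
    have "(\<lambda>v. (w, x, scaled_Z x v)) \<in> N \<rightarrow>\<^sub>M borel \<Otimes>\<^sub>M borel \<Otimes>\<^sub>M path_space UNIV" by measurable
    from measurable_compose[OF this g] show ?thesis by simp
  qed
  have g's: "(\<lambda>v. g' w x (scaled_Z x v)) \<in> borel_measurable N" for w x
    by (rule borel_measurable_LIMSEQ_real[OF lim[OF scaled_Z_continuous] gs])
  have g'01: "0 \<le> g' w x z" "g' w x z \<le> 1" if "continuous_on UNIV z" for w x z
    using tendsto_lowerbound[OF lim[OF that], of 0 w x] tendsto_upperbound[OF lim[OF that], of w x 1] g01 by auto
  have g'i: "integrable N (\<lambda>v. g' w x (scaled_Z x v))" for w x
    by (rule mark.integrable_const_bound[of _ 1]) (use g's g'01[OF scaled_Z_continuous] in auto)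
  have m01: "0 \<le> (LINT v|N. g' w x (scaled_Z x v))" "(LINT v|N. g' w x (scaled_Z x v)) \<le> 1" for w x
  proof -
    show "0 \<le> (LINT v|N. g' w x (scaled_Z x v))"
      by (intro integral_nonneg_AE AE_I2 g'01 scaled_Z_continuous)
    have "(LINT v|N. g' w x (scaled_Z x v)) \<le> (LINT v|N. 1)"
      by (intro integral_mono g'i g'01 scaled_Z_continuous) auto
    then show "(LINT v|N. g' w x (scaled_Z x v)) \<le> 1" by (simp add: mark.prob_space)
  qed
  have "(\<integral>\<^sup>+\<omega>. R \<omega> \<partial>M) \<le> (\<integral>\<^sup>+\<omega>. ennreal ((\<Prod>s\<in>JX \<epsilon> t \<omega>. 1 + a * \<phi> (lX \<omega> s) (dX \<omega> s)) * Y \<omega>) \<partial>M)"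
    unfolding R(3)
  proof (intro nn_integral_mono ennreal_leI)
    fix \<omega>
    have "(\<Prod>s\<in>JX \<epsilon> t \<omega>. LINT w|N. 1 + a * g' (lX \<omega> s) (dX \<omega> s) (scaled_Z (dX \<omega> s) w)) \<le>
      (\<Prod>s\<in>JX \<epsilon> t \<omega>. 1 + a * \<phi> (lX \<omega> s) (dX \<omega> s))"
    proof (rule prod_mono)
      fix s assume "s \<in> JX \<epsilon> t \<omega>"
      then have "\<epsilon> < dX \<omega> s" by (simp add: big_jumps_def)
      have "(LINT w|N. 1 + a * g' (lX \<omega> s) (dX \<omega> s) (scaled_Z (dX \<omega> s) w)) = 1 + a * (LINT w|N. g' (lX \<omega> s) (dX \<omega> s) (scaled_Z (dX \<omega> s) w))"
        using g'i by (simp add: mark.prob_space)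
      then show "0 \<le> (LINT w|N. 1 + a * g' (lX \<omega> s) (dX \<omega> s) (scaled_Z (dX \<omega> s) w)) \<and>
        (LINT w|N. 1 + a * g' (lX \<omega> s) (dX \<omega> s) (scaled_Z (dX \<omega> s) w)) \<le> 1 + a * \<phi> (lX \<omega> s) (dX \<omega> s)"
        using dom[OF \<open>\<epsilon> < dX \<omega> s\<close>] pos[OF m01] by simp
    qed
    then show "Y \<omega> * (\<Prod>s\<in>JX \<epsilon> t \<omega>. LINT w|N. 1 + a * g' (lX \<omega> s) (dX \<omega> s) (scaled_Z (dX \<omega> s) w)) \<le>
      (\<Prod>s\<in>JX \<epsilon> t \<omega>. 1 + a * \<phi> (lX \<omega> s) (dX \<omega> s)) * Y \<omega>"
      by (subst mult.commute) (intro mult_right_mono, auto simp: Y_def)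
  qed
  also have "\<dots> \<le> 1"
    unfolding Y_def G_def by (rule jump_exponential_inequality[OF t a \<phi> e \<phi>0 \<phi>1])
  finally show ?thesis using R(1,2) by (intro bexI[of _ R]) (simp_all add: Y_def G_def mult.commute)
qed

end

subsection \<open>Cutoffs\<close>

text \<open>Continuous functions with compact support in \<open>(0, \<infinity>)\<close> that tend to \<open>1\<close> there. They remove the
  infinitely many small jumps.\<close>

definition cutoff :: "nat \<Rightarrow> real \<Rightarrow> real" where
  "cutoff k x = max 0 (min 1 (min (2 * real (Suc k) * x - 1) (2 - x / real (Suc k))))"

lemma cutoff_bounds: "0 \<le> cutoff k x" "cutoff k x \<le> 1"
  by (auto simp: cutoff_def)

lemma cutoff_continuous [continuous_intros]: "continuous_on A f \<Longrightarrow> continuous_on A (\<lambda>x. cutoff k (f x))"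
  unfolding cutoff_def by (intro continuous_intros) auto

lemma cutoff_measurable [measurable]: "cutoff k \<in> borel_measurable borel"
  unfolding cutoff_def[abs_def] by measurable

lemma cutoff_eq_0: "x \<le> 1 / (2 * real (Suc k)) \<or> 2 * real (Suc k) \<le> x \<Longrightarrow> cutoff k x = 0"
proof -
  assume "x \<le> 1 / (2 * real (Suc k)) \<or> 2 * real (Suc k) \<le> x"
  then have "2 * real (Suc k) * x - 1 \<le> 0 \<or> 2 - x / real (Suc k) \<le> 0"
  proof
    assume "x \<le> 1 / (2 * real (Suc k))"
    then have "2 * real (Suc k) * x \<le> 2 * real (Suc k) * (1 / (2 * real (Suc k)))" by (intro mult_left_mono) auto
    then show ?thesis by simp
  next
    assume "2 * real (Suc k) \<le> x"
    then show ?thesis by (simp add: pos_le_divide_eq del: of_nat_Suc)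
  qed
  then show ?thesis unfolding cutoff_def by linarith
qed

lemma cutoff_eq_1: "1 / real (Suc k) \<le> x \<Longrightarrow> x \<le> real (Suc k) \<Longrightarrow> cutoff k x = 1"
proof -
  assume x: "1 / real (Suc k) \<le> x" "x \<le> real (Suc k)"
  have "real (Suc k) * (1 / real (Suc k)) \<le> real (Suc k) * x" using x(1) by (intro mult_left_mono) auto
  then have "1 \<le> real (Suc k) * x" by simp
  then have "1 \<le> 2 * real (Suc k) * x - 1" unfolding mult.assoc by linarith
  moreover have "1 \<le> 2 - x / real (Suc k)" using x(2) by (simp add: pos_divide_le_eq del: of_nat_Suc)
  ultimately show ?thesis unfolding cutoff_def by linarith
qed

lemma cutoff_tendsto: "0 < x \<Longrightarrow> (\<lambda>k. cutoff k x) \<longlonglongrightarrow> 1"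
proof -
  assume x: "0 < x"
  obtain k0 :: nat where k0: "max x (1 / x) \<le> real k0" using real_arch_simple by blast
  have "\<forall>\<^sub>F k in sequentially. cutoff k x = 1"
    unfolding eventually_sequentially
  proof (intro exI[of _ k0] allI impI)
    fix k assume "k0 \<le> k"
    then have "x \<le> real (Suc k)" "1 / x \<le> real (Suc k)" using k0 by auto
    then show "cutoff k x = 1" using x by (intro cutoff_eq_1) (auto simp: field_simps)
  qed
  then show ?thesis by (rule tendsto_eventually)
qed

lemma exp_mult_le_affine:
  fixes r \<theta> :: real
  assumes "0 \<le> r" "r \<le> 1"
  shows "exp (\<theta> * r) \<le> 1 + (exp \<theta> - 1) * r"
  using convex_onD[OF exp_convex, of r 0 \<theta>] assms by (simp add: algebra_simps)

context marked_stable_process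
begin

text \<open>The count of the marks, with \<open>G\<close> in place of the indicator of \<open>{h..}\<close>, and its compensator.\<close>

definition smooth_count :: "(real \<Rightarrow> real) \<Rightarrow> nat \<Rightarrow> real \<Rightarrow> real \<Rightarrow> 'a \<Rightarrow> real" where
  "smooth_count G k y t \<omega> = (\<Sum>s\<in>JX (1 / (2 * real (Suc k))) t \<omega>. cutoff k (dX \<omega> s) * G (\<zeta> s \<omega> (y - lX \<omega> s)))"

definition mark_mean :: "(real \<Rightarrow> real) \<Rightarrow> real \<Rightarrow> real \<Rightarrow> real" where
  "mark_mean G u x = (LINT v|N. G (scaled_Z x v u))"

definition intensity_upto :: "(real \<Rightarrow> real) \<Rightarrow> nat \<Rightarrow> real \<Rightarrow> real" where
  "intensity_upto G k u = (LINT x|levy_measure \<alpha>. cutoff k x * mark_mean G u x)"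

lemma mark_mean_bounds:
  assumes "continuous_on UNIV G" "\<And>r. 0 \<le> G r" "\<And>r. G r \<le> 1"
  shows "0 \<le> mark_mean G u x" "mark_mean G u x \<le> 1"
proof -
  have [measurable]: "G \<in> borel_measurable borel" by (rule borel_measurable_continuous_onI[OF assms(1)])
  have [measurable]: "(\<lambda>v. scaled_Z x v u) \<in> borel_measurable N"
    using measurable_compose[OF scaled_Z_measurable1 measurable_component_singleton[of u UNIV]] by simp
  show "0 \<le> mark_mean G u x" unfolding mark_mean_def by (intro Bochner_Integration.integral_nonneg assms)
  have "mark_mean G u x \<le> (LINT v|N. 1)" unfolding mark_mean_def
    by (intro integral_mono mark.integrable_const_bound[of _ 1]) (auto simp: assms)
  then show "mark_mean G u x \<le> 1" by (simp add: mark.prob_space)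
qed

lemma mark_mean_continuous:
  assumes G: "continuous_on UNIV G" "\<And>r. 0 \<le> G r" "\<And>r. G r \<le> 1"
    and c: "(u \<longlonglongrightarrow> u0)" "(x \<longlonglongrightarrow> x0)" "0 < x0"
  shows "(\<lambda>n. mark_mean G (u n) (x n)) \<longlonglongrightarrow> mark_mean G u0 x0"
  unfolding mark_mean_def
proof (rule integral_dominated_convergence[where w="\<lambda>_. 1"])
  have Gm[measurable]: "G \<in> borel_measurable borel" by (rule borel_measurable_continuous_onI[OF G(1)])
  have sm[measurable]: "(\<lambda>v. scaled_Z x v u) \<in> borel_measurable N" for x u
    using measurable_compose[OF scaled_Z_measurable1 measurable_component_singleton[of u UNIV]] by simp
  show "(\<lambda>v. G (scaled_Z x0 v u0)) \<in> borel_measurable N" by measurable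
  show "(\<lambda>v. G (scaled_Z (x n) v (u n))) \<in> borel_measurable N" for n by measurable
  show "AE v in N. (\<lambda>n. G (scaled_Z (x n) v (u n))) \<longlonglongrightarrow> G (scaled_Z x0 v u0)"
  proof (intro AE_I2)
    fix v assume v: "v \<in> space N"
    have Gs: "(\<lambda>n. G (r n)) \<longlonglongrightarrow> G r0" if "r \<longlonglongrightarrow> r0" for r r0
      using G(1) that by (auto simp: continuous_on_sequentially o_def)
    have Zs: "(\<lambda>n. Z01 v (r n)) \<longlonglongrightarrow> Z01 v r0" if "r \<longlonglongrightarrow> r0" for r r0
      using Z01_continuous[OF v] that by (auto simp: continuous_on_sequentially o_def)
    have ev: "\<forall>\<^sub>F n in sequentially. 0 < x n" using c by (intro order_tendstoD)
    have "(\<lambda>n. x n powr q * Z01 v (u n / x n)) \<longlonglongrightarrow> x0 powr q * Z01 v (u0 / x0)"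
      using c by (intro tendsto_mult tendsto_powr Zs tendsto_divide) auto
    moreover have "\<forall>\<^sub>F n in sequentially. x n powr q * Z01 v (u n / x n) = scaled_Z (x n) v (u n)"
      using ev by eventually_elim (simp add: scaled_Z_def scale_path_eq[OF v])
    ultimately have "(\<lambda>n. scaled_Z (x n) v (u n)) \<longlonglongrightarrow> x0 powr q * Z01 v (u0 / x0)"
      by (rule Lim_transform_eventually)
    then show "(\<lambda>n. G (scaled_Z (x n) v (u n))) \<longlonglongrightarrow> G (scaled_Z x0 v u0)"
      using c(3) by (intro Gs) (simp add: scaled_Z_def scale_path_eq[OF v])
  qed
qed (auto simp: G)

text \<open>The mean is continuous in the jump size away from \<open>0\<close>, and the cutoff vanishes near \<open>0\<close>.\<close>

lemma cutoff_mark_mean_continuous: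
  assumes G: "continuous_on UNIV G" "\<And>r. 0 \<le> G r" "\<And>r. G r \<le> 1"
  shows "continuous_on UNIV (\<lambda>(w, x). cutoff k x * mark_mean G (y - w) x)"
proof -
  define d where "d = 1 / (2 * real (Suc k))"
  have d: "d > 0" by (simp add: d_def)
  have eq: "(\<lambda>(w, x). cutoff k x * mark_mean G (y - w) x) = (\<lambda>(w, x). cutoff k x * mark_mean G (y - w) (max d x))"
  proof (intro ext, clarify)
    fix w x
    show "cutoff k x * mark_mean G (y - w) x = cutoff k x * mark_mean G (y - w) (max d x)"
      using cutoff_eq_0[of x k] by (cases "x \<le> d") (auto simp: d_def max_def)
  qed
  show ?thesis
    unfolding eq continuous_on_sequentially
  proof (intro allI ballI impI, unfold o_def)
    fix p :: "nat \<Rightarrow> real \<times> real" and p0 :: "real \<times> real"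
    assume "(\<forall>n. p n \<in> UNIV) \<and> p \<longlonglongrightarrow> p0"
    then have l: "(\<lambda>n. fst (p n)) \<longlonglongrightarrow> fst p0" "(\<lambda>n. snd (p n)) \<longlonglongrightarrow> snd p0"
      by (auto intro: tendsto_fst tendsto_snd)
    have "(\<lambda>n. cutoff k (snd (p n))) \<longlonglongrightarrow> cutoff k (snd p0)"
      using cutoff_continuous[of UNIV "\<lambda>x. x" k] l(2) by (auto simp: continuous_on_sequentially o_def)
    then have "(\<lambda>n. cutoff k (snd (p n)) * mark_mean G (y - fst (p n)) (max d (snd (p n)))) \<longlonglongrightarrow>
       cutoff k (snd p0) * mark_mean G (y - fst p0) (max d (snd p0))"
      using l d by (intro tendsto_mult mark_mean_continuous[OF G] tendsto_diff tendsto_max tendsto_const) auto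
    then show "(\<lambda>n. case p n of (w, x) \<Rightarrow> cutoff k x * mark_mean G (y - w) (max d x)) \<longlonglongrightarrow>
        (case p0 of (w, x) \<Rightarrow> cutoff k x * mark_mean G (y - w) (max d x))"
      by (simp add: case_prod_beta)
  qed
qed

text \<open>By convexity \<open>exp (\<theta> r)\<close> is at most \<open>1 + (exp \<theta> - 1) r\<close> for \<open>r\<close> in \<open>[0, 1]\<close>, so the exponential of
  the count is dominated by the product in the inequality for the marks, with \<open>a = exp \<theta> - 1\<close>. Both
  signs of \<open>\<theta>\<close> are admitted, which will bound the count from above and from below.\<close>

theorem smooth_count_exponential_inequality:
  assumes t: "0 < t" and G: "continuous_on UNIV G" "\<And>r. 0 \<le> G r" "\<And>r. G r \<le> 1"
  shows "\<exists>R\<in>borel_measurable M. (\<integral>\<^sup>+\<omega>. R \<omega> \<partial>M) \<le> 1 \<and>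
     (AE \<omega> in M. ennreal (exp (\<theta> * smooth_count G k y t \<omega> -
         (exp \<theta> - 1) * (LINT s:{0..t}|lborel. intensity_upto G k (y - X s \<omega>)))) \<le> R \<omega>)"
proof -
  define a where "a = exp \<theta> - 1"
  have a: "-1 \<le> a" by (simp add: a_def)
  define \<epsilon> K where "\<epsilon> = 1 / (2 * real (Suc k))" and "K = 2 * real (Suc k)"
  have "\<epsilon> \<le> 1" by (simp add: \<epsilon>_def)
  moreover have "1 < K" by (simp add: K_def)
  ultimately have "\<epsilon> < K" by linarith
  moreover have "0 < \<epsilon>" by (simp add: \<epsilon>_def)
  ultimately have e: "0 < \<epsilon>" "\<epsilon> < K" by simp_all
  have [measurable]: "G \<in> borel_measurable borel" by (rule borel_measurable_continuous_onI[OF G(1)])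
  define ap where "ap j u = real_of_int \<lfloor>u * real (Suc j)\<rfloor> / real (Suc j)" for j u
  have ap: "(\<lambda>j. ap j u) \<longlonglongrightarrow> u" for u unfolding ap_def by (rule real_floor_approx)
  define g where "g j w x z = cutoff k x * G (z (ap j (y - w)))" for j w x and z :: "real \<Rightarrow> real"
  define g' where "g' w x z = cutoff k x * G (z (y - w))" for w x and z :: "real \<Rightarrow> real"
  define \<phi> where "\<phi> w x = cutoff k x * mark_mean G (y - w) x" for w x
  have gm: "(\<lambda>(w, x, z). g j w x z) \<in> borel_measurable (borel \<Otimes>\<^sub>M borel \<Otimes>\<^sub>M path_space UNIV)" for j
  proof -
    have f: "(\<lambda>p. \<lfloor>(y - fst p) * real (Suc j)\<rfloor>) \<in> borel \<Otimes>\<^sub>M borel \<Otimes>\<^sub>M path_space UNIV \<rightarrow>\<^sub>M count_space UNIV" by measurable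
    have "(\<lambda>p. snd (snd p) (real_of_int \<lfloor>(y - fst p) * real (Suc j)\<rfloor> / real (Suc j))) \<in>
       borel_measurable ((borel :: real measure) \<Otimes>\<^sub>M (borel :: real measure) \<Otimes>\<^sub>M path_space UNIV)"
      by (rule measurable_compose_countable[OF _ f])
         (rule measurable_compose[OF measurable_compose[OF measurable_snd measurable_snd] measurable_component_singleton], simp)
    then have [measurable]: "(\<lambda>p. snd (snd p) (ap j (y - fst p))) \<in>
       borel_measurable ((borel :: real measure) \<Otimes>\<^sub>M (borel :: real measure) \<Otimes>\<^sub>M path_space UNIV)"
      by (simp add: ap_def)
    show ?thesis unfolding g_def case_prod_beta' by measurable
  qed
  have "\<exists>R\<in>borel_measurable M. (AE \<omega> in M. R \<omega> = ennreal ((\<Prod>s\<in>JX \<epsilon> t \<omega>. 1 + a * g' (lX \<omega> s) (dX \<omega> s) (\<zeta> s \<omega>)) *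
       exp (- a * (LINT s:{0..t}|lborel. LINT x|levy_measure \<alpha>. \<phi> (X s \<omega>) x)))) \<and>
     (\<integral>\<^sup>+\<omega>. R \<omega> \<partial>M) \<le> 1"
  proof (rule marked_exponential_inequality[where g=g, OF t a gm _ _ _ _ e])
    show "0 \<le> g j w x z" "g j w x z \<le> 1" for j w x z
      unfolding g_def using cutoff_bounds G(2,3) by (auto intro!: mult_le_one)
    show "(\<lambda>j. g j w x z) \<longlonglongrightarrow> g' w x z" if z: "continuous_on UNIV z" for w x z
    proof -
      have "continuous_on UNIV (\<lambda>r. G (z r))" by (rule continuous_on_compose2[OF G(1) z]) auto
      then have "(\<lambda>j. G (z (ap j (y - w)))) \<longlonglongrightarrow> G (z (y - w))"
        using ap[of "y - w"] by (auto simp: continuous_on_sequentially o_def)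
      then show ?thesis unfolding g_def g'_def by (intro tendsto_intros)
    qed
    show "continuous_on UNIV (\<lambda>(w, x). \<phi> w x)"
      unfolding \<phi>_def by (rule cutoff_mark_mean_continuous[OF G])
    show "\<phi> w x = 0" if "x \<le> \<epsilon> \<or> K \<le> x" for w x
      using cutoff_eq_0[of x k] that by (auto simp: \<phi>_def \<epsilon>_def K_def)
    show "0 \<le> \<phi> w x" "\<phi> w x \<le> 1" for w x
      unfolding \<phi>_def using cutoff_bounds mark_mean_bounds[OF G] by (auto intro!: mult_le_one)
    show "a * (LINT v|N. g' w x (scaled_Z x v)) \<le> a * \<phi> w x" for w x
      by (simp add: g'_def \<phi>_def mark_mean_def)
  qed
  then obtain R where R: "R \<in> borel_measurable M" "(\<integral>\<^sup>+\<omega>. R \<omega> \<partial>M) \<le> 1"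
    "AE \<omega> in M. R \<omega> = ennreal ((\<Prod>s\<in>JX \<epsilon> t \<omega>. 1 + a * g' (lX \<omega> s) (dX \<omega> s) (\<zeta> s \<omega>)) *
       exp (- a * (LINT s:{0..t}|lborel. LINT x|levy_measure \<alpha>. \<phi> (X s \<omega>) x)))" by blast
  have "AE \<omega> in M. ennreal (exp (\<theta> * smooth_count G k y t \<omega> -
         (exp \<theta> - 1) * (LINT s:{0..t}|lborel. intensity_upto G k (y - X s \<omega>)))) \<le> R \<omega>"
    using R(3) AE_space
  proof eventually_elim
    case (elim \<omega>)
    have fin: "finite (JX \<epsilon> t \<omega>)" by (rule finite_big_jumps[OF X_cadlag[OF elim(2)] e(1)])
    have "exp (\<theta> * smooth_count G k y t \<omega>) = (\<Prod>s\<in>JX \<epsilon> t \<omega>. exp (\<theta> * g' (lX \<omega> s) (dX \<omega> s) (\<zeta> s \<omega>)))"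
      unfolding smooth_count_def sum_distrib_left \<epsilon>_def[symmetric] exp_sum[OF fin] g'_def ..
    also have "\<dots> \<le> (\<Prod>s\<in>JX \<epsilon> t \<omega>. 1 + a * g' (lX \<omega> s) (dX \<omega> s) (\<zeta> s \<omega>))"
      unfolding a_def
      by (intro prod_mono conjI exp_mult_le_affine) (auto simp: g'_def G cutoff_bounds intro!: mult_le_one)
    finally have 1: "exp (\<theta> * smooth_count G k y t \<omega>) \<le> (\<Prod>s\<in>JX \<epsilon> t \<omega>. 1 + a * g' (lX \<omega> s) (dX \<omega> s) (\<zeta> s \<omega>))" .
    define I where "I = (LINT s:{0..t}|lborel. intensity_upto G k (y - X s \<omega>))"
    have I: "I = (LINT s:{0..t}|lborel. LINT x|levy_measure \<alpha>. \<phi> (X s \<omega>) x)"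
      by (simp add: I_def intensity_upto_def \<phi>_def)
    have "exp (\<theta> * smooth_count G k y t \<omega> - a * I) = exp (\<theta> * smooth_count G k y t \<omega>) * exp (- a * I)"
      unfolding exp_add[symmetric] by simp
    also have "\<dots> \<le> (\<Prod>s\<in>JX \<epsilon> t \<omega>. 1 + a * g' (lX \<omega> s) (dX \<omega> s) (\<zeta> s \<omega>)) * exp (- a * I)"
      by (intro mult_right_mono 1) auto
    finally show ?case unfolding elim(1) I[symmetric] I_def[symmetric] a_def[symmetric] by (rule ennreal_leI)
  qed
  with R(1,2) show ?thesis by blast
qed

end

section \<open>Tail integrals of the Levy measure\<close>

lemma levy_measure_min_powr_finite:
  assumes a: "0 < \<alpha>" "\<alpha> < 1" and ab: "1 + \<alpha> < a" "b < 1 + \<alpha>"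
  shows "(\<integral>\<^sup>+x. ennreal (min (x powr a) (x powr b)) \<partial>levy_measure \<alpha>) < \<infinity>"
proof -
  define D where "D = \<alpha> * (1 + \<alpha>) / Gamma (1 - \<alpha>)"
  have D: "D \<ge> 0" using a by (simp add: D_def Gamma_real_nonneg)
  have "(\<integral>\<^sup>+x. ennreal (min (x powr a) (x powr b)) \<partial>levy_measure \<alpha>) =
     (\<integral>\<^sup>+x. ennreal (levy_density \<alpha> x) * ennreal (min (x powr a) (x powr b)) \<partial>lborel)"
    by (rule nn_integral_levy_measure) measurable
  also have "\<dots> \<le> (\<integral>\<^sup>+x. ennreal D * (ennreal (x powr (a - 2 - \<alpha>)) * indicator {0..1} x + ennreal (x powr (b - 2 - \<alpha>)) * indicator {1..} x) \<partial>lborel)"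
  proof (intro nn_integral_mono)
    fix x :: real
    show "ennreal (levy_density \<alpha> x) * ennreal (min (x powr a) (x powr b)) \<le>
      ennreal D * (ennreal (x powr (a - 2 - \<alpha>)) * indicator {0..1} x + ennreal (x powr (b - 2 - \<alpha>)) * indicator {1..} x)"
    proof (cases "0 < x")
      case True
      have l: "levy_density \<alpha> x = D * x powr (- 2 - \<alpha>)" using True by (simp add: levy_density_def D_def)
      have p: "x powr (- 2 - \<alpha>) * x powr c = x powr (c - 2 - \<alpha>)" for c
        unfolding powr_add[symmetric] by (simp add: algebra_simps)
      have "levy_density \<alpha> x * min (x powr a) (x powr b) \<le> levy_density \<alpha> x * x powr c" if "c \<in> {a, b}" for c
        using that by (intro mult_left_mono levy_density_nonneg a) auto
      then have "levy_density \<alpha> x * min (x powr a) (x powr b) \<le> D * (x powr (c - 2 - \<alpha>))" if "c \<in> {a, b}" for c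
        using that unfolding l mult.assoc p by blast
      then have "ennreal (levy_density \<alpha> x) * ennreal (min (x powr a) (x powr b)) \<le> ennreal D * ennreal (x powr (c - 2 - \<alpha>))" if "c \<in> {a, b}" for c
        using that D by (simp add: ennreal_mult'[symmetric] levy_density_nonneg a ennreal_leI)
      note * = this[of a] this[of b]
      show ?thesis
      proof (cases "x \<le> 1")
        case T1: True
        have "ennreal D * ennreal (x powr (a - 2 - \<alpha>)) \<le> ennreal D * (ennreal (x powr (a - 2 - \<alpha>)) * indicator {0..1} x + ennreal (x powr (b - 2 - \<alpha>)) * indicator {1..} x)"
          using T1 True by (intro mult_left_mono) auto
        with *(1) show ?thesis by (auto intro: order.trans)
      next
        case F1: False
        have "ennreal D * ennreal (x powr (b - 2 - \<alpha>)) \<le> ennreal D * (ennreal (x powr (a - 2 - \<alpha>)) * indicator {0..1} x + ennreal (x powr (b - 2 - \<alpha>)) * indicator {1..} x)"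
          using F1 True by (intro mult_left_mono) auto
        with *(2) show ?thesis by (auto intro: order.trans)
      qed
    qed (simp add: levy_density_def)
  qed
  also have "\<dots> = ennreal D * ((\<integral>\<^sup>+x. ennreal (x powr (a - 2 - \<alpha>)) * indicator {0..1} x \<partial>lborel) + (\<integral>\<^sup>+x. ennreal (x powr (b - 2 - \<alpha>)) * indicator {1..} x \<partial>lborel))"
    by (subst nn_integral_cmult, measurable, subst nn_integral_add) auto
  also have "(\<integral>\<^sup>+x. ennreal (x powr (a - 2 - \<alpha>)) * indicator {0..1} x \<partial>lborel) = ennreal (1 powr (a - 2 - \<alpha> + 1) / (a - 2 - \<alpha> + 1))"
    by (rule nn_integral_has_integral_lebesgue'[OF _ has_integral_powr_from_0]) (use ab in auto)
  also have "(\<integral>\<^sup>+x. ennreal (x powr (b - 2 - \<alpha>)) * indicator {1..} x \<partial>lborel) = ennreal (- (1 powr (b - 2 - \<alpha> + 1)) / (b - 2 - \<alpha> + 1))"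
    by (rule nn_integral_has_integral_lebesgue'[OF _ has_integral_powr_to_inf]) (use ab in auto)
  also have "ennreal D * (ennreal (1 powr (a - 2 - \<alpha> + 1) / (a - 2 - \<alpha> + 1)) + ennreal (- (1 powr (b - 2 - \<alpha> + 1)) / (b - 2 - \<alpha> + 1))) < \<infinity>"
    by (simp add: ennreal_mult_less_top)
  finally show ?thesis .
qed

lemma levy_measure_min_powr_integrable:
  assumes a: "0 < \<alpha>" "\<alpha> < 1" and ab: "1 + \<alpha> < a" "b < 1 + \<alpha>"
  shows "integrable (levy_measure \<alpha>) (\<lambda>x. min (x powr a) (x powr b))"
proof (rule integrableI_nonneg)
  show "(\<lambda>x. min (x powr a) (x powr b)) \<in> borel_measurable (levy_measure \<alpha>)" by measurable
qed (use levy_measure_min_powr_finite[OF assms] in \<open>auto intro!: AE_I2\<close>)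

section \<open>A Borel-Cantelli criterion\<close>

text \<open>By Markov's inequality each of the events has probability at most \<open>exp (- x n)\<close>.\<close>

lemma (in prob_space) exponential_borel_cantelli:
  fixes W :: "nat \<Rightarrow> 'i \<Rightarrow> 'a \<Rightarrow> ennreal" and x :: "nat \<Rightarrow> real"
  assumes W[measurable]: "\<And>n i. W n i \<in> borel_measurable M" and W1: "\<And>n i. (\<integral>\<^sup>+\<omega>. W n i \<omega> \<partial>M) \<le> 1"
    and I: "\<And>n. finite (I n)" and s: "summable (\<lambda>n. real (card (I n)) * exp (- x n))"
  shows "AE \<omega> in M. \<forall>\<^sub>F n in sequentially. \<forall>i\<in>I n. W n i \<omega> < ennreal (exp (x n))"
proof -
  define A where "A n = (\<Union>i\<in>I n. {\<omega> \<in> space M. ennreal (exp (x n)) \<le> W n i \<omega>})" for n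
  have [measurable]: "A n \<in> sets M" for n unfolding A_def using I by (intro sets.finite_UN) auto
  have "emeasure M (A n) \<le> ennreal (real (card (I n)) * exp (- x n))" for n
  proof -
    have 1: "emeasure M {\<omega> \<in> space M. ennreal (exp (x n)) \<le> W n i \<omega>} \<le> ennreal (exp (- x n))" for i
    proof -
      have "{\<omega> \<in> space M. ennreal (exp (x n)) \<le> W n i \<omega>} \<subseteq> {\<omega> \<in> space M. 1 \<le> ennreal (exp (- x n)) * W n i \<omega>}"
      proof safe
        fix \<omega> assume "ennreal (exp (x n)) \<le> W n i \<omega>"
        then have "ennreal (exp (- x n)) * ennreal (exp (x n)) \<le> ennreal (exp (- x n)) * W n i \<omega>"
          by (intro mult_left_mono) auto
        then show "1 \<le> ennreal (exp (- x n)) * W n i \<omega>" by (simp add: ennreal_mult'[symmetric] exp_minus)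
      qed
      then have "emeasure M {\<omega> \<in> space M. ennreal (exp (x n)) \<le> W n i \<omega>} \<le> emeasure M {\<omega> \<in> space M. 1 \<le> ennreal (exp (- x n)) * W n i \<omega>}"
        by (intro emeasure_mono) measurable
      also have "\<dots> \<le> ennreal (exp (- x n)) * (\<integral>\<^sup>+\<omega>. W n i \<omega> * indicator (space M) \<omega> \<partial>M)"
        using nn_integral_Markov_inequality[of "W n i" "space M" M "ennreal (exp (- x n))"] by simp
      also have "(\<integral>\<^sup>+\<omega>. W n i \<omega> * indicator (space M) \<omega> \<partial>M) = (\<integral>\<^sup>+\<omega>. W n i \<omega> \<partial>M)"
        by (intro nn_integral_cong) auto
      also have "ennreal (exp (- x n)) * \<dots> \<le> ennreal (exp (- x n)) * 1" by (intro mult_left_mono W1) auto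
      finally show ?thesis by simp
    qed
    have "emeasure M (A n) \<le> (\<Sum>i\<in>I n. emeasure M {\<omega> \<in> space M. ennreal (exp (x n)) \<le> W n i \<omega>})"
      unfolding A_def by (rule emeasure_subadditive_finite) (use I in auto)
    also have "\<dots> \<le> (\<Sum>i\<in>I n. ennreal (exp (- x n)))" by (intro sum_mono 1)
    also have "\<dots> = ennreal (real (card (I n)) * exp (- x n))"
      by (simp add: ennreal_mult' ennreal_of_nat_eq_real_of_nat)
    finally show ?thesis .
  qed
  then have "measure M (A n) \<le> real (card (I n)) * exp (- x n)" for n
    by (simp add: emeasure_eq_measure)
  then have "summable (\<lambda>n. measure M (A n))"
    by (intro summable_comparison_test'[OF s, of 0]) auto
  then have "AE \<omega> in M. \<forall>\<^sub>F n in sequentially. \<omega> \<in> space M - A n"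
    by (intro borel_cantelli_AE1) (auto simp: emeasure_eq_measure)
  then show ?thesis
  proof eventually_elim
    case (elim \<omega>)
    then show ?case by eventually_elim (auto simp: A_def not_le)
  qed
qed

section \<open>Marks with Hoelder moments\<close>

locale holder_marked_process = marked_stable_process M X \<alpha> N Z q \<zeta>
  for M :: "'a measure" and X :: "real \<Rightarrow> 'a \<Rightarrow> real" and \<alpha> :: real and N :: "'b measure"
    and Z :: "'b \<Rightarrow> real \<Rightarrow> real" and q :: real and \<zeta> :: "real \<Rightarrow> 'a \<Rightarrow> real \<Rightarrow> real" +
  fixes \<gamma> :: real and D :: "'b \<Rightarrow> real"
  assumes gamma: "0 < \<gamma>" "\<gamma> < q"
    and D_measurable [measurable]: "D \<in> borel_measurable N"
    and D_nonneg: "AE v in N. 0 \<le> D v"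
    and D_moments: "\<And>p. 0 < p \<Longrightarrow> integrable N (\<lambda>v. D v powr p)"
    and Z_holder: "AE v in N. \<forall>r\<in>{0..1}. \<forall>s\<in>{0..1}. \<bar>Z v s - Z v r\<bar> \<le> D v * \<bar>s - r\<bar> powr \<gamma>"
begin

lemma q_pos: "0 < q" using gamma by simp

text \<open>The path of length \<open>x\<close> is stretched by \<open>x\<close> in time and by \<open>x\<^sup>q\<close> in space, which multiplies its
  Hoelder constant by \<open>x\<^bsup>q-\<gamma>\<^esup>\<close>.\<close>

lemma scaled_Z_holder:
  "AE v in N. \<forall>x>0. \<forall>r s. \<bar>scaled_Z x v s - scaled_Z x v r\<bar> \<le> x powr (q - \<gamma>) * D v * \<bar>s - r\<bar> powr \<gamma>"
  using Z_holder D_nonneg AE_space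
proof eventually_elim
  case (elim v)
  show ?case
  proof (intro allI impI)
    fix x r s :: real assume x: "0 < x"
    have cl: "\<bar>max 0 (min 1 a) - max 0 (min 1 b)\<bar> \<le> \<bar>a - b\<bar>" for a b :: real by linarith
    have "\<bar>scaled_Z x v s - scaled_Z x v r\<bar> = x powr q * \<bar>Z01 v (s / x) - Z01 v (r / x)\<bar>"
      using x by (simp add: scaled_Z_def scale_path_eq[OF elim(3)] abs_mult right_diff_distrib[symmetric])
    also have "\<dots> \<le> x powr q * (D v * \<bar>max 0 (min 1 (s / x)) - max 0 (min 1 (r / x))\<bar> powr \<gamma>)"
      unfolding Z01_def by (intro mult_left_mono elim(1)[rule_format]) auto
    also have "\<dots> \<le> x powr q * (D v * \<bar>s / x - r / x\<bar> powr \<gamma>)"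
      using elim(2) gamma cl by (intro mult_left_mono powr_mono2) auto
    also have "\<bar>s / x - r / x\<bar> powr \<gamma> = \<bar>s - r\<bar> powr \<gamma> * x powr (- \<gamma>)"
      using x by (simp add: diff_divide_distrib[symmetric] abs_divide powr_divide powr_minus field_simps)
    also have "x powr q * (D v * (\<bar>s - r\<bar> powr \<gamma> * x powr (- \<gamma>))) = x powr (q - \<gamma>) * D v * \<bar>s - r\<bar> powr \<gamma>"
      using x by (simp add: powr_diff powr_minus field_simps)
    finally show "\<bar>scaled_Z x v s - scaled_Z x v r\<bar> \<le> x powr (q - \<gamma>) * D v * \<bar>s - r\<bar> powr \<gamma>" .
  qed
qed

lemma scaled_Z_le: "AE v in N. \<forall>x>0. \<forall>u. scaled_Z x v u \<le> x powr q * D v"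
  using Z_holder D_nonneg AE_space
proof eventually_elim
  case (elim v)
  show ?case
  proof (intro allI impI)
    fix x u :: real assume x: "0 < x"
    have "Z01 v (u / x) \<le> D v * \<bar>max 0 (min 1 (u / x)) - 0\<bar> powr \<gamma>"
      using elim(1)[rule_format, of 0 "max 0 (min 1 (u / x))"] Z_ends[OF elim(3)] by (simp add: Z01_def)
    also have "\<dots> \<le> D v * 1" using elim(2) gamma by (intro mult_left_mono powr_le1) auto
    finally show "scaled_Z x v u \<le> x powr q * D v"
      using x by (simp add: scaled_Z_def scale_path_eq[OF elim(3)] mult_left_mono)
  qed
qed

lemma D_tail_bound:
  assumes p: "0 < p" and b: "0 < b" and x: "0 < x"
  shows "measure N {v \<in> space N. b < x powr \<beta> * D v} \<le> (LINT v|N. D v powr p) * (x powr (\<beta> * p) * b powr (- p))"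
proof -
  have "measure N {v \<in> space N. b < x powr \<beta> * D v} = (LINT v|N. indicator {v \<in> space N. b < x powr \<beta> * D v} v)"
    by simp
  also have "\<dots> \<le> (LINT v|N. D v powr p * (x powr (\<beta> * p) * b powr (- p)))"
  proof (rule integral_mono_AE)
    show "AE v in N. indicator {v \<in> space N. b < x powr \<beta> * D v} v \<le> D v powr p * (x powr (\<beta> * p) * b powr (- p))"
      using D_nonneg
    proof eventually_elim
      case (elim v)
      show ?case
      proof (cases "b < x powr \<beta> * D v")
        case True
        then have "1 \<le> (x powr \<beta> * D v / b) powr p" using b p by (intro ge_one_powr_ge_zero) (auto simp: field_simps)
        also have "\<dots> = D v powr p * (x powr (\<beta> * p) * b powr (- p))"
          using b elim by (simp add: powr_divide powr_mult powr_powr powr_minus field_simps)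
        finally show ?thesis by (auto simp: indicator_def)
      qed (auto simp: indicator_def)
    qed
  qed (auto intro!: integrable_mult_left D_moments p mark.integrable_const_bound[of _ 1])
  finally show ?thesis by simp
qed

text \<open>\<open>intensity G u\<close> is the rate at which marks at height \<open>u\<close> above the left limit are counted.\<close>

definition intensity :: "(real \<Rightarrow> real) \<Rightarrow> real \<Rightarrow> real" where
  "intensity G u = (LINT x|levy_measure \<alpha>. mark_mean G u x)"

text \<open>A continuous substitute for the indicator of a height above \<open>b\<close>.\<close>

definition threshold_fun :: "(real \<Rightarrow> real) \<Rightarrow> real \<Rightarrow> bool" where
  "threshold_fun G b \<longleftrightarrow> continuous_on UNIV G \<and> (\<forall>r. 0 \<le> G r \<and> G r \<le> 1) \<and> 0 < b \<and> (\<forall>r\<le>b. G r = 0)"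

lemma threshold_funD:
  assumes "threshold_fun G b"
  shows "continuous_on UNIV G" "0 \<le> G r" "G r \<le> 1" "0 < b" "r \<le> b \<Longrightarrow> G r = 0" "G \<in> borel_measurable borel"
  using assms by (auto simp: threshold_fun_def intro: borel_measurable_continuous_onI)

lemma mark_mean_measurable:
  assumes G[measurable]: "G \<in> borel_measurable borel"
  shows "(\<lambda>(u, x). mark_mean G u x) \<in> borel_measurable (borel \<Otimes>\<^sub>M borel)"
proof -
  have "(\<lambda>p. (\<lambda>(x, v). (\<lambda>(s, w). Z01 w s) (fst (fst p) / x, v)) (snd (fst p), snd p)) \<in> borel_measurable ((borel \<Otimes>\<^sub>M borel) \<Otimes>\<^sub>M N)"
    by measurable
  then have [measurable]: "(\<lambda>p. Z01 (snd p) (fst (fst p) / snd (fst p))) \<in> borel_measurable ((borel \<Otimes>\<^sub>M borel) \<Otimes>\<^sub>M N)"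
    by simp
  have "(\<lambda>p. if 0 < snd (fst p) then snd (fst p) powr q * Z01 (snd p) (fst (fst p) / snd (fst p)) else 0) \<in> borel_measurable ((borel \<Otimes>\<^sub>M borel) \<Otimes>\<^sub>M N)"
    by measurable
  then have "(\<lambda>p. scaled_Z (snd (fst p)) (snd p) (fst (fst p))) \<in> borel_measurable ((borel \<Otimes>\<^sub>M borel) \<Otimes>\<^sub>M N)"
    by (rule measurable_cong[THEN iffD1, rotated]) (auto simp: space_pair_measure scaled_Z_def scale_path_eq)
  from measurable_compose[OF this G]
  have "(\<lambda>(p, v). G (scaled_Z (snd p) v (fst p))) \<in> borel_measurable ((borel \<Otimes>\<^sub>M borel) \<Otimes>\<^sub>M N)"
    by (simp add: case_prod_beta')
  from mark.borel_measurable_lebesgue_integral[OF this] show ?thesis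
    by (simp add: mark_mean_def case_prod_beta')
qed

text \<open>A mark on a jump of size \<open>x\<close> is at most \<open>x\<^sup>q D\<close>, so Markov's inequality with the moment of order
  \<open>(2 + \<alpha>) / q\<close> bounds the probability of exceeding \<open>b\<close> by a multiple of \<open>x\<^bsup>2+\<alpha>\<^esup>\<close>. The Levy measure
  integrates this power near \<open>0\<close>, and constants near infinity.\<close>

lemma mark_mean_bound:
  assumes G: "threshold_fun G b"
  obtains C where "0 \<le> C" "\<And>u x. 0 < x \<Longrightarrow> mark_mean G u x \<le> C * min (x powr (2 + \<alpha>)) (x powr 0)"
proof -
  note Gs = threshold_funD[OF G]
  define p where "p = (2 + \<alpha>) / q"
  have p: "0 < p" "q * p = 2 + \<alpha>" using q_pos alpha by (auto simp: p_def)
  define C where "C = (LINT v|N. D v powr p) * b powr (- p)"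
  have C0: "0 \<le> C" by (simp add: C_def)
  have "mark_mean G u x \<le> (1 + C) * min (x powr (2 + \<alpha>)) (x powr 0)" if x: "0 < x" for u x
  proof -
    have sm[measurable]: "(\<lambda>v. scaled_Z x v u) \<in> borel_measurable N"
      using measurable_compose[OF scaled_Z_measurable1 measurable_component_singleton[of u UNIV]] by simp
    note [measurable] = Gs(6)
    have "mark_mean G u x \<le> (LINT v|N. indicator {v \<in> space N. b < x powr q * D v} v)"
      unfolding mark_mean_def
    proof (rule integral_mono_AE)
      show "AE v in N. G (scaled_Z x v u) \<le> indicator {v \<in> space N. b < x powr q * D v} v"
        using scaled_Z_le AE_space
      proof eventually_elim
        case (elim v)
        show ?case
        proof (cases "b < x powr q * D v")
          case False
          then have "scaled_Z x v u \<le> b" using elim(1)[rule_format, OF x, of u] by linarith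
          then show ?thesis using Gs(5) by simp
        qed (use Gs(3) elim in \<open>auto simp: indicator_def\<close>)
      qed
    qed (auto intro!: mark.integrable_const_bound[of _ 1] simp: Gs)
    also have "\<dots> = measure N {v \<in> space N. b < x powr q * D v}" by simp
    also have "\<dots> \<le> (LINT v|N. D v powr p) * (x powr (q * p) * b powr (- p))" by (rule D_tail_bound[OF p(1) Gs(4) x])
    also have "\<dots> = C * x powr (2 + \<alpha>)" by (simp add: C_def p(2))
    finally have 1: "mark_mean G u x \<le> C * x powr (2 + \<alpha>)" .
    have 2: "mark_mean G u x \<le> 1" by (rule mark_mean_bounds) (use Gs in auto)
    show ?thesis
    proof (cases "x powr (2 + \<alpha>) \<le> 1")
      case True
      then show ?thesis using 1 x by (simp add: min_def distrib_right add_increasing)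
    next
      case False
      then show ?thesis using 2 C0 x by (simp add: min_def)
    qed
  qed
  with C0 show thesis by (intro that[of "1 + C"]) auto
qed

lemma intensity_facts:
  assumes G: "threshold_fun G b"
  shows "integrable (levy_measure \<alpha>) (mark_mean G u)"
    and "0 \<le> intensity_upto G k u" "intensity_upto G k u \<le> intensity G u"
    and "(\<lambda>k. intensity_upto G k u) \<longlonglongrightarrow> intensity G u"
    and "intensity G \<in> borel_measurable borel" "intensity_upto G k \<in> borel_measurable borel"
    and "\<exists>C. \<forall>u. intensity G u \<le> C"
proof -
  note Gs = threshold_funD[OF G]
  obtain C where C: "0 \<le> C" "\<And>u x. 0 < x \<Longrightarrow> mark_mean G u x \<le> C * min (x powr (2 + \<alpha>)) (x powr 0)"
    by (rule mark_mean_bound[OF G]) blast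
  have m01: "0 \<le> mark_mean G u x" "mark_mean G u x \<le> 1" for u x by (rule mark_mean_bounds; use Gs in auto)+
  have mm: "mark_mean G u \<in> borel_measurable borel" for u
    using measurable_compose[OF measurable_Pair1'[of u borel borel] mark_mean_measurable[OF Gs(6)]] by simp
  have ib: "integrable (levy_measure \<alpha>) (\<lambda>x. C * min (x powr (2 + \<alpha>)) (x powr 0))"
    using alpha by (intro integrable_mult_right levy_measure_min_powr_integrable) auto
  have aeC: "AE x in levy_measure \<alpha>. mark_mean G u x \<le> C * min (x powr (2 + \<alpha>)) (x powr 0)" for u
    using AE_levy_measure_pos by eventually_elim (rule C)
  show i: "integrable (levy_measure \<alpha>) (mark_mean G u)" for u
    by (rule Bochner_Integration.integrable_bound[OF ib]) (use mm m01 aeC C(1) in auto)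
  have ik: "integrable (levy_measure \<alpha>) (\<lambda>x. cutoff k x * mark_mean G u x)" for k u
    by (rule Bochner_Integration.integrable_bound[OF i[of u]])
       (use mm m01 cutoff_bounds in \<open>auto intro!: mult_left_le_one_le simp: abs_mult\<close>)
  show "0 \<le> intensity_upto G k u" for k u
    unfolding intensity_upto_def by (intro Bochner_Integration.integral_nonneg mult_nonneg_nonneg cutoff_bounds m01)
  show "intensity_upto G k u \<le> intensity G u" for k u
    unfolding intensity_upto_def intensity_def
    by (intro integral_mono ik i mult_left_le_one_le cutoff_bounds m01)
  show "(\<lambda>k. intensity_upto G k u) \<longlonglongrightarrow> intensity G u" for u
    unfolding intensity_upto_def intensity_def
  proof (rule integral_dominated_convergence[where w="mark_mean G u"])
    show "AE x in levy_measure \<alpha>. (\<lambda>k. cutoff k x * mark_mean G u x) \<longlonglongrightarrow> mark_mean G u x"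
      using AE_levy_measure_pos
    proof eventually_elim
      case (elim x)
      from tendsto_mult[OF cutoff_tendsto[OF elim] tendsto_const] show ?case by simp
    qed
    show "AE x in levy_measure \<alpha>. norm (cutoff k x * mark_mean G u x) \<le> mark_mean G u x" for k
      using m01 cutoff_bounds by (intro AE_I2) (auto intro!: mult_left_le_one_le simp: abs_mult)
  qed (use i mm in auto)
  have sf: "sigma_finite_measure (levy_measure \<alpha>)"
    unfolding levy_measure_def by (subst sigma_finite_measure.sigma_finite_iff_density_finite[OF sigma_finite_lborel]) auto
  interpret L: sigma_finite_measure "levy_measure \<alpha>" by (rule sf)
  show "intensity G \<in> borel_measurable borel"
    unfolding intensity_def
    by (rule L.borel_measurable_lebesgue_integral) (use mark_mean_measurable[OF Gs(6)] in \<open>simp add: measurable_cong_sets[OF sets_pair_measure_cong[OF refl sets_levy_measure] refl]\<close>)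
  show "intensity_upto G k \<in> borel_measurable borel" for k
    unfolding intensity_upto_def
  proof (rule L.borel_measurable_lebesgue_integral)
    note [measurable] = mark_mean_measurable[OF Gs(6)]
    have "(\<lambda>p. cutoff k (snd p) * (case p of (u, x) \<Rightarrow> mark_mean G u x)) \<in> borel_measurable (borel \<Otimes>\<^sub>M borel)" by measurable
    then show "(\<lambda>(u, x). cutoff k x * mark_mean G u x) \<in> borel_measurable (borel \<Otimes>\<^sub>M levy_measure \<alpha>)"
      by (simp add: case_prod_beta' measurable_cong_sets[OF sets_pair_measure_cong[OF refl sets_levy_measure] refl])
  qed
  have "intensity G u \<le> (LINT x|levy_measure \<alpha>. C * min (x powr (2 + \<alpha>)) (x powr 0))" for u
    unfolding intensity_def by (rule integral_mono_AE[OF i ib aeC])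
  then show "\<exists>C. \<forall>u. intensity G u \<le> C" by blast
qed

lemma time_integral_intensity_tendsto:
  assumes G: "threshold_fun G b" and \<omega>: "\<omega> \<in> space M" and t: "0 \<le> t"
  shows "(\<lambda>k. LINT s:{0..t}|lborel. intensity_upto G k (y - X s \<omega>)) \<longlonglongrightarrow> (LINT s:{0..t}|lborel. intensity G (y - X s \<omega>))"
    "(LINT s:{0..t}|lborel. intensity_upto G k (y - X s \<omega>)) \<le> (LINT s:{0..t}|lborel. intensity G (y - X s \<omega>))"
proof -
  note I = intensity_facts[OF G]
  obtain C where C: "\<And>u. intensity G u \<le> C" using I(7) by blast
  have C0: "0 \<le> C" using order.trans[OF I(2) order.trans[OF I(3) C]] .
  have Im: "(\<lambda>s. indicator {0..t} s *\<^sub>R f (y - X s \<omega>)) \<in> borel_measurable lborel" if f: "f \<in> borel_measurable borel" for f :: "real \<Rightarrow> real"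
  proof -
    note [measurable] = f cadlag_measurable[OF X_cadlag[OF \<omega>]]
    have "(\<lambda>s. indicator {0..t} s *\<^sub>R f (y - X (max 0 s) \<omega>)) \<in> borel_measurable lborel" by measurable
    also have "(\<lambda>s. indicator {0..t} s *\<^sub>R f (y - X (max 0 s) \<omega>)) = (\<lambda>s. indicator {0..t} s *\<^sub>R f (y - X s \<omega>))"
      by (auto simp: indicator_def)
    finally show ?thesis .
  qed
  have "integrable lborel (indicator {0..t} :: real \<Rightarrow> real)" using t by (intro integrable_real_indicator) auto
  then have iC: "integrable lborel (\<lambda>s. indicator {0..t} s * C)" by (rule integrable_mult_left)
  have bd: "0 \<le> intensity G u" for u using order.trans[OF I(2) I(3)] .
  show "(\<lambda>k. LINT s:{0..t}|lborel. intensity_upto G k (y - X s \<omega>)) \<longlonglongrightarrow> (LINT s:{0..t}|lborel. intensity G (y - X s \<omega>))"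
    unfolding set_lebesgue_integral_def
    by (rule integral_dominated_convergence[where w="\<lambda>s. indicator {0..t} s * C"])
       (use I C iC Im order.trans[OF I(3) C] in \<open>auto intro!: AE_I2 tendsto_intros simp: indicator_def\<close>)
  show "(LINT s:{0..t}|lborel. intensity_upto G k (y - X s \<omega>)) \<le> (LINT s:{0..t}|lborel. intensity G (y - X s \<omega>))"
    unfolding set_lebesgue_integral_def
  proof (rule integral_mono)
    show "integrable lborel (\<lambda>s. indicator {0..t} s *\<^sub>R intensity_upto G k (y - X s \<omega>))"
      by (rule Bochner_Integration.integrable_bound[OF iC Im[OF I(6)]])
         (use I(2) order.trans[OF I(3) C] C0 in \<open>auto simp: indicator_def\<close>)
    show "integrable lborel (\<lambda>s. indicator {0..t} s *\<^sub>R intensity G (y - X s \<omega>))"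
      by (rule Bochner_Integration.integrable_bound[OF iC Im[OF I(5)]])
         (use bd C C0 in \<open>auto simp: indicator_def\<close>)
  qed (auto simp: indicator_def I)
qed

end

text \<open>The form in which Fatou's lemma is used to remove the cutoff.\<close>

lemma frequently_less_if_liminf_less:
  fixes f :: "nat \<Rightarrow> ennreal"
  assumes "liminf f < c"
  shows "\<exists>\<^sub>F k in sequentially. f k < c"
proof (rule ccontr)
  assume "\<not> ?thesis"
  then have "\<forall>\<^sub>F k in sequentially. c \<le> f k" by (simp add: not_frequently not_less)
  then have "c \<le> liminf f" by (rule Liminf_bounded)
  with assms show False by simp
qed

context holder_marked_process
begin

lemma mark_zero: "\<omega> \<in> space M \<Longrightarrow> 0 \<le> s \<Longrightarrow> u \<notin> {0<..<dX \<omega> s} \<Longrightarrow> \<zeta> s \<omega> u = 0"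
  using marked unfolding marked_process_def by blast

lemma marks_continuous: "AE \<omega> in M. \<forall>t\<ge>0. continuous_on UNIV (\<zeta> t \<omega>)"
  using marked by (simp add: marked_process_def)

text \<open>Countably many conditions make this set measurable for the product sigma-algebra; a continuous path
  in it satisfies the condition at all times.\<close>

definition holder_paths :: "real \<Rightarrow> (real \<Rightarrow> real) set" where
  "holder_paths K = {z. \<forall>u\<in>\<rat>. \<forall>v\<in>\<rat>. \<bar>z u - z v\<bar> \<le> K * \<bar>u - v\<bar> powr \<gamma>}"

lemma holder_paths_measurable: "holder_paths K \<in> sets (path_space UNIV)"
proof -
  have "{z \<in> space (path_space UNIV). \<exists>u\<in>\<rat>. \<exists>v\<in>\<rat>. \<not> \<bar>z u - z v\<bar> \<le> K * \<bar>u - v\<bar> powr \<gamma>} \<in> sets (path_space UNIV)"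
  proof -
    have "Measurable.pred (path_space UNIV) (\<lambda>z. \<exists>u\<in>\<rat>. \<exists>v\<in>\<rat>. \<not> \<bar>z u - z v\<bar> \<le> K * \<bar>u - v\<bar> powr \<gamma>)"
    proof (intro pred_Bex_countable countable_rat)
      fix u v :: real
      have [measurable]: "(\<lambda>z. z r) \<in> borel_measurable (path_space UNIV)" for r :: real
        by (rule measurable_component_singleton) simp
      show "Measurable.pred (path_space UNIV) (\<lambda>z. \<not> \<bar>z u - z v\<bar> \<le> K * \<bar>u - v\<bar> powr \<gamma>)" by measurable
    qed
    then show ?thesis by (simp add: pred_def)
  qed
  then have "space (path_space UNIV) - {z \<in> space (path_space UNIV). \<exists>u\<in>\<rat>. \<exists>v\<in>\<rat>. \<not> \<bar>z u - z v\<bar> \<le> K * \<bar>u - v\<bar> powr \<gamma>} \<in> sets (path_space UNIV)"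
    by (rule sets.compl_sets)
  also have "space (path_space UNIV) - {z \<in> space (path_space UNIV). \<exists>u\<in>\<rat>. \<exists>v\<in>\<rat>. \<not> \<bar>z u - z v\<bar> \<le> K * \<bar>u - v\<bar> powr \<gamma>} = holder_paths K"
    by (auto simp: holder_paths_def space_PiM)
  finally show ?thesis .
qed

lemma holder_paths_imp_holder:
  assumes z: "z \<in> holder_paths K" "continuous_on UNIV z"
  shows "\<bar>z u - z v\<bar> \<le> K * \<bar>u - v\<bar> powr \<gamma>"
proof -
  define r where "r x n = real_of_int \<lfloor>x * real (Suc n)\<rfloor> / real (Suc n)" for x n
  have r: "r x \<longlonglongrightarrow> x" for x unfolding r_def[abs_def] by (rule real_floor_approx)
  have zr: "(\<lambda>n. z (r x n)) \<longlonglongrightarrow> z x" for x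
    using z(2) r[of x] by (auto simp: continuous_on_sequentially o_def)
  have 1: "(\<lambda>n. \<bar>z (r u n) - z (r v n)\<bar>) \<longlonglongrightarrow> \<bar>z u - z v\<bar>" by (intro tendsto_intros zr)
  have 2: "(\<lambda>n. K * \<bar>r u n - r v n\<bar> powr \<gamma>) \<longlonglongrightarrow> K * \<bar>u - v\<bar> powr \<gamma>"
    using gamma by (intro tendsto_mult tendsto_const tendsto_powr2 tendsto_rabs tendsto_diff r) auto
  have rq: "r x n \<in> \<rat>" for x n unfolding r_def by (intro Rats_divide) auto
  show ?thesis
    by (rule LIMSEQ_le[OF 1 2]) (use z(1) rq in \<open>auto simp: holder_paths_def\<close>)
qed

text \<open>Some jump carries a mark outside \<open>holder_paths (2 ^ n)\<close> with a probability of order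
  \<open>2\<^bsup>-np\<^esup>\<close>, for some positive \<open>p\<close>. This follows from the exponential inequality for the number of such marks, with
  \<open>a = 2\<^bsup>np\<^esup>\<close>: one such mark makes the product at least \<open>1 + a\<close>, while the compensator stays bounded.\<close>

theorem marks_eventually_holder:
  assumes t: "0 < t"
  shows "AE \<omega> in M. \<forall>\<^sub>F n in sequentially. \<forall>s\<in>{0<..t}. \<forall>u v. \<bar>\<zeta> s \<omega> u - \<zeta> s \<omega> v\<bar> \<le> 2 ^ n * \<bar>u - v\<bar> powr \<gamma>"
proof -
  define c where "c = q - \<gamma>"
  have c: "c > 0" using gamma by (simp add: c_def)
  \<comment> \<open>Moments of two orders, such that the Levy measure integrates \<open>x\<^bsup>c p1\<^esup>\<close> near \<open>0\<close> and \<open>x\<^bsup>c p2\<^esup>\<close> near infinity.\<close>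
  define p1 p2 where "p1 = (2 + \<alpha>) / c" and "p2 = (1/2) / c"
  have p12: "p1 > 0" "p2 > 0" "c * p1 = 2 + \<alpha>" "c * p2 = 1/2" using c alpha by (auto simp: p1_def p2_def)
  define p where "p = min p1 p2"
  have p: "p > 0" "p \<le> p1" "p \<le> p2" using p12 by (auto simp: p_def)
  define C where "C = max (LINT v|N. D v powr p1) (LINT v|N. D v powr p2)"
  have C0: "0 \<le> C" by (auto simp: C_def le_max_iff_disj intro!: Bochner_Integration.integral_nonneg)
  define B where "B n = holder_paths (2 ^ n)" for n
  have Bm[measurable]: "B n \<in> sets (path_space UNIV)" for n unfolding B_def by (rule holder_paths_measurable)
  define a where "a n = 2 powr (real n * p)" for n
  have a: "1 \<le> a n" for n unfolding a_def using p by (intro ge_one_powr_ge_zero) auto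
  have aK: "((2::real) ^ n) powr (- p) = 1 / a n" for n
    by (simp add: a_def powr_minus_divide powr_realpow[symmetric] powr_powr)
  have bad: "measure N {v \<in> space N. scaled_Z x v \<notin> B n} \<le> C / a n * min (x powr (2 + \<alpha>)) (x powr (1/2))" if x: "0 < x" for x n
  proof -
    have "measure N {v \<in> space N. scaled_Z x v \<notin> B n} \<le> measure N {v \<in> space N. 2 ^ n < x powr c * D v}"
    proof (rule mark.finite_measure_mono_AE)
      show "AE v in N. v \<in> {v \<in> space N. scaled_Z x v \<notin> B n} \<longrightarrow> v \<in> {v \<in> space N. 2 ^ n < x powr c * D v}"
        using scaled_Z_holder
      proof eventually_elim
        case v: (elim v)
        have False if v': "v \<in> {v \<in> space N. scaled_Z x v \<notin> B n}" "v \<notin> {v \<in> space N. 2 ^ n < x powr c * D v}"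
        proof -
        have "\<bar>scaled_Z x v s - scaled_Z x v r\<bar> \<le> 2 ^ n * \<bar>s - r\<bar> powr \<gamma>" for r s
        proof -
          have "\<bar>scaled_Z x v s - scaled_Z x v r\<bar> \<le> x powr c * D v * \<bar>s - r\<bar> powr \<gamma>"
            using v x by (simp add: c_def)
          also have "\<dots> \<le> 2 ^ n * \<bar>s - r\<bar> powr \<gamma>" using v' by (intro mult_right_mono) auto
          finally show ?thesis .
        qed
        then show False using v'(1) by (auto simp: B_def holder_paths_def)
        qed
        then show ?case by blast
      qed
    qed auto
    moreover have "measure N {v \<in> space N. 2 ^ n < x powr c * D v} \<le> C / a n * x powr (c * p')" if p': "p' \<in> {p1, p2}" for p'
    proof -
      have "0 < p'" "p \<le> p'" using p' p12 p by auto
      then have "measure N {v \<in> space N. 2 ^ n < x powr c * D v} \<le> (LINT v|N. D v powr p') * (x powr (c * p') * (2 ^ n) powr (- p'))"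
        by (intro D_tail_bound x) auto
      also have "\<dots> \<le> C * (x powr (c * p') * (2 ^ n) powr (- p))"
      proof (intro mult_mono)
        show "(LINT v|N. D v powr p') \<le> C" using p' by (auto simp: C_def)
        show "((2::real) ^ n) powr (- p') \<le> (2 ^ n) powr (- p)" using \<open>p \<le> p'\<close> by (intro powr_mono) auto
      qed (use C0 in auto)
      finally show ?thesis by (simp add: aK)
    qed
    from this[of p1] this[of p2] have "measure N {v \<in> space N. 2 ^ n < x powr c * D v} \<le> C / a n * min (x powr (2 + \<alpha>)) (x powr (1/2))"
      using p12 by (auto simp: min_def)
    ultimately show ?thesis by linarith
  qed
  define \<psi> where "\<psi> n x = min 1 (C / a n * min ((max 0 x) powr (2 + \<alpha>)) ((max 0 x) powr (1/2)))" for n x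
  have psi01: "0 \<le> \<psi> n x" "\<psi> n x \<le> 1" for n x
    unfolding \<psi>_def using C0 a[of n] by (auto intro!: mult_nonneg_nonneg divide_nonneg_nonneg)
  have psic: "continuous_on UNIV (\<psi> n)" for n
    unfolding \<psi>_def using alpha by (intro continuous_intros continuous_on_powr') auto
  define J where "J = (LINT x|levy_measure \<alpha>. min (x powr (2 + \<alpha>)) (x powr (1/2)))"
  have Ji: "integrable (levy_measure \<alpha>) (\<lambda>x. min (x powr (2 + \<alpha>)) (x powr (1/2)))"
    using alpha by (intro levy_measure_min_powr_integrable) auto
  have J0: "0 \<le> J" unfolding J_def by (intro Bochner_Integration.integral_nonneg) auto
  have Ile: "(LINT x|levy_measure \<alpha>. cutoff k x * \<psi> n x) \<le> C / a n * J" for n k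
  proof -
    have "(LINT x|levy_measure \<alpha>. cutoff k x * \<psi> n x) \<le> (LINT x|levy_measure \<alpha>. C / a n * min (x powr (2 + \<alpha>)) (x powr (1/2)))"
    proof (rule integral_mono_AE')
      show "integrable (levy_measure \<alpha>) (\<lambda>x. C / a n * min (x powr (2 + \<alpha>)) (x powr (1/2)))"
        by (intro integrable_mult_right Ji)
      show "AE x in levy_measure \<alpha>. cutoff k x * \<psi> n x \<le> C / a n * min (x powr (2 + \<alpha>)) (x powr (1/2))"
        using AE_levy_measure_pos
      proof eventually_elim
        case (elim x)
        have "cutoff k x * \<psi> n x \<le> 1 * \<psi> n x" by (intro mult_right_mono cutoff_bounds psi01)
        also have "\<dots> \<le> C / a n * min (x powr (2 + \<alpha>)) (x powr (1/2))" using elim by (simp add: \<psi>_def max_def)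
        finally show ?case .
      qed
      show "AE x in levy_measure \<alpha>. 0 \<le> C / a n * min (x powr (2 + \<alpha>)) (x powr (1/2))"
        using a[of n] C0 by (intro AE_I2 mult_nonneg_nonneg divide_nonneg_nonneg) auto
    qed
    then show ?thesis by (simp add: J_def)
  qed
  define Q where "Q n k R \<longleftrightarrow> R \<in> borel_measurable M \<and> (AE \<omega> in M. R \<omega> = ennreal ((\<Prod>s\<in>JX (1 / (2 * real (Suc k))) t \<omega>. 1 + a n * (cutoff k (dX \<omega> s) * indicator (- B n) (\<zeta> s \<omega>))) *
       exp (- a n * (LINT s:{0..t}|lborel. LINT x|levy_measure \<alpha>. cutoff k x * \<psi> n x)))) \<and>
     (\<integral>\<^sup>+\<omega>. R \<omega> \<partial>M) \<le> 1" for n k R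
  have "\<exists>R. Q n k R" for n k
    unfolding Q_def Bex_def[symmetric]
  proof (rule marked_exponential_inequality[where g="\<lambda>j w x z. cutoff k x * indicator (- B n) z" and \<phi>="\<lambda>w x. cutoff k x * \<psi> n x" and K="2 * real (Suc k)", OF t])
    show "- 1 \<le> a n" using a[of n] by simp
    have [measurable]: "- B n \<in> sets (path_space UNIV)"
      using sets.compl_sets[OF Bm[of n]] by (simp add: space_PiM Compl_eq_Diff_UNIV)
    show "(\<lambda>(w, x, z). cutoff k x * indicator (- B n) z) \<in> borel_measurable ((borel::real measure) \<Otimes>\<^sub>M borel \<Otimes>\<^sub>M path_space UNIV)" for j :: nat
      by measurable
    show "continuous_on UNIV (\<lambda>(w::real, x). cutoff k x * \<psi> n x)"
      unfolding case_prod_beta' by (intro continuous_intros continuous_on_compose2[OF psic]) auto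
    have "1 / (2 * real (Suc k)) \<le> 1" by simp
    moreover have "1 < 2 * real (Suc k)" by simp
    ultimately show "1 / (2 * real (Suc k)) < 2 * real (Suc k)" by linarith
    show "a n * (LINT v|N. cutoff k x * indicator (- B n) (scaled_Z x v)) \<le> a n * (cutoff k x * \<psi> n x)"
      if x: "1 / (2 * real (Suc k)) < x" for x w :: real
    proof -
      have "0 < 1 / (2 * real (Suc k))" by simp
      with x have x0: "0 < x" by linarith
      have "(LINT v|N. indicator (- B n) (scaled_Z x v) :: real) = (LINT v|N. indicator {v \<in> space N. scaled_Z x v \<notin> B n} v)"
        by (intro Bochner_Integration.integral_cong) (auto simp: indicator_def)
      also have "\<dots> = measure N {v \<in> space N. scaled_Z x v \<notin> B n}" by simp
      also have "\<dots> \<le> \<psi> n x" unfolding \<psi>_def using bad[OF x0, of n] x0 by (simp add: max_def mark.prob_le_1)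
      finally show ?thesis using a[of n] cutoff_bounds[of k x] by (intro mult_left_mono) (auto intro: mult_left_mono)
    qed
  qed (use psi01 cutoff_bounds cutoff_eq_0[of _ k] in \<open>auto intro!: mult_le_one simp: indicator_def\<close>)
  then obtain R where "\<And>n k. Q n k (R n k)" by metis
  then have R: "\<And>n k. R n k \<in> borel_measurable M" "\<And>n k. (\<integral>\<^sup>+\<omega>. R n k \<omega> \<partial>M) \<le> 1"
    "\<And>n k. AE \<omega> in M. R n k \<omega> = ennreal ((\<Prod>s\<in>JX (1 / (2 * real (Suc k))) t \<omega>. 1 + a n * (cutoff k (dX \<omega> s) * indicator (- B n) (\<zeta> s \<omega>))) *
       exp (- a n * (LINT s:{0..t}|lborel. LINT x|levy_measure \<alpha>. cutoff k x * \<psi> n x)))"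
    unfolding Q_def by blast+
  define c1 where "c1 = t * C * J"
  define xx where "xx n = real n * p * ln 2 - c1" for n
  have xx: "exp (xx n) = a n * exp (- c1)" for n by (simp add: xx_def a_def powr_def exp_diff exp_minus field_simps)
  define W where "W n (i::unit) \<omega> = liminf (\<lambda>k. R n k \<omega>)" for n i \<omega>
  have Wm: "W n i \<in> borel_measurable M" for n i unfolding W_def using R(1) by measurable
  have W1: "(\<integral>\<^sup>+\<omega>. W n i \<omega> \<partial>M) \<le> 1" for n i
  proof -
    have "(\<integral>\<^sup>+\<omega>. W n i \<omega> \<partial>M) \<le> liminf (\<lambda>k. \<integral>\<^sup>+\<omega>. R n k \<omega> \<partial>M)"
      unfolding W_def using R(1) by (rule nn_integral_liminf)
    also have "\<dots> \<le> liminf (\<lambda>k::nat. 1)" by (intro Liminf_mono always_eventually allI R(2))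
    also have "\<dots> = 1" by (simp add: Liminf_const)
    finally show ?thesis .
  qed
  have "summable (\<lambda>n. exp c1 * (2 powr (- p)) ^ n)"
    using p(1) by (intro summable_mult summable_geometric) (simp add: powr_less_one)
  moreover have "exp c1 * (2 powr (- p)) ^ n = real (card {()}) * exp (- xx n)" for n
    by (simp add: exp_minus xx a_def powr_realpow[symmetric] powr_powr powr_minus field_simps)
  ultimately have "summable (\<lambda>n. real (card {()}) * exp (- xx n))" by simp
  from exponential_borel_cantelli[OF Wm W1 _ this]
  have ae1: "AE \<omega> in M. \<forall>\<^sub>F n in sequentially. W n () \<omega> < ennreal (exp (xx n))" by simp
  have ae2: "AE \<omega> in M. \<forall>n k. R n k \<omega> = ennreal ((\<Prod>s\<in>JX (1 / (2 * real (Suc k))) t \<omega>. 1 + a n * (cutoff k (dX \<omega> s) * indicator (- B n) (\<zeta> s \<omega>))) *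
       exp (- a n * (LINT s:{0..t}|lborel. LINT x|levy_measure \<alpha>. cutoff k x * \<psi> n x)))"
    unfolding AE_all_countable using R(3) by blast
  show ?thesis using ae1 ae2 marks_continuous AE_space
  proof eventually_elim
    case (elim \<omega>)
    from elim(1) show ?case
    proof eventually_elim
      fix n assume Wn: "W n () \<omega> < ennreal (exp (xx n))"
      have "\<zeta> s \<omega> \<in> B n" if s: "s \<in> {0<..t}" for s
      proof (rule ccontr)
        assume nB: "\<zeta> s \<omega> \<notin> B n"
        have jp: "0 < dX \<omega> s"
        proof (rule ccontr)
          assume "\<not> 0 < dX \<omega> s"
          then have "\<zeta> s \<omega> = (\<lambda>_. 0)" using mark_zero[OF elim(4), of s] s by auto
          then show False using nB by (simp add: B_def holder_paths_def)
        qed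
        obtain k0 :: nat where k0: "max (dX \<omega> s) (1 / dX \<omega> s) \<le> real k0" using real_arch_simple by blast
        have "ennreal (exp (xx n)) \<le> R n k \<omega>" if k: "k0 \<le> k" for k
        proof -
          have kk: "dX \<omega> s \<le> real (Suc k)" "1 / dX \<omega> s \<le> real (Suc k)" using k0 k by auto
          have k2: "1 / real (Suc k) \<le> dX \<omega> s" using kk(2) jp by (simp add: field_simps)
          have cut: "cutoff k (dX \<omega> s) = 1" by (rule cutoff_eq_1[OF k2 kk(1)])
          have "1 / (2 * real (Suc k)) < 1 / real (Suc k)" by (simp add: field_simps)
          then have sJ: "s \<in> JX (1 / (2 * real (Suc k))) t \<omega>" using k2 s by (auto simp: big_jumps_def)
          have fin: "finite (JX (1 / (2 * real (Suc k))) t \<omega>)" by (rule finite_big_jumps[OF X_cadlag[OF elim(4)]]) simp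
          let ?f = "\<lambda>s. 1 + a n * (cutoff k (dX \<omega> s) * indicator (- B n) (\<zeta> s \<omega>))"
          have f1: "1 \<le> ?f s" for s using a[of n] cutoff_bounds[of k] by simp
          have Pr: "(\<Prod>s\<in>JX (1 / (2 * real (Suc k))) t \<omega>. ?f s) = ?f s * (\<Prod>s\<in>JX (1 / (2 * real (Suc k))) t \<omega> - {s}. ?f s)"
            by (rule prod.remove[OF fin sJ])
          have P1: "1 \<le> (\<Prod>s\<in>JX (1 / (2 * real (Suc k))) t \<omega> - {s}. ?f s)" by (rule prod_ge_1) (rule f1)
          have P2: "?f s = 1 + a n" using nB cut by simp
          have le: "a n \<le> c * r" if "c = 1 + a n" "1 \<le> r" for c r
          proof -
            have "c * 1 \<le> c * r" using that a[of n] by (intro mult_left_mono) auto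
            then show ?thesis using that(1) by linarith
          qed
          have P: "a n \<le> (\<Prod>s\<in>JX (1 / (2 * real (Suc k))) t \<omega>. ?f s)" unfolding Pr by (rule le[OF P2 P1])
          have "(LINT s:{0..t}|lborel. LINT x|levy_measure \<alpha>. cutoff k x * \<psi> n x) = t * (LINT x|levy_measure \<alpha>. cutoff k x * \<psi> n x)"
            using t by (simp add: set_lebesgue_integral_def)
          also have "\<dots> \<le> t * (C / a n * J)" using t Ile by (intro mult_left_mono) auto
          finally have "a n * (LINT s:{0..t}|lborel. LINT x|levy_measure \<alpha>. cutoff k x * \<psi> n x) \<le> a n * (t * (C / a n * J))"
            using a[of n] by (intro mult_left_mono) auto
          also have "\<dots> = c1" using a[of n] by (simp add: c1_def)
          finally have "exp (- c1) \<le> exp (- a n * (LINT s:{0..t}|lborel. LINT x|levy_measure \<alpha>. cutoff k x * \<psi> n x))" by simp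
          then have "a n * exp (- c1) \<le> (\<Prod>s\<in>JX (1 / (2 * real (Suc k))) t \<omega>. ?f s) * exp (- a n * (LINT s:{0..t}|lborel. LINT x|levy_measure \<alpha>. cutoff k x * \<psi> n x))"
            using P a[of n] by (intro mult_mono) auto
          then show ?thesis unfolding elim(2)[rule_format] xx by (rule ennreal_leI)
        qed
        then have "ennreal (exp (xx n)) \<le> W n () \<omega>"
          unfolding W_def by (intro Liminf_bounded) (auto simp: eventually_sequentially)
        with Wn show False by simp
      qed
      then show "\<forall>s\<in>{0<..t}. \<forall>u v. \<bar>\<zeta> s \<omega> u - \<zeta> s \<omega> v\<bar> \<le> 2 ^ n * \<bar>u - v\<bar> powr \<gamma>"
        using elim(3) unfolding B_def by (intro ballI allI holder_paths_imp_holder) auto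
    qed
  qed
qed

text \<open>The exponential inequality and Borel-Cantelli. The bound holds for infinitely many \<open>k\<close> rather than
  for all, since the cutoff is removed by Fatou's lemma.\<close>

theorem smooth_count_eventually:
  fixes Y :: "nat \<Rightarrow> real set"
  assumes t: "0 < t" and G: "\<And>n. threshold_fun (G n) (b n)"
    and Y: "\<And>n. finite (Y n)" and s: "summable (\<lambda>n. real (card (Y n)) * exp (- x n))"
  shows "AE \<omega> in M. \<forall>\<^sub>F n in sequentially. \<forall>y\<in>Y n. \<exists>\<^sub>F k in sequentially.
    \<theta> * smooth_count (G n) k y t \<omega> - (exp \<theta> - 1) * (LINT s:{0..t}|lborel. intensity_upto (G n) k (y - X s \<omega>)) < x n"
proof -
  define Q where "Q n k y R \<longleftrightarrow> R \<in> borel_measurable M \<and> (\<integral>\<^sup>+\<omega>. R \<omega> \<partial>M) \<le> 1 \<and>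
     (AE \<omega> in M. ennreal (exp (\<theta> * smooth_count (G n) k y t \<omega> -
         (exp \<theta> - 1) * (LINT s:{0..t}|lborel. intensity_upto (G n) k (y - X s \<omega>)))) \<le> R \<omega>)" for n k y R
  have "\<exists>R. Q n k y R" for n k y
    unfolding Q_def Bex_def[symmetric]
    by (rule smooth_count_exponential_inequality[OF t]) (use threshold_funD[OF G[of n]] in auto)
  then obtain R where "\<And>n k y. Q n k y (R n k y)" by metis
  then have R: "\<And>n k y. R n k y \<in> borel_measurable M" "\<And>n k y. (\<integral>\<^sup>+\<omega>. R n k y \<omega> \<partial>M) \<le> 1"
    "\<And>n k y. AE \<omega> in M. ennreal (exp (\<theta> * smooth_count (G n) k y t \<omega> -
         (exp \<theta> - 1) * (LINT s:{0..t}|lborel. intensity_upto (G n) k (y - X s \<omega>)))) \<le> R n k y \<omega>"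
    unfolding Q_def by blast+
  define W where "W n y \<omega> = liminf (\<lambda>k. R n k y \<omega>)" for n y \<omega>
  have Wm: "W n i \<in> borel_measurable M" for n i unfolding W_def using R(1) by measurable
  have W1: "(\<integral>\<^sup>+\<omega>. W n i \<omega> \<partial>M) \<le> 1" for n i
  proof -
    have "(\<integral>\<^sup>+\<omega>. W n i \<omega> \<partial>M) \<le> liminf (\<lambda>k. \<integral>\<^sup>+\<omega>. R n k i \<omega> \<partial>M)"
      unfolding W_def using R(1) by (rule nn_integral_liminf)
    also have "\<dots> \<le> liminf (\<lambda>k::nat. 1)" by (intro Liminf_mono always_eventually allI R(2))
    also have "\<dots> = 1" by (simp add: Liminf_const)
    finally show ?thesis .
  qed
  have ae2: "AE \<omega> in M. \<forall>n. \<forall>y\<in>Y n. \<forall>k. ennreal (exp (\<theta> * smooth_count (G n) k y t \<omega> -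
         (exp \<theta> - 1) * (LINT s:{0..t}|lborel. intensity_upto (G n) k (y - X s \<omega>)))) \<le> R n k y \<omega>"
    unfolding AE_all_countable
  proof
    fix n
    show "AE \<omega> in M. \<forall>y\<in>Y n. \<forall>k. ennreal (exp (\<theta> * smooth_count (G n) k y t \<omega> -
         (exp \<theta> - 1) * (LINT s:{0..t}|lborel. intensity_upto (G n) k (y - X s \<omega>)))) \<le> R n k y \<omega>"
      using Y[of n] by (intro AE_finite_allI) (auto simp: AE_all_countable R(3))
  qed
  show ?thesis using exponential_borel_cantelli[where W=W and I=Y and x=x, OF Wm W1 Y s] ae2
  proof eventually_elim
    case (elim \<omega>)
    from elim(1) show ?case
    proof (eventually_elim, intro ballI)
      fix n y assume W: "\<forall>y\<in>Y n. W n y \<omega> < ennreal (exp (x n))" and y: "y \<in> Y n"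
      then have "\<exists>\<^sub>F k in sequentially. R n k y \<omega> < ennreal (exp (x n))"
        unfolding W_def by (intro frequently_less_if_liminf_less) auto
      then show "\<exists>\<^sub>F k in sequentially. \<theta> * smooth_count (G n) k y t \<omega> -
         (exp \<theta> - 1) * (LINT s:{0..t}|lborel. intensity_upto (G n) k (y - X s \<omega>)) < x n"
      proof (rule frequently_elim1)
        fix k assume "R n k y \<omega> < ennreal (exp (x n))"
        with elim(2)[rule_format, OF y, of k]
        have "ennreal (exp (\<theta> * smooth_count (G n) k y t \<omega> - (exp \<theta> - 1) * (LINT s:{0..t}|lborel. intensity_upto (G n) k (y - X s \<omega>)))) < ennreal (exp (x n))"
          by (rule le_less_trans)
        then show "\<theta> * smooth_count (G n) k y t \<omega> - (exp \<theta> - 1) * (LINT s:{0..t}|lborel. intensity_upto (G n) k (y - X s \<omega>)) < x n"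
          by (simp add: ennreal_less_iff)
      qed
    qed
  qed
qed

abbreviation count_marks :: "real \<Rightarrow> real \<Rightarrow> real \<Rightarrow> 'a \<Rightarrow> ennreal" where
  "count_marks h y t \<omega> \<equiv> mark_count (\<lambda>u. X u \<omega>) (\<lambda>u. \<zeta> u \<omega>) h y t"

text \<open>A finite set of counted times contributes fully to the smooth count as soon as the cutoff equals
  \<open>1\<close> at its jumps, and so has at most \<open>B\<close> elements. In particular the counted set is finite.\<close>

lemma count_marks_le:
  assumes \<omega>: "\<omega> \<in> space M" and h: "0 < h" and B: "0 \<le> B"
    and G: "\<And>r. 0 \<le> G r"
    and f: "\<exists>\<^sub>F k in sequentially. smooth_count G k y' t \<omega> \<le> B"
    and imp: "\<And>s. s \<in> {0<..t} \<Longrightarrow> h \<le> \<zeta> s \<omega> (y - lX \<omega> s) \<Longrightarrow> 1 \<le> G (\<zeta> s \<omega> (y' - lX \<omega> s))"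
  shows "count_marks h y t \<omega> \<le> ennreal B"
proof -
  define A where "A = {s. 0 \<le> s \<and> s \<le> t \<and> h \<le> \<zeta> s \<omega> (y - lX \<omega> s)}"
  have jp: "0 < dX \<omega> s" "0 < s" if "s \<in> A" for s
  proof -
    have "y - lX \<omega> s \<in> {0<..<dX \<omega> s}"
      using mark_zero[OF \<omega>, of s "y - lX \<omega> s"] that h by (auto simp: A_def)
    then show j: "0 < dX \<omega> s" by auto
    show "0 < s"
    proof (rule ccontr)
      assume "\<not> 0 < s"
      then have "s = 0" using that by (auto simp: A_def)
      then show False using j by (simp add: jump_def left_lim_def)
    qed
  qed
  have card: "real (card F) \<le> B" if F: "finite F" "F \<subseteq> A" for F
  proof -
    have "\<forall>\<^sub>F k in sequentially. cutoff k (dX \<omega> s) = 1 \<and> 1 / (2 * real (Suc k)) < dX \<omega> s" if s: "s \<in> F" for s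
    proof -
      have j: "0 < dX \<omega> s" using jp F s by auto
      obtain k0 :: nat where k0: "max (dX \<omega> s) (1 / dX \<omega> s) \<le> real k0" using real_arch_simple by blast
      show ?thesis unfolding eventually_sequentially
      proof (intro exI[of _ k0] allI impI)
        fix k assume k: "k0 \<le> k"
        have kk: "dX \<omega> s \<le> real (Suc k)" "1 / dX \<omega> s \<le> real (Suc k)" using k0 k by auto
        have k2: "1 / real (Suc k) \<le> dX \<omega> s" using kk(2) j by (simp add: field_simps)
        have "1 / (2 * real (Suc k)) < 1 / real (Suc k)" by (simp add: field_simps)
        with k2 cutoff_eq_1[OF k2 kk(1)] show "cutoff k (dX \<omega> s) = 1 \<and> 1 / (2 * real (Suc k)) < dX \<omega> s" by auto
      qed
    qed
    then have "\<forall>\<^sub>F k in sequentially. \<forall>s\<in>F. cutoff k (dX \<omega> s) = 1 \<and> 1 / (2 * real (Suc k)) < dX \<omega> s"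
      using F(1) by (intro eventually_ball_finite ballI)
    from frequently_ex[OF frequently_eventually_frequently[OF f this]]
    obtain k where k: "smooth_count G k y' t \<omega> \<le> B" "\<And>s. s \<in> F \<Longrightarrow> cutoff k (dX \<omega> s) = 1" "\<And>s. s \<in> F \<Longrightarrow> 1 / (2 * real (Suc k)) < dX \<omega> s"
      by blast
    have "real (card F) = (\<Sum>s\<in>F. 1)" by simp
    also have "\<dots> \<le> (\<Sum>s\<in>F. cutoff k (dX \<omega> s) * G (\<zeta> s \<omega> (y' - lX \<omega> s)))"
    proof (rule sum_mono)
      fix s assume s: "s \<in> F"
      then have "s \<in> {0<..t}" "h \<le> \<zeta> s \<omega> (y - lX \<omega> s)" using F(2) jp by (auto simp: A_def)
      from imp[OF this] k(2)[OF s] show "1 \<le> cutoff k (dX \<omega> s) * G (\<zeta> s \<omega> (y' - lX \<omega> s))" by simp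
    qed
    also have "\<dots> \<le> smooth_count G k y' t \<omega>"
      unfolding smooth_count_def
    proof (rule sum_mono2)
      show "finite (JX (1 / (2 * real (Suc k))) t \<omega>)" by (rule finite_big_jumps[OF X_cadlag[OF \<omega>]]) simp
      show "F \<subseteq> JX (1 / (2 * real (Suc k))) t \<omega>"
        using F(2) jp k(3) by (auto simp: big_jumps_def A_def)
    qed (auto intro!: mult_nonneg_nonneg cutoff_bounds G)
    finally show ?thesis using k(1) by linarith
  qed
  have fin: "finite A"
  proof (rule ccontr)
    assume "infinite A"
    then obtain F where F: "finite F" "F \<subseteq> A" "card F = Suc (nat \<lceil>B\<rceil>)"
      using infinite_arbitrarily_large by blast
    with card[OF F(1,2)] have "real (Suc (nat \<lceil>B\<rceil>)) \<le> B" by simp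
    then show False using B by linarith
  qed
  have "count_marks h y t \<omega> = emeasure (count_space UNIV) A" by (simp add: mark_count_def A_def)
  also have "\<dots> = ennreal (real (card A))" using fin by (simp add: ennreal_of_nat_eq_real_of_nat)
  also have "\<dots> \<le> ennreal B" by (intro ennreal_leI card fin) simp
  finally show ?thesis .
qed

lemma smooth_count_le_count_marks:
  assumes \<omega>: "\<omega> \<in> space M"
    and G: "\<And>r. 0 \<le> G r" "\<And>r. G r \<le> 1"
    and imp: "\<And>s. s \<in> {0<..t} \<Longrightarrow> 0 < G (\<zeta> s \<omega> (y' - lX \<omega> s)) \<Longrightarrow> h \<le> \<zeta> s \<omega> (y - lX \<omega> s)"
  shows "ennreal (smooth_count G k y' t \<omega>) \<le> count_marks h y t \<omega>"
proof -
  define A where "A = {s. 0 \<le> s \<and> s \<le> t \<and> h \<le> \<zeta> s \<omega> (y - lX \<omega> s)}"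
  let ?J = "JX (1 / (2 * real (Suc k))) t \<omega>"
  have fin: "finite ?J" by (rule finite_big_jumps[OF X_cadlag[OF \<omega>]]) simp
  have "smooth_count G k y' t \<omega> \<le> (\<Sum>s\<in>?J. indicator A s)"
    unfolding smooth_count_def
  proof (rule sum_mono)
    fix s assume s: "s \<in> ?J"
    show "cutoff k (dX \<omega> s) * G (\<zeta> s \<omega> (y' - lX \<omega> s)) \<le> indicator A s"
    proof (cases "s \<in> A")
      case True
      then show ?thesis using cutoff_bounds[of k "dX \<omega> s"] G by (auto intro!: mult_le_one)
    next
      case False
      then have "\<not> 0 < G (\<zeta> s \<omega> (y' - lX \<omega> s))" using imp[of s] s by (auto simp: A_def big_jumps_def)
      then have "G (\<zeta> s \<omega> (y' - lX \<omega> s)) = 0" using G(1)[of "\<zeta> s \<omega> (y' - lX \<omega> s)"] by simp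
      then show ?thesis by simp
    qed
  qed
  also have "\<dots> = real (card (?J \<inter> A))" using fin by (simp add: indicator_def sum.If_cases)
  finally have "ennreal (smooth_count G k y' t \<omega>) \<le> ennreal (real (card (?J \<inter> A)))" by (rule ennreal_leI)
  also have "\<dots> = emeasure (count_space UNIV) (?J \<inter> A)" using fin by (simp add: ennreal_of_nat_eq_real_of_nat)
  also have "\<dots> \<le> emeasure (count_space UNIV) A" by (rule emeasure_mono) auto
  finally show ?thesis by (simp add: mark_count_def A_def)
qed

end

section \<open>Scaling and total mass of the intensity\<close>

text \<open>Linear between the values \<open>0\<close> at \<open>b\<close> and \<open>1\<close> at \<open>(1 + \<rho>) b\<close>.\<close>

definition ramp :: "real \<Rightarrow> real \<Rightarrow> real \<Rightarrow> real" where
  "ramp \<rho> b r = max 0 (min 1 ((r - b) / (\<rho> * b)))"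

lemma ramp_bounds: "0 \<le> ramp \<rho> b r" "ramp \<rho> b r \<le> 1"
  by (auto simp: ramp_def)

lemma ramp_eq_0: "0 < \<rho> \<Longrightarrow> 0 < b \<Longrightarrow> r \<le> b \<Longrightarrow> ramp \<rho> b r = 0"
  using divide_nonpos_pos[of "r - b" "\<rho> * b"] by (simp add: ramp_def)

lemma ramp_eq_1: "0 < \<rho> \<Longrightarrow> 0 < b \<Longrightarrow> b * (1 + \<rho>) \<le> r \<Longrightarrow> ramp \<rho> b r = 1"
  by (auto simp: ramp_def field_simps min_def max_def)

lemma ramp_continuous: "0 < \<rho> \<Longrightarrow> 0 < b \<Longrightarrow> continuous_on UNIV (ramp \<rho> b)"
  unfolding ramp_def by (intro continuous_intros) auto

lemma ramp_scale: "0 < b \<Longrightarrow> ramp \<rho> b r = ramp \<rho> 1 (r / b)"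
  by (simp add: ramp_def diff_divide_distrib divide_divide_eq_left mult.commute)

lemma levy_measure_scaling:
  fixes f :: "real \<Rightarrow> real"
  assumes l: "0 < l" and f[measurable]: "f \<in> borel_measurable borel"
    and a: "0 < \<alpha>" "\<alpha> < 1"
  shows "(LINT x|levy_measure \<alpha>. f (x / l)) = l powr (- 1 - \<alpha>) * (LINT x|levy_measure \<alpha>. f x)"
proof -
  have nn: "AE x in lborel. 0 \<le> levy_density \<alpha> x" using levy_density_nonneg[OF a] by auto
  have "(LINT x|levy_measure \<alpha>. f (x / l)) = (LINT x|lborel. levy_density \<alpha> x * f (x / l))"
    unfolding levy_measure_def by (subst integral_density) (use nn in auto)
  also have "\<dots> = \<bar>l\<bar> *\<^sub>R (LINT x|lborel. levy_density \<alpha> (0 + l * x) * f ((0 + l * x) / l))"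
    by (rule lborel_integral_real_affine) (use l in auto)
  also have "(LINT x|lborel. levy_density \<alpha> (0 + l * x) * f ((0 + l * x) / l)) =
     (LINT x|lborel. l powr (- 2 - \<alpha>) * (levy_density \<alpha> x * f x))"
    by (intro Bochner_Integration.integral_cong)
       (use l in \<open>auto simp: levy_density_def zero_less_mult_iff powr_mult\<close>)
  also have "\<dots> = l powr (- 2 - \<alpha>) * (LINT x|lborel. levy_density \<alpha> x * f x)" by simp
  also have "(LINT x|lborel. levy_density \<alpha> x * f x) = (LINT x|levy_measure \<alpha>. f x)"
    unfolding levy_measure_def by (subst integral_density) (use nn in auto)
  also have "\<bar>l\<bar> *\<^sub>R (l powr (- 2 - \<alpha>) * (LINT x|levy_measure \<alpha>. f x)) = (l powr 1 * l powr (- 2 - \<alpha>)) * (LINT x|levy_measure \<alpha>. f x)"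
    using l by simp
  also have "l powr 1 * l powr (- 2 - \<alpha>) = l powr (- 1 - \<alpha>)" unfolding powr_add[symmetric] by simp
  finally show ?thesis .
qed

context holder_marked_process
begin

lemma threshold_ramp: "0 < \<rho> \<Longrightarrow> 0 < b \<Longrightarrow> threshold_fun (ramp \<rho> b) b"
  by (simp add: threshold_fun_def ramp_continuous ramp_bounds ramp_eq_0)

text \<open>A jump of size \<open>l x\<close> has a mark with the law of \<open>l\<^sup>q\<close> times the mark of a jump of size \<open>x\<close>, and the
  Levy measure is homogeneous of degree \<open>- 1 - \<alpha>\<close>; the choice is \<open>l\<^sup>q = b\<close>.\<close>

lemma intensity_ramp_scaling:
  assumes r: "0 < \<rho>" and b: "0 < b"
  shows "intensity (ramp \<rho> b) u = b powr (- (1 + \<alpha>) / q) * intensity (ramp \<rho> 1) (u / b powr (1 / q))"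
proof -
  define l where "l = b powr (1 / q)"
  have l: "0 < l" "l powr q = b" using b q_pos by (auto simp: l_def powr_powr)
  have mm: "mark_mean (ramp \<rho> b) u x = mark_mean (ramp \<rho> 1) (u / l) (x / l)" for x
    unfolding mark_mean_def
  proof (intro Bochner_Integration.integral_cong refl)
    fix v assume v: "v \<in> space N"
    have "scaled_Z x v u / b = scaled_Z (x / l) v (u / l)"
      using l by (auto simp: scaled_Z_def scale_path_eq[OF v] zero_less_divide_iff powr_divide)
    then show "ramp \<rho> b (scaled_Z x v u) = ramp \<rho> 1 (scaled_Z (x / l) v (u / l))"
      using ramp_scale[OF b] by simp
  qed
  have m: "mark_mean (ramp \<rho> 1) (u / l) \<in> borel_measurable borel"
    using measurable_compose[OF measurable_Pair1'[of "u / l" borel borel] mark_mean_measurable[OF threshold_funD(6)[OF threshold_ramp[OF r zero_less_one]]]] by simp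
  have "intensity (ramp \<rho> b) u = l powr (- 1 - \<alpha>) * intensity (ramp \<rho> 1) (u / l)"
    unfolding intensity_def mm by (rule levy_measure_scaling[OF l(1) m alpha])
  also have "l powr (- 1 - \<alpha>) = b powr (- (1 + \<alpha>) / q)"
  proof -
    have e: "1 / q * (- 1 - \<alpha>) = - (1 + \<alpha>) / q" using q_pos by (simp add: field_simps)
    show ?thesis unfolding l_def powr_powr e ..
  qed
  finally show ?thesis by (simp add: l_def)
qed

lemma intensity_nonneg: "threshold_fun G b \<Longrightarrow> 0 \<le> intensity G u"
  using order.trans[OF intensity_facts(2) intensity_facts(3)] .

lemma scaled_Z_measurable3 [measurable]:
  "(\<lambda>p. scaled_Z (fst p) (fst (snd p)) (snd (snd p))) \<in> borel_measurable (borel \<Otimes>\<^sub>M N \<Otimes>\<^sub>M borel)"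
proof -
  have "(\<lambda>p. (\<lambda>(s, w). Z01 w s) (snd (snd p) / fst p, fst (snd p))) \<in> borel_measurable (borel \<Otimes>\<^sub>M N \<Otimes>\<^sub>M borel)"
    by measurable
  then have [measurable]: "(\<lambda>p. Z01 (fst (snd p)) (snd (snd p) / fst p)) \<in> borel_measurable (borel \<Otimes>\<^sub>M N \<Otimes>\<^sub>M borel)"
    by simp
  have "(\<lambda>p. if 0 < fst p then fst p powr q * Z01 (fst (snd p)) (snd (snd p) / fst p) else 0) \<in> borel_measurable (borel \<Otimes>\<^sub>M N \<Otimes>\<^sub>M borel)"
    by measurable
  then show ?thesis
    by (rule measurable_cong[THEN iffD1, rotated]) (auto simp: space_pair_measure scaled_Z_def scale_path_eq)
qed

text \<open>The mean value of \<open>Z(U)\<^bsup>\<alpha>/q\<^esup>\<close> with \<open>U\<close> integrated out.\<close>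

definition mean_Z_power :: ennreal where
  "mean_Z_power = (\<integral>\<^sup>+v. (\<integral>\<^sup>+r. ennreal (Z01 v r powr (\<alpha> / q)) * indicator {0..1} r \<partial>lborel) \<partial>N)"

lemma levy_density_tail:
  assumes a0: "0 < a0"
  shows "(\<integral>\<^sup>+x. ennreal (levy_density \<alpha> x) * (ennreal x * indicator {a0<..} x) \<partial>lborel) = ennreal ((1 + \<alpha>) / Gamma (1 - \<alpha>) * a0 powr (- \<alpha>))"
proof -
  define D where "D = \<alpha> * (1 + \<alpha>) / Gamma (1 - \<alpha>)"
  have D: "D \<ge> 0" using alpha by (simp add: D_def Gamma_real_nonneg)
  have "(\<integral>\<^sup>+x. ennreal (levy_density \<alpha> x) * (ennreal x * indicator {a0<..} x) \<partial>lborel) =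
    (\<integral>\<^sup>+x. ennreal D * (ennreal (x powr (- 1 - \<alpha>)) * indicator {a0..} x) \<partial>lborel)"
  proof (intro nn_integral_cong_AE)
    have "AE s in lborel. s \<noteq> a0" by (rule AE_lborel_singleton)
    then show "AE x in lborel. ennreal (levy_density \<alpha> x) * (ennreal x * indicator {a0<..} x) = ennreal D * (ennreal (x powr (- 1 - \<alpha>)) * indicator {a0..} x)"
    proof eventually_elim
      case (elim x)
      show ?case
      proof (cases "a0 < x")
        case True
        then have x: "0 < x" using a0 by simp
        have "x powr (- 2 - \<alpha>) * x powr 1 = x powr (- 1 - \<alpha>)" unfolding powr_add[symmetric] by simp
        then have "levy_density \<alpha> x * x = D * x powr (- 1 - \<alpha>)"
          using x by (simp add: levy_density_def D_def)
        then show ?thesis using True x D by (simp add: ennreal_mult'[symmetric] levy_density_nonneg alpha)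
      qed (use elim in auto)
    qed
  qed
  also have "\<dots> = ennreal D * (\<integral>\<^sup>+x. ennreal (x powr (- 1 - \<alpha>)) * indicator {a0..} x \<partial>lborel)"
    by (rule nn_integral_cmult) measurable
  also have "(\<integral>\<^sup>+x. ennreal (x powr (- 1 - \<alpha>)) * indicator {a0..} x \<partial>lborel) = ennreal (- (a0 powr (- 1 - \<alpha> + 1)) / (- 1 - \<alpha> + 1))"
    by (rule nn_integral_has_integral_lebesgue'[OF _ has_integral_powr_to_inf]) (use a0 alpha in auto)
  also have "ennreal D * \<dots> = ennreal ((1 + \<alpha>) / Gamma (1 - \<alpha>) * a0 powr (- \<alpha>))"
    using D alpha by (simp add: ennreal_mult'[symmetric] D_def)
  finally show ?thesis .
qed

lemma Z01_outside: "v \<in> space N \<Longrightarrow> r \<notin> {0..1} \<Longrightarrow> Z01 v r = 0"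
  using Z_ends by (auto simp: Z01_def max_def min_def)

text \<open>By Tonelli's theorem the jump size may be integrated first. If the mark is \<open>x\<^sup>q z\<close> at the relative
  position \<open>r\<close>, it exceeds \<open>c\<close> for jumps of size \<open>x > (c / z)\<^bsup>1/q\<^esup>\<close>; the factor \<open>x\<close> from the substitution
  \<open>u = r x\<close> and the density \<open>x\<^bsup>-2-\<alpha>\<^esup>\<close> then give a multiple of \<open>(c / z)\<^bsup>-\<alpha>/q\<^esup>\<close>. This is where the constant
  of the theorem comes from.\<close>

lemma exceedance_measure:
  assumes c: "0 < c"
  shows "(\<integral>\<^sup>+x. (\<integral>\<^sup>+v. (\<integral>\<^sup>+u. indicator {c<..} (scaled_Z x v u) \<partial>lborel) \<partial>N) \<partial>levy_measure \<alpha>) =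
    ennreal ((1 + \<alpha>) / Gamma (1 - \<alpha>) * c powr (- \<alpha> / q)) * mean_Z_power"
proof -
  interpret P: pair_sigma_finite N "lborel :: real measure" by standard
  interpret Q: pair_sigma_finite "lborel :: real measure" "N \<Otimes>\<^sub>M (lborel :: real measure)"
    unfolding pair_sigma_finite_def
    using sigma_finite_lborel sigma_finite_pair_measure[OF mark.sigma_finite_measure_axioms sigma_finite_lborel] by blast
  have [measurable]: "(\<lambda>p. Z01 (fst p) (snd p)) \<in> borel_measurable (N \<Otimes>\<^sub>M borel)"
    using measurable_compose[OF measurable_pair_swap' Z01_measurable] by (simp add: case_prod_beta')
  have [measurable]: "(\<lambda>p. scaled_Z (fst (fst p)) (snd (fst p)) (snd p)) \<in> borel_measurable ((borel \<Otimes>\<^sub>M N) \<Otimes>\<^sub>M borel)"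
  proof -
    have "(\<lambda>p. (fst (fst p), snd (fst p), snd p)) \<in> (borel \<Otimes>\<^sub>M N) \<Otimes>\<^sub>M borel \<rightarrow>\<^sub>M borel \<Otimes>\<^sub>M N \<Otimes>\<^sub>M borel" by measurable
    from measurable_compose[OF this scaled_Z_measurable3] show ?thesis by simp
  qed
  define F where "F p = (case p of (x, v, r) \<Rightarrow> ennreal (levy_density \<alpha> x) * (ennreal x * (indicator {c<..} (x powr q * Z01 v r) * indicator {0..1} r)))" for p
  have Fm[measurable]: "F \<in> borel_measurable (borel \<Otimes>\<^sub>M N \<Otimes>\<^sub>M borel)"
    unfolding F_def case_prod_beta' by measurable
  have u: "(\<integral>\<^sup>+u. indicator {c<..} (scaled_Z x v u) \<partial>lborel) = ennreal x * (\<integral>\<^sup>+r. indicator {c<..} (x powr q * Z01 v r) * indicator {0..1} r \<partial>lborel)"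
    if x: "0 < x" and v: "v \<in> space N" for x v
  proof -
    have [measurable]: "Z01 v \<in> borel_measurable borel" by (rule borel_measurable_continuous_onI[OF Z01_continuous[OF v]])
    have "(\<integral>\<^sup>+u. indicator {c<..} (scaled_Z x v u) \<partial>lborel) = (\<integral>\<^sup>+u. indicator {c<..} (x powr q * Z01 v (u / x)) \<partial>lborel)"
      using x by (simp add: scaled_Z_def scale_path_eq[OF v])
    also have "\<dots> = \<bar>x\<bar> * (\<integral>\<^sup>+r. indicator {c<..} (x powr q * Z01 v ((0 + x * r) / x)) \<partial>lborel)"
      by (rule nn_integral_real_affine) (use x in auto)
    also have "(\<integral>\<^sup>+r. indicator {c<..} (x powr q * Z01 v ((0 + x * r) / x)) \<partial>lborel) =
      (\<integral>\<^sup>+r. indicator {c<..} (x powr q * Z01 v r) * indicator {0..1} r \<partial>lborel)"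
    proof (intro nn_integral_cong)
      fix r :: real
      show "(indicator {c<..} (x powr q * Z01 v ((0 + x * r) / x)) :: ennreal) = indicator {c<..} (x powr q * Z01 v r) * indicator {0..1} r"
        using x c Z01_outside[OF v, of r] by (cases "r \<in> {0..1}") auto
    qed
    finally show ?thesis using x by simp
  qed
  have "(\<integral>\<^sup>+x. (\<integral>\<^sup>+v. (\<integral>\<^sup>+u. indicator {c<..} (scaled_Z x v u) \<partial>lborel) \<partial>N) \<partial>levy_measure \<alpha>) =
    (\<integral>\<^sup>+x. ennreal (levy_density \<alpha> x) * (\<integral>\<^sup>+v. (\<integral>\<^sup>+u. indicator {c<..} (scaled_Z x v u) \<partial>lborel) \<partial>N) \<partial>lborel)"
    by (rule nn_integral_levy_measure) measurable
  also have "\<dots> = (\<integral>\<^sup>+x. (\<integral>\<^sup>+v. (\<integral>\<^sup>+r. F (x, v, r) \<partial>lborel) \<partial>N) \<partial>lborel)"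
  proof (intro nn_integral_cong)
    fix x :: real
    show "ennreal (levy_density \<alpha> x) * (\<integral>\<^sup>+v. (\<integral>\<^sup>+u. indicator {c<..} (scaled_Z x v u) \<partial>lborel) \<partial>N) = (\<integral>\<^sup>+v. (\<integral>\<^sup>+r. F (x, v, r) \<partial>lborel) \<partial>N)"
    proof (cases "0 < x")
      case True
      have m[measurable]: "(\<lambda>p. indicator {c<..} (x powr q * Z01 (fst p) (snd p)) * indicator {0..1} (snd p) :: ennreal) \<in> borel_measurable (N \<Otimes>\<^sub>M borel)" by measurable
      have "(\<integral>\<^sup>+v. (\<integral>\<^sup>+u. indicator {c<..} (scaled_Z x v u) \<partial>lborel) \<partial>N) = (\<integral>\<^sup>+v. ennreal x * (\<integral>\<^sup>+r. indicator {c<..} (x powr q * Z01 v r) * indicator {0..1} r \<partial>lborel) \<partial>N)"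
        by (intro nn_integral_cong u True)
      also have "\<dots> = ennreal x * (\<integral>\<^sup>+v. (\<integral>\<^sup>+r. indicator {c<..} (x powr q * Z01 v r) * indicator {0..1} r \<partial>lborel) \<partial>N)"
        by (rule nn_integral_cmult) (use lborel.borel_measurable_nn_integral[of "\<lambda>v r. indicator {c<..} (x powr q * Z01 v r) * indicator {0..1} r" N] m in \<open>simp add: case_prod_beta'\<close>)
      also have "ennreal (levy_density \<alpha> x) * \<dots> = (\<integral>\<^sup>+v. (\<integral>\<^sup>+r. F (x, v, r) \<partial>lborel) \<partial>N)"
      proof -
        have "(\<integral>\<^sup>+r. F (x, v, r) \<partial>lborel) = (ennreal (levy_density \<alpha> x) * ennreal x) * (\<integral>\<^sup>+r. indicator {c<..} (x powr q * Z01 v r) * indicator {0..1} r \<partial>lborel)" if v: "v \<in> space N" for v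
        proof -
          have [measurable]: "Z01 v \<in> borel_measurable borel" by (rule borel_measurable_continuous_onI[OF Z01_continuous[OF v]])
          show ?thesis unfolding F_def by (subst nn_integral_cmult[symmetric]) (auto simp: mult.assoc)
        qed
        then have "(\<integral>\<^sup>+v. (\<integral>\<^sup>+r. F (x, v, r) \<partial>lborel) \<partial>N) = (\<integral>\<^sup>+v. (ennreal (levy_density \<alpha> x) * ennreal x) * (\<integral>\<^sup>+r. indicator {c<..} (x powr q * Z01 v r) * indicator {0..1} r \<partial>lborel) \<partial>N)"
          by (intro nn_integral_cong)
        also have "\<dots> = (ennreal (levy_density \<alpha> x) * ennreal x) * (\<integral>\<^sup>+v. (\<integral>\<^sup>+r. indicator {c<..} (x powr q * Z01 v r) * indicator {0..1} r \<partial>lborel) \<partial>N)"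
          by (rule nn_integral_cmult) (use lborel.borel_measurable_nn_integral[of "\<lambda>v r. indicator {c<..} (x powr q * Z01 v r) * indicator {0..1} r" N] m in \<open>simp add: case_prod_beta'\<close>)
        finally show ?thesis by (simp add: mult.assoc)
      qed
      finally show ?thesis .
    next
      case False
      then show ?thesis by (simp add: F_def levy_density_def)
    qed
  qed
  also have "\<dots> = (\<integral>\<^sup>+x. (\<integral>\<^sup>+p. F (x, p) \<partial>(N \<Otimes>\<^sub>M lborel)) \<partial>lborel)"
    by (intro nn_integral_cong lborel.nn_integral_fst[of "\<lambda>p. F (_, p)"]) measurable
  also have "\<dots> = (\<integral>\<^sup>+p. (\<integral>\<^sup>+x. F (x, p) \<partial>lborel) \<partial>(N \<Otimes>\<^sub>M lborel))"
    by (rule Q.Fubini'[symmetric]) measurable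
  also have "\<dots> = (\<integral>\<^sup>+p. ennreal ((1 + \<alpha>) / Gamma (1 - \<alpha>) * c powr (- \<alpha> / q)) * (ennreal (Z01 (fst p) (snd p) powr (\<alpha> / q)) * indicator {0..1} (snd p)) \<partial>(N \<Otimes>\<^sub>M lborel))"
  proof (intro nn_integral_cong)
    fix p assume "p \<in> space (N \<Otimes>\<^sub>M (lborel :: real measure))"
    then have v: "fst p \<in> space N" by (auto simp: space_pair_measure)
    define z where "z = Z01 (fst p) (snd p)"
    have z0: "0 \<le> z" using Z01_nonneg[OF v] by (simp add: z_def)
    have "(\<integral>\<^sup>+x. F (x, p) \<partial>lborel) = (\<integral>\<^sup>+x. ennreal (levy_density \<alpha> x) * (ennreal x * indicator {c<..} (x powr q * z)) * indicator {0..1} (snd p) \<partial>lborel)"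
      by (intro nn_integral_cong) (simp add: F_def case_prod_beta' z_def mult.assoc)
    also have "\<dots> = (\<integral>\<^sup>+x. ennreal (levy_density \<alpha> x) * (ennreal x * indicator {c<..} (x powr q * z)) \<partial>lborel) * indicator {0..1} (snd p)"
      by (rule nn_integral_multc) measurable
    also have "(\<integral>\<^sup>+x. ennreal (levy_density \<alpha> x) * (ennreal x * indicator {c<..} (x powr q * z)) \<partial>lborel) =
      ennreal ((1 + \<alpha>) / Gamma (1 - \<alpha>) * c powr (- \<alpha> / q)) * ennreal (z powr (\<alpha> / q))"
    proof (cases "z = 0")
      case True
      then show ?thesis using c alpha q_pos by simp
    next
      case False
      then have z: "0 < z" using z0 by simp
      define a0 where "a0 = (c / z) powr (1 / q)"
      have a0: "0 < a0" "a0 powr q = c / z" using c z q_pos by (auto simp: a0_def powr_powr)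
      have iff: "c < x powr q * z \<longleftrightarrow> a0 < x" if "0 < x" for x
      proof -
        have "c < x powr q * z \<longleftrightarrow> a0 powr q < x powr q" unfolding a0(2) using z by (simp add: field_simps)
        also have "\<dots> \<longleftrightarrow> a0 < x" using a0(1) that q_pos by (meson linorder_not_le powr_less_mono2 powr_mono2 less_imp_le)
        finally show ?thesis .
      qed
      have "(\<integral>\<^sup>+x. ennreal (levy_density \<alpha> x) * (ennreal x * indicator {c<..} (x powr q * z)) \<partial>lborel) =
        (\<integral>\<^sup>+x. ennreal (levy_density \<alpha> x) * (ennreal x * indicator {a0<..} x) \<partial>lborel)"
      proof (intro nn_integral_cong)
        fix x :: real
        show "ennreal (levy_density \<alpha> x) * (ennreal x * indicator {c<..} (x powr q * z)) = ennreal (levy_density \<alpha> x) * (ennreal x * indicator {a0<..} x)"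
          using iff[of x] by (cases "0 < x") (auto simp: indicator_def levy_density_def)
      qed
      also have "\<dots> = ennreal ((1 + \<alpha>) / Gamma (1 - \<alpha>) * a0 powr (- \<alpha>))" by (rule levy_density_tail[OF a0(1)])
      also have "a0 powr (- \<alpha>) = c powr (- \<alpha> / q) * z powr (\<alpha> / q)"
        using c z by (simp add: a0_def powr_powr powr_divide powr_minus field_simps)
      also have "ennreal ((1 + \<alpha>) / Gamma (1 - \<alpha>) * (c powr (- \<alpha> / q) * z powr (\<alpha> / q))) = ennreal ((1 + \<alpha>) / Gamma (1 - \<alpha>) * c powr (- \<alpha> / q)) * ennreal (z powr (\<alpha> / q))"
        by (subst ennreal_mult''[symmetric]) (auto simp: mult.assoc)
      finally show ?thesis .
    qed
    finally show "(\<integral>\<^sup>+x. F (x, p) \<partial>lborel) = ennreal ((1 + \<alpha>) / Gamma (1 - \<alpha>) * c powr (- \<alpha> / q)) * (ennreal (Z01 (fst p) (snd p) powr (\<alpha> / q)) * indicator {0..1} (snd p))"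
      by (simp add: z_def mult.assoc)
  qed
  also have "\<dots> = ennreal ((1 + \<alpha>) / Gamma (1 - \<alpha>) * c powr (- \<alpha> / q)) * (\<integral>\<^sup>+p. (ennreal (Z01 (fst p) (snd p) powr (\<alpha> / q)) * indicator {0..1} (snd p)) \<partial>(N \<Otimes>\<^sub>M lborel))"
    by (rule nn_integral_cmult) measurable
  also have "(\<integral>\<^sup>+p. (ennreal (Z01 (fst p) (snd p) powr (\<alpha> / q)) * indicator {0..1} (snd p)) \<partial>(N \<Otimes>\<^sub>M lborel)) = mean_Z_power"
    unfolding mean_Z_power_def by (subst lborel.nn_integral_fst[symmetric]) auto
  finally show ?thesis .
qed

lemma nn_integral_intensity:
  assumes G: "threshold_fun G b"
  shows "(\<integral>\<^sup>+u. ennreal (intensity G u) \<partial>lborel) = (\<integral>\<^sup>+x. (\<integral>\<^sup>+v. (\<integral>\<^sup>+u. ennreal (G (scaled_Z x v u)) \<partial>lborel) \<partial>N) \<partial>levy_measure \<alpha>)"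
proof -
  note Gs = threshold_funD[OF G] and [measurable] = threshold_funD(6)[OF G]
  have sf: "sigma_finite_measure (levy_measure \<alpha>)"
    unfolding levy_measure_def by (subst sigma_finite_measure.sigma_finite_iff_density_finite[OF sigma_finite_lborel]) auto
  interpret P: pair_sigma_finite N "lborel :: real measure" by standard
  interpret Q: pair_sigma_finite "levy_measure \<alpha>" "lborel :: real measure"
    unfolding pair_sigma_finite_def using sf sigma_finite_lborel by blast
  have m01: "0 \<le> mark_mean G u x" for u x by (rule mark_mean_bounds) (use Gs in auto)
  have sm[measurable]: "(\<lambda>v. scaled_Z x v u) \<in> borel_measurable N" for x u
    using measurable_compose[OF scaled_Z_measurable1 measurable_component_singleton[of u UNIV]] by simp
  have mm: "(\<lambda>(x, u). ennreal (mark_mean G u x)) \<in> borel_measurable (levy_measure \<alpha> \<Otimes>\<^sub>M lborel)"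
    using measurable_compose[OF measurable_pair_swap' mark_mean_measurable[OF Gs(6)]]
    by (simp add: case_prod_beta' measurable_cong_sets[OF sets_pair_measure_cong[OF sets_levy_measure sets_lborel] refl])
  have "(\<integral>\<^sup>+u. ennreal (intensity G u) \<partial>lborel) = (\<integral>\<^sup>+u. (\<integral>\<^sup>+x. ennreal (mark_mean G u x) \<partial>levy_measure \<alpha>) \<partial>lborel)"
    unfolding intensity_def
    by (intro nn_integral_cong nn_integral_eq_integral[symmetric] intensity_facts(1)[OF G] AE_I2 m01)
  also have "\<dots> = (\<integral>\<^sup>+x. (\<integral>\<^sup>+u. ennreal (mark_mean G u x) \<partial>lborel) \<partial>levy_measure \<alpha>)"
    by (rule Q.Fubini'[OF mm])
  also have "\<dots> = (\<integral>\<^sup>+x. (\<integral>\<^sup>+v. (\<integral>\<^sup>+u. ennreal (G (scaled_Z x v u)) \<partial>lborel) \<partial>N) \<partial>levy_measure \<alpha>)"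
  proof (intro nn_integral_cong)
    fix x :: real
    have "(\<lambda>p. G (scaled_Z x (fst p) (snd p))) \<in> borel_measurable (N \<Otimes>\<^sub>M borel)"
    proof -
      have "(\<lambda>p. (x, fst p, snd p)) \<in> N \<Otimes>\<^sub>M borel \<rightarrow>\<^sub>M borel \<Otimes>\<^sub>M N \<Otimes>\<^sub>M borel" by measurable
      from measurable_compose[OF measurable_compose[OF this scaled_Z_measurable3] Gs(6)] show ?thesis by simp
    qed
    then have gm: "(\<lambda>(v, u). ennreal (G (scaled_Z x v u))) \<in> borel_measurable (N \<Otimes>\<^sub>M lborel)"
      by (simp add: case_prod_beta')
    have "(\<integral>\<^sup>+u. ennreal (mark_mean G u x) \<partial>lborel) = (\<integral>\<^sup>+u. (\<integral>\<^sup>+v. ennreal (G (scaled_Z x v u)) \<partial>N) \<partial>lborel)"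
      unfolding mark_mean_def
      by (intro nn_integral_cong nn_integral_eq_integral[symmetric] mark.integrable_const_bound[of _ 1])
         (use Gs in auto)
    also have "\<dots> = (\<integral>\<^sup>+v. (\<integral>\<^sup>+u. ennreal (G (scaled_Z x v u)) \<partial>lborel) \<partial>N)" by (rule P.Fubini'[OF gm])
    finally show "(\<integral>\<^sup>+u. ennreal (mark_mean G u x) \<partial>lborel) = (\<integral>\<^sup>+v. (\<integral>\<^sup>+u. ennreal (G (scaled_Z x v u)) \<partial>lborel) \<partial>N)" .
  qed
  finally show ?thesis .
qed

text \<open>The ramp lies between the indicators of the heights above \<open>1 + \<rho>\<close> and above \<open>1\<close>.\<close>

lemma nn_integral_intensity_ramp:
  assumes r: "0 < \<rho>"
  shows "(\<integral>\<^sup>+u. ennreal (intensity (ramp \<rho> 1) u) \<partial>lborel) \<le> ennreal ((1 + \<alpha>) / Gamma (1 - \<alpha>)) * mean_Z_power"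
    and "ennreal ((1 + \<alpha>) / Gamma (1 - \<alpha>) * (1 + \<rho>) powr (- \<alpha> / q)) * mean_Z_power \<le> (\<integral>\<^sup>+u. ennreal (intensity (ramp \<rho> 1) u) \<partial>lborel)"
proof -
  note E = nn_integral_intensity[OF threshold_ramp[OF r zero_less_one]]
  have "(\<integral>\<^sup>+u. ennreal (intensity (ramp \<rho> 1) u) \<partial>lborel) \<le> (\<integral>\<^sup>+x. (\<integral>\<^sup>+v. (\<integral>\<^sup>+u. indicator {1<..} (scaled_Z x v u) \<partial>lborel) \<partial>N) \<partial>levy_measure \<alpha>)"
    unfolding E
  proof (intro nn_integral_mono)
    fix x v u
    show "ennreal (ramp \<rho> 1 (scaled_Z x v u)) \<le> indicator {1<..} (scaled_Z x v u)"
      using ramp_eq_0[OF r, of 1 "scaled_Z x v u"] ramp_bounds[of \<rho> 1] by (auto simp: indicator_def)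
  qed
  also have "\<dots> = ennreal ((1 + \<alpha>) / Gamma (1 - \<alpha>)) * mean_Z_power" by (subst exceedance_measure) auto
  finally show "(\<integral>\<^sup>+u. ennreal (intensity (ramp \<rho> 1) u) \<partial>lborel) \<le> ennreal ((1 + \<alpha>) / Gamma (1 - \<alpha>)) * mean_Z_power" .
  have "ennreal ((1 + \<alpha>) / Gamma (1 - \<alpha>) * (1 + \<rho>) powr (- \<alpha> / q)) * mean_Z_power = (\<integral>\<^sup>+x. (\<integral>\<^sup>+v. (\<integral>\<^sup>+u. indicator {1 + \<rho><..} (scaled_Z x v u) \<partial>lborel) \<partial>N) \<partial>levy_measure \<alpha>)"
    using r by (subst exceedance_measure) auto
  also have "\<dots> \<le> (\<integral>\<^sup>+u. ennreal (intensity (ramp \<rho> 1) u) \<partial>lborel)"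
    unfolding E
  proof (intro nn_integral_mono)
    fix x v u
    show "indicator {1 + \<rho><..} (scaled_Z x v u) \<le> ennreal (ramp \<rho> 1 (scaled_Z x v u))"
      using ramp_eq_1[OF r, of 1 "scaled_Z x v u"] by (auto simp: indicator_def)
  qed
  finally show "ennreal ((1 + \<alpha>) / Gamma (1 - \<alpha>) * (1 + \<rho>) powr (- \<alpha> / q)) * mean_Z_power \<le> (\<integral>\<^sup>+u. ennreal (intensity (ramp \<rho> 1) u) \<partial>lborel)" .
qed

end

section \<open>Approximate identities and local times\<close>

text \<open>The part of \<open>g\<close> outside some \<open>[- m, m]\<close> has a small integral, and for \<open>u\<close> in this interval
  \<open>l (y - \<delta> u)\<close> is close to \<open>l y\<close> once \<open>\<delta> m\<close> is small.\<close>

lemma approximate_identity: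
  fixes g l :: "real \<Rightarrow> real"
  assumes g: "integrable lborel g" "\<And>u. 0 \<le> g u"
    and l: "continuous_on UNIV l" "\<And>y. \<bar>l y\<bar> \<le> B" "uniformly_continuous_on UNIV l" and e: "0 < e"
  shows "\<exists>d>0. \<forall>\<delta>. 0 < \<delta> \<and> \<delta> < d \<longrightarrow> (\<forall>y. \<bar>(LINT u|lborel. g u * l (y - \<delta> * u)) - (LINT u|lborel. g u) * l y\<bar> \<le> e)"
proof -
  have lm[measurable]: "l \<in> borel_measurable borel" by (rule borel_measurable_continuous_onI[OF l(1)])
  have gm[measurable]: "g \<in> borel_measurable borel" using g(1) by auto
  have B0: "0 \<le> B" using order.trans[OF abs_ge_zero l(2)] .
  have m0: "0 \<le> (LINT u|lborel. g u)" by (intro Bochner_Integration.integral_nonneg g)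
  have "(\<lambda>m::nat. LINT u|lborel. g u * indicator {u. real m < \<bar>u\<bar>} u) \<longlonglongrightarrow> (LINT u::real|lborel. (0::real))"
  proof (rule integral_dominated_convergence[where w=g])
    show "AE u in lborel. (\<lambda>m. g u * indicator {u. real m < \<bar>u\<bar>} u) \<longlonglongrightarrow> 0"
    proof (intro AE_I2)
      fix u :: real
      obtain m0 :: nat where "\<bar>u\<bar> \<le> real m0" using real_arch_simple by blast
      then have "\<forall>\<^sub>F m in sequentially. g u * indicator {u. real m < \<bar>u\<bar>} u = 0"
        unfolding eventually_sequentially by (intro exI[of _ m0]) (auto simp: indicator_def)
      then show "(\<lambda>m. g u * indicator {u. real m < \<bar>u\<bar>} u) \<longlonglongrightarrow> 0" by (rule tendsto_eventually)
    qed
    show "AE u in lborel. norm (g u * indicator {u. real m < \<bar>u\<bar>} u) \<le> g u" for m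
      using g(2) by (intro AE_I2) (auto simp: indicator_def)
  qed (use g in auto)
  then have "(\<lambda>m::nat. LINT u|lborel. g u * indicator {u. real m < \<bar>u\<bar>} u) \<longlonglongrightarrow> 0" by simp
  then have "\<forall>\<^sub>F m in sequentially. (LINT u|lborel. g u * indicator {u. real m < \<bar>u\<bar>} u) < e / (4 * (B + 1))"
    using e B0 by (intro order_tendstoD) auto
  then obtain m where m: "(LINT u|lborel. g u * indicator {u. real m < \<bar>u\<bar>} u) < e / (4 * (B + 1))"
    by (auto simp: eventually_sequentially)
  define e' where "e' = e / (2 * ((LINT u|lborel. g u) + 1))"
  have e': "0 < e'" using e m0 by (simp add: e'_def)
  obtain d0 where d0: "d0 > 0" "\<And>y y'. \<bar>y' - y\<bar> < d0 \<Longrightarrow> \<bar>l y' - l y\<bar> < e'"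
    using l(3) e' unfolding uniformly_continuous_on_def dist_real_def by (meson UNIV_I)
  define d where "d = d0 / (real m + 1)"
  show ?thesis
  proof (intro exI[of _ d] conjI allI impI)
    show "0 < d" using d0 by (simp add: d_def)
    fix \<delta> y assume \<delta>: "0 < \<delta> \<and> \<delta> < d"
    have bd: "\<bar>g u * l (y - \<delta> * u) - g u * l y\<bar> \<le> g u * e' + 2 * B * (g u * indicator {u. real m < \<bar>u\<bar>} u)" for u
    proof (cases "real m < \<bar>u\<bar>")
      case True
      have "\<bar>l (y - \<delta> * u) - l y\<bar> \<le> 2 * B" using l(2)[of y] l(2)[of "y - \<delta> * u"] by linarith
      then have "g u * \<bar>l (y - \<delta> * u) - l y\<bar> \<le> g u * (2 * B)" using g(2) by (intro mult_left_mono)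
      moreover have "0 \<le> g u * e'" using g(2) e' by auto
      ultimately show ?thesis using True g(2)[of u] by (simp add: right_diff_distrib[symmetric] abs_mult mult_ac)
    next
      case False
      have "\<delta> * \<bar>u\<bar> \<le> \<delta> * (real m + 1)" using False \<delta> by (intro mult_left_mono) auto
      also have "\<dots> < d * (real m + 1)" using \<delta> by (intro mult_strict_right_mono) auto
      also have "\<dots> = d0" by (simp add: d_def)
      finally have "\<bar>l (y - \<delta> * u) - l y\<bar> < e'" using \<delta> by (intro d0) (simp add: abs_mult)
      then have "g u * \<bar>l (y - \<delta> * u) - l y\<bar> \<le> g u * e'" using g(2) by (intro mult_left_mono) auto
      then show ?thesis using False g(2)[of u] by (simp add: right_diff_distrib[symmetric] abs_mult)
    qed
    have ib: "integrable lborel (\<lambda>u. g u * indicator {u. real m < \<bar>u\<bar>} u)"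
      by (rule Bochner_Integration.integrable_bound[OF g(1)]) (use g(2) in \<open>auto simp: indicator_def\<close>)
    have i1: "integrable lborel (\<lambda>u. g u * l (y - \<delta> * u))"
      by (rule Bochner_Integration.integrable_bound[OF integrable_mult_left[OF g(1), of B]])
         (use g(2) l(2) B0 in \<open>auto simp: abs_mult intro!: mult_left_mono\<close>)
    have i2: "integrable lborel (\<lambda>u. g u * l y)" using g(1) by auto
    have "\<bar>(LINT u|lborel. g u * l (y - \<delta> * u)) - (LINT u|lborel. g u) * l y\<bar> = \<bar>LINT u|lborel. g u * l (y - \<delta> * u) - g u * l y\<bar>"
      using i1 i2 by simp
    also have "\<dots> \<le> (LINT u|lborel. \<bar>g u * l (y - \<delta> * u) - g u * l y\<bar>)" by (rule integral_abs_bound)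
    also have "\<dots> \<le> (LINT u|lborel. g u * e' + 2 * B * (g u * indicator {u. real m < \<bar>u\<bar>} u))"
      using i1 i2 g(1) ib by (intro integral_mono bd) auto
    also have "\<dots> = (LINT u|lborel. g u) * e' + 2 * B * (LINT u|lborel. g u * indicator {u. real m < \<bar>u\<bar>} u)"
      using g(1) ib by simp
    also have "\<dots> \<le> e / 2 + e / 2"
    proof (intro add_mono)
      have "(LINT u|lborel. g u) * e' \<le> ((LINT u|lborel. g u) + 1) * e'" using e' by (intro mult_right_mono) auto
      also have "\<dots> = e / 2"
      proof -
        have "p * (e / (2 * p)) = e / 2" if "p > 0" for p :: real using that by simp
        from this[of "(LINT u|lborel. g u) + 1"] show ?thesis unfolding e'_def using m0 by simp
      qed
      finally show "(LINT u|lborel. g u) * e' \<le> e / 2" .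
      have "2 * B * (LINT u|lborel. g u * indicator {u. real m < \<bar>u\<bar>} u) \<le> 2 * (B + 1) * (e / (4 * (B + 1)))"
        using m B0 g(2) by (intro mult_mono) (auto intro!: Bochner_Integration.integral_nonneg)
      also have "\<dots> = e / 2"
      proof -
        have "2 * p * (e / (4 * p)) = e / 2" if "p > 0" for p :: real using that by simp
        from this[of "B + 1"] show ?thesis using B0 by simp
      qed
      finally show "2 * B * (LINT u|lborel. g u * indicator {u. real m < \<bar>u\<bar>} u) \<le> e / 2" .
    qed
    finally show "\<bar>(LINT u|lborel. g u * l (y - \<delta> * u)) - (LINT u|lborel. g u) * l y\<bar> \<le> e" by simp
  qed
qed

lemma compact_support_uniformly_continuous:
  fixes l :: "real \<Rightarrow> real"
  assumes l: "continuous_on UNIV l" and R: "0 \<le> R" "\<And>y. R < \<bar>y\<bar> \<Longrightarrow> l y = 0"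
  shows "uniformly_continuous_on UNIV l" "\<exists>B. \<forall>y. \<bar>l y\<bar> \<le> B"
proof -
  define K where "K = {- (R + 1)..R + 1}"
  have uc: "uniformly_continuous_on K l"
    unfolding K_def by (intro compact_uniformly_continuous continuous_on_subset[OF l]) auto
  define p where "p y = max (- (R + 1)) (min (R + 1) y)" for y
  have pK: "p y \<in> K" for y using R(1) by (auto simp: p_def K_def)
  have lp: "l y = l (p y)" for y
  proof (cases "\<bar>y\<bar> \<le> R + 1")
    case True
    then show ?thesis by (auto simp: p_def min_def max_def)
  next
    case False
    then have "R < \<bar>y\<bar>" "R < \<bar>p y\<bar>" using R(1) by (auto simp: p_def min_def max_def)
    then show ?thesis using R(2) by simp
  qed
  show "uniformly_continuous_on UNIV l"
    unfolding uniformly_continuous_on_def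
  proof (intro allI impI)
    fix e :: real assume "0 < e"
    then obtain d where d: "d > 0" "\<And>x x'. x \<in> K \<Longrightarrow> x' \<in> K \<Longrightarrow> dist x' x < d \<Longrightarrow> dist (l x') (l x) < e"
      using uc unfolding uniformly_continuous_on_def by meson
    have "dist (l x') (l x) < e" if "dist x' x < d" for x x'
    proof -
      have "dist (p x') (p x) \<le> dist x' x" unfolding p_def dist_real_def by linarith
      then have "dist (p x') (p x) < d" using that by linarith
      from d(2)[OF pK pK this] show ?thesis by (simp add: lp[symmetric])
    qed
    then show "\<exists>d>0. \<forall>x\<in>UNIV. \<forall>x'\<in>UNIV. dist x' x < d \<longrightarrow> dist (l x') (l x) < e" using d(1) by blast
  qed
  have "compact (l ` K)" unfolding K_def by (intro compact_continuous_image continuous_on_subset[OF l]) auto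
  then have "bounded (l ` K)" by (rule compact_imp_bounded)
  then obtain B where "\<And>y. y \<in> K \<Longrightarrow> \<bar>l y\<bar> \<le> B" by (auto simp: bounded_iff)
  then show "\<exists>B. \<forall>y. \<bar>l y\<bar> \<le> B" using pK lp by metis
qed

lemma nonneg_if_interval_integrals_nonneg:
  fixes l :: "real \<Rightarrow> real"
  assumes l: "continuous_on UNIV l" and e: "0 < e"
    and int: "\<And>a b. a \<in> \<rat> \<Longrightarrow> b \<in> \<rat> \<Longrightarrow> y0 - e < a \<Longrightarrow> a < b \<Longrightarrow> b < y0 + e \<Longrightarrow>
      0 \<le> (LINT y|lborel. indicator {a<..<b} y * l y)"
  shows "0 \<le> l y0"
proof (rule ccontr)
  assume n: "\<not> 0 \<le> l y0"
  have "isCont l y0" using l by (simp add: continuous_on_eq_continuous_at)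
  then obtain d where d: "d > 0" "\<And>y. \<bar>y - y0\<bar> < d \<Longrightarrow> \<bar>l y - l y0\<bar> < - l y0 / 2"
    using n unfolding continuous_at_eps_delta dist_real_def by (metis half_gt_zero linorder_not_le neg_0_less_iff_less)
  obtain a where a: "a \<in> \<rat>" "y0 - min d e < a" "a < y0" using Rats_dense_in_real[of "y0 - min d e" y0] d e by auto
  obtain b where b: "b \<in> \<rat>" "y0 < b" "b < y0 + min d e" using Rats_dense_in_real[of y0 "y0 + min d e"] d e by auto
  have i1: "integrable lborel (\<lambda>y. indicator {a<..<b} y * l y)"
  proof -
    have i0: "integrable lborel (\<lambda>y. indicator {a..b} y *\<^sub>R l y)"
      by (rule borel_integrable_compact) (auto intro: continuous_on_subset[OF l])
    have [measurable]: "l \<in> borel_measurable borel" by (rule borel_measurable_continuous_onI[OF l])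
    show ?thesis
      by (rule Bochner_Integration.integrable_bound[OF i0]) (auto simp: indicator_def)
  qed
  have "0 \<le> (LINT y|lborel. indicator {a<..<b} y * l y)" using a b by (intro int) auto
  also have "\<dots> \<le> (LINT y|lborel. indicator {a<..<b} y * (l y0 / 2))"
  proof (rule integral_mono[OF i1])
    show "integrable lborel (\<lambda>y. indicator {a<..<b} y * (l y0 / 2))"
      using a b by (intro integrable_mult_left integrable_real_indicator) auto
    show "indicator {a<..<b} y * l y \<le> indicator {a<..<b} y * (l y0 / 2)" for y
    proof (cases "y \<in> {a<..<b}")
      case True
      have "y0 - d < a" "b < y0 + d" using a(2) b(3) by linarith+
      then have "\<bar>y - y0\<bar> < d" using True by auto
      from d(2)[OF this] have "l y \<le> l y0 / 2" by linarith
      then show ?thesis using True by simp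
    qed simp
  qed
  also have "\<dots> = (b - a) * (l y0 / 2)" using a b by simp
  also have "\<dots> < 0" using a b n by (intro mult_pos_neg) auto
  finally show False by simp
qed

section \<open>A grid of levels\<close>

text \<open>The multiples of \<open>2\<^bsup>-nk\<^esup>\<close> in \<open>[- n, n]\<close>.\<close>

definition level_grid :: "nat \<Rightarrow> nat \<Rightarrow> real set" where
  "level_grid k n = (\<lambda>i::int. real_of_int i / 2 ^ (n * k)) ` {- (int n * 2 ^ (n * k))..int n * 2 ^ (n * k)}"

lemma finite_level_grid: "finite (level_grid k n)"
  by (simp add: level_grid_def)

lemma card_level_grid: "real (card (level_grid k n)) \<le> 3 * 2 ^ n * 2 ^ (n * k)"
proof -
  let ?a = "int n * 2 ^ (n * k)"
  have "card (level_grid k n) \<le> card {- ?a..?a}" unfolding level_grid_def by (rule card_image_le) simp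
  also have "\<dots> = nat (2 * ?a + 1)" by simp
  finally have "real (card (level_grid k n)) \<le> real (nat (2 * ?a + 1))" by (rule of_nat_mono)
  also have "\<dots> = 2 * real n * 2 ^ (n * k) + 1" by simp
  also have "\<dots> \<le> 2 * real n * 2 ^ (n * k) + 1 * 2 ^ (n * k)" by (intro add_left_mono) simp
  also have "\<dots> = (2 * real n + 1) * 2 ^ (n * k)" by (simp add: algebra_simps)
  also have "\<dots> \<le> (3 * 2 ^ n) * 2 ^ (n * k)"
  proof (intro mult_right_mono)
    have "real n \<le> 2 ^ n" using of_nat_less_two_power[of n] by (metis less_imp_le of_nat_less_iff of_nat_numeral of_nat_power)
    moreover have "(1::real) \<le> 2 ^ n" by simp
    ultimately show "2 * real n + 1 \<le> 3 * 2 ^ n" by linarith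
  qed simp
  finally show ?thesis .
qed

lemma level_grid_near:
  assumes "\<bar>y\<bar> \<le> real n"
  obtains y' where "y' \<in> level_grid k n" "\<bar>y - y'\<bar> \<le> 1 / 2 ^ (n * k)"
proof -
  define i where "i = \<lfloor>y * 2 ^ (n * k)\<rfloor>"
  have "- real n * 2 ^ (n * k) \<le> y * 2 ^ (n * k)" by (rule mult_right_mono) (use assms in auto)
  moreover have "y * 2 ^ (n * k) \<le> real n * 2 ^ (n * k)" by (rule mult_right_mono) (use assms in auto)
  ultimately have "i \<in> {- (int n * 2 ^ (n * k))..int n * 2 ^ (n * k)}"
    unfolding i_def atLeastAtMost_iff le_floor_iff floor_le_iff of_int_minus of_int_mult of_int_of_nat_eq of_int_power of_int_numeral
    by linarith
  moreover have "\<bar>y - real_of_int i / 2 ^ (n * k)\<bar> \<le> 1 / 2 ^ (n * k)"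
  proof -
    have "\<bar>y * 2 ^ (n * k) - real_of_int i\<bar> \<le> 1" unfolding i_def by linarith
    then have "\<bar>y * 2 ^ (n * k) - real_of_int i\<bar> / 2 ^ (n * k) \<le> 1 / 2 ^ (n * k)" by (intro divide_right_mono) auto
    moreover have "\<bar>y * 2 ^ (n * k) - real_of_int i\<bar> / 2 ^ (n * k) = \<bar>y - real_of_int i / 2 ^ (n * k)\<bar>"
    proof -
      have "\<bar>A - I\<bar> / c = \<bar>A / c - I / c\<bar>" if "c > 0" for A I c :: real
        using that by (simp add: abs_divide diff_divide_distrib[symmetric])
      from this[of "2 ^ (n * k)" "y * 2 ^ (n * k)" "real_of_int i"] show ?thesis by simp
    qed
    ultimately show ?thesis by simp
  qed
  ultimately show thesis by (intro that[of "real_of_int i / 2 ^ (n * k)"]) (auto simp: level_grid_def)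
qed

text \<open>The number of levels grows exponentially in \<open>n\<close>, which a factor \<open>exp (- c \<mu>\<^sup>n)\<close> beats:
  \<open>exp x \<ge> (x / m)\<^sup>m\<close> for a power \<open>m\<close> with \<open>\<mu>\<^sup>m \<ge> 2\<^bsup>k+2\<^esup>\<close>.\<close>

lemma level_grid_summable:
  assumes c: "0 < c" and mu: "1 < \<mu>"
  shows "summable (\<lambda>n. real (card (level_grid k n)) * exp (- (c * \<mu> ^ n)))"
proof -
  obtain m0 where m0: "2 ^ (k + 2) < \<mu> ^ m0" using real_arch_pow[OF mu] by blast
  define m where "m = Suc m0"
  have "\<mu> ^ m0 \<le> \<mu> ^ m" unfolding m_def using mu by (intro power_increasing) auto
  with m0 have m: "2 ^ (k + 2) \<le> \<mu> ^ m" by linarith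
  have m1: "0 < m" by (simp add: m_def)
  have "summable (\<lambda>n. 3 * (real m / c) ^ m * (1/2) ^ n)"
    by (intro summable_mult summable_geometric) simp
  then show ?thesis
  proof (rule summable_comparison_test'[where N=0])
    fix n
    define x where "x = c * \<mu> ^ n"
    have x: "x > 0" using c mu by (simp add: x_def)
    have "(x / m) ^ m \<le> exp (x / m) ^ m" using x order.trans[OF _ exp_ge_add_one_self[of "x / m"], of "x / m"] by (intro power_mono) auto
    also have "\<dots> = exp x" using m1 by (simp add: exp_of_nat_mult[symmetric])
    finally have "exp (- x) \<le> 1 / (x / m) ^ m" using x m1 by (simp add: exp_minus field_simps)
    also have "\<dots> = (real m / c) ^ m * (1 / (\<mu> ^ m) ^ n)"
      using c mu by (simp add: x_def power_divide power_mult_distrib power_mult[symmetric] mult.commute)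
    also have "\<dots> \<le> (real m / c) ^ m * (1 / (2 ^ (k + 2)) ^ n)"
      using c m mu by (intro mult_left_mono divide_left_mono power_mono) auto
    finally have "real (card (level_grid k n)) * exp (- x) \<le> (3 * 2 ^ n * 2 ^ (n * k)) * ((real m / c) ^ m * (1 / (2 ^ (k + 2)) ^ n))"
      using card_level_grid by (intro mult_mono) auto
    also have "\<dots> = 3 * (real m / c) ^ m * (1/2) ^ n"
    proof -
      have e: "((2::real) ^ (k + 2)) ^ n = 2 ^ (n * k) * 2 ^ n * 2 ^ n"
        unfolding power_mult[symmetric] power_add[symmetric] by (simp add: algebra_simps)
      have "3 * Q * P * (A * (1 / (P * Q * Q))) = 3 * A * (1 / Q)" if "P > 0" "Q > 0" for P Q A :: real
        using that by (simp add: field_simps)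
      from this[of "2 ^ (n * k)" "2 ^ n" "(real m / c) ^ m"] show ?thesis unfolding e power_one_over by simp
    qed
    finally show "norm (real (card (level_grid k n)) * exp (- (c * \<mu> ^ n))) \<le> 3 * (real m / c) ^ m * (1/2) ^ n"
      by (simp add: x_def)
  qed
qed

section \<open>Convergence at a fixed time\<close>

locale counted_local_times = holder_marked_process M X \<alpha> N Z q \<zeta> \<gamma> D
  for M :: "'a measure" and X :: "real \<Rightarrow> 'a \<Rightarrow> real" and \<alpha> :: real and N :: "'b measure"
    and Z :: "'b \<Rightarrow> real \<Rightarrow> real" and q :: real and \<zeta> :: "real \<Rightarrow> 'a \<Rightarrow> real \<Rightarrow> real"
    and \<gamma> :: real and D :: "'b \<Rightarrow> real" +
  fixes L :: "real \<Rightarrow> real \<Rightarrow> 'a \<Rightarrow> real" and c :: real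
  assumes local_times: "local_times M X L"
    and c_pos: "0 < c" and c_eq: "ennreal ((1 + \<alpha>) / Gamma (1 - \<alpha>)) * mean_Z_power = ennreal c"
begin

abbreviation "\<beta> \<equiv> \<alpha> / q"

lemma beta_pos: "0 < \<beta>" using alpha q_pos by simp

text \<open>The total mass of the intensity, which tends to \<open>c\<close> as \<open>\<rho>\<close> tends to \<open>0\<close>.\<close>

definition mass :: "real \<Rightarrow> real" where
  "mass \<rho> = (LINT u|lborel. intensity (ramp \<rho> 1) u)"

lemma mass_facts:
  assumes r: "0 < \<rho>"
  shows "integrable lborel (intensity (ramp \<rho> 1))" "mass \<rho> \<le> c" "(1 + \<rho>) powr (- \<beta>) * c \<le> mass \<rho>" "0 \<le> mass \<rho>"
proof -
  note T = threshold_ramp[OF r zero_less_one]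
  have g0: "0 \<le> intensity (ramp \<rho> 1) u" for u by (rule intensity_nonneg[OF T])
  have m: "intensity (ramp \<rho> 1) \<in> borel_measurable lborel" using intensity_facts(5)[OF T] by simp
  have le: "(\<integral>\<^sup>+u. ennreal (intensity (ramp \<rho> 1) u) \<partial>lborel) \<le> ennreal c"
    using nn_integral_intensity_ramp(1)[OF r] by (simp add: c_eq)
  show i: "integrable lborel (intensity (ramp \<rho> 1))"
    by (rule integrableI_nonneg[OF m]) (use g0 le in \<open>auto intro: le_less_trans\<close>)
  have eq: "(\<integral>\<^sup>+u. ennreal (intensity (ramp \<rho> 1) u) \<partial>lborel) = ennreal (mass \<rho>)"
    unfolding mass_def by (rule nn_integral_eq_integral[OF i]) (use g0 in auto)
  show m0: "0 \<le> mass \<rho>" unfolding mass_def by (intro Bochner_Integration.integral_nonneg g0)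
  show "mass \<rho> \<le> c" using le c_pos by (simp add: eq)
  have "ennreal ((1 + \<rho>) powr (- \<beta>) * c) = ennreal ((1 + \<rho>) powr (- \<beta>)) * (ennreal ((1 + \<alpha>) / Gamma (1 - \<alpha>)) * mean_Z_power)"
    using c_pos by (simp add: c_eq ennreal_mult')
  also have "\<dots> = ennreal ((1 + \<alpha>) / Gamma (1 - \<alpha>) * (1 + \<rho>) powr (- \<alpha> / q)) * mean_Z_power"
  proof -
    have "ennreal ((1 + \<alpha>) / Gamma (1 - \<alpha>) * (1 + \<rho>) powr (- \<alpha> / q)) =
      ennreal ((1 + \<alpha>) / Gamma (1 - \<alpha>)) * ennreal ((1 + \<rho>) powr (- \<beta>))"
      unfolding minus_divide_left by (rule ennreal_mult'') simp
    then show ?thesis by (simp only: mult_ac)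
  qed
  also have "\<dots> \<le> ennreal (mass \<rho>)" using nn_integral_intensity_ramp(2)[OF r] by (simp add: eq)
  finally show "(1 + \<rho>) powr (- \<beta>) * c \<le> mass \<rho>" using m0 by (simp add: ennreal_le_iff)
qed

text \<open>The mark heights decrease geometrically, so that each small \<open>h\<close> is within a factor \<open>1 + \<rho>\<close> of one of them.\<close>

definition level :: "real \<Rightarrow> nat \<Rightarrow> real" where
  "level \<rho> n = (1 + \<rho>) powr (- real n)"

definition compensator :: "real \<Rightarrow> nat \<Rightarrow> real \<Rightarrow> real \<Rightarrow> 'a \<Rightarrow> real" where
  "compensator \<rho> n y t \<omega> = (LINT s:{0..t}|lborel. intensity (ramp \<rho> (level \<rho> n)) (y - X s \<omega>))"

lemma level_pos: "0 < \<rho> \<Longrightarrow> 0 < level \<rho> n"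
  by (simp add: level_def)

lemma level_powr: "level \<rho> n powr p = (1 + \<rho>) powr (- real n * p)"
  by (simp add: level_def powr_powr)

text \<open>The mesh \<open>2\<^bsup>-n kg\<^esup>\<close> is such that a path with Hoelder constant \<open>2\<^sup>n\<close> varies by at most \<open>4\<^bsup>-n\<^esup>\<close> over it.\<close>

definition kg :: nat where "kg = nat \<lceil>3 / \<gamma>\<rceil>"

lemma kg: "3 \<le> real kg * \<gamma>" "1 \<le> kg"
proof -
  have "3 / \<gamma> \<le> real kg" unfolding kg_def by linarith
  then show "3 \<le> real kg * \<gamma>" using gamma by (simp add: field_simps)
  then show "1 \<le> kg" by (cases kg) auto
qed

text \<open>For \<open>\<theta> = \<rho>\<close> this bounds the count from above by nearly its compensator, for \<open>\<theta> = - \<rho>\<close> from below.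
  Both are of order \<open>b\<^bsup>-\<beta>\<^esup>\<close> at the height \<open>b\<close>; after division by \<open>\<rho>\<close> the error is \<open>\<rho> b\<^bsup>-\<beta>\<^esup>\<close>.\<close>

definition count_bounds :: "real \<Rightarrow> real \<Rightarrow> 'a \<Rightarrow> nat \<Rightarrow> real \<Rightarrow> bool" where
  "count_bounds \<rho> t \<omega> n y \<longleftrightarrow>
    (\<forall>\<theta>\<in>{\<rho>, - \<rho>}. \<exists>\<^sub>F k in sequentially. \<theta> * smooth_count (ramp \<rho> (level \<rho> n)) k y t \<omega> -
      (exp \<theta> - 1) * (LINT s:{0..t}|lborel. intensity_upto (ramp \<rho> (level \<rho> n)) k (y - X s \<omega>)) < \<rho>\<^sup>2 * level \<rho> n powr (- \<beta>))"

text \<open>The number of levels is exponential in \<open>n\<close>, whereas \<open>b\<^bsup>-\<beta>\<^esup>\<close> grows geometrically and appears in the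
  exponent of the probabilities.\<close>

lemma count_bounds_eventually:
  assumes r: "0 < \<rho>" and t: "0 < t"
  shows "AE \<omega> in M. \<forall>\<^sub>F n in sequentially. \<forall>y\<in>level_grid kg n. count_bounds \<rho> t \<omega> n y"
proof -
  have eq: "level \<rho> n powr (- \<beta>) = ((1 + \<rho>) powr \<beta>) ^ n" for n
  proof -
    have "((1 + \<rho>) powr \<beta>) ^ n = ((1 + \<rho>) powr \<beta>) powr real n"
      by (rule powr_realpow[symmetric]) (use r in simp)
    then show ?thesis by (simp add: level_powr powr_powr mult.commute)
  qed
  have "1 < (1 + \<rho>) powr \<beta>" using r beta_pos by (intro gr_one_powr) auto
  then have s: "summable (\<lambda>n. real (card (level_grid kg n)) * exp (- (\<rho>\<^sup>2 * level \<rho> n powr (- \<beta>))))"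
    unfolding eq using r by (intro level_grid_summable) auto
  note E = smooth_count_eventually[where G="\<lambda>n. ramp \<rho> (level \<rho> n)" and b="level \<rho>" and Y="level_grid kg"
      and x="\<lambda>n. \<rho>\<^sup>2 * level \<rho> n powr (- \<beta>)", OF t threshold_ramp[OF r level_pos[OF r]] finite_level_grid s]
  show ?thesis using E[where \<theta>="\<rho>"] E[where \<theta>="- \<rho>"]
  proof eventually_elim
    case (elim \<omega>)
    then show ?case by (auto simp: count_bounds_def elim: eventually_elim2)
  qed
qed

lemma exp_bounds:
  fixes \<rho> :: real
  assumes "0 < \<rho>" "\<rho> \<le> 1"
  shows "exp \<rho> - 1 \<le> \<rho> * (1 + \<rho>)" "\<rho> * (1 - \<rho>) \<le> 1 - exp (- \<rho>)"
proof -
  show "exp \<rho> - 1 \<le> \<rho> * (1 + \<rho>)"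
    using exp_bound[of \<rho>] assms by (simp add: power2_eq_square algebra_simps)
  have "exp (- \<rho>) \<le> 1 / (1 + \<rho>)"
    using exp_ge_add_one_self[of \<rho>] assms by (simp add: exp_minus inverse_eq_divide frac_le)
  also have "\<dots> \<le> 1 - \<rho> + \<rho> * \<rho>"
  proof -
    have "(1 - \<rho> + \<rho> * \<rho>) * (1 + \<rho>) = 1 + \<rho> * \<rho> * \<rho>" by (simp add: algebra_simps)
    moreover have "0 \<le> \<rho> * \<rho> * \<rho>" using assms by auto
    ultimately have "1 \<le> (1 - \<rho> + \<rho> * \<rho>) * (1 + \<rho>)" by linarith
    then show ?thesis using assms by (simp add: pos_divide_le_eq)
  qed
  finally show "\<rho> * (1 - \<rho>) \<le> 1 - exp (- \<rho>)" by (simp add: algebra_simps)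
qed

text \<open>The continuous mark count at a level of the grid bounds the count at all levels nearby, since
  the marks vary by at most \<open>4\<^bsup>-n\<^esup>\<close> over the mesh.\<close>

lemma count_marks_bounds:
  assumes \<omega>: "\<omega> \<in> space M" and r: "0 < \<rho>" "\<rho> \<le> 1" and t: "0 < t"
    and cb: "count_bounds \<rho> t \<omega> n y"
    and H: "\<forall>s\<in>{0<..t}. \<forall>u v. \<bar>\<zeta> s \<omega> u - \<zeta> s \<omega> v\<bar> \<le> 2 ^ n * \<bar>u - v\<bar> powr \<gamma>"
    and small: "(1/4) ^ n \<le> level \<rho> n * \<rho> / (1 + \<rho>)"
    and y': "\<bar>y' - y\<bar> \<le> 1 / 2 ^ (n * kg)"
  shows "level \<rho> n * (1 + \<rho>)\<^sup>2 \<le> h \<Longrightarrow>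
      count_marks h y' t \<omega> \<le> ennreal ((1 + \<rho>) * compensator \<rho> n y t \<omega> + \<rho> * level \<rho> n powr (- \<beta>))"
    and "0 < h \<Longrightarrow> h \<le> level \<rho> n / (1 + \<rho>) \<Longrightarrow>
      ennreal ((1 - \<rho>) * compensator \<rho> n y t \<omega> - \<rho> * level \<rho> n powr (- \<beta>)) \<le> count_marks h y' t \<omega>"
proof -
  define b where "b = level \<rho> n"
  have b: "0 < b" using level_pos[OF r(1)] by (simp add: b_def)
  note T = threshold_ramp[OF r(1) b]
  define A where "A = compensator \<rho> n y t \<omega>"
  define x where "x = b powr (- \<beta>)"
  define I where "I j = (LINT s:{0..t}|lborel. intensity_upto (ramp \<rho> b) j (y - X s \<omega>))" for j
  note TI = time_integral_intensity_tendsto[OF T \<omega> less_imp_le[OF t], where y=y]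
  have IA: "I \<longlonglongrightarrow> A" "\<And>j. I j \<le> A" using TI by (auto simp: I_def[abs_def] A_def compensator_def b_def)
  have A0: "0 \<le> A" unfolding A_def compensator_def set_lebesgue_integral_def
    by (intro Bochner_Integration.integral_nonneg) (use intensity_nonneg[OF T] in \<open>auto simp: b_def indicator_def\<close>)
  have x0: "0 \<le> x" by (simp add: x_def)
  note cb' = cb[unfolded count_bounds_def, folded b_def, folded I_def x_def]
  have osc: "\<bar>\<zeta> s \<omega> (y' - l) - \<zeta> s \<omega> (y - l)\<bar> \<le> b * \<rho> / (1 + \<rho>)" if s: "s \<in> {0<..t}" for s l
  proof -
    have "\<bar>\<zeta> s \<omega> (y' - l) - \<zeta> s \<omega> (y - l)\<bar> \<le> 2 ^ n * \<bar>(y' - l) - (y - l)\<bar> powr \<gamma>" using H s by blast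
    also have "\<dots> \<le> 2 ^ n * (1 / 2 ^ (n * kg)) powr \<gamma>"
      using y' gamma by (intro mult_left_mono powr_mono2) auto
    also have "(1 / 2 ^ (n * kg)) powr \<gamma> = 2 powr (- (real n * (real kg * \<gamma>)))"
      by (simp add: powr_divide powr_minus_divide powr_realpow[symmetric] powr_powr mult.assoc)
    also have "2 ^ n * \<dots> \<le> 2 ^ n * 2 powr (- (real n * 3))"
      using kg(1) by (intro mult_left_mono powr_mono) (auto intro!: mult_left_mono)
    also have "\<dots> = 2 powr (real n * (- 2))"
    proof -
      have "(2::real) ^ n = 2 powr real n" by (rule powr_realpow[symmetric]) simp
      then show ?thesis by (simp add: powr_add[symmetric] algebra_simps)
    qed
    also have "\<dots> = (2 powr (- 2)) ^ n"
      by (subst powr_realpow[symmetric], simp, subst powr_powr) (simp add: mult.commute)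
    also have "\<dots> = (1/4) ^ n" by (simp add: powr_minus_divide)
    finally show ?thesis using small by (simp add: b_def)
  qed
  show "count_marks h y' t \<omega> \<le> ennreal ((1 + \<rho>) * compensator \<rho> n y t \<omega> + \<rho> * level \<rho> n powr (- \<beta>))"
    if h: "level \<rho> n * (1 + \<rho>)\<^sup>2 \<le> h"
    unfolding A_def[symmetric] x_def[symmetric, unfolded b_def]
  proof (rule count_marks_le[OF \<omega>, where G="ramp \<rho> b" and y'=y])
    show "0 < h" using h b r by (intro less_le_trans[OF _ h]) (auto simp: b_def[symmetric])
    show "0 \<le> (1 + \<rho>) * A + \<rho> * x" using A0 x0 r by auto
    have "\<exists>\<^sub>F k in sequentially. \<rho> * smooth_count (ramp \<rho> b) k y t \<omega> - (exp \<rho> - 1) * I k < \<rho>\<^sup>2 * x"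
      using cb' by blast
    then show "\<exists>\<^sub>F k in sequentially. smooth_count (ramp \<rho> b) k y t \<omega> \<le> (1 + \<rho>) * A + \<rho> * x"
    proof (rule frequently_elim1)
      fix k assume k: "\<rho> * smooth_count (ramp \<rho> b) k y t \<omega> - (exp \<rho> - 1) * I k < \<rho>\<^sup>2 * x"
      have "(exp \<rho> - 1) * I k \<le> (exp \<rho> - 1) * A" using r IA(2) by (intro mult_left_mono) auto
      also have "\<dots> \<le> \<rho> * (1 + \<rho>) * A" using exp_bounds[OF r] A0 by (intro mult_right_mono)
      finally have "\<rho> * smooth_count (ramp \<rho> b) k y t \<omega> \<le> \<rho> * ((1 + \<rho>) * A + \<rho> * x)"
        using k by (simp add: power2_eq_square algebra_simps)
      then show "smooth_count (ramp \<rho> b) k y t \<omega> \<le> (1 + \<rho>) * A + \<rho> * x" using r by simp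
    qed
    show "1 \<le> ramp \<rho> b (\<zeta> s \<omega> (y - lX \<omega> s))" if s: "s \<in> {0<..t}" "h \<le> \<zeta> s \<omega> (y' - lX \<omega> s)" for s
    proof -
      have "b * \<rho> / (1 + \<rho>) \<le> b * \<rho> * (1 + \<rho>)"
      proof -
        have "b * \<rho> / (1 + \<rho>) \<le> b * \<rho> / 1" using b r by (intro divide_left_mono) auto
        also have "\<dots> \<le> b * \<rho> * (1 + \<rho>)" using b r by simp
        finally show ?thesis .
      qed
      moreover have "b * (1 + \<rho>)\<^sup>2 = b * (1 + \<rho>) + b * \<rho> * (1 + \<rho>)" by (simp add: power2_eq_square algebra_simps)
      ultimately have "b * (1 + \<rho>) \<le> \<zeta> s \<omega> (y - lX \<omega> s)"
        using osc[OF s(1), of "lX \<omega> s"] s(2) h unfolding b_def[symmetric] by linarith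
      then show ?thesis using ramp_eq_1[OF r(1) b] by simp
    qed
  qed (rule ramp_bounds)
  show "ennreal ((1 - \<rho>) * compensator \<rho> n y t \<omega> - \<rho> * level \<rho> n powr (- \<beta>)) \<le> count_marks h y' t \<omega>"
    if h: "0 < h" "h \<le> level \<rho> n / (1 + \<rho>)"
    unfolding A_def[symmetric] x_def[symmetric, unfolded b_def]
  proof (cases "count_marks h y' t \<omega>")
    case (real m)
    have S: "smooth_count (ramp \<rho> b) k y t \<omega> \<le> m" for k
    proof -
      have "ennreal (smooth_count (ramp \<rho> b) k y t \<omega>) \<le> count_marks h y' t \<omega>"
      proof (rule smooth_count_le_count_marks[OF \<omega>])
        show "h \<le> \<zeta> s \<omega> (y' - lX \<omega> s)" if s: "s \<in> {0<..t}" "0 < ramp \<rho> b (\<zeta> s \<omega> (y - lX \<omega> s))" for s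
        proof -
          have "b < \<zeta> s \<omega> (y - lX \<omega> s)" using ramp_eq_0[OF r(1) b] s(2) by (metis less_irrefl not_less)
          moreover have "b / (1 + \<rho>) = b - b * \<rho> / (1 + \<rho>)" using r by (simp add: field_simps)
          ultimately show ?thesis using osc[OF s(1), of "lX \<omega> s"] h(2) unfolding b_def[symmetric] by linarith
        qed
      qed (rule ramp_bounds)+
      then show ?thesis using real by (simp add: ennreal_le_iff)
    qed
    have f: "\<exists>\<^sub>F k in sequentially. - \<rho> * smooth_count (ramp \<rho> b) k y t \<omega> - (exp (- \<rho>) - 1) * I k < \<rho>\<^sup>2 * x"
      using cb' by blast
    have "(1 - exp (- \<rho>)) * A \<le> \<rho>\<^sup>2 * x + \<rho> * m"
    proof (rule ccontr)
      assume "\<not> ?thesis"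
      moreover have "(\<lambda>k. (1 - exp (- \<rho>)) * I k) \<longlonglongrightarrow> (1 - exp (- \<rho>)) * A" by (intro tendsto_intros IA)
      ultimately have "\<forall>\<^sub>F k in sequentially. \<rho>\<^sup>2 * x + \<rho> * m < (1 - exp (- \<rho>)) * I k"
        by (intro order_tendstoD(1)) auto
      from frequently_ex[OF frequently_eventually_frequently[OF f this]]
      obtain k where k: "- \<rho> * smooth_count (ramp \<rho> b) k y t \<omega> - (exp (- \<rho>) - 1) * I k < \<rho>\<^sup>2 * x"
        "\<rho>\<^sup>2 * x + \<rho> * m < (1 - exp (- \<rho>)) * I k" by blast
      have "\<rho> * smooth_count (ramp \<rho> b) k y t \<omega> \<le> \<rho> * m" using S r by (intro mult_left_mono) auto
      moreover have "(exp (- \<rho>) - 1) * I k = - ((1 - exp (- \<rho>)) * I k)" by (simp add: algebra_simps)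
      ultimately show False using k by simp
    qed
    moreover have "\<rho> * (1 - \<rho>) * A \<le> (1 - exp (- \<rho>)) * A" using exp_bounds[OF r] A0 by (intro mult_right_mono)
    ultimately have "\<rho> * ((1 - \<rho>) * A - \<rho> * x) \<le> \<rho> * m" by (simp add: power2_eq_square algebra_simps)
    then have "(1 - \<rho>) * A - \<rho> * x \<le> m" using r by simp
    then show "ennreal ((1 - \<rho>) * A - \<rho> * x) \<le> count_marks h y' t \<omega>" unfolding real by (rule ennreal_leI)
  qed simp
qed

text \<open>By the occupation density formula the compensator is the convolution of the local time with the
  intensity, which by scaling is \<open>b\<^bsup>-\<beta>\<^esup>\<close> times an approximate identity at the scale \<open>b\<^bsup>1/q\<^esup>\<close>, of mass
  \<open>mass \<rho>\<close>.\<close>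

lemma compensator_tendsto_local_time:
  assumes r: "0 < \<rho>" and l: "continuous_on UNIV l" "\<And>y. \<bar>l y\<bar> \<le> B" "uniformly_continuous_on UNIV l"
    and occ: "\<And>n y. y \<in> level_grid kg n \<Longrightarrow>
      has_bochner_integral lborel (\<lambda>w. intensity (ramp \<rho> (level \<rho> n)) (y - w) * l w) (compensator \<rho> n y t \<omega>)"
    and e: "0 < e"
  shows "\<forall>\<^sub>F n in sequentially. \<forall>y\<in>level_grid kg n. \<bar>level \<rho> n powr \<beta> * compensator \<rho> n y t \<omega> - mass \<rho> * l y\<bar> \<le> e"
proof -
  obtain d where d: "d > 0" "\<And>\<delta> y. 0 < \<delta> \<Longrightarrow> \<delta> < d \<Longrightarrow>
     \<bar>(LINT u|lborel. intensity (ramp \<rho> 1) u * l (y - \<delta> * u)) - mass \<rho> * l y\<bar> \<le> e"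
    using approximate_identity[OF mass_facts(1)[OF r] intensity_nonneg[OF threshold_ramp[OF r zero_less_one]] l e]
    unfolding mass_def by blast
  have "(\<lambda>n. ((1 + \<rho>) powr (- 1 / q)) ^ n) \<longlonglongrightarrow> 0"
    using r q_pos by (intro LIMSEQ_realpow_zero) (auto simp: powr_less_one)
  then have "\<forall>\<^sub>F n in sequentially. ((1 + \<rho>) powr (- 1 / q)) ^ n < d" using d(1) by (intro order_tendstoD)
  then show ?thesis
  proof (eventually_elim, intro ballI)
    fix n y assume n: "((1 + \<rho>) powr (- 1 / q)) ^ n < d" and y: "y \<in> level_grid kg n"
    define b where "b = level \<rho> n"
    have b: "0 < b" using level_pos[OF r] by (simp add: b_def)
    define \<delta> where "\<delta> = b powr (1 / q)"
    have \<delta>: "0 < \<delta>" using b by (simp add: \<delta>_def)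
    have "\<delta> = ((1 + \<rho>) powr (- 1 / q)) ^ n"
    proof -
      have "((1 + \<rho>) powr (- 1 / q)) ^ n = ((1 + \<rho>) powr (- 1 / q)) powr real n"
        by (rule powr_realpow[symmetric]) (use r in simp)
      also have "\<dots> = (1 + \<rho>) powr (- real n * (1 / q))" by (simp add: powr_powr mult.commute)
      finally show ?thesis by (simp only: \<delta>_def b_def level_powr)
    qed
    then have \<delta>d: "\<delta> < d" using n by simp
    have "compensator \<rho> n y t \<omega> = (LINT w|lborel. intensity (ramp \<rho> b) (y - w) * l w)"
      using has_bochner_integral_integral_eq[OF occ[OF y]] by (simp add: b_def)
    also have "\<dots> = \<bar>- \<delta>\<bar> *\<^sub>R (LINT u|lborel. intensity (ramp \<rho> b) (y - (y + (- \<delta>) * u)) * l (y + (- \<delta>) * u))"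
      by (rule lborel_integral_real_affine) (use \<delta> in simp)
    also have "(LINT u|lborel. intensity (ramp \<rho> b) (y - (y + (- \<delta>) * u)) * l (y + (- \<delta>) * u)) =
      (LINT u|lborel. b powr (- (1 + \<alpha>) / q) * (intensity (ramp \<rho> 1) u * l (y - \<delta> * u)))"
    proof (intro Bochner_Integration.integral_cong refl)
      fix u
      have "intensity (ramp \<rho> b) (\<delta> * u) = b powr (- (1 + \<alpha>) / q) * intensity (ramp \<rho> 1) (\<delta> * u / b powr (1 / q))"
        by (rule intensity_ramp_scaling[OF r b])
      also have "\<delta> * u / b powr (1 / q) = u" using \<delta> by (simp add: \<delta>_def[symmetric])
      finally show "intensity (ramp \<rho> b) (y - (y + (- \<delta>) * u)) * l (y + (- \<delta>) * u) =
        b powr (- (1 + \<alpha>) / q) * (intensity (ramp \<rho> 1) u * l (y - \<delta> * u))" by simp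
    qed
    also have "\<bar>- \<delta>\<bar> *\<^sub>R \<dots> = \<delta> * b powr (- (1 + \<alpha>) / q) * (LINT u|lborel. intensity (ramp \<rho> 1) u * l (y - \<delta> * u))"
      using \<delta> by simp
    also have "\<delta> * b powr (- (1 + \<alpha>) / q) = b powr (- \<beta>)"
    proof -
      have e: "1 / q + - (1 + \<alpha>) / q = - \<beta>" using q_pos by (simp add: field_simps)
      show ?thesis unfolding \<delta>_def powr_add[symmetric] e ..
    qed
    finally have "b powr \<beta> * compensator \<rho> n y t \<omega> = (b powr \<beta> * b powr (- \<beta>)) * (LINT u|lborel. intensity (ramp \<rho> 1) u * l (y - \<delta> * u))"
      by simp
    also have "b powr \<beta> * b powr (- \<beta>) = 1" using b by (simp add: powr_add[symmetric])
    finally show "\<bar>level \<rho> n powr \<beta> * compensator \<rho> n y t \<omega> - mass \<rho> * l y\<bar> \<le> e"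
      using d(2)[OF \<delta> \<delta>d, of y] by (simp add: b_def)
  qed
qed

end

context counted_local_times
begin

text \<open>At a place where the local time is \<open>l\<close>, the normalised count lies between the lower and the upper
  factor. The powers of \<open>1 + \<rho>\<close> stem from the comparison of \<open>h\<close> with the heights of the grid, the
  terms \<open>l \<plusminus> \<rho>\<close> from the oscillation of the local time over the mesh.\<close>

definition upper_factor :: "real \<Rightarrow> real \<Rightarrow> real" where
  "upper_factor \<rho> l = (1 + \<rho>) powr (3 * \<beta>) * ((1 + \<rho>) * (c * (l + \<rho>) + \<rho>) + \<rho>) / c"

definition lower_factor :: "real \<Rightarrow> real \<Rightarrow> real" where
  "lower_factor \<rho> l = (1 + \<rho>) powr (- 2 * \<beta>) * ((1 - \<rho>) * ((1 + \<rho>) powr (- \<beta>) * c * (l - \<rho>) - \<rho>) - \<rho>) / c"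

text \<open>Both factors are affine in \<open>l\<close> and tend to \<open>l\<close>, so it suffices to compare at the ends of \<open>[0, B]\<close>.\<close>

lemma factors_close:
  assumes B: "0 \<le> B" and e: "0 < e"
  shows "\<exists>r::nat. \<forall>l\<in>{0..B}. upper_factor (1 / real (Suc r)) l \<le> l + e \<and> l - e \<le> lower_factor (1 / real (Suc r)) l"
proof -
  define \<rho> where "\<rho> r = 1 / real (Suc r)" for r
  have \<rho>: "\<rho> \<longlonglongrightarrow> 0" unfolding \<rho>_def[abs_def] by (rule lim_const_over_n[THEN LIMSEQ_Suc])
  have p1: "(\<lambda>r. 1 + \<rho> r) \<longlonglongrightarrow> 1" using tendsto_add[OF tendsto_const \<rho>, of 1] by simp
  have pw: "(\<lambda>r. (1 + \<rho> r) powr p) \<longlonglongrightarrow> 1" for p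
    using tendsto_powr[OF p1 tendsto_const, of p] by simp
  have m1: "(\<lambda>r. 1 - \<rho> r) \<longlonglongrightarrow> 1" using tendsto_diff[OF tendsto_const \<rho>, of 1] by simp
  have U: "(\<lambda>r. upper_factor (\<rho> r) l) \<longlonglongrightarrow> l" for l
  proof -
    have "(\<lambda>r. upper_factor (\<rho> r) l) \<longlonglongrightarrow> 1 * (1 * (c * (l + 0) + 0) + 0) / c"
      unfolding upper_factor_def by (intro tendsto_intros pw p1 \<rho>) (use c_pos in auto)
    then show ?thesis using c_pos by simp
  qed
  have V: "(\<lambda>r. lower_factor (\<rho> r) l) \<longlonglongrightarrow> l" for l
  proof -
    have "(\<lambda>r. lower_factor (\<rho> r) l) \<longlonglongrightarrow> 1 * (1 * (1 * c * (l - 0) - 0) - 0) / c"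
      unfolding lower_factor_def by (intro tendsto_intros pw m1 \<rho>) (use c_pos in auto)
    then show ?thesis using c_pos by simp
  qed
  have "\<forall>\<^sub>F r in sequentially. upper_factor (\<rho> r) 0 < 0 + e \<and> upper_factor (\<rho> r) B < B + e \<and>
     0 - e < lower_factor (\<rho> r) 0 \<and> B - e < lower_factor (\<rho> r) B"
    using e by (intro eventually_conj order_tendstoD(2)[OF U] order_tendstoD(1)[OF V]) auto
  then obtain r where r: "upper_factor (\<rho> r) 0 < 0 + e" "upper_factor (\<rho> r) B < B + e"
     "0 - e < lower_factor (\<rho> r) 0" "B - e < lower_factor (\<rho> r) B"
    by (auto simp: eventually_sequentially)
  have affine: "p * l + s \<le> e" if "p * 0 + s \<le> e" "p * B + s \<le> e" "0 \<le> l" "l \<le> B" for p s l :: real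
  proof (cases "0 \<le> p")
    case True
    then have "p * l \<le> p * B" using that by (intro mult_left_mono)
    with that show ?thesis by linarith
  next
    case False
    then have "p * l \<le> 0" using that by (simp add: mult_nonpos_nonneg)
    with that show ?thesis by linarith
  qed
  show ?thesis
  proof (intro exI[of _ r] ballI conjI)
    fix l assume l: "l \<in> {0..B}"
    have u: "upper_factor (\<rho> r) l - l = ((1 + \<rho> r) powr (3 * \<beta>) * (1 + \<rho> r) - 1) * l + upper_factor (\<rho> r) 0" for l
      using c_pos by (simp add: upper_factor_def field_simps)
    have "upper_factor (\<rho> r) l - l \<le> e"
      unfolding u by (rule affine) (use l r u[of B] u[of 0] in auto)
    then show "upper_factor (1 / real (Suc r)) l \<le> l + e" by (simp add: \<rho>_def)
    have v: "l - lower_factor (\<rho> r) l = (1 - (1 + \<rho> r) powr (- 2 * \<beta>) * (1 - \<rho> r) * (1 + \<rho> r) powr (- \<beta>)) * l - lower_factor (\<rho> r) 0" for l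
      using c_pos by (simp add: lower_factor_def field_simps)
    have "l - lower_factor (\<rho> r) l \<le> e"
      unfolding v diff_conv_add_uminus[of _ "lower_factor (\<rho> r) 0"]
      by (rule affine) (use l r v[of B] v[of 0] in auto)
    then show "l - e \<le> lower_factor (1 / real (Suc r)) l" by (simp add: \<rho>_def)
  qed
qed

text \<open>The occupation density formula at time \<open>t\<close>, for the countably many functions to which it is applied.\<close>

definition local_good :: "real \<Rightarrow> 'a \<Rightarrow> bool" where
  "local_good t \<omega> \<longleftrightarrow>
    (\<forall>r n. \<forall>y\<in>level_grid kg n. has_bochner_integral lborel
        (\<lambda>w. intensity (ramp (1 / real (Suc r)) (level (1 / real (Suc r)) n)) (y - w) * L w t \<omega>)
        (compensator (1 / real (Suc r)) n y t \<omega>)) \<and>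
    (\<forall>a\<in>\<rat>. \<forall>b\<in>\<rat>. has_bochner_integral lborel (\<lambda>w. indicator {a<..<b} w * L w t \<omega>)
        (LINT s:{0..t}|lborel. indicator {a<..<b} (X s \<omega>)))"

lemma local_good_AE:
  assumes t: "0 \<le> t"
  shows "AE \<omega> in M. local_good t \<omega>"
proof -
  have lt: "AE \<omega> in M. has_bochner_integral lborel (\<lambda>w. f w * L w t \<omega>) (LINT s:{0..t}|lborel. f (X s \<omega>))"
    if "f \<in> borel_measurable borel" "bounded (range f)" for f
    using local_times that t unfolding local_times_def by blast
  have 1: "AE \<omega> in M. \<forall>r n. \<forall>y\<in>level_grid kg n. has_bochner_integral lborel
        (\<lambda>w. intensity (ramp (1 / real (Suc r)) (level (1 / real (Suc r)) n)) (y - w) * L w t \<omega>)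
        (compensator (1 / real (Suc r)) n y t \<omega>)"
    unfolding AE_all_countable
  proof (intro allI AE_finite_allI finite_level_grid)
    fix r n y
    have r: "0 < 1 / real (Suc r)" by simp
    note T = threshold_ramp[OF r level_pos[OF r, of n]]
    note [measurable] = intensity_facts(5)[OF T]
    obtain C where C: "\<And>u. intensity (ramp (1 / real (Suc r)) (level (1 / real (Suc r)) n)) u \<le> C"
      using intensity_facts(7)[OF T] by blast
    show "AE \<omega> in M. has_bochner_integral lborel
        (\<lambda>w. intensity (ramp (1 / real (Suc r)) (level (1 / real (Suc r)) n)) (y - w) * L w t \<omega>)
        (compensator (1 / real (Suc r)) n y t \<omega>)"
      unfolding compensator_def
    proof (rule lt)
      show "(\<lambda>w. intensity (ramp (1 / real (Suc r)) (level (1 / real (Suc r)) n)) (y - w)) \<in> borel_measurable borel" by measurable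
      show "bounded (range (\<lambda>w. intensity (ramp (1 / real (Suc r)) (level (1 / real (Suc r)) n)) (y - w)))"
        unfolding bounded_iff using intensity_nonneg[OF T] C by (intro exI[of _ C]) auto
    qed
  qed
  have ind: "AE \<omega> in M. has_bochner_integral lborel (\<lambda>w. indicator {a<..<b} w * L w t \<omega>)
        (LINT s:{0..t}|lborel. indicator {a<..<b} (X s \<omega>))" for a b :: real
  proof (rule lt)
    show "bounded (range (indicator {a<..<b} :: real \<Rightarrow> real))"
      unfolding bounded_iff by (intro exI[of _ 1]) (auto simp: indicator_def)
  qed simp
  have 2: "AE \<omega> in M. \<forall>a\<in>\<rat>. \<forall>b\<in>\<rat>. has_bochner_integral lborel (\<lambda>w. indicator {a<..<b} w * L w t \<omega>)
        (LINT s:{0..t}|lborel. indicator {a<..<b} (X s \<omega>))"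
    unfolding AE_ball_countable[OF countable_rat] using ind by blast
  show ?thesis using 1 2 by eventually_elim (simp add: local_good_def)
qed

text \<open>The formula for intervals with rational ends determines the sign and the support of the local time,
  which is continuous.\<close>

lemma local_time_facts:
  assumes \<omega>: "\<omega> \<in> space M" and t: "0 \<le> t" and lg: "local_good t \<omega>"
    and cont: "continuous_on UNIV (\<lambda>y. L y t \<omega>)"
    and R: "\<And>s. 0 \<le> s \<Longrightarrow> s \<le> t \<Longrightarrow> \<bar>X s \<omega>\<bar> \<le> R"
  shows "0 \<le> L y t \<omega>" "R < \<bar>y\<bar> \<Longrightarrow> L y t \<omega> = 0" "t = 0 \<Longrightarrow> L y t \<omega> = 0"
proof -
  have I: "(LINT w|lborel. indicator {a<..<b} w * L w t \<omega>) = (LINT s:{0..t}|lborel. indicator {a<..<b} (X s \<omega>))"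
    if "a \<in> \<rat>" "b \<in> \<rat>" for a b
    using lg that unfolding local_good_def by (blast intro: has_bochner_integral_integral_eq)
  have I0: "0 \<le> (LINT s:{0..t}|lborel. indicator {a<..<b} (X s \<omega>) :: real)" for a b
    unfolding set_lebesgue_integral_def by (intro Bochner_Integration.integral_nonneg) auto
  have nonneg: "0 \<le> L y t \<omega>" for y
    by (rule nonneg_if_interval_integrals_nonneg[OF cont zero_less_one]) (simp add: I I0)
  then show "0 \<le> L y t \<omega>" .
  have zero: "L y t \<omega> = 0" if e: "0 < e" and z: "\<And>a b. y - e < a \<Longrightarrow> b < y + e \<Longrightarrow> (LINT s:{0..t}|lborel. indicator {a<..<b} (X s \<omega>) :: real) = 0" for e
  proof -
    have "0 \<le> - L y t \<omega>"
    proof (rule nonneg_if_interval_integrals_nonneg[of "\<lambda>y. - L y t \<omega>" e y, OF _ e])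
      show "continuous_on UNIV (\<lambda>y. - L y t \<omega>)" by (intro continuous_intros cont)
      fix a b assume "a \<in> \<rat>" "b \<in> \<rat>" "y - e < a" "a < b" "b < y + e"
      then show "0 \<le> (LINT w|lborel. indicator {a<..<b} w * - L w t \<omega>)" using I[of a b] z[of a b] by simp
    qed
    with nonneg[of y] show ?thesis by simp
  qed
  show "L y t \<omega> = 0" if y: "R < \<bar>y\<bar>"
  proof (rule zero[of "\<bar>y\<bar> - R"])
    show "0 < \<bar>y\<bar> - R" using y by simp
    fix a b assume ab: "y - (\<bar>y\<bar> - R) < a" "b < y + (\<bar>y\<bar> - R)"
    have "X s \<omega> \<notin> {a<..<b}" if "s \<in> {0..t}" for s
      using R[of s] that ab by (cases "0 \<le> y") auto
    then have "(LINT s:{0..t}|lborel. indicator {a<..<b} (X s \<omega>) :: real) = (LINT s:{0..t}|lborel. 0)"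
      by (intro set_lebesgue_integral_cong) auto
    then show "(LINT s:{0..t}|lborel. indicator {a<..<b} (X s \<omega>) :: real) = 0" by (simp add: set_lebesgue_integral_def)
  qed
  show "L y t \<omega> = 0" if t0: "t = 0"
  proof (rule zero[OF zero_less_one])
    fix a b :: real
    have "AE s in lborel. s \<noteq> (0::real)" by (rule AE_lborel_singleton)
    then have "AE s in lborel. indicator {0..t} s *\<^sub>R indicator {a<..<b} (X s \<omega>) = (0::real)"
      by eventually_elim (auto simp: t0)
    then show "(LINT s:{0..t}|lborel. indicator {a<..<b} (X s \<omega>) :: real) = 0"
      unfolding set_lebesgue_integral_def by (rule integral_eq_zero_AE)
  qed
qed

lemma local_time_sections_continuous:
  assumes "continuous_on (UNIV \<times> {0..}) (\<lambda>(y, t). L y t \<omega>)"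
  shows "0 \<le> t \<Longrightarrow> continuous_on UNIV (\<lambda>y. L y t \<omega>)" "continuous_on {0..} (\<lambda>t. L y t \<omega>)"
proof -
  have "continuous_on UNIV (\<lambda>y. (y, t))" by (intro continuous_on_Pair continuous_on_id continuous_on_const)
  from continuous_on_compose2[OF assms this] show "0 \<le> t \<Longrightarrow> continuous_on UNIV (\<lambda>y. L y t \<omega>)" by auto
  have "continuous_on {0..} (\<lambda>t. (y, t))" by (intro continuous_on_Pair continuous_on_id continuous_on_const)
  from continuous_on_compose2[OF assms this] show "continuous_on {0..} (\<lambda>t. L y t \<omega>)" by auto
qed

lemma local_time_facts_all_times:
  assumes \<omega>: "\<omega> \<in> space M" and Lc: "continuous_on (UNIV \<times> {0..}) (\<lambda>(y, t). L y t \<omega>)"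
    and lg: "\<And>t. t \<in> \<rat> \<Longrightarrow> 0 \<le> t \<Longrightarrow> local_good t \<omega>" and t: "0 \<le> t"
    and R: "\<And>s. 0 \<le> s \<Longrightarrow> s \<le> t \<Longrightarrow> \<bar>X s \<omega>\<bar> \<le> R"
  shows "0 \<le> L y t \<omega>" "R < \<bar>y\<bar> \<Longrightarrow> L y t \<omega> = 0"
proof -
  define p where "p n = real_of_int \<lfloor>t * real (Suc n)\<rfloor> / real (Suc n)" for n
  have p: "p n \<in> \<rat>" "0 \<le> p n" "p n \<le> t" for n
    using t unfolding p_def by (auto intro!: Rats_divide divide_nonneg_nonneg simp: pos_divide_le_eq)
  have "p \<longlonglongrightarrow> t" unfolding p_def[abs_def] by (rule real_floor_approx)
  then have lim: "(\<lambda>n. L y (p n) \<omega>) \<longlonglongrightarrow> L y t \<omega>"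
    using local_time_sections_continuous(2)[OF Lc, of y] p t by (auto simp: continuous_on_sequentially o_def)
  have Rp: "\<bar>X s \<omega>\<bar> \<le> R" if "0 \<le> s" "s \<le> p n" for s n using R that p(3)[of n] by auto
  note good = \<omega> p(2) lg[OF p(1,2)] local_time_sections_continuous(1)[OF Lc p(2)]
  have "0 \<le> L y (p n) \<omega>" for n by (rule local_time_facts(1)[OF good Rp]) auto
  then show "0 \<le> L y t \<omega>" using LIMSEQ_le_const[OF lim] by blast
  show "L y t \<omega> = 0" if y: "R < \<bar>y\<bar>"
  proof -
    have "L y (p n) \<omega> = 0" for n by (rule local_time_facts(2)[OF good Rp y]) auto
    then show ?thesis using lim by (simp add: LIMSEQ_const_iff)
  qed
qed

text \<open>A mark is counted at the level \<open>y\<close> only if the jump crosses \<open>y\<close>.\<close>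

lemma count_marks_outside:
  assumes \<omega>: "\<omega> \<in> space M" and h: "0 < h" and y: "R < \<bar>y\<bar>"
    and R: "\<And>s. 0 \<le> s \<Longrightarrow> s \<le> t \<Longrightarrow> \<bar>X s \<omega>\<bar> \<le> R"
  shows "count_marks h y t \<omega> = 0"
proof -
  have E: "{s. 0 \<le> s \<and> s \<le> t \<and> h \<le> \<zeta> s \<omega> (y - lX \<omega> s)} = {}"
  proof (rule ccontr)
    assume "\<not> ?thesis"
    then obtain s where s: "0 \<le> s" "s \<le> t" "h \<le> \<zeta> s \<omega> (y - lX \<omega> s)" by auto
    have j: "y - lX \<omega> s \<in> {0<..<dX \<omega> s}" using mark_zero[OF \<omega> s(1), of "y - lX \<omega> s"] s(3) h by auto
    then have s0: "s \<noteq> 0" by (auto simp: jump_def left_lim_def)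
    have "lX \<omega> s \<in> {-R..R}"
      using s s0 R by (intro left_lim_bound[OF X_cadlag[OF \<omega>], where t=t]) (auto simp: abs_le_iff minus_le_iff)
    moreover have "\<bar>X s \<omega>\<bar> \<le> R" using R s by auto
    ultimately show False using j y by (auto simp: jump_def)
  qed
  show ?thesis unfolding mark_count_def E by simp
qed

lemma small_mesh_eventually:
  assumes r: "0 < \<rho>" "\<rho> \<le> 1"
  shows "\<forall>\<^sub>F n in sequentially. (1/4) ^ n \<le> level \<rho> n * \<rho> / (1 + \<rho>)"
proof -
  have "(\<lambda>n. (1/2::real) ^ n) \<longlonglongrightarrow> 0" by (rule LIMSEQ_realpow_zero) auto
  then have "\<forall>\<^sub>F n in sequentially. (1/2) ^ n < \<rho> / (1 + \<rho>)" using r by (intro order_tendstoD) auto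
  then show ?thesis
  proof eventually_elim
    case (elim n)
    have "level \<rho> n = 1 / (1 + \<rho>) ^ n"
      using r by (simp add: level_def powr_minus_divide powr_realpow)
    moreover have "(1 + \<rho>) ^ n \<le> 2 ^ n" using r by (intro power_mono) auto
    ultimately have "(1/2) ^ n \<le> level \<rho> n" using r by (simp add: power_one_over frac_le)
    then have "(1/2) ^ n * (1/2) ^ n \<le> level \<rho> n * (\<rho> / (1 + \<rho>))" using elim r level_pos[of \<rho> n] by (intro mult_mono) auto
    moreover have "(1/2::real) ^ n * (1/2) ^ n = (1/4) ^ n" by (simp flip: power_mult_distrib)
    ultimately show ?case by simp
  qed
qed

text \<open>The mark count at \<open>(h, y)\<close> is compared with the continuous counts at a height and a level of the
  grids nearby, these with their compensators, and the compensators with the local time.\<close>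

lemma fixed_time_convergence:
  assumes \<omega>: "\<omega> \<in> space M" and t: "0 < t" and lg: "local_good t \<omega>"
    and cont: "continuous_on UNIV (\<lambda>y. L y t \<omega>)"
    and R: "0 \<le> R" "\<And>s. 0 \<le> s \<Longrightarrow> s \<le> t \<Longrightarrow> \<bar>X s \<omega>\<bar> \<le> R"
    and cb: "\<And>r. \<forall>\<^sub>F n in sequentially. \<forall>y\<in>level_grid kg n. count_bounds (1 / real (Suc r)) t \<omega> n y"
    and H: "\<forall>\<^sub>F n in sequentially. \<forall>s\<in>{0<..t}. \<forall>u v. \<bar>\<zeta> s \<omega> u - \<zeta> s \<omega> v\<bar> \<le> 2 ^ n * \<bar>u - v\<bar> powr \<gamma>"
    and e: "0 < e"
  shows "\<forall>\<^sub>F h in at_right 0. \<forall>y. count_marks h y t \<omega> \<le> ennreal (c * h powr (- \<beta>) * (L y t \<omega> + e)) \<and>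
     ennreal (c * h powr (- \<beta>) * (L y t \<omega> - e)) \<le> count_marks h y t \<omega>"
proof -
  define l where "l y = L y t \<omega>" for y
  note lf = local_time_facts[OF \<omega> less_imp_le[OF t] lg cont R(2), folded l_def]
  have lc: "continuous_on UNIV l" using cont by (simp add: l_def[abs_def])
  note us = compact_support_uniformly_continuous[OF lc R(1) lf(2)]
  obtain B where B: "\<And>y. \<bar>l y\<bar> \<le> B" using us(2) by blast
  have B0: "0 \<le> B" using order.trans[OF abs_ge_zero B] .
  obtain r :: nat where r: "\<And>x. x \<in> {0..B} \<Longrightarrow> upper_factor (1 / real (Suc r)) x \<le> x + e"
    "\<And>x. x \<in> {0..B} \<Longrightarrow> x - e \<le> lower_factor (1 / real (Suc r)) x"
    using factors_close[OF B0 e] by blast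
  define \<rho> where "\<rho> = 1 / real (Suc r)"
  have \<rho>: "0 < \<rho>" "\<rho> \<le> 1" by (auto simp: \<rho>_def)
  have lB: "l y \<in> {0..B}" for y using lf(1)[of y] B[of y] by auto
  obtain d where d: "d > 0" "\<And>y y'. \<bar>y' - y\<bar> < d \<Longrightarrow> \<bar>l y' - l y\<bar> < \<rho>"
    using us(1) \<rho>(1) unfolding uniformly_continuous_on_def dist_real_def by (meson UNIV_I)
  have occ: "has_bochner_integral lborel (\<lambda>w. intensity (ramp \<rho> (level \<rho> n)) (y - w) * l w) (compensator \<rho> n y t \<omega>)"
    if "y \<in> level_grid kg n" for n y
    using lg that unfolding local_good_def \<rho>_def l_def by blast
  have E4: "\<forall>\<^sub>F n in sequentially. \<forall>y\<in>level_grid kg n. \<bar>level \<rho> n powr \<beta> * compensator \<rho> n y t \<omega> - mass \<rho> * l y\<bar> \<le> \<rho>"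
    by (rule compensator_tendsto_local_time[OF \<rho>(1) lc B us(1) occ \<rho>(1)])
  have E5: "\<forall>\<^sub>F n in sequentially. 1 / 2 ^ (n * kg) < d"
  proof -
    have "(\<lambda>n. (1 / 2 ^ kg :: real) ^ n) \<longlonglongrightarrow> 0"
      using kg(2) by (intro LIMSEQ_realpow_zero) (auto intro!: one_less_power)
    then have "\<forall>\<^sub>F n in sequentially. (1 / 2 ^ kg :: real) ^ n < d" using d(1) by (intro order_tendstoD)
    then show ?thesis by eventually_elim (simp add: power_one_over power_mult[symmetric] mult.commute)
  qed
  have E6: "\<forall>\<^sub>F n in sequentially. R \<le> real n"
  proof -
    obtain n0 :: nat where "R \<le> real n0" using real_arch_simple by blast
    then show ?thesis unfolding eventually_sequentially by (intro exI[of _ n0]) (auto intro: order.trans)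
  qed
  have "\<forall>\<^sub>F n in sequentially. (\<forall>y\<in>level_grid kg n. count_bounds \<rho> t \<omega> n y) \<and>
     (\<forall>s\<in>{0<..t}. \<forall>u v. \<bar>\<zeta> s \<omega> u - \<zeta> s \<omega> v\<bar> \<le> 2 ^ n * \<bar>u - v\<bar> powr \<gamma>) \<and>
     (1/4) ^ n \<le> level \<rho> n * \<rho> / (1 + \<rho>) \<and>
     (\<forall>y\<in>level_grid kg n. \<bar>level \<rho> n powr \<beta> * compensator \<rho> n y t \<omega> - mass \<rho> * l y\<bar> \<le> \<rho>) \<and>
     1 / 2 ^ (n * kg) < d \<and> R \<le> real n"
    by (intro eventually_conj cb[of r, folded \<rho>_def] H small_mesh_eventually \<rho> E4 E5 E6)
  then obtain n0 where n0: "\<And>n. n \<ge> n0 \<Longrightarrow> (\<forall>y\<in>level_grid kg n. count_bounds \<rho> t \<omega> n y) \<and>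
     (\<forall>s\<in>{0<..t}. \<forall>u v. \<bar>\<zeta> s \<omega> u - \<zeta> s \<omega> v\<bar> \<le> 2 ^ n * \<bar>u - v\<bar> powr \<gamma>) \<and>
     (1/4) ^ n \<le> level \<rho> n * \<rho> / (1 + \<rho>) \<and>
     (\<forall>y\<in>level_grid kg n. \<bar>level \<rho> n powr \<beta> * compensator \<rho> n y t \<omega> - mass \<rho> * l y\<bar> \<le> \<rho>) \<and>
     1 / 2 ^ (n * kg) < d \<and> R \<le> real n"
    by (auto simp: eventually_sequentially)
  note mf = mass_facts[OF \<rho>(1)]
  \<comment> \<open>Both bounds in terms of the local time, at any late index.\<close>
  have bounds: "(level \<rho> n * (1 + \<rho>)\<^sup>2 \<le> h \<longrightarrow> count_marks h y t \<omega> \<le> ennreal (level \<rho> n powr (- \<beta>) * ((1 + \<rho>) * (c * (l y + \<rho>) + \<rho>) + \<rho>))) \<and>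
     (h \<le> level \<rho> n / (1 + \<rho>) \<longrightarrow> ennreal (level \<rho> n powr (- \<beta>) * ((1 - \<rho>) * ((1 + \<rho>) powr (- \<beta>) * c * (l y - \<rho>) - \<rho>) - \<rho>)) \<le> count_marks h y t \<omega>)"
    if n: "n0 \<le> n" and h: "0 < h" and y: "\<bar>y\<bar> \<le> R" for n h y
  proof -
    note N = n0[OF n]
    have "\<bar>y\<bar> \<le> real n" using N y by linarith
    then obtain y' where y': "y' \<in> level_grid kg n" "\<bar>y - y'\<bar> \<le> 1 / 2 ^ (n * kg)" by (rule level_grid_near)
    define x where "x = level \<rho> n powr (- \<beta>)"
    have x: "0 < x" using level_pos[OF \<rho>(1), of n] by (simp add: x_def)
    define A where "A = compensator \<rho> n y' t \<omega>"
    have cm: "level \<rho> n * (1 + \<rho>)\<^sup>2 \<le> h \<Longrightarrow> count_marks h y t \<omega> \<le> ennreal ((1 + \<rho>) * A + \<rho> * x)"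
      "h \<le> level \<rho> n / (1 + \<rho>) \<Longrightarrow> ennreal ((1 - \<rho>) * A - \<rho> * x) \<le> count_marks h y t \<omega>"
      unfolding A_def x_def using N y' h
      by (intro count_marks_bounds[OF \<omega> \<rho> t]; blast)+
    have "\<bar>l y - l y'\<bar> < \<rho>" using y'(2) N by (intro d(2)) auto
    then have ll: "l y' \<le> l y + \<rho>" "l y - \<rho> \<le> l y'" by auto
    have inv: "x * (level \<rho> n powr \<beta> * A) = A"
      using level_pos[OF \<rho>(1), of n] by (simp add: x_def powr_minus field_simps)
    have Am: "\<bar>level \<rho> n powr \<beta> * A - mass \<rho> * l y'\<bar> \<le> \<rho>" using N y' unfolding A_def by blast
    have "mass \<rho> * l y' \<le> c * (l y + \<rho>)" using mf ll lf(1)[of y'] c_pos by (intro mult_mono) auto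
    with Am have "level \<rho> n powr \<beta> * A \<le> c * (l y + \<rho>) + \<rho>" by linarith
    then have "x * (level \<rho> n powr \<beta> * A) \<le> x * (c * (l y + \<rho>) + \<rho>)" using x by (intro mult_left_mono) auto
    then have "(1 + \<rho>) * A \<le> (1 + \<rho>) * (x * (c * (l y + \<rho>) + \<rho>))" unfolding inv using \<rho> by (intro mult_left_mono) auto
    then have up: "(1 + \<rho>) * A + \<rho> * x \<le> x * ((1 + \<rho>) * (c * (l y + \<rho>) + \<rho>) + \<rho>)" by (simp add: algebra_simps)
    have "(1 + \<rho>) powr (- \<beta>) * c * (l y - \<rho>) \<le> (1 + \<rho>) powr (- \<beta>) * c * l y'" using ll c_pos by (intro mult_left_mono) auto
    also have "\<dots> \<le> mass \<rho> * l y'" using mf lf(1)[of y'] by (intro mult_right_mono) auto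
    finally have "(1 + \<rho>) powr (- \<beta>) * c * (l y - \<rho>) - \<rho> \<le> level \<rho> n powr \<beta> * A" using Am by linarith
    then have "x * ((1 + \<rho>) powr (- \<beta>) * c * (l y - \<rho>) - \<rho>) \<le> x * (level \<rho> n powr \<beta> * A)" using x by (intro mult_left_mono) auto
    then have "(1 - \<rho>) * (x * ((1 + \<rho>) powr (- \<beta>) * c * (l y - \<rho>) - \<rho>)) \<le> (1 - \<rho>) * A" unfolding inv using \<rho> by (intro mult_left_mono) auto
    then have lo: "x * ((1 - \<rho>) * ((1 + \<rho>) powr (- \<beta>) * c * (l y - \<rho>) - \<rho>) - \<rho>) \<le> (1 - \<rho>) * A - \<rho> * x" by (simp add: algebra_simps)
    show ?thesis unfolding x_def[symmetric]
      using cm order.trans[OF _ ennreal_leI[OF up]] order.trans[OF ennreal_leI[OF lo]] by blast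
  qed
  show ?thesis unfolding eventually_at_right_field
  proof (intro exI[of _ "(1 + \<rho>) powr (- (real n0 + 3))"] conjI allI impI)
    show "0 < (1 + \<rho>) powr (- (real n0 + 3))" using \<rho> by simp
    fix h y assume h: "0 < h" "h < (1 + \<rho>) powr (- (real n0 + 3))"
    \<comment> \<open>On a logarithmic scale, \<open>h\<close> corresponds to \<open>\<tau>\<close> and the heights to the integers.\<close>
    define \<tau> where "\<tau> = - ln h / ln (1 + \<rho>)"
    have ln: "0 < ln (1 + \<rho>)" using \<rho> by simp
    have h\<tau>: "h = (1 + \<rho>) powr (- \<tau>)" using h ln \<rho> by (simp add: \<tau>_def powr_def)
    have pmono: "(1 + \<rho>) powr a \<le> (1 + \<rho>) powr b \<longleftrightarrow> a \<le> b" for a b using \<rho> by simp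
    have \<tau>: "real n0 + 3 < \<tau>" using h(2) \<rho> unfolding h\<tau> by simp
    have plus: "level \<rho> n * (1 + \<rho>) ^ j = (1 + \<rho>) powr (real j - real n)" for n j
      using \<rho> by (simp add: level_def powr_realpow[symmetric] powr_add[symmetric])
    have minus: "level \<rho> n / (1 + \<rho>) ^ j = (1 + \<rho>) powr (- real j - real n)" for n j
      using \<rho> by (simp add: level_def powr_realpow[symmetric] powr_diff[symmetric] minus_diff_commute)
    show "count_marks h y t \<omega> \<le> ennreal (c * h powr (- \<beta>) * (L y t \<omega> + e))"
    proof (cases "\<bar>y\<bar> \<le> R")
      case False
      then show ?thesis using count_marks_outside[OF \<omega> h(1) _ R(2), of y] by simp
    next
      case True
      define n where "n = nat \<lceil>\<tau>\<rceil> + 2"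
      have n: "n0 \<le> n" "\<tau> + 2 \<le> real n" "real n \<le> \<tau> + 3" using \<tau> unfolding n_def by linarith+
      have "level \<rho> n * (1 + \<rho>)\<^sup>2 \<le> h" unfolding plus h\<tau> pmono using n by simp
      then have 1: "count_marks h y t \<omega> \<le> ennreal (level \<rho> n powr (- \<beta>) * ((1 + \<rho>) * (c * (l y + \<rho>) + \<rho>) + \<rho>))"
        using bounds[OF n(1) h(1) True] by blast
      have "level \<rho> n powr (- \<beta>) = (1 + \<rho>) powr (real n * \<beta>)" by (simp add: level_powr)
      also have "\<dots> \<le> (1 + \<rho>) powr ((\<tau> + 3) * \<beta>)" unfolding pmono using n beta_pos by (intro mult_right_mono) auto
      also have "\<dots> = h powr (- \<beta>) * (1 + \<rho>) powr (3 * \<beta>)"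
        by (simp add: h\<tau> powr_powr powr_add[symmetric] algebra_simps)
      finally have "level \<rho> n powr (- \<beta>) * ((1 + \<rho>) * (c * (l y + \<rho>) + \<rho>) + \<rho>) \<le> h powr (- \<beta>) * (1 + \<rho>) powr (3 * \<beta>) * ((1 + \<rho>) * (c * (l y + \<rho>) + \<rho>) + \<rho>)"
        using \<rho> c_pos lf(1)[of y] by (intro mult_right_mono) auto
      also have "\<dots> = c * h powr (- \<beta>) * upper_factor \<rho> (l y)" using c_pos by (simp add: upper_factor_def)
      also have "\<dots> \<le> c * h powr (- \<beta>) * (l y + e)"
        using r(1)[OF lB, folded \<rho>_def] c_pos by (intro mult_left_mono) auto
      finally show ?thesis using order.trans[OF 1 ennreal_leI] by (simp add: l_def)
    qed
    show "ennreal (c * h powr (- \<beta>) * (L y t \<omega> - e)) \<le> count_marks h y t \<omega>"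
    proof (cases "\<bar>y\<bar> \<le> R")
      case False
      then have "L y t \<omega> = 0" using lf(2)[of y] by (simp add: l_def)
      then show ?thesis using c_pos e by (simp add: ennreal_neg mult_nonneg_nonpos)
    next
      case True
      define n where "n = nat (\<lfloor>\<tau>\<rfloor> - 1)"
      have n: "n0 \<le> n" "\<tau> \<le> real n + 2" "real n + 1 \<le> \<tau>" using \<tau> unfolding n_def by linarith+
      have "h \<le> level \<rho> n / (1 + \<rho>) ^ 1" unfolding minus h\<tau> pmono using n by simp
      then have 1: "ennreal (level \<rho> n powr (- \<beta>) * ((1 - \<rho>) * ((1 + \<rho>) powr (- \<beta>) * c * (l y - \<rho>) - \<rho>) - \<rho>)) \<le> count_marks h y t \<omega>"
        using bounds[OF n(1) h(1) True] by simp
      have "h powr (- \<beta>) * (1 + \<rho>) powr (- 2 * \<beta>) = (1 + \<rho>) powr ((\<tau> - 2) * \<beta>)"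
        by (simp add: h\<tau> powr_powr powr_add[symmetric] algebra_simps)
      also have "\<dots> \<le> (1 + \<rho>) powr (real n * \<beta>)" unfolding pmono using n beta_pos by (intro mult_right_mono) auto
      also have "\<dots> = level \<rho> n powr (- \<beta>)" by (simp add: level_powr)
      finally have xx: "h powr (- \<beta>) * (1 + \<rho>) powr (- 2 * \<beta>) \<le> level \<rho> n powr (- \<beta>)" .
      define W where "W = (1 - \<rho>) * ((1 + \<rho>) powr (- \<beta>) * c * (l y - \<rho>) - \<rho>) - \<rho>"
      have "c * h powr (- \<beta>) * (l y - e) \<le> c * h powr (- \<beta>) * lower_factor \<rho> (l y)"
        using r(2)[OF lB, folded \<rho>_def] c_pos by (intro mult_left_mono) auto
      also have "\<dots> = h powr (- \<beta>) * (1 + \<rho>) powr (- 2 * \<beta>) * W" using c_pos by (simp add: lower_factor_def W_def)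
      finally have 2: "c * h powr (- \<beta>) * (l y - e) \<le> h powr (- \<beta>) * (1 + \<rho>) powr (- 2 * \<beta>) * W" .
      show ?thesis
      proof (cases "0 \<le> W")
        case True
        have "c * h powr (- \<beta>) * (l y - e) \<le> level \<rho> n powr (- \<beta>) * W"
          using 2 mult_right_mono[OF xx True] by linarith
        then show ?thesis using order.trans[OF ennreal_leI 1[folded W_def]] by (simp add: l_def)
      next
        case False
        then have "h powr (- \<beta>) * (1 + \<rho>) powr (- 2 * \<beta>) * W \<le> 0" by (intro mult_nonneg_nonpos) auto
        then show ?thesis using 2 by (simp add: ennreal_neg l_def)
      qed
    qed
  qed
qed

section \<open>Uniformity in time\<close>

lemma count_marks_mono: "s \<le> t \<Longrightarrow> count_marks h y s \<omega> \<le> count_marks h y t \<omega>"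
  unfolding mark_count_def by (intro emeasure_mono) auto

text \<open>The count increases in \<open>t\<close> and its limit is continuous in \<open>t\<close>, so that convergence at a finite
  set of times suffices.\<close>

lemma all_times_convergence:
  assumes \<omega>: "\<omega> \<in> space M" and Lc: "continuous_on (UNIV \<times> {0..}) (\<lambda>(y, t). L y t \<omega>)"
    and lg: "\<And>t. t \<in> \<rat> \<Longrightarrow> 0 \<le> t \<Longrightarrow> local_good t \<omega>"
    and cb: "\<And>t r. t \<in> \<rat> \<Longrightarrow> 0 < t \<Longrightarrow> \<forall>\<^sub>F n in sequentially. \<forall>y\<in>level_grid kg n. count_bounds (1 / real (Suc r)) t \<omega> n y"
    and H: "\<And>t. t \<in> \<rat> \<Longrightarrow> 0 < t \<Longrightarrow> \<forall>\<^sub>F n in sequentially. \<forall>s\<in>{0<..t}. \<forall>u v. \<bar>\<zeta> s \<omega> u - \<zeta> s \<omega> v\<bar> \<le> 2 ^ n * \<bar>u - v\<bar> powr \<gamma>"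
    and T: "0 < T" and e: "0 < e"
  shows "\<forall>\<^sub>F h in at_right 0. \<forall>t\<in>{0..T}. \<forall>y. count_marks h y t \<omega> \<le> ennreal (c * h powr (- \<beta>) * (L y t \<omega> + 2 * e)) \<and>
     ennreal (c * h powr (- \<beta>) * (L y t \<omega> - 2 * e)) \<le> count_marks h y t \<omega>"
proof -
  obtain R where R: "0 < R" "\<And>s. 0 \<le> s \<Longrightarrow> s \<le> T + 1 \<Longrightarrow> \<bar>X s \<omega>\<bar> \<le> R"
    using cadlag_bounded[OF X_cadlag[OF \<omega>], of "T + 1"] T by auto
  note cy = local_time_sections_continuous(1)[OF Lc]
  have zero: "L y t \<omega> = 0" if "0 \<le> t" "t \<le> T" "R < \<bar>y\<bar>" for y t
    using that R(2) by (intro local_time_facts_all_times(2)[OF \<omega> Lc lg]) auto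
  have L0: "L y 0 \<omega> = 0" for y
    by (rule local_time_facts(3)[OF \<omega> order_refl lg cy]) (use R(2) T in auto)
  have "uniformly_continuous_on ({- R..R} \<times> {0..T + 1}) (\<lambda>(y, t). L y t \<omega>)"
    by (intro compact_uniformly_continuous compact_Times continuous_on_subset[OF Lc]) auto
  then obtain d where d: "d > 0" "\<And>p p'. p \<in> {- R..R} \<times> {0..T + 1} \<Longrightarrow> p' \<in> {- R..R} \<times> {0..T + 1} \<Longrightarrow> dist p' p < d \<Longrightarrow>
     dist ((\<lambda>(y, t). L y t \<omega>) p') ((\<lambda>(y, t). L y t \<omega>) p) < e"
    using e unfolding uniformly_continuous_on_def by meson
  have Lt: "\<bar>L y t' \<omega> - L y t \<omega>\<bar> < e" if "0 \<le> t" "t \<le> T + 1" "0 \<le> t'" "t' \<le> T + 1" "\<bar>t' - t\<bar> < d" "\<bar>y\<bar> \<le> R" for t t' y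
    using d(2)[of "(y, t)" "(y, t')"] that by (auto simp: dist_Pair_Pair dist_real_def abs_le_iff)
  obtain m0 :: nat where m0: "inverse (real (Suc m0)) < d" using reals_Archimedean[OF d(1)] by blast
  define m where "m = real (Suc m0)"
  \<comment> \<open>The multiples of \<open>1 / m\<close> are the finitely many rational times that enclose all others.\<close>
  have m: "1 \<le> m" "1 / m < d" using m0 by (auto simp: m_def inverse_eq_divide)
  define J where "J = {j::nat. 1 \<le> j \<and> real j / m \<le> T + 1}"
  have J: "finite J"
  proof -
    have "J \<subseteq> {..nat \<lceil>(T + 1) * m\<rceil>}"
    proof
      fix j assume "j \<in> J"
      then have "real j \<le> (T + 1) * m" using m by (simp add: J_def pos_divide_le_eq)
      then show "j \<in> {..nat \<lceil>(T + 1) * m\<rceil>}" by (auto intro!: le_nat_iff[THEN iffD2] simp: le_ceiling_iff)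
    qed
    then show ?thesis by (rule finite_subset) simp
  qed
  have "\<forall>\<^sub>F h in at_right 0. \<forall>y. count_marks h y (real j / m) \<omega> \<le> ennreal (c * h powr (- \<beta>) * (L y (real j / m) \<omega> + e)) \<and>
     ennreal (c * h powr (- \<beta>) * (L y (real j / m) \<omega> - e)) \<le> count_marks h y (real j / m) \<omega>" if j: "j \<in> J" for j
  proof -
    have q: "real j / m \<in> \<rat>" "0 < real j / m" "real j / m \<le> T + 1"
      using j m unfolding J_def m_def by (auto intro!: Rats_divide)
    show ?thesis
      by (rule fixed_time_convergence[OF \<omega> q(2) lg[OF q(1) less_imp_le[OF q(2)]] cy[OF less_imp_le[OF q(2)]] less_imp_le[OF R(1)] R(2) cb[OF q(1,2)] H[OF q(1,2)] e])
         (use q(3) in auto)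
  qed
  then have "\<forall>\<^sub>F h in at_right 0. \<forall>j\<in>J. \<forall>y. count_marks h y (real j / m) \<omega> \<le> ennreal (c * h powr (- \<beta>) * (L y (real j / m) \<omega> + e)) \<and>
     ennreal (c * h powr (- \<beta>) * (L y (real j / m) \<omega> - e)) \<le> count_marks h y (real j / m) \<omega>"
    using J by (intro eventually_ball_finite ballI)
  moreover have "\<forall>\<^sub>F h in at_right (0::real). 0 < h" by (rule eventually_at_right_less)
  ultimately show ?thesis
  proof (eventually_elim, intro ballI allI)
    fix h t y
    assume hJ: "\<forall>j\<in>J. \<forall>y. count_marks h y (real j / m) \<omega> \<le> ennreal (c * h powr (- \<beta>) * (L y (real j / m) \<omega> + e)) \<and>
     ennreal (c * h powr (- \<beta>) * (L y (real j / m) \<omega> - e)) \<le> count_marks h y (real j / m) \<omega>"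
      and h: "0 < h" and t: "t \<in> {0..T}"
    define K where "K = c * h powr (- \<beta>)"
    have K: "0 < K" using c_pos h by (simp add: K_def)
    show "count_marks h y t \<omega> \<le> ennreal (c * h powr (- \<beta>) * (L y t \<omega> + 2 * e)) \<and>
     ennreal (c * h powr (- \<beta>) * (L y t \<omega> - 2 * e)) \<le> count_marks h y t \<omega>"
    proof (cases "\<bar>y\<bar> \<le> R")
      case False
      have "count_marks h y t \<omega> = 0" using False R(2) t by (intro count_marks_outside[OF \<omega> h, of R]) auto
      moreover have "L y t \<omega> = 0" using zero[of t y] t False by auto
      ultimately show ?thesis using K e by (simp add: K_def[symmetric] ennreal_neg mult_nonneg_nonpos)
    next
      case True
      define i where "i = nat \<lfloor>t * m\<rfloor>"
      have i: "real i \<le> t * m" "t * m < real i + 1" using t m unfolding i_def by (auto simp: of_nat_nat)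
      have i1: "real i / m \<le> t" "t < real (Suc i) / m" using i m by (auto simp: field_simps)
      have i2: "real (Suc i) / m \<le> t + 1 / m" using i m by (simp add: field_simps)
      have m1: "1 / m \<le> 1" using m by simp
      have Sb: "real (Suc i) / m \<le> T + 1" using i2 m1 t unfolding atLeastAtMost_iff by linarith
      have SJ: "Suc i \<in> J" using i2 m1 t by (auto simp: J_def)
      have "count_marks h y t \<omega> \<le> count_marks h y (real (Suc i) / m) \<omega>" using i1 by (intro count_marks_mono) auto
      also have "\<dots> \<le> ennreal (K * (L y (real (Suc i) / m) \<omega> + e))" using hJ SJ unfolding K_def by blast
      also have "\<dots> \<le> ennreal (K * (L y t \<omega> + 2 * e))"
      proof (intro ennreal_leI mult_left_mono)
        have "\<bar>L y (real (Suc i) / m) \<omega> - L y t \<omega>\<bar> < e"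
          using i1 i2 m Sb t True by (intro Lt) (auto simp del: of_nat_Suc)
        then show "L y (real (Suc i) / m) \<omega> + e \<le> L y t \<omega> + 2 * e" by linarith
      qed (use K in auto)
      finally have up: "count_marks h y t \<omega> \<le> ennreal (K * (L y t \<omega> + 2 * e))" .
      have "real (Suc i) / m = real i / m + 1 / m" by (simp add: add_divide_distrib)
      then have td: "t - real i / m < d" using i1 m by linarith
      have Li: "\<bar>L y t \<omega> - L y (real i / m) \<omega>\<bar> < e"
        using i1 td t True m by (intro Lt) auto
      have lo: "ennreal (K * (L y t \<omega> - 2 * e)) \<le> count_marks h y t \<omega>"
      proof (cases "i = 0")
        case True
        then have "L y t \<omega> - 2 * e \<le> 0" using Li L0[of y] by auto
        then have "K * (L y t \<omega> - 2 * e) \<le> 0" using K by (intro mult_nonneg_nonpos) auto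
        then show ?thesis by (simp add: ennreal_neg)
      next
        case False
        then have iJ: "i \<in> J" using i1 t by (auto simp: J_def)
        have "ennreal (K * (L y t \<omega> - 2 * e)) \<le> ennreal (K * (L y (real i / m) \<omega> - e))"
          using Li K by (intro ennreal_leI mult_left_mono) auto
        also have "\<dots> \<le> count_marks h y (real i / m) \<omega>" using hJ iJ unfolding K_def by blast
        also have "\<dots> \<le> count_marks h y t \<omega>" using i1 by (intro count_marks_mono)
        finally show ?thesis .
      qed
      show ?thesis using up lo by (simp add: K_def)
    qed
  qed
qed

lemma ereal_scaled_diff_le:
  assumes K: "0 < K" and e: "0 \<le> e" and l: "0 \<le> l"
    and up: "m \<le> ennreal (K * (l + e))" and lo: "ennreal (K * (l - e)) \<le> m"
  shows "\<bar>ereal (1 / K) * enn2ereal m - ereal l\<bar> \<le> ereal e"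
proof -
  have "m < top" using le_less_trans[OF up ennreal_less_top] .
  then obtain r where r: "0 \<le> r" "m = ennreal r" by (cases m) auto
  have "r \<le> K * (l + e)" using up r K e l by (simp add: ennreal_le_iff)
  moreover have "K * (l - e) \<le> r"
    using lo r by (cases "0 \<le> K * (l - e)") (auto simp: ennreal_le_iff)
  ultimately have "\<bar>r / K - l\<bar> \<le> e" using K by (simp add: abs_le_iff field_simps)
  then show ?thesis using r by (simp add: enn2ereal_ennreal)
qed

theorem mark_counts_converge_to_local_time:
  "AE \<omega> in M. \<forall>T>0. ((\<lambda>h. SUP t\<in>{0..T}. SUP y.
      \<bar>ereal (h powr \<beta> / c) * enn2ereal (count_marks h y t \<omega>) - ereal (L y t \<omega>)\<bar>) \<longlongrightarrow> 0) (at_right 0)"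
proof -
  have rat: "countable {t::real. t \<in> \<rat> \<and> P t}" for P
    by (rule countable_subset[OF _ countable_rat]) auto
  have 1: "AE \<omega> in M. \<forall>t\<in>{t. t \<in> \<rat> \<and> 0 \<le> t}. local_good t \<omega>"
    unfolding AE_ball_countable[OF rat] using local_good_AE by auto
  have 2: "AE \<omega> in M. \<forall>t\<in>{t. t \<in> \<rat> \<and> 0 < t}. \<forall>r.
      \<forall>\<^sub>F n in sequentially. \<forall>y\<in>level_grid kg n. count_bounds (1 / real (Suc r)) t \<omega> n y"
    unfolding AE_ball_countable[OF rat] AE_all_countable
    by (auto intro!: count_bounds_eventually simp del: of_nat_Suc)
  have 3: "AE \<omega> in M. \<forall>t\<in>{t. t \<in> \<rat> \<and> 0 < t}.
      \<forall>\<^sub>F n in sequentially. \<forall>s\<in>{0<..t}. \<forall>u v. \<bar>\<zeta> s \<omega> u - \<zeta> s \<omega> v\<bar> \<le> 2 ^ n * \<bar>u - v\<bar> powr \<gamma>"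
    unfolding AE_ball_countable[OF rat] using marks_eventually_holder by auto
  have 4: "AE \<omega> in M. continuous_on (UNIV \<times> {0..}) (\<lambda>(y, t). L y t \<omega>)"
    using local_times by (simp add: local_times_def)
  show ?thesis using 1 2 3 4 AE_space
  proof (eventually_elim, intro allI impI)
    fix \<omega> T assume lg: "\<forall>t\<in>{t. t \<in> \<rat> \<and> 0 \<le> t}. local_good t \<omega>"
      and cb: "\<forall>t\<in>{t. t \<in> \<rat> \<and> 0 < t}. \<forall>r.
      \<forall>\<^sub>F n in sequentially. \<forall>y\<in>level_grid kg n. count_bounds (1 / real (Suc r)) t \<omega> n y"
      and H: "\<forall>t\<in>{t. t \<in> \<rat> \<and> 0 < t}.
      \<forall>\<^sub>F n in sequentially. \<forall>s\<in>{0<..t}. \<forall>u v. \<bar>\<zeta> s \<omega> u - \<zeta> s \<omega> v\<bar> \<le> 2 ^ n * \<bar>u - v\<bar> powr \<gamma>"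
      and Lc: "continuous_on (UNIV \<times> {0..}) (\<lambda>(y, t). L y t \<omega>)"
      and \<omega>: "\<omega> \<in> space M" and T: "0 < (T::real)"
    have nonneg: "0 \<le> L y t \<omega>" if t: "0 \<le> t" for y t
    proof -
      obtain R where "R > 0" "\<And>s. 0 \<le> s \<Longrightarrow> s \<le> t \<Longrightarrow> \<bar>X s \<omega>\<bar> \<le> R"
        by (rule cadlag_bounded[OF X_cadlag[OF \<omega>] t]) (rule that)
      then show ?thesis using lg by (intro local_time_facts_all_times(1)[OF \<omega> Lc _ t]) auto
    qed
    let ?S = "\<lambda>h. SUP t\<in>{0..T}. SUP y. \<bar>ereal (h powr \<beta> / c) * enn2ereal (count_marks h y t \<omega>) - ereal (L y t \<omega>)\<bar>"
    have S0: "0 \<le> ?S h" for h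
      by (rule SUP_upper2[of 0], use T in simp, rule SUP_upper2[of 0]) auto
    have Se: "\<forall>\<^sub>F h in at_right 0. ?S h \<le> ereal (2 * e)" if e: "0 < e" for e
    proof -
      have "\<forall>\<^sub>F h in at_right 0. \<forall>t\<in>{0..T}. \<forall>y. count_marks h y t \<omega> \<le> ennreal (c * h powr (- \<beta>) * (L y t \<omega> + 2 * e)) \<and>
         ennreal (c * h powr (- \<beta>) * (L y t \<omega> - 2 * e)) \<le> count_marks h y t \<omega>"
        by (rule all_times_convergence[OF \<omega> Lc _ _ _ T e]) (use lg cb H in blast)+
      moreover have "\<forall>\<^sub>F h in at_right (0::real). 0 < h" by (rule eventually_at_right_less)
      ultimately show ?thesis
      proof eventually_elim
        case (elim h)
        have K: "h powr \<beta> / c = 1 / (c * h powr (- \<beta>))" by (simp add: powr_minus field_simps)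
        show ?case
        proof (intro SUP_least)
          fix t y assume t: "t \<in> {0..T}"
          show "\<bar>ereal (h powr \<beta> / c) * enn2ereal (count_marks h y t \<omega>) - ereal (L y t \<omega>)\<bar> \<le> ereal (2 * e)"
            unfolding K
            by (rule ereal_scaled_diff_le) (use elim t nonneg e c_pos in auto)
        qed
      qed
    qed
    show "(?S \<longlongrightarrow> 0) (at_right 0)"
    proof (rule order_tendstoI)
      fix a :: ereal assume "a < 0"
      then show "\<forall>\<^sub>F h in at_right 0. a < ?S h" using less_le_trans[OF _ S0] by (intro always_eventually) blast
    next
      fix a :: ereal assume "0 < a"
      then obtain e where e: "0 < ereal e" "ereal e < a" using ereal_dense2 by blast
      have "\<forall>\<^sub>F h in at_right 0. ?S h \<le> ereal (2 * (e / 2))" using e by (intro Se) auto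
      then show "\<forall>\<^sub>F h in at_right 0. ?S h < a" by eventually_elim (use e in auto)
    qed
  qed
qed

end

section \<open>The constant and the Hoelder bound in terms of the random path\<close>

text \<open>The identity map from \<open>N\<close> to the space with the sigma-algebra generated by \<open>Z\<close> is independent of
  \<open>U\<close>, so that the pair of the two has a product law and Tonelli's theorem applies.\<close>

lemma nn_integral_at_independent_uniform:
  fixes f :: "real \<Rightarrow> ennreal" and Z :: "'b \<Rightarrow> real \<Rightarrow> real"
  assumes N: "prob_space N"
    and Z: "Z \<in> N \<rightarrow>\<^sub>M path_space {0..1}"
    and cont: "\<And>v. v \<in> space N \<Longrightarrow> continuous_on {0..1} (Z v)"
    and U: "U \<in> borel_measurable N" "distr N lborel U = uniform_measure lborel {0..1}"
    and ind: "prob_space.indep_set N (sets (vimage_algebra (space N) Z (path_space {0..1})))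
           (sets (vimage_algebra (space N) U borel))"
    and f[measurable]: "f \<in> borel_measurable borel"
  shows "(\<integral>\<^sup>+v. f (Z v (max 0 (min 1 (U v)))) \<partial>N) =
    (\<integral>\<^sup>+v. (\<integral>\<^sup>+r. f (Z v (max 0 (min 1 r))) * indicator {0..1} r \<partial>lborel) \<partial>N)"
proof -
  interpret N: prob_space N by fact
  define S where "S = vimage_algebra (space N) Z (path_space {0..1})"
  have ZS: "Z \<in> space N \<rightarrow> space (path_space {0..1})" using measurable_space[OF Z] by auto
  have sS: "space S = space N" by (simp add: S_def)
  have idm: "(\<lambda>v. v) \<in> N \<rightarrow>\<^sub>M S"
    unfolding S_def by (rule measurable_vimage_algebra2[OF _ Z]) simp
  have ZmS: "Z \<in> S \<rightarrow>\<^sub>M path_space {0..1}" unfolding S_def by (rule measurable_vimage_algebra1[OF ZS])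
  have Zu: "(\<lambda>v. Z v (max 0 (min 1 u))) \<in> borel_measurable S" for u
    using measurable_compose[OF ZmS measurable_component_singleton[of "max 0 (min 1 u)"]] by simp
  have "(\<lambda>(u, v). Z v (max 0 (min 1 u))) \<in> borel_measurable (borel \<Otimes>\<^sub>M S)"
    by (rule caratheodory_measurable[OF _ Zu])
       (auto intro!: continuous_on_compose2[OF cont] continuous_intros simp: sS)
  from measurable_compose[OF measurable_pair_swap' this]
  have [measurable]: "(\<lambda>p. Z (fst p) (max 0 (min 1 (snd p)))) \<in> borel_measurable (S \<Otimes>\<^sub>M borel)"
    by (simp add: case_prod_beta')
  interpret D: prob_space "distr N borel U" by (rule N.prob_space_distr[OF U(1)])
  interpret E: prob_space "distr N S (\<lambda>v. v)" by (rule N.prob_space_distr[OF idm])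
  have P: "distr N S (\<lambda>v. v) \<Otimes>\<^sub>M distr N borel U = distr N (S \<Otimes>\<^sub>M borel) (\<lambda>v. (v, U v))"
  proof (rule pair_measure_eqI)
    fix A B assume "A \<in> sets (distr N S (\<lambda>v. v))" "B \<in> sets (distr N borel U)"
    then have A: "A \<in> sets S" and B[measurable]: "B \<in> sets borel" by auto
    have AN: "A \<subseteq> space N" "A \<in> sets N"
      using sets.sets_into_space[OF A] measurable_sets[OF idm A] by (auto simp: sS Int_absorb2)
    have "N.prob (A \<inter> (U -` B \<inter> space N)) = N.prob A * N.prob (U -` B \<inter> space N)"
      by (rule N.indep_setD[OF ind]) (use A B in \<open>auto simp: S_def sets_vimage_algebra2\<close>)
    moreover have "(\<lambda>v. (v, U v)) -` (A \<times> B) \<inter> space N = A \<inter> (U -` B \<inter> space N)" using AN by auto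
    ultimately show "emeasure (distr N S (\<lambda>v. v)) A * emeasure (distr N borel U) B =
        emeasure (distr N (S \<Otimes>\<^sub>M borel) (\<lambda>v. (v, U v))) (A \<times> B)"
      using A B AN idm U(1) measurable_Pair[OF idm U(1)]
      by (simp add: emeasure_distr N.emeasure_eq_measure ennreal_mult Int_absorb2 del: vimage_Times)
  qed (auto simp: E.sigma_finite_measure_axioms D.sigma_finite_measure_axioms cong: sets_pair_measure_cong)
  have dU: "distr N borel U = uniform_measure lborel {0..1}"
    unfolding U(2)[symmetric] by (rule distr_cong) auto
  have g: "(\<lambda>p. f (Z (fst p) (max 0 (min 1 (snd p))))) \<in> borel_measurable (S \<Otimes>\<^sub>M borel)" by measurable
  have g': "(\<lambda>p. f (Z (fst p) (max 0 (min 1 (snd p))))) \<in> borel_measurable (distr N S (\<lambda>v. v) \<Otimes>\<^sub>M distr N borel U)"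
    using g by (simp cong: measurable_cong_sets sets_pair_measure_cong)
  have "(\<integral>\<^sup>+v. f (Z v (max 0 (min 1 (U v)))) \<partial>N) =
     (\<integral>\<^sup>+p. f (Z (fst p) (max 0 (min 1 (snd p)))) \<partial>distr N (S \<Otimes>\<^sub>M borel) (\<lambda>v. (v, U v)))"
    by (subst nn_integral_distr) (use g measurable_Pair[OF idm U(1)] in auto)
  also have "\<dots> = (\<integral>\<^sup>+v. (\<integral>\<^sup>+r. f (Z v (max 0 (min 1 r))) \<partial>distr N borel U) \<partial>distr N S (\<lambda>v. v))"
    unfolding P[symmetric] by (subst D.nn_integral_fst[OF g', symmetric]) simp
  also have "\<dots> = (\<integral>\<^sup>+v. (\<integral>\<^sup>+r. f (Z v (max 0 (min 1 r))) \<partial>distr N borel U) \<partial>N)"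
    by (subst nn_integral_distr[OF idm]) (use D.borel_measurable_nn_integral_fst[OF g'] in auto)
  also have "\<dots> = (\<integral>\<^sup>+v. (\<integral>\<^sup>+r. f (Z v (max 0 (min 1 r))) * indicator {0..1} r \<partial>lborel) \<partial>N)"
  proof (rule nn_integral_cong)
    fix v assume v: "v \<in> space N"
    from measurable_compose[OF measurable_Pair1' g, of v] v
    have m: "(\<lambda>r. f (Z v (max 0 (min 1 r)))) \<in> borel_measurable lborel" by (simp add: sS)
    show "(\<integral>\<^sup>+r. f (Z v (max 0 (min 1 r))) \<partial>distr N borel U) = (\<integral>\<^sup>+r. f (Z v (max 0 (min 1 r))) * indicator {0..1} r \<partial>lborel)"
      unfolding dU by (subst nn_integral_uniform_measure[OF m]) (auto simp: divide_ennreal_def)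
  qed
  finally show ?thesis .
qed

lemma holder_constant_bound:
  assumes "holder_continuous \<gamma> z" and r: "r \<in> {0..1}" and s: "s \<in> {0..1}"
  shows "\<bar>z s - z r\<bar> \<le> holder_constant \<gamma> z * \<bar>s - r\<bar> powr \<gamma>"
proof -
  obtain C where C: "\<And>r s. r \<in> {0..1} \<Longrightarrow> s \<in> {0..1} \<Longrightarrow> \<bar>z s - z r\<bar> \<le> C * \<bar>s - r\<bar> powr \<gamma>"
    using assms unfolding holder_continuous_def by blast
  have bdd: "bdd_above ((\<lambda>(r, s). \<bar>z s - z r\<bar> / \<bar>s - r\<bar> powr \<gamma>) ` {(r, s). 0 \<le> r \<and> r < s \<and> s \<le> 1})"
  proof (rule bdd_aboveI[of _ C], safe)
    fix a b :: real assume ab: "0 \<le> a" "a < b" "b \<le> 1"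
    then have "\<bar>z b - z a\<bar> \<le> C * \<bar>b - a\<bar> powr \<gamma>" by (intro C) auto
    then show "\<bar>z b - z a\<bar> / \<bar>b - a\<bar> powr \<gamma> \<le> C" using ab by (simp add: pos_divide_le_eq)
  qed
  have less: "\<bar>z b - z a\<bar> \<le> holder_constant \<gamma> z * \<bar>b - a\<bar> powr \<gamma>" if "0 \<le> a" "a < b" "b \<le> 1" for a b
  proof -
    have "\<bar>z b - z a\<bar> / \<bar>b - a\<bar> powr \<gamma> \<le> holder_constant \<gamma> z"
      unfolding holder_constant_def using cSUP_upper[OF _ bdd, of "(a, b)"] that by simp
    then show ?thesis using that by (simp add: pos_divide_le_eq)
  qed
  consider "r < s" | "s < r" | "r = s" by linarith
  then show ?thesis
    using less[of r s] less[of s r] r s by cases (auto simp: abs_minus_commute)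
qed

theorem theorem1:
  fixes \<alpha> q \<gamma> c :: real
    and N :: "'b measure" and Z :: "'b \<Rightarrow> real \<Rightarrow> real" and U :: "'b \<Rightarrow> real"
    and M :: "'a measure" and X :: "real \<Rightarrow> 'a \<Rightarrow> real"
    and \<zeta> :: "real \<Rightarrow> 'a \<Rightarrow> real \<Rightarrow> real" and L :: "real \<Rightarrow> real \<Rightarrow> 'a \<Rightarrow> real"
  assumes "0 < \<alpha>" "\<alpha> < 1" "\<alpha> < q"
    and "prob_space N"
    and "Z \<in> measurable N (path_space {0..1})"
    and "\<forall>\<omega>\<in>space N. continuous_on {0..1} (Z \<omega>) \<and> (\<forall>s\<in>{0..1}. 0 \<le> Z \<omega> s)
           \<and> Z \<omega> 0 = 0 \<and> Z \<omega> 1 = 0"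
    and "0 < \<gamma>" "\<gamma> < q"
    and "AE \<omega> in N. holder_continuous \<gamma> (Z \<omega>)"
    and "moments_of_all_orders N (\<lambda>\<omega>. holder_constant \<gamma> (Z \<omega>))"
    and "U \<in> borel_measurable N"
    and "distr N lborel U = uniform_measure lborel {0..1}"
    and "prob_space.indep_set N (sets (vimage_algebra (space N) Z (path_space {0..1})))
           (sets (vimage_algebra (space N) U borel))"
    and "c = (1 + \<alpha>) / Gamma (1 - \<alpha>) * (LINT \<omega>|N. Z \<omega> (U \<omega>) powr (\<alpha> / q))"
    and "0 < c"
    and "prob_space M"
    and "levy_process M X"
    and "no_negative_jumps M X"
    and "has_laplace_exponent M X (\<lambda>\<eta>. \<eta> powr (1 + \<alpha>))"
    and "marked_process M X (mark_kernel q N Z) \<zeta>"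
    and "local_times M X L"
  shows "AE \<omega> in M. \<forall>T>0.
    ((\<lambda>h. SUP t\<in>{0..T}. SUP y.
        \<bar>ereal (h powr (\<alpha> / q) / c)
            * enn2ereal (mark_count (\<lambda>u. X u \<omega>) (\<lambda>u. \<zeta> u \<omega>) h y t)
          - ereal (L y t \<omega>)\<bar>) \<longlongrightarrow> 0) (at_right 0)"
proof -
  define D where "D v = \<bar>holder_constant \<gamma> (Z v)\<bar>" for v
  have mom: "integrable N (\<lambda>v. D v powr p)" if "0 < p" for p
    using assms(10) that by (simp add: moments_of_all_orders_def D_def)
  have D1: "D = (\<lambda>v. D v powr 1)" by (auto simp: D_def)
  have Dm: "D \<in> borel_measurable N" by (subst D1, rule borel_measurable_integrable[OF mom]) simp
  have Zh: "AE v in N. \<forall>r\<in>{0..1}. \<forall>s\<in>{0..1}. \<bar>Z v s - Z v r\<bar> \<le> D v * \<bar>s - r\<bar> powr \<gamma>"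
    using assms(9)
  proof eventually_elim
    case (elim v)
    show ?case
    proof (intro ballI)
      fix r s :: real assume rs: "r \<in> {0..1}" "s \<in> {0..1}"
      have "holder_constant \<gamma> (Z v) * \<bar>s - r\<bar> powr \<gamma> \<le> D v * \<bar>s - r\<bar> powr \<gamma>"
        unfolding D_def by (intro mult_right_mono) auto
      with holder_constant_bound[OF elim rs] show "\<bar>Z v s - Z v r\<bar> \<le> D v * \<bar>s - r\<bar> powr \<gamma>" by linarith
    qed
  qed
  interpret M: prob_space M by fact
  interpret N: prob_space N by fact
  interpret H: holder_marked_process M X \<alpha> N Z q \<zeta> \<gamma> D
    by unfold_locales (use assms Dm mom Zh in \<open>auto simp: D_def\<close>)
  have UZ: "AE v in N. H.Z01 v (U v) = Z v (U v)"
  proof -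
    have Um: "U \<in> N \<rightarrow>\<^sub>M lborel" using assms(11) by simp
    have "AE u in distr N lborel U. u \<in> {0..1}" unfolding assms(12) by (rule AE_uniform_measureI) auto
    then have "AE v in N. U v \<in> {0..1}" by (subst (asm) AE_distr_iff[OF Um]) auto
    then show ?thesis by eventually_elim (auto simp: H.Z01_def)
  qed
  have mZ: "H.mean_Z_power = (\<integral>\<^sup>+v. ennreal (Z v (U v) powr (\<alpha> / q)) \<partial>N)"
  proof -
    have "H.mean_Z_power = (\<integral>\<^sup>+v. ennreal (H.Z01 v (U v) powr (\<alpha> / q)) \<partial>N)"
      unfolding H.mean_Z_power_def H.Z01_def
      by (rule nn_integral_at_independent_uniform[OF assms(4,5) _ assms(11,12,13), symmetric]) (use assms(6) in auto)
    also have "\<dots> = (\<integral>\<^sup>+v. ennreal (Z v (U v) powr (\<alpha> / q)) \<partial>N)"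
      by (rule nn_integral_cong_AE) (use UZ in \<open>eventually_elim, simp\<close>)
    finally show ?thesis .
  qed
  have "integrable N (\<lambda>v. Z v (U v) powr (\<alpha> / q))"
    using assms(14,15) not_integrable_integral_eq by force
  then have "H.mean_Z_power = ennreal (LINT v|N. Z v (U v) powr (\<alpha> / q))"
    unfolding mZ by (rule nn_integral_eq_integral) simp
  moreover have "0 \<le> (1 + \<alpha>) / Gamma (1 - \<alpha>)" using assms(1,2) by (simp add: Gamma_real_nonneg)
  ultimately have cm: "ennreal ((1 + \<alpha>) / Gamma (1 - \<alpha>)) * H.mean_Z_power = ennreal c"
    by (simp add: ennreal_mult'[symmetric] assms(14))
  interpret counted_local_times M X \<alpha> N Z q \<zeta> \<gamma> D L c
    by unfold_locales (use assms(15,21) cm in auto)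
  show ?thesis by (rule mark_counts_converge_to_local_time)
qed

end
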